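(* For every $\delta>0$ there is some $\epsilon>0$ such that $d$-weights All-Edges Exact Triangle with $d=n^{(3-\omega)-\delta}$ can be solved in time $O(n^{3-\epsilon})$.
   Context: Model: word-RAM with $O(\log n)$-bit words; all matrix entries are integers in $\{-n^c,\dots,n^c\}$ for a constant $c$, or the symbol $\bot$ (a missing entry; a sum involving $\bot$ never equals anything). $\omega$ is the matrix multiplication exponent. For $A,B,C\in(\mathbb Z\cup\{\bot\})^{n\times n}$, a triple $(i,k,j)\in[n]^3$ is an exact triangle if $A[i,k]+B[k,j]=C[i,j]$ (all three entries non-$\bot$). All-Edges Exact Triangle: given $(A,B,C)$, decide for every pair $(i,j)\in[n]^2$ whether there is $k\in[n]$ with $(i,k,j)$ an exact triangle. An instance is $d$-weights if in at least one of the matrices $A,A^T,B,B^T,C,C^T$ every row contains at most $d$ distinct non-$\bot$ entries. *)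

theory Defs
  imports Complex_Main "HOL-Library.Landau_Symbols" "HOL-Library.Log_Nat"
    "Jordan_Normal_Form.Matrix"
begin

section \<open>The word RAM\<close>

text \<open>
  A program is a fixed finite list of instructions. A \<open>w\<close>-bit word is a natural number below
  \<open>2 ^ w\<close>. Registers and memory cells hold words, memory is addressed by words, every result is
  truncated to \<open>w\<close> bits, and every instruction takes unit time. The machine halts when the
  program counter leaves the program. Programs are deterministic.
\<close>

datatype binop = Add | Sub | Mul | Quot | Rem | BitAnd | BitOr | BitXor | ShiftL | ShiftR
  | Less | Equal

fun binop_val :: "nat \<Rightarrow> binop \<Rightarrow> nat \<Rightarrow> nat \<Rightarrow> nat" where
  "binop_val w Add x y = x + y"
| "binop_val w Sub x y = x + 2 ^ w - y"
| "binop_val w Mul x y = x * y"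
| "binop_val w Quot x y = x div y"
| "binop_val w Rem x y = x mod y"
| "binop_val w BitAnd x y = semiring_bit_operations_class.and x y"
| "binop_val w BitOr x y = semiring_bit_operations_class.or x y"
| "binop_val w BitXor x y = semiring_bit_operations_class.xor x y"
| "binop_val w ShiftL x y = push_bit y x"
| "binop_val w ShiftR x y = drop_bit y x"
| "binop_val w Less x y = of_bool (x < y)"
| "binop_val w Equal x y = of_bool (x = y)"

text \<open>The arguments of type \<^typ>\<open>nat\<close> are register numbers, except for the constant in
  \<open>Const\<close> and the jump targets.\<close>

datatype instr =
    Const nat nat
  | Move nat nat
  | BinOp binop nat nat nat
  | Load nat nat
  | Store nat nat
  | Jump nat
  | JumpZero nat nat

record config =
  pc :: nat
  regs :: "nat \<Rightarrow> nat"
  mem :: "nat \<Rightarrow> nat"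

definition set_reg :: "nat \<Rightarrow> nat \<Rightarrow> nat \<Rightarrow> config \<Rightarrow> config" where
  "set_reg w r x s = s\<lparr>pc := Suc (pc s), regs := (regs s)(r := take_bit w x)\<rparr>"

fun exec_instr :: "nat \<Rightarrow> instr \<Rightarrow> config \<Rightarrow> config" where
  "exec_instr w (Const r x) s = set_reg w r x s"
| "exec_instr w (Move r a) s = set_reg w r (regs s a) s"
| "exec_instr w (BinOp f r a b) s = set_reg w r (binop_val w f (regs s a) (regs s b)) s"
| "exec_instr w (Load r a) s = set_reg w r (mem s (regs s a)) s"
| "exec_instr w (Store a b) s =
     s\<lparr>pc := Suc (pc s), mem := (mem s)(regs s a := regs s b)\<rparr>"
| "exec_instr w (Jump l) s = s\<lparr>pc := l\<rparr>"
| "exec_instr w (JumpZero a l) s = s\<lparr>pc := (if regs s a = 0 then l else Suc (pc s))\<rparr>"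

definition halted :: "instr list \<Rightarrow> config \<Rightarrow> bool" where
  "halted P s \<longleftrightarrow> length P \<le> pc s"

definition step :: "nat \<Rightarrow> instr list \<Rightarrow> config \<Rightarrow> config" where
  "step w P s = (if halted P s then s else exec_instr w (P ! pc s) s)"

definition run :: "nat \<Rightarrow> instr list \<Rightarrow> nat \<Rightarrow> config \<Rightarrow> config" where
  "run w P t = step w P ^^ t"

text \<open>The size parameter \<open>n\<close> is in register 0 and the input occupies the memory from address 0
  on; everything else is zero.\<close>

definition init_config :: "nat \<Rightarrow> nat \<Rightarrow> nat list \<Rightarrow> config" where
  "init_config w n xs =
     \<lparr>pc = 0, regs = (\<lambda>_. 0)(0 := take_bit w n),
      mem = (\<lambda>a. if a < length xs then take_bit w (xs ! a) else 0)\<rparr>"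

text \<open>\<open>O(log n)\<close>-bit words: \<open>\<kappa>\<close> times the length of the binary representation of \<open>n\<close>.\<close>

definition word_size :: "nat \<Rightarrow> nat \<Rightarrow> nat" where
  "word_size \<kappa> n = \<kappa> * floorlog 2 n"


section \<open>The matrix multiplication exponent\<close>

text \<open>
  Straight-line programs over a field whose inputs are the entries of two matrices. Input entries
  and scalars are available for free, each gate \<open>+\<close>, \<open>-\<close>, \<open>*\<close> costs one operation, and
  \<open>Gate k\<close> refers to the value of the \<open>k\<close>-th gate.
\<close>

datatype 'a operand = LeftEntry nat nat | RightEntry nat nat | Scalar 'a | Gate nat

datatype 'a gate =
    Plus "'a operand" "'a operand"
  | Minus "'a operand" "'a operand"
  | Times "'a operand" "'a operand"

fun operand_val :: "'a :: field mat \<Rightarrow> 'a mat \<Rightarrow> 'a list \<Rightarrow> 'a operand \<Rightarrow> 'a" where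
  "operand_val A B vs (LeftEntry i j) = (if i < dim_row A \<and> j < dim_col A then A $$ (i, j) else 0)"
| "operand_val A B vs (RightEntry i j) = (if i < dim_row B \<and> j < dim_col B then B $$ (i, j) else 0)"
| "operand_val A B vs (Scalar x) = x"
| "operand_val A B vs (Gate k) = (if k < length vs then vs ! k else 0)"

fun gate_val :: "'a :: field mat \<Rightarrow> 'a mat \<Rightarrow> 'a list \<Rightarrow> 'a gate \<Rightarrow> 'a" where
  "gate_val A B vs (Plus x y) = operand_val A B vs x + operand_val A B vs y"
| "gate_val A B vs (Minus x y) = operand_val A B vs x - operand_val A B vs y"
| "gate_val A B vs (Times x y) = operand_val A B vs x * operand_val A B vs y"

definition slp_vals :: "'a :: field mat \<Rightarrow> 'a mat \<Rightarrow> 'a gate list \<Rightarrow> 'a list" where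
  "slp_vals A B gs = foldl (\<lambda>vs g. vs @ [gate_val A B vs g]) [] gs"

definition slp_multiplies ::
  "nat \<Rightarrow> 'a :: field gate list \<Rightarrow> (nat \<Rightarrow> nat \<Rightarrow> 'a operand) \<Rightarrow> bool" where
  "slp_multiplies n gs out \<longleftrightarrow>
     (\<forall>A \<in> carrier_mat n n. \<forall>B \<in> carrier_mat n n. \<forall>i<n. \<forall>j<n.
        operand_val A B (slp_vals A B gs) (out i j) = (A * B) $$ (i, j))"

definition matmul_ops :: "'a :: field itself \<Rightarrow> nat \<Rightarrow> nat" where
  "matmul_ops _ n = (LEAST s. \<exists>(gs :: 'a gate list) out. length gs = s \<and> slp_multiplies n gs out)"

text \<open>The exponent over the rationals. It depends only on the characteristic of the field.\<close>

definition matmul_exponent :: real ("\<omega>") where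
  "\<omega> = Inf {\<tau>. (\<lambda>n. real (matmul_ops TYPE(rat) n)) \<in> O(\<lambda>n. real n powr \<tau>)}"


section \<open>All-Edges Exact Triangle\<close>

text \<open>A missing entry is \<^const>\<open>None\<close>; rows and columns are numbered from 0.\<close>

type_synonym wmat = "int option mat"

definition exact_triangle :: "wmat \<Rightarrow> wmat \<Rightarrow> wmat \<Rightarrow> nat \<Rightarrow> nat \<Rightarrow> nat \<Rightarrow> bool" where
  "exact_triangle A B C i k j \<longleftrightarrow>
     (\<exists>a b c. A $$ (i, k) = Some a \<and> B $$ (k, j) = Some b \<and> C $$ (i, j) = Some c \<and> a + b = c)"

definition entries_bounded :: "int \<Rightarrow> wmat \<Rightarrow> bool" where
  "entries_bounded u M \<longleftrightarrow>
     (\<forall>i<dim_row M. \<forall>j<dim_col M. \<forall>x. M $$ (i, j) = Some x \<longrightarrow> x \<in> {- u..u})"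

definition row_weights :: "wmat \<Rightarrow> nat \<Rightarrow> int set" where
  "row_weights M i = {x. \<exists>j<dim_col M. M $$ (i, j) = Some x}"

definition few_row_weights :: "real \<Rightarrow> wmat \<Rightarrow> bool" where
  "few_row_weights d M \<longleftrightarrow> (\<forall>i<dim_row M. real (card (row_weights M i)) \<le> d)"

definition d_weights :: "real \<Rightarrow> wmat \<Rightarrow> wmat \<Rightarrow> wmat \<Rightarrow> bool" where
  "d_weights d A B C \<longleftrightarrow>
     (\<exists>M \<in> {A, transpose_mat A, B, transpose_mat B, C, transpose_mat C}. few_row_weights d M)"

text \<open>
  An entry occupies two words, a presence flag and the value in two's complement; matrices are
  stored in row-major order.
\<close>

fun encode_entry :: "nat \<Rightarrow> int option \<Rightarrow> nat list" where
  "encode_entry w None = [0, 0]"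
| "encode_entry w (Some x) = [1, nat (take_bit w x)]"

definition encode_mat :: "nat \<Rightarrow> wmat \<Rightarrow> nat list" where
  "encode_mat w M =
     concat (map (\<lambda>i. concat (map (\<lambda>j. encode_entry w (M $$ (i, j))) [0..<dim_col M]))
       [0..<dim_row M])"

text \<open>
  \<open>P\<close>, run with word size \<open>word_size \<kappa> n\<close>, solves within \<open>T n\<close> steps all \<open>n \<times> n\<close> instances
  that are \<open>d n\<close>-weights and have entries in \<open>{- n ^ c..n ^ c}\<close>. The answer for \<open>(i, j)\<close> is left
  at address \<open>i * n + j\<close>.
\<close>

definition solves_d_weights_exact_triangle ::
  "(nat \<Rightarrow> real) \<Rightarrow> nat \<Rightarrow> nat \<Rightarrow> instr list \<Rightarrow> (nat \<Rightarrow> nat) \<Rightarrow> bool" where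
  "solves_d_weights_exact_triangle d c \<kappa> P T \<longleftrightarrow>
     (\<forall>n\<ge>1. \<forall>A \<in> carrier_mat n n. \<forall>B \<in> carrier_mat n n. \<forall>C \<in> carrier_mat n n.
        (\<forall>M \<in> {A, B, C}. entries_bounded (int n ^ c) M) \<longrightarrow> d_weights (d n) A B C \<longrightarrow>
        (let w = word_size \<kappa> n;
             s = init_config w n (encode_mat w A @ encode_mat w B @ encode_mat w C)
         in \<exists>t \<le> T n. halted P (run w P t s) \<and>
              (\<forall>i<n. \<forall>j<n. mem (run w P t s) (i * n + j) =
                 of_bool (\<exists>k<n. exact_triangle A B C i k j))))"

end

theory Submission
 imports Defs "HOL-Computational_Algebra.Polynomial" "HOL-Computational_Algebra.Primes"
  "HOL-Number_Theory.Cong" "HOL-Real_Asymp.Real_Asymp"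
begin

text \<open>
 Shift the entries so that an exact triangle is a triple with weight sum \<open>S\<close>, and call \<open>U\<close> the matrix with at most
 \<open>d = n ^ (3 - \<omega> - \<delta>)\<close> weights per row. Modulo \<open>m\<close>, the triangles through every pair can be counted by one
 multiplication of matrices of polynomials of degree below \<open>m\<close>. As \<open>m\<close> is about \<open>n ^ (3 - \<omega> - \<delta> / 4)\<close>, this takes time
 about \<open>n ^ \<omega> * m\<close>, which is truly subcubic. On a RAM it is done by a tensor power of (matrix multiplication of a
 fixed size) \<open>\<otimes>\<close> (multiplication of polynomials of a fixed degree), evaluated with Yates's algorithm. The counts
 include false triangles, whose sum is congruent to \<open>S\<close> modulo \<open>m\<close> but different from \<open>S\<close>; they are listed and
 subtracted.

 All false triangles are found by going through the pairs \<open>(y, z)\<close> and the at most \<open>d\<close> weights \<open>u\<close> of row \<open>y\<close> of \<open>U\<close>, and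
 inspecting the \<open>x\<close> with \<open>u + V[x, z] + W[y, z]\<close> congruent but not equal to \<open>S\<close>. For a random modulus there are
 about \<open>n ^ 3 * d / m\<close> of them, again truly subcubic. The randomness is removed by building \<open>m\<close> as a product of
 a constant number \<open>t\<close> of factors of size \<open>Q = m ^ (1 / t)\<close>, each chosen greedily to minimise the number of
 collisions: a nonzero number of polynomial size has boundedly many prime divisors above \<open>sqrt Q\<close>, so some prime
 below \<open>Q\<close> divides the number of collisions by almost \<open>Q\<close>. Trying all factors costs only a factor \<open>Q\<close>.
\<close>

section \<open>From straight-line programs to bilinear algorithms\<close>

subsection \<open>The size of straight-line programs for matrix multiplication\<close>

text \<open>The exponent is defined through arbitrary straight-line programs over the rationals,
  while the RAM needs one fixed program that serves all n with short words. Hence a single size n0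
  is frozen: the gates for n0 by n0 matrices become a bilinear algorithm whose integer coefficients
  are constants in the code. Every level of the tensor power loses a constant factor, which is
  harmless once n0 ^ (\<delta> / 32) is at least 8. Clearing denominators scales each count by D ^
  l; as a count is at most n, arithmetic modulo D ^ l * n + 1 tells zero from nonzero without any
  division. Polynomials of degree below m enter through base-K digits that are added without
  carries. The listing must avoid the exact triangles, of which there can be cubically many: the
  entries of V with one residue are therefore grouped by value, and the group of the exact value is
  skipped in constant time. Every factor of m is the best among all q up to Q, so no primality test
  is run; primes occur only in the analysis, which compares the choice with an average over
  them.\<close>

lemma slp_vals_snoc: "slp_vals A B (gs @ [g]) = slp_vals A B gs @ [gate_val A B (slp_vals A B gs) g]"
 by (simp add: slp_vals_def)

lemma slp_vals_Nil [simp]: "slp_vals A B [] = []"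
 by (simp add: slp_vals_def)

lemma length_slp_vals [simp]: "length (slp_vals A B gs) = length gs"
 by (induction gs rule: rev_induct) (auto simp: slp_vals_snoc)

text \<open>An out-of-range \<open>Gate\<close> has the value 0, so appending gates could change it.
  Operands that refer to existing gates only keep their value under extension.\<close>

definition opn_ok :: "nat => 'a operand => bool" where
 "opn_ok m p \<longleftrightarrow> (case p of Gate k => k < m | _ => True)"

lemma operand_val_append:
 "opn_ok (length vs) p \<Longrightarrow> operand_val A B (vs @ us) p = operand_val A B vs p"
 by (cases p) (auto simp: opn_ok_def nth_append)

text \<open>Two gates per summand: one multiplies two entries, the other adds the product to the
  partial sum. The start \<open>Scalar 0\<close> is free.\<close>

lemma slp_entry:
 fixes gs :: "'a :: field gate list"
 assumes "m \<le> n" "i < n" "j < n"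
 shows "\<exists>hs p. length hs \<le> 2 * m \<and> opn_ok (length (gs @ hs)) p \<and>
  (\<forall>A \<in> carrier_mat n n. \<forall>B \<in> carrier_mat n n. (\<exists>us. slp_vals A B (gs @ hs) = slp_vals A B gs @ us) \<and>
   operand_val A B (slp_vals A B (gs @ hs)) p = (\<Sum>k<m. A $$ (i, k) * B $$ (k, j)))"
 using assms(1)
proof (induction m)
 case 0
 show ?case
  by (intro exI[of _ "[]"] exI[of _ "Scalar 0"]) (auto simp: opn_ok_def)
next
 case (Suc m)
 then obtain hs p where h: "length hs \<le> 2 * m" "opn_ok (length (gs @ hs)) p"
  "\<And>A B. A \<in> carrier_mat n n \<Longrightarrow> B \<in> carrier_mat n n \<Longrightarrow> \<exists>us. slp_vals A B (gs @ hs) = slp_vals A B gs @ us"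
  "\<And>A B. A \<in> carrier_mat n n \<Longrightarrow> B \<in> carrier_mat n n \<Longrightarrow>
   operand_val A B (slp_vals A B (gs @ hs)) p = (\<Sum>k<m. A $$ (i, k) * B $$ (k, j))"
  by (auto simp del: append_assoc)
 define g where "g = Times (LeftEntry i m) (RightEntry m j :: 'a operand)"
 define g' where "g' = Plus p (Gate (length (gs @ hs)))"
 show ?case
 proof (intro exI[of _ "hs @ [g, g']"] exI[of _ "Gate (Suc (length (gs @ hs)))"] conjI ballI)
  fix A B :: "'a mat" assume AB: "A \<in> carrier_mat n n" "B \<in> carrier_mat n n"
  let ?vs = "slp_vals A B (gs @ hs)"
  have v: "slp_vals A B (gs @ hs @ [g, g']) = ?vs @ [A $$ (i, m) * B $$ (m, j),
    (\<Sum>k<m. A $$ (i, k) * B $$ (k, j)) + A $$ (i, m) * B $$ (m, j)]"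
   using slp_vals_snoc[of A B "(gs @ hs) @ [g]" g'] slp_vals_snoc[of A B "gs @ hs" g] AB Suc.prems
    assms h(4)[OF AB] operand_val_append[of ?vs p A B] h(2)
   by (simp add: g_def g'_def nth_append)
  from h(3)[OF AB] obtain us where "?vs = slp_vals A B gs @ us" by auto
  with v show "\<exists>us. slp_vals A B (gs @ hs @ [g, g']) = slp_vals A B gs @ us"
   by auto
  show "operand_val A B (slp_vals A B (gs @ hs @ [g, g'])) (Gate (Suc (length (gs @ hs)))) =
    (\<Sum>k<Suc m. A $$ (i, k) * B $$ (k, j))"
   unfolding v by (simp add: nth_append)
 qed (use h in \<open>auto simp: opn_ok_def\<close>)
qed

lemma slp_entries:
 assumes "set xs \<subseteq> {..<n} \<times> {..<n}"
 shows "\<exists>(gs :: 'a :: field gate list) out. length gs \<le> 2 * n * length xs \<and>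
  (\<forall>x\<in>set xs. opn_ok (length gs) (out x) \<and> (\<forall>A \<in> carrier_mat n n. \<forall>B \<in> carrier_mat n n.
   operand_val A B (slp_vals A B gs) (out x) = (A * B) $$ x))"
 using assms
proof (induction xs)
 case (Cons x xs)
 have "set xs \<subseteq> {..<n} \<times> {..<n}" using Cons.prems by auto
 from Cons.IH[OF this] obtain gs :: "'a gate list" and out where g0: "length gs \<le> 2 * n * length xs"
  "\<forall>x\<in>set xs. opn_ok (length gs) (out x) \<and> (\<forall>A \<in> carrier_mat n n. \<forall>B \<in> carrier_mat n n.
   operand_val A B (slp_vals A B gs) (out x) = (A * B) $$ x)" by blast
 then have g: "length gs \<le> 2 * n * length xs"
  "\<And>x. x \<in> set xs \<Longrightarrow> opn_ok (length gs) (out x)"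
  "\<And>x A B. x \<in> set xs \<Longrightarrow> A \<in> carrier_mat n n \<Longrightarrow> B \<in> carrier_mat n n \<Longrightarrow>
   operand_val A B (slp_vals A B gs) (out x) = (A * B) $$ x"
  by blast+
 obtain i j where x: "x = (i, j)" "i < n" "j < n" using Cons.prems by auto
 obtain hs p where h: "length hs \<le> 2 * n" "opn_ok (length (gs @ hs)) p"
  "\<And>A B. A \<in> carrier_mat n n \<Longrightarrow> B \<in> carrier_mat n n \<Longrightarrow> \<exists>us. slp_vals A B (gs @ hs) = slp_vals A B gs @ us"
  "\<And>A B. A \<in> carrier_mat n n \<Longrightarrow> B \<in> carrier_mat n n \<Longrightarrow>
   operand_val A B (slp_vals A B (gs @ hs)) p = (\<Sum>k<n. A $$ (i, k) * B $$ (k, j))"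
  using slp_entry[OF order_refl x(2,3), of gs] by (auto simp del: append_assoc)
 show ?case
 proof (intro exI[of _ "gs @ hs"] exI[of _ "out(x := p)"] conjI ballI)
  show "length (gs @ hs) \<le> 2 * n * length (x # xs)" using g(1) h(1) by simp
  fix y assume y: "y \<in> set (x # xs)"
  show "opn_ok (length (gs @ hs)) ((out(x := p)) y)"
  proof (cases "y = x")
   case False
   then have "opn_ok (length gs) (out y)" using g(2) y by auto
   then show ?thesis using False by (auto simp: opn_ok_def split: operand.splits)
  qed (use h in auto)
  fix A B :: "'a mat" assume AB: "A \<in> carrier_mat n n" "B \<in> carrier_mat n n"
  obtain us where us: "slp_vals A B (gs @ hs) = slp_vals A B gs @ us" using h(3)[OF AB] by auto
  show "operand_val A B (slp_vals A B (gs @ hs)) ((out(x := p)) y) = (A * B) $$ y"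
  proof (cases "y = x")
   case True
   then show ?thesis
    using h(4)[OF AB] x AB by (simp add: times_mat_def scalar_prod_def lessThan_atLeast0)
  next
   case False
   then have "y \<in> set xs" using y by auto
   then show ?thesis
    using False us operand_val_append[of "slp_vals A B gs" "out y" A B us] g(2,3)[of y] AB by auto
  qed
 qed
qed (auto intro!: exI[of _ "[]"])

text \<open>The cubic program makes the \<open>LEAST\<close> in \<open>matmul_ops\<close> range over
  a nonempty set, and later places 3 among the admissible exponents.\<close>

lemma naive_slp:
 "\<exists>(gs :: 'a :: field gate list) out. length gs \<le> 2 * n ^ 3 \<and> slp_multiplies n gs out"
proof -
 let ?xs = "List.product [0..<n] [0..<n]"
 have "set ?xs \<subseteq> {..<n} \<times> {..<n}" by auto
 from slp_entries[OF this] obtain gs :: "'a gate list" and out where "length gs \<le> 2 * n * length ?xs"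
  "\<forall>x\<in>set ?xs. opn_ok (length gs) (out x) \<and> (\<forall>A \<in> carrier_mat n n. \<forall>B \<in> carrier_mat n n.
   operand_val A B (slp_vals A B gs) (out x) = (A * B) $$ x)"
  by blast
 then have "length gs \<le> 2 * n ^ 3" "slp_multiplies n gs (\<lambda>i j. out (i, j))"
  by (auto simp: slp_multiplies_def power3_eq_cube)
 then show ?thesis by blast
qed

lemma matmul_ops_witness:
 "\<exists>(gs :: 'a :: field gate list) out. length gs = matmul_ops TYPE('a) n \<and> slp_multiplies n gs out"
 unfolding matmul_ops_def by (rule LeastI_ex) (use naive_slp in blast)

lemma matmul_ops_upper: "matmul_ops TYPE('a :: field) n \<le> 2 * n ^ 3"
proof -
 obtain gs :: "'a gate list" and out where g: "length gs \<le> 2 * n ^ 3" "slp_multiplies n gs out"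
  using naive_slp by blast
 then have "matmul_ops TYPE('a) n \<le> length gs"
  unfolding matmul_ops_def by (intro Least_le) auto
 then show ?thesis using g by simp
qed

definition unit_m :: "nat => nat => nat => 'a :: field mat" where
 "unit_m n a b = mat n n (\<lambda>(i, j). of_bool (i = a \<and> j = b))"

lemma unit_m_carrier [simp]: "unit_m n a b \<in> carrier_mat n n"
 by (simp add: unit_m_def)

lemma unit_m_mult:
 assumes "i < n" "j < n" "b < n"
 shows "(unit_m n a b * unit_m n b' c) $$ (i, j) = of_bool (i = a \<and> b = b' \<and> j = c)"
proof -
 have "(unit_m n a b * unit_m n b' c) $$ (i, j) =
   (\<Sum>k<n. of_bool (i = a \<and> k = b) * of_bool (k = b' \<and> j = c) :: 'a)"
  using assms by (simp add: times_mat_def scalar_prod_def lessThan_atLeast0 unit_m_def)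
 also have "\<dots> = (\<Sum>k<n. if k = b then of_bool (i = a \<and> b = b' \<and> j = c) else 0)"
  by (intro sum.cong) auto
 also have "\<dots> = of_bool (i = a \<and> b = b' \<and> j = c)"
  using assms by simp
 finally show ?thesis .
qed

text \<open>The n ^ 2 outputs sit at distinct gates. The bound gives \<omega> \<ge> 2, and it
  ensures that the rank chosen for the base tensor is at least the size of its output.\<close>

lemma matmul_ops_lower: "n ^ 2 \<le> matmul_ops TYPE('a :: field) n"
proof -
 obtain gs :: "'a gate list" and out where
  g: "length gs = matmul_ops TYPE('a) n" "slp_multiplies n gs out"
  using matmul_ops_witness by blast
 have val: "operand_val A B (slp_vals A B gs) (out i j) = (A * B) $$ (i, j)"
  if "A \<in> carrier_mat n n" "B \<in> carrier_mat n n" "i < n" "j < n" for A B i j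
  using g(2) that by (auto simp: slp_multiplies_def)
 \<comment> \<open>An operand that is not an existing gate depends on at most one of the two
   matrices. But the entry (i, j) of the product of these unit matrices is 1 and drops to 0 as soon
   as either factor is replaced by 0.\<close>
 have ex: "\<exists>k<length gs. out i j = Gate k" if ij: "i < n" "j < n" for i j
 proof (rule ccontr)
  assume no: "\<not> ?thesis"
  let ?A = "unit_m n i 0 :: 'a mat" and ?B = "unit_m n 0 j :: 'a mat" and ?O = "0\<^sub>m n n :: 'a mat"
  have one: "operand_val ?A ?B (slp_vals ?A ?B gs) (out i j) = 1"
   using val[of ?A ?B i j] unit_m_mult[of i n j 0 i 0 j] ij by simp
  have z1: "operand_val ?A ?O (slp_vals ?A ?O gs) (out i j) = 0"
   using val[of ?A ?O i j] right_mult_zero_mat[of ?A n n n] ij by simp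
  have z2: "operand_val ?O ?B (slp_vals ?O ?B gs) (out i j) = 0"
   using val[of ?O ?B i j] left_mult_zero_mat[of ?B n n n] ij by simp
  show False
   using one z1 z2 no by (cases "out i j") (auto split: if_splits)
 qed
 define f where "f = (\<lambda>x. SOME k. k < length gs \<and> out (fst x) (snd x) = Gate k)"
 have f: "f (i, j) < length gs \<and> out i j = Gate (f (i, j))" if "i < n" "j < n" for i j
  unfolding f_def using someI_ex[of "\<lambda>k. k < length gs \<and> out i j = Gate k"] ex[OF that] by auto
 \<comment> \<open>A gate shared by two positions would force equal entries there in every product;
   the product of these two unit matrices has its only 1 at (i, j).\<close>
 have "inj_on f ({..<n} \<times> {..<n})"
 proof (rule inj_onI, clarify)
  fix i j i' j' assume ij: "i < n" "j < n" "i' < n" "j' < n" and eq: "f (i, j) = f (i', j')"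
  let ?A = "unit_m n i 0 :: 'a mat" and ?B = "unit_m n 0 j :: 'a mat"
  have "out i j = out i' j'" using f ij eq by metis
  then have "(?A * ?B) $$ (i, j) = (?A * ?B) $$ (i', j')"
   using val[of ?A ?B i j] val[of ?A ?B i' j'] ij by simp
  then show "i = i' \<and> j = j'"
   using unit_m_mult[where 'a = 'a, of i n j 0 i 0 j]
    unit_m_mult[where 'a = 'a, of i' n j' 0 i 0 j] ij
   by (auto split: if_splits)
 qed
 moreover have "f ` ({..<n} \<times> {..<n}) \<subseteq> {..<length gs}" using f by auto
 ultimately have "card ({..<n} \<times> {..<n}) \<le> card {..<length gs}"
  by (intro card_inj_on_le) auto
 then show ?thesis using g by (simp add: power2_eq_square card_cartesian_product)
qed

subsection \<open>Extracting the bilinear part\<close>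

text \<open>The gates are evaluated at \<open>(s A, t B)\<close> as polynomials in \<open>s\<close> (outer) and \<open>t\<close> (inner variable).
 The coefficient of \<open>s t\<close> of a product involves only two products of a linear form in the
 entries of \<open>A\<close> with a linear form in the entries of \<open>B\<close>.\<close>

type_synonym pp = "rat poly poly"

fun opnd_poly :: "rat mat => rat mat => pp list => rat operand => pp" where
 "opnd_poly A B vs (LeftEntry i j) =
   [:0, [:if i < dim_row A \<and> j < dim_col A then A $$ (i, j) else 0:]:]"
| "opnd_poly A B vs (RightEntry i j) =
   [:[:0, if i < dim_row B \<and> j < dim_col B then B $$ (i, j) else 0:]:]"
| "opnd_poly A B vs (Scalar x) = [:[:x:]:]"
| "opnd_poly A B vs (Gate k) = (if k < length vs then vs ! k else 0)"

fun gate_poly :: "rat mat => rat mat => pp list => rat gate => pp" where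
 "gate_poly A B vs (Plus x y) = opnd_poly A B vs x + opnd_poly A B vs y"
| "gate_poly A B vs (Minus x y) = opnd_poly A B vs x - opnd_poly A B vs y"
| "gate_poly A B vs (Times x y) = opnd_poly A B vs x * opnd_poly A B vs y"

definition slp_polys :: "rat mat => rat mat => rat gate list => pp list" where
 "slp_polys A B gs = foldl (\<lambda>vs g. vs @ [gate_poly A B vs g]) [] gs"

lemma slp_polys_snoc:
 "slp_polys A B (gs @ [g]) = slp_polys A B gs @ [gate_poly A B (slp_polys A B gs) g]"
 by (simp add: slp_polys_def)

lemma slp_polys_Nil [simp]: "slp_polys A B [] = []"
 by (simp add: slp_polys_def)

lemma length_slp_polys [simp]: "length (slp_polys A B gs) = length gs"
 by (induction gs rule: rev_induct) (auto simp: slp_polys_snoc)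

definition ev2 :: "rat => rat => pp => rat" where
 "ev2 s t P = poly (poly P [:s:]) t"

lemma ev2_hom: "ev2 s t (P + Q) = ev2 s t P + ev2 s t Q" "ev2 s t (P - Q) = ev2 s t P - ev2 s t Q"
 "ev2 s t (P * Q) = ev2 s t P * ev2 s t Q" "ev2 s t 0 = 0"
 by (auto simp: ev2_def)

lemma ev2_opnd:
 "ev2 s t (opnd_poly A B vs p) = operand_val (s \<cdot>\<^sub>m A) (t \<cdot>\<^sub>m B) (map (ev2 s t) vs) p"
 by (cases p) (auto simp: ev2_def)

lemma ev2_slp: "map (ev2 s t) (slp_polys A B gs) = slp_vals (s \<cdot>\<^sub>m A) (t \<cdot>\<^sub>m B) gs"
proof (induction gs rule: rev_induct)
 case (snoc g gs)
 have "ev2 s t (gate_poly A B (slp_polys A B gs) g) =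
   gate_val (s \<cdot>\<^sub>m A) (t \<cdot>\<^sub>m B) (slp_vals (s \<cdot>\<^sub>m A) (t \<cdot>\<^sub>m B) gs) g"
  by (cases g) (auto simp: ev2_hom ev2_opnd snoc)
 then show ?case
  by (simp add: slp_polys_snoc slp_vals_snoc snoc)
qed simp

text \<open>Over the infinite field of rationals a polynomial is determined by its values; this is
  applied to the inner variable t and then to s.\<close>

lemma ev2_eqI:
 assumes "\<And>s t. ev2 s t P = ev2 s t Q"
 shows "P = Q"
proof -
 have "poly (P - Q) [:s:] = 0" for s
 proof -
  have "\<forall>t. poly (poly (P - Q) [:s:]) t = 0"
   using assms by (simp add: ev2_def)
  then show ?thesis using poly_all_0_iff_0 by blast
 qed
 then have "range (\<lambda>s. [:s:]) \<subseteq> {x. poly (P - Q) x = 0}" by auto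
 moreover have "infinite (range (\<lambda>s :: rat. [:s:]))"
  using infinite_UNIV_char_0[where 'a = rat] by (subst finite_image_iff) (auto simp: inj_on_def)
 ultimately have "infinite {x. poly (P - Q) x = 0}"
  using finite_subset by blast
 then have "P - Q = 0" using poly_roots_finite by blast
 then show ?thesis by simp
qed

text \<open>The program is correct on every scaled pair s A, t B, whose product is s t A B. So the
  output polynomial has only the term s t: all other monomials produced by the gates must
  cancel.\<close>

lemma slp_poly_out:
 assumes "slp_multiplies n gs out" "A \<in> carrier_mat n n" "B \<in> carrier_mat n n" "i < n" "j < n"
 shows "opnd_poly A B (slp_polys A B gs) (out i j) = [:0, [:0, (A * B) $$ (i, j):]:]"
proof (rule ev2_eqI)
 fix s t
 have "ev2 s t (opnd_poly A B (slp_polys A B gs) (out i j)) = ((s \<cdot>\<^sub>m A) * (t \<cdot>\<^sub>m B)) $$ (i, j)"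
  using assms by (simp add: ev2_opnd ev2_slp slp_multiplies_def)
 also have "\<dots> = s * (t * (A * B) $$ (i, j))"
  using assms by (simp add: mult_smult_assoc_mat[of _ n n _ n] mult_smult_distrib[of _ n n _ n])
 finally show "ev2 s t (opnd_poly A B (slp_polys A B gs) (out i j)) =
   ev2 s t [:0, [:0, (A * B) $$ (i, j):]:]"
  by (simp add: ev2_def)
qed

section \<open>Low-degree coefficients of the gates as linear and bilinear forms\<close>

definition lf :: "nat => (nat => nat => rat) => rat mat => rat" where
 "lf n a A = (\<Sum>i<n. \<Sum>j<n. a i j * A $$ (i, j))"

lemma lf_add: "lf n (\<lambda>i j. a i j + b i j) A = lf n a A + lf n b A"
 and lf_diff: "lf n (\<lambda>i j. a i j - b i j) A = lf n a A - lf n b A"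
 and lf_scale: "lf n (\<lambda>i j. c * a i j) A = c * lf n a A"
 and lf_zero: "lf n (\<lambda>i j. 0) A = 0"
 by (auto simp: lf_def algebra_simps sum.distrib sum_subtractf sum_distrib_left)

type_synonym lpair = "(nat => nat => rat) \<times> (nat => nat => rat)"

definition bl :: "nat => lpair list => (nat => rat) => rat mat => rat mat => rat" where
 "bl n ps w A B = (\<Sum>r<length ps. w r * (lf n (fst (ps ! r)) A * lf n (snd (ps ! r)) B))"

text \<open>The data c, a, b, w are fixed before A and B; this uniformity is what makes a bilinear
  algorithm. The list \<open>ps\<close> of products is common to all gates, only the weights w
  belong to the individual gate.\<close>

definition rep :: "nat => lpair list => (rat mat => rat mat => pp) => bool" where
 "rep n ps P \<longleftrightarrow> (\<exists>c a b w. \<forall>A \<in> carrier_mat n n. \<forall>B \<in> carrier_mat n n.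
   coeff (coeff (P A B) 0) 0 = c \<and> coeff (coeff (P A B) 1) 0 = lf n a A \<and>
   coeff (coeff (P A B) 0) 1 = lf n b B \<and> coeff (coeff (P A B) 1) 1 = bl n ps w A B)"

lemma repI:
 assumes "\<And>A B. A \<in> carrier_mat n n \<Longrightarrow> B \<in> carrier_mat n n \<Longrightarrow>
   coeff (coeff (P A B) 0) 0 = c \<and> coeff (coeff (P A B) 1) 0 = lf n a A \<and>
   coeff (coeff (P A B) 0) 1 = lf n b B \<and> coeff (coeff (P A B) 1) 1 = bl n ps w A B"
 shows "rep n ps P"
 unfolding rep_def by (intro exI ballI) (rule assms)

lemma bl_extend: "bl n ps w A B = bl n (ps @ qs) (\<lambda>r. if r < length ps then w r else 0) A B"
 unfolding bl_def by (rule sum.mono_neutral_cong_left) (auto simp: nth_append)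

lemma rep_append: "rep n ps P \<Longrightarrow> rep n (ps @ qs) P"
 unfolding rep_def by (subst (asm) bl_extend[of _ _ _ _ _ qs]) blast

lemma coeff_mult_01:
 fixes p q :: "'a :: comm_ring_1 poly"
 shows "coeff (p * q) 0 = coeff p 0 * coeff q 0"
  "coeff (p * q) 1 = coeff p 0 * coeff q 1 + coeff p 1 * coeff q 0"
 by (simp_all add: coeff_mult)

lemma rep_plus:
 assumes "rep n ps P" "rep n ps Q"
 shows "rep n ps (\<lambda>A B. P A B + Q A B)" "rep n ps (\<lambda>A B. P A B - Q A B)"
proof -
 obtain c a b w where 1: "\<And>A B. A \<in> carrier_mat n n \<Longrightarrow> B \<in> carrier_mat n n \<Longrightarrow>
   coeff (coeff (P A B) 0) 0 = c \<and> coeff (coeff (P A B) 1) 0 = lf n a A \<and>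
   coeff (coeff (P A B) 0) 1 = lf n b B \<and> coeff (coeff (P A B) 1) 1 = bl n ps w A B"
  using assms(1) unfolding rep_def by blast
 obtain c' a' b' w' where 2: "\<And>A B. A \<in> carrier_mat n n \<Longrightarrow> B \<in> carrier_mat n n \<Longrightarrow>
   coeff (coeff (Q A B) 0) 0 = c' \<and> coeff (coeff (Q A B) 1) 0 = lf n a' A \<and>
   coeff (coeff (Q A B) 0) 1 = lf n b' B \<and> coeff (coeff (Q A B) 1) 1 = bl n ps w' A B"
  using assms(2) unfolding rep_def by blast
 show "rep n ps (\<lambda>A B. P A B + Q A B)"
  by (rule repI[of _ _ "c + c'" "\<lambda>i j. a i j + a' i j" "\<lambda>i j. b i j + b' i j" _ "\<lambda>r. w r + w' r"])
   (use 1 2 in \<open>auto simp: lf_add bl_def algebra_simps sum.distrib\<close>)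
 show "rep n ps (\<lambda>A B. P A B - Q A B)"
  by (rule repI[of _ _ "c - c'" "\<lambda>i j. a i j - a' i j" "\<lambda>i j. b i j - b' i j" _ "\<lambda>r. w r - w' r"])
   (use 1 2 in \<open>auto simp: lf_diff bl_def algebra_simps sum_subtractf\<close>)
qed

text \<open>Of the four contributions to the coefficient of s t, two are a constant times such a
  coefficient of one factor and reuse \<open>ps\<close>; the other two pair a linear form in A with
  one in B and are appended.\<close>

lemma rep_times:
 assumes "rep n ps P" "rep n ps Q"
 shows "\<exists>x y. rep n (ps @ [x, y]) (\<lambda>A B. P A B * Q A B)"
proof -
 obtain c a b w where 1: "\<And>A B. A \<in> carrier_mat n n \<Longrightarrow> B \<in> carrier_mat n n \<Longrightarrow>
   coeff (coeff (P A B) 0) 0 = c \<and> coeff (coeff (P A B) 1) 0 = lf n a A \<and>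
   coeff (coeff (P A B) 0) 1 = lf n b B \<and> coeff (coeff (P A B) 1) 1 = bl n ps w A B"
  using assms(1) unfolding rep_def by blast
 obtain c' a' b' w' where 2: "\<And>A B. A \<in> carrier_mat n n \<Longrightarrow> B \<in> carrier_mat n n \<Longrightarrow>
   coeff (coeff (Q A B) 0) 0 = c' \<and> coeff (coeff (Q A B) 1) 0 = lf n a' A \<and>
   coeff (coeff (Q A B) 0) 1 = lf n b' B \<and> coeff (coeff (Q A B) 1) 1 = bl n ps w' A B"
  using assms(2) unfolding rep_def by blast
 let ?m = "length ps"
 define v where "v = (\<lambda>r. if r < ?m then c * w' r + c' * w r else 1)"
 have v: "bl n (ps @ [(a, b'), (a', b)]) v A B =
   c * bl n ps w' A B + c' * bl n ps w A B + lf n a A * lf n b' B + lf n a' A * lf n b B" for A B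
 proof -
  have "(\<Sum>r<?m. v r * (lf n (fst ((ps @ [(a, b'), (a', b)]) ! r)) A * lf n (snd ((ps @ [(a, b'), (a', b)]) ! r)) B)) =
    (\<Sum>r<?m. (c * w' r + c' * w r) * (lf n (fst (ps ! r)) A * lf n (snd (ps ! r)) B))"
   by (intro sum.cong) (auto simp: v_def nth_append)
  then show ?thesis
   by (simp add: bl_def v_def nth_append sum_distrib_left algebra_simps sum.distrib)
 qed
 have "rep n (ps @ [(a, b'), (a', b)]) (\<lambda>A B. P A B * Q A B)"
  by (rule repI[of _ _ "c * c'" "\<lambda>i j. c * a' i j + c' * a i j" "\<lambda>i j. c * b' i j + c' * b i j" _ v])
   (use 1 2 in \<open>auto simp: lf_add lf_scale v coeff_mult_01[unfolded One_nat_def] algebra_simps\<close>)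
 then show ?thesis by blast
qed

lemma lf_single:
 assumes "A \<in> carrier_mat n n"
 shows "lf n (\<lambda>i' j'. of_bool (i' = i \<and> j' = j)) A = (if i < n \<and> j < n then A $$ (i, j) else 0)"
proof -
 have "lf n (\<lambda>i' j'. of_bool (i' = i \<and> j' = j)) A =
   (\<Sum>i'<n. if i' = i then (\<Sum>j'<n. if j' = j then A $$ (i', j') else 0) else 0)"
  unfolding lf_def by (intro sum.cong) (auto intro!: sum.cong)
 also have "\<dots> = (if i < n \<and> j < n then A $$ (i, j) else 0)"
  by simp
 finally show ?thesis .
qed

lemma rep_const: "rep n ps (\<lambda>A B. [:[:x:]:])"
 by (rule repI[of _ _ x "\<lambda>_ _. 0" "\<lambda>_ _. 0" _ "\<lambda>_. 0"]) (auto simp: lf_zero bl_def)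

lemma rep_opnd:
 assumes "\<And>k. k < m \<Longrightarrow> rep n ps (\<lambda>A B. vs A B ! k)" "\<And>A B. length (vs A B) = m"
 shows "rep n ps (\<lambda>A B. opnd_poly A B (vs A B) p)"
proof (cases p)
 case (LeftEntry i j)
 show ?thesis
  by (rule repI[of _ _ 0 "\<lambda>i' j'. of_bool (i' = i \<and> j' = j)" "\<lambda>_ _. 0" _ "\<lambda>_. 0"])
   (auto simp: LeftEntry lf_zero lf_single bl_def)
next
 case (RightEntry i j)
 show ?thesis
  by (rule repI[of _ _ 0 "\<lambda>_ _. 0" "\<lambda>i' j'. of_bool (i' = i \<and> j' = j)" _ "\<lambda>_. 0"])
   (auto simp: RightEntry lf_zero lf_single bl_def)
next
 case (Gate k)
 then show ?thesis
  using assms rep_const[of n ps 0] by (cases "k < m") auto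
qed (auto simp: rep_const)

lemma slp_rep: "\<exists>ps. length ps \<le> 2 * length gs \<and> (\<forall>k<length gs. rep n ps (\<lambda>A B. slp_polys A B gs ! k))"
proof (induction gs rule: rev_induct)
 case (snoc g gs)
 then obtain ps where ps: "length ps \<le> 2 * length gs"
  "\<And>k. k < length gs \<Longrightarrow> rep n ps (\<lambda>A B. slp_polys A B gs ! k)" by auto
 have op: "rep n ps (\<lambda>A B. opnd_poly A B (slp_polys A B gs) p)" for p
  by (rule rep_opnd[where m = "length gs"]) (use ps in auto)
 have "\<exists>x y. rep n (ps @ [x, y]) (\<lambda>A B. gate_poly A B (slp_polys A B gs) g)"
 proof (cases g)
  case (Times p q)
  then show ?thesis using rep_times[OF op[of p] op[of q]] by simp
 qed (use rep_append rep_plus[OF op op] in fastforce)+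
 then obtain x y where xy: "rep n (ps @ [x, y]) (\<lambda>A B. gate_poly A B (slp_polys A B gs) g)"
  by blast
 have "rep n (ps @ [x, y]) (\<lambda>A B. slp_polys A B (gs @ [g]) ! k)" if "k < length (gs @ [g])" for k
  using that xy rep_append[OF ps(2)] by (cases "k < length gs") (auto simp: slp_polys_snoc nth_append less_Suc_eq)
 then show ?case using ps(1) by (intro exI[of _ "ps @ [x, y]"]) auto
qed auto

lemma lf_unit:
 assumes "a < n" "b < n"
 shows "lf n f (unit_m n a b) = f a b"
proof -
 have "lf n f (unit_m n a b) = (\<Sum>i<n. if i = a then (\<Sum>j<n. if j = b then f i j else 0) else 0)"
  unfolding lf_def by (intro sum.cong) (auto simp: unit_m_def intro!: sum.cong)
 then show ?thesis using assms by simp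
qed

text \<open>Strassen's passage from arbitrary programs to bilinear ones: each gate accounts for at
  most two products. Unit matrices turn the identity of forms into an identity of tensor
  coefficients.\<close>

lemma bilinear_of_slp:
 assumes "slp_multiplies n (gs :: rat gate list) out"
 shows "\<exists>R al be ga. R \<le> 2 * length gs \<and> (\<forall>i<n. \<forall>j<n. \<forall>a<n. \<forall>b<n. \<forall>b'<n. \<forall>c<n.
  (\<Sum>r<R. ga i j r * (al r a b * be r b' c)) = (of_bool (i = a \<and> b = b' \<and> j = c) :: rat))"
proof -
 obtain ps where ps: "length ps \<le> 2 * length gs" "\<And>k. k < length gs \<Longrightarrow> rep n ps (\<lambda>A B. slp_polys A B gs ! k)"
  using slp_rep[of gs n] by auto
 have op: "rep n ps (\<lambda>A B. opnd_poly A B (slp_polys A B gs) p)" for p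
  by (rule rep_opnd[where m = "length gs"]) (use ps in auto)
 have "\<forall>i j. \<exists>w. \<forall>A \<in> carrier_mat n n. \<forall>B \<in> carrier_mat n n.
   coeff (coeff (opnd_poly A B (slp_polys A B gs) (out i j)) 1) 1 = bl n ps w A B"
  using op unfolding rep_def by meson
 then obtain ga where ga: "\<And>i j A B. A \<in> carrier_mat n n \<Longrightarrow> B \<in> carrier_mat n n \<Longrightarrow>
   coeff (coeff (opnd_poly A B (slp_polys A B gs) (out i j)) 1) 1 = bl n ps (ga i j) A B"
  by metis
 have "(\<Sum>r<length ps. ga i j r * (fst (ps ! r) a b * snd (ps ! r) b' c)) =
    (of_bool (i = a \<and> b = b' \<and> j = c) :: rat)"
  if l: "i < n" "j < n" "a < n" "b < n" "b' < n" "c < n" for i j a b b' c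
 proof -
  have "bl n ps (ga i j) (unit_m n a b) (unit_m n b' c) = (unit_m n a b * unit_m n b' c) $$ (i, j)"
   using ga[of "unit_m n a b" "unit_m n b' c" i j] slp_poly_out[OF assms, of "unit_m n a b" "unit_m n b' c" i j] l
   by simp
  then show ?thesis
   using l by (simp add: bl_def lf_unit unit_m_mult del: index_mult_mat)
 qed
 then show ?thesis
  using ps(1) by (intro exI[of _ "length ps"] exI[of _ "\<lambda>r. fst (ps ! r)"]
    exI[of _ "\<lambda>r. snd (ps ! r)"] exI[of _ ga]) auto
qed

subsection \<open>Tensors over the integers\<close>

text \<open>A bilinear algorithm with R multiplications for the 0/1 tensor t: x and y index the two
  inputs, z the output. The factor D stands for cleared denominators, so that all coefficients are
  integers.\<close>

definition tensor_alg :: "nat => nat => nat => int => (nat => nat => int) => (nat => nat => int) =>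
  (nat => nat => int) => (nat => nat => nat => bool) => bool" where
 "tensor_alg q q' R D al be ga t \<longleftrightarrow> (\<forall>x<q. \<forall>y<q. \<forall>z<q'.
   (\<Sum>r<R. ga z r * (al r x * be r y)) = D * of_bool (t x y z))"

lemma common_denominator:
 assumes "finite (S :: rat set)"
 shows "\<exists>D :: int. D > 0 \<and> (\<forall>x\<in>S. of_int D * x \<in> \<int>)"
 using assms
proof (induction S)
 case (insert x S)
 then obtain D :: int where D: "D > 0" "\<And>x. x \<in> S \<Longrightarrow> of_int D * x \<in> \<int>" by blast
 obtain a b where q: "quotient_of x = (a, b)" by (cases "quotient_of x")
 have b: "b > 0" "x = of_int a / of_int b"
  using q quotient_of_denom_pos quotient_of_div by blast+
 have "of_int (D * b) * y \<in> \<int>" if "y \<in> insert x S" for y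
 proof (cases "y = x")
  case True
  then have "of_int (D * b) * y = of_int (D * a)" using b by simp
  then show ?thesis by (metis Ints_of_int)
 next
  case False
  then have "of_int D * y \<in> \<int>" using D that by auto
  then have "of_int b * (of_int D * y) \<in> \<int>" by (rule Ints_mult[OF Ints_of_int])
  then show ?thesis by (simp add: ac_simps)
 qed
 then show ?case using D b by (intro exI[of _ "D * b"]) auto
qed (auto intro: exI[of _ 1])

lemma tensor_alg_of_rat:
 assumes "\<And>x y z. x < q \<Longrightarrow> y < q \<Longrightarrow> z < q' \<Longrightarrow>
   (\<Sum>r<R. ga z r * (al r x * be r y)) = (of_bool (t x y z) :: rat)"
 shows "\<exists>D al be ga. D > 0 \<and> tensor_alg q q' R D al be ga t"
proof -
 let ?S = "(\<lambda>(r, x). al r x) ` ({..<R} \<times> {..<q}) \<union> (\<lambda>(r, x). be r x) ` ({..<R} \<times> {..<q}) \<union>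
  (\<lambda>(r, x). ga x r) ` ({..<R} \<times> {..<q'})"
 obtain D :: int where D: "D > 0" "\<And>x. x \<in> ?S \<Longrightarrow> of_int D * x \<in> \<int>"
  using common_denominator[of ?S] by auto
 define f :: "rat => int" where "f = (\<lambda>x. \<lfloor>of_int D * x\<rfloor>)"
 have f: "of_int (f x) = of_int D * x" if "x \<in> ?S" for x
  using D(2)[OF that] by (auto simp: f_def)
 \<comment> \<open>Each product has three coefficients, all of them scaled by D; hence the
   cube.\<close>
 have "(\<Sum>r<R. f (ga z r) * (f (al r x) * f (be r y))) = D ^ 3 * of_bool (t x y z)"
  if "x < q" "y < q" "z < q'" for x y z
 proof -
  have "rat_of_int (\<Sum>r<R. f (ga z r) * (f (al r x) * f (be r y))) =
    (\<Sum>r<R. (of_int D * ga z r) * ((of_int D * al r x) * (of_int D * be r y)))"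
   unfolding of_int_sum of_int_mult
   by (intro sum.cong refl, subst (1 2 3) f) (use that in \<open>auto simp: image_iff Bex_def\<close>)
  also have "\<dots> = of_int D ^ 3 * (\<Sum>r<R. ga z r * (al r x * be r y))"
   by (simp add: sum_distrib_left power3_eq_cube ac_simps)
  also have "\<dots> = rat_of_int (D ^ 3 * of_bool (t x y z))"
   using assms[OF that] by simp
  finally show ?thesis by (simp only: of_int_eq_iff)
 qed
 then show ?thesis
  using D(1) unfolding tensor_alg_def
  by (intro exI[of _ "D ^ 3"] exI[of _ "\<lambda>r x. f (al r x)"] exI[of _ "\<lambda>r x. f (be r x)"]
    exI[of _ "\<lambda>z r. f (ga z r)"]) auto
qed

text \<open>Padding with zero products gives the rank a prescribed value, so that the code can be
  written for a chosen R.\<close>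

lemma tensor_alg_mono:
 assumes "tensor_alg q q' R D al be ga t" "R \<le> R'"
 shows "tensor_alg q q' R' D al be (\<lambda>z r. if r < R then ga z r else 0) t"
proof -
 have "(\<Sum>r<R'. (if r < R then ga z r else 0) * (al r x * be r y)) =
   (\<Sum>r<R. ga z r * (al r x * be r y))" for x y z
  using assms(2) by (intro sum.mono_neutral_cong_right) auto
 then show ?thesis using assms(1) by (auto simp: tensor_alg_def)
qed

lemma sum_lessThan_times:
 fixes f :: "nat => 'a :: comm_monoid_add"
 shows "(\<Sum>r<m * k. f r) = (\<Sum>a<m. \<Sum>b<k. f (a * k + b))"
proof (induction m)
 case (Suc m)
 have "(\<Sum>r<Suc m * k. f r) = (\<Sum>r<m * k. f r) + (\<Sum>r\<in>{m * k..<m * k + k}. f r)"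
  using sum.atLeastLessThan_concat[of 0 "m * k" "m * k + k" f] by (simp add: lessThan_atLeast0 add.commute)
 also have "(\<Sum>r\<in>{m * k..<m * k + k}. f r) = (\<Sum>b<k. f (m * k + b))"
  using sum.shift_bounds_nat_ivl[of f 0 "m * k" k] by (simp add: lessThan_atLeast0 add.commute)
 finally show ?case using Suc by simp
qed simp

lemma mult_add_less: "(a::nat) < m \<Longrightarrow> b < k \<Longrightarrow> a * k + b < m * k"
 by (metis add.commute mult_Suc Suc_leI mult_le_mono1 less_le_trans nat_add_left_cancel_less)

lemma tensor_alg_product:
 assumes "tensor_alg q1 p1 R1 D1 al1 be1 ga1 t1" "tensor_alg q2 p2 R2 D2 al2 be2 ga2 t2"
 shows "tensor_alg (q1 * q2) (p1 * p2) (R1 * R2) (D1 * D2)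
  (\<lambda>r x. al1 (r div R2) (x div q2) * al2 (r mod R2) (x mod q2))
  (\<lambda>r x. be1 (r div R2) (x div q2) * be2 (r mod R2) (x mod q2))
  (\<lambda>z r. ga1 (z div p2) (r div R2) * ga2 (z mod p2) (r mod R2))
  (\<lambda>x y z. t1 (x div q2) (y div q2) (z div p2) \<and> t2 (x mod q2) (y mod q2) (z mod p2))"
 unfolding tensor_alg_def
proof (intro allI impI)
 fix x y z assume l: "x < q1 * q2" "y < q1 * q2" "z < p1 * p2"
 have q: "q2 > 0" "p2 > 0" using l by (auto intro: Nat.gr0I)
 have d: "x div q2 < q1" "y div q2 < q1" "z div p2 < p1" "x mod q2 < q2" "y mod q2 < q2" "z mod p2 < p2"
  using l q by (auto simp: less_mult_imp_div_less)
 let ?f = "\<lambda>r. ga1 (z div p2) (r div R2) * ga2 (z mod p2) (r mod R2) *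
  (al1 (r div R2) (x div q2) * al2 (r mod R2) (x mod q2) * (be1 (r div R2) (y div q2) * be2 (r mod R2) (y mod q2)))"
 have "(\<Sum>r<R1 * R2. ?f r) = (\<Sum>a<R1. \<Sum>b<R2. ?f (a * R2 + b))"
  by (rule sum_lessThan_times)
 also have "\<dots> = (\<Sum>a<R1. \<Sum>b<R2. (ga1 (z div p2) a * (al1 a (x div q2) * be1 a (y div q2))) *
   (ga2 (z mod p2) b * (al2 b (x mod q2) * be2 b (y mod q2))))"
  by (intro sum.cong refl) (simp add: ac_simps)
 also have "\<dots> = (\<Sum>a<R1. ga1 (z div p2) a * (al1 a (x div q2) * be1 a (y div q2))) *
   (\<Sum>b<R2. ga2 (z mod p2) b * (al2 b (x mod q2) * be2 b (y mod q2)))"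
  by (simp only: sum_product)
 also have "\<dots> = (D1 * of_bool (t1 (x div q2) (y div q2) (z div p2))) *
   (D2 * of_bool (t2 (x mod q2) (y mod q2) (z mod p2)))"
  using assms d unfolding tensor_alg_def by simp
 finally show "(\<Sum>r<R1 * R2. ?f r) = D1 * D2 * of_bool
   (t1 (x div q2) (y div q2) (z div p2) \<and> t2 (x mod q2) (y mod q2) (z mod p2))"
  by simp
qed

text \<open>An entry of the l-th Kronecker power of M, with row and column written in bases p and q;
  the least significant digits belong to the last factor.\<close>

fun kp :: "(nat => nat => int) => nat => nat => nat => nat => nat => int" where
 "kp M p q 0 r c = 1"
| "kp M p q (Suc l) r c = kp M p q l (r div p) (c div q) * M (r mod p) (c mod q)"

fun tpow :: "(nat => nat => nat => bool) => nat => nat => nat => nat => nat => nat => bool" where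
 "tpow t q p 0 x y z = True"
| "tpow t q p (Suc l) x y z \<longleftrightarrow> tpow t q p l (x div q) (y div q) (z div p) \<and> t (x mod q) (y mod q) (z mod p)"

lemma tensor_alg_power:
 assumes "tensor_alg q p R D al be ga t"
 shows "tensor_alg (q ^ l) (p ^ l) (R ^ l) (D ^ l) (kp al R q l) (kp be R q l) (kp ga p R l) (tpow t q p l)"
proof (induction l)
 case (Suc l)
 from tensor_alg_product[OF Suc assms] show ?case
  by (simp add: tensor_alg_def ac_simps)
qed (auto simp: tensor_alg_def)

subsection \<open>Polynomial multiplication\<close>

text \<open>Evaluation at the points 0, ..., 2 * K - 2 followed by Lagrange interpolation: a product
  of polynomials of degree below K is determined by its values at 2 * K - 1 points.\<close>

lemma polynomial_tensor:
 "\<exists>D al be ga. D > 0 \<and> tensor_alg K (2 * K - 1) (2 * K - 1) D al be ga (\<lambda>u v e. u + v = e)"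
proof (rule tensor_alg_of_rat)
 let ?m = "2 * K - 1"
 define Lg :: "nat => rat poly" where
  "Lg = (\<lambda>r. \<Prod>s\<in>{..<?m} - {r}. smult (1 / (of_nat r - of_nat s)) [:- of_nat s, 1:])"
 have val: "poly (Lg r) (of_nat s) = of_bool (r = s)" if "r < ?m" "s < ?m" for r s
 proof (cases "r = s")
  case True
  have "poly (Lg r) (of_nat r) = (\<Prod>s\<in>{..<?m} - {r}. 1)"
   unfolding Lg_def poly_prod by (intro prod.cong) (auto simp flip: diff_divide_distrib)
  then show ?thesis using True by simp
 next
  case False
  then have "poly (Lg r) (of_nat s) = 0"
   unfolding Lg_def poly_prod using that by (intro prod_zero) (auto intro!: bexI[of _ s])
  then show ?thesis using False by simp
 qed
 have deg: "degree (Lg r) < ?m" if "r < ?m" for r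
 proof -
  have "degree (Lg r) \<le> (\<Sum>s\<in>{..<?m} - {r}. degree (smult (1 / (of_nat r - of_nat s)) [:- of_nat s, 1 :: rat:]))"
   unfolding Lg_def by (rule order.trans[OF degree_prod_sum_le]) (auto simp: o_def)
  also have "\<dots> \<le> (\<Sum>s\<in>{..<?m} - {r}. 1)"
   by (intro sum_mono) (auto intro: order.trans[OF degree_smult_le])
  also have "\<dots> < ?m" using that by (simp add: card_Diff_singleton_if)
  finally show ?thesis .
 qed
 fix u v e assume l: "u < K" "v < K" "e < ?m"
 have uv: "u + v < ?m" using l by simp
 \<comment> \<open>Interpolates the monomial of degree u + v, which is below the number of points;
   its values r ^ (u + v) are the products of the values of the two inputs.\<close>
 have "(\<Sum>r<?m. smult (of_nat r ^ (u + v)) (Lg r)) = monom 1 (u + v)"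
 proof (rule poly_eqI_degree[where A = "of_nat ` {..<?m}"])
  fix x :: rat assume "x \<in> of_nat ` {..<?m}"
  then obtain s where s: "x = of_nat s" "s < ?m" by auto
  have "poly (\<Sum>r<?m. smult (of_nat r ^ (u + v)) (Lg r)) x = (\<Sum>r<?m. if r = s then of_nat r ^ (u + v) else 0)"
   unfolding poly_sum s(1) by (intro sum.cong) (use s val in auto)
  then show "poly (\<Sum>r<?m. smult (of_nat r ^ (u + v)) (Lg r)) x = poly (monom 1 (u + v)) x"
   using s by (simp add: poly_monom)
 next
  have c: "card ((of_nat :: nat => rat) ` {..<?m}) = ?m" by (subst card_image) (auto simp: inj_on_def)
  show "card ((of_nat :: nat => rat) ` {..<?m}) > degree (\<Sum>r<?m. smult (of_nat r ^ (u + v)) (Lg r))"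
   unfolding c
  proof (rule degree_sum_less)
   fix r assume "r \<in> {..<?m}"
   then show "degree (smult (of_nat r ^ (u + v)) (Lg r)) < ?m"
    by (intro le_less_trans[OF degree_smult_le] deg) simp
  qed (use l in simp)
  show "card ((of_nat :: nat => rat) ` {..<?m}) > degree (monom (1 :: rat) (u + v))"
   unfolding c by (rule le_less_trans[OF degree_monom_le uv])
 qed
 then have "coeff (\<Sum>r<?m. smult (of_nat r ^ (u + v)) (Lg r)) e = of_bool (u + v = e)"
  by simp
 then show "(\<Sum>r<?m. coeff (Lg r) e * (of_nat r ^ u * of_nat r ^ v)) = of_bool (u + v = e)"
  by (simp add: coeff_sum power_add ac_simps)
qed

text \<open>Entry (a, b) of a matrix has the index a * N + b; the conditions say that x = (i, k), y
  = (k, j) and z = (i, j) for some i, k, j.\<close>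

definition tmm :: "nat => nat => nat => nat => bool" where
 "tmm N x y z \<longleftrightarrow> z div N = x div N \<and> x mod N = y div N \<and> z mod N = y mod N"

lemma mm_tensor:
 assumes "slp_multiplies N (gs :: rat gate list) out"
 shows "\<exists>R D al be ga. R \<le> 2 * length gs \<and> D > 0 \<and> tensor_alg (N * N) (N * N) R D al be ga (tmm N)"
proof -
 obtain R al be ga where R: "R \<le> 2 * length gs" and
  s: "\<forall>i<N. \<forall>j<N. \<forall>a<N. \<forall>b<N. \<forall>b'<N. \<forall>c<N.
  (\<Sum>r<R. ga i j r * (al r a b * be r b' c)) = (of_bool (i = a \<and> b = b' \<and> j = c) :: rat)"
  using bilinear_of_slp[OF assms] by (elim exE conjE) (rule that)
 have "\<exists>D al be ga. D > 0 \<and> tensor_alg (N * N) (N * N) R D al be ga (tmm N)"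
 proof (rule tensor_alg_of_rat)
  fix x y z assume l: "x < N * N" "y < N * N" "z < N * N"
  then have "N > 0" by (auto intro: Nat.gr0I)
  with l have d: "x div N < N" "y div N < N" "z div N < N" "x mod N < N" "y mod N < N" "z mod N < N"
   by (auto simp: less_mult_imp_div_less)
  show "(\<Sum>r<R. ga (z div N) (z mod N) r * (al r (x div N) (x mod N) * be r (y div N) (y mod N))) =
    of_bool (tmm N x y z)"
   using s d by (simp add: tmm_def)
 qed
 then show ?thesis using R by blast
qed

text \<open>N by N matrices whose entries are polynomials of degree below K: an index is a matrix
  position followed by an exponent, which ranges below 2 * K - 1 in the product.\<close>

definition tbase :: "nat => nat => nat => nat => nat => bool" where
 "tbase N K x y z \<longleftrightarrow> tmm N (x div K) (y div K) (z div (2 * K - 1)) \<and>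
   x mod K + y mod K = z mod (2 * K - 1)"

lemma base_tensor:
 assumes "slp_multiplies N (gs :: rat gate list) out" "2 * length gs \<le> R"
 shows "\<exists>D al be ga. D > 0 \<and>
  tensor_alg (N * N * K) (N * N * (2 * K - 1)) (R * (2 * K - 1)) D al be ga (tbase N K)"
proof -
 obtain R0 D al be ga where 1: "R0 \<le> 2 * length gs" "D > 0" "tensor_alg (N * N) (N * N) R0 D al be ga (tmm N)"
  using mm_tensor[OF assms(1)] by blast
 have "R0 \<le> R" using 1 assms by simp
 obtain D' al' be' ga' where 2: "D' > 0"
  "tensor_alg K (2 * K - 1) (2 * K - 1) D' al' be' ga' (\<lambda>u v e. u + v = e)"
  using polynomial_tensor by blast
 have "D * D' > 0" using 1 2 by simp
 with tensor_alg_product[OF tensor_alg_mono[OF 1(3) \<open>R0 \<le> R\<close>] 2(2)] show ?thesis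
  unfolding tbase_def by blast
qed

subsection \<open>Interleaved digits\<close>

text \<open>The index, in the l-th tensor power, of the monomial with exponent a at position (i, k):
  each level takes one base-N digit of i, one of k, and one base-b digit of a.\<close>

fun enc :: "nat => nat => nat => nat => nat => nat => nat" where
 "enc N b 0 i k a = 0"
| "enc N b (Suc l) i k a = ((i mod N) * N + k mod N) * b + a mod b +
   N * N * b * enc N b l (i div N) (k div N) (a div b)"

text \<open>The digitwise sum of base-K numbers, recorded in base 2 * K - 1 where no carry arises:
  the exponent vector of a product of two monomials in l variables.\<close>

fun dsum :: "nat => nat => nat => nat => nat" where
 "dsum K 0 a b = 0"
| "dsum K (Suc l) a b = a mod K + b mod K + (2 * K - 1) * dsum K l (a div K) (b div K)"

text \<open>Makes up for the missing carries by weighting the digits with powers of K, so that an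
  exponent vector becomes an ordinary exponent again (\<open>sg_dsum\<close>).\<close>

fun sg :: "nat => nat => nat => nat" where
 "sg K 0 e = 0"
| "sg K (Suc l) e = e mod (2 * K - 1) + K * sg K l (e div (2 * K - 1))"

lemma enc_digit:
 fixes N b i k a :: nat
 assumes "N > 0" "b > 0"
 shows "(i mod N * N + k mod N) * b + a mod b < N * N * b"
 by (intro mult_add_less) (use assms in auto)

lemma low_digit: "(d::nat) < m \<Longrightarrow> (d + m * x) mod m = d" "d < m \<Longrightarrow> (d + m * x) div m = x"
 by auto

lemma enc_less:
 assumes "N > 0" "b > 0"
 shows "enc N b l i k a < (N * N * b) ^ l"
proof (induction l arbitrary: i k a)
 case (Suc l)
 have "enc N b (Suc l) i k a = enc N b l (i div N) (k div N) (a div b) * (N * N * b) +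
   (((i mod N) * N + k mod N) * b + a mod b)"
  by simp
 also have "\<dots> < (N * N * b) ^ l * (N * N * b)"
  using Suc enc_digit[OF assms] by (rule mult_add_less)
 finally show ?case by (simp add: ac_simps)
qed simp

lemma enc_Suc_mod:
 assumes "N > 0" "b > 0"
 shows "enc N b (Suc l) i k a mod (N * N * b) = ((i mod N) * N + k mod N) * b + a mod b"
  "enc N b (Suc l) i k a div (N * N * b) = enc N b l (i div N) (k div N) (a div b)"
 unfolding enc.simps by (rule low_digit[OF enc_digit[OF assms]])+

lemma dsum_less: "K > 0 \<Longrightarrow> dsum K l a b < (2 * K - 1) ^ l"
proof (induction l arbitrary: a b)
 case (Suc l)
 have "a mod K < K" "b mod K < K" using Suc by auto
 then have "a mod K + b mod K < 2 * K - 1" by linarith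
 from mult_add_less[OF Suc.IH[OF Suc.prems] this, of "a div K" "b div K"] show ?case by (simp add: ac_simps)
qed simp

lemma dsum_Suc_mod:
 assumes "K > 0"
 shows "dsum K (Suc l) a b mod (2 * K - 1) = a mod K + b mod K"
  "dsum K (Suc l) a b div (2 * K - 1) = dsum K l (a div K) (b div K)"
proof -
 have "a mod K < K" "b mod K < K" using assms by auto
 then have "a mod K + b mod K < 2 * K - 1" by linarith
 then show "dsum K (Suc l) a b mod (2 * K - 1) = a mod K + b mod K"
  "dsum K (Suc l) a b div (2 * K - 1) = dsum K l (a div K) (b div K)"
  unfolding dsum.simps by (rule low_digit; assumption)+
qed

lemma sg_dsum:
 assumes "K > 0"
 shows "a < K ^ l \<Longrightarrow> b < K ^ l \<Longrightarrow> sg K l (dsum K l a b) = a + b"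
proof (induction l arbitrary: a b)
 case (Suc l)
 have "a div K < K ^ l" "b div K < K ^ l"
  using Suc.prems by (auto simp: less_mult_imp_div_less mult.commute)
 then have "sg K (Suc l) (dsum K (Suc l) a b) = a mod K + b mod K + K * (a div K + b div K)"
  using Suc.IH dsum_Suc_mod[OF assms] by (simp del: dsum.simps)
 also have "\<dots> = (a mod K + K * (a div K)) + (b mod K + K * (b div K))"
  by (simp add: algebra_simps)
 finally show ?case by simp
qed simp

lemma eq_div_mod: "(x::nat) = y \<longleftrightarrow> x div m = y div m \<and> x mod m = y mod m"
 by (metis div_mult_mod_eq)

text \<open>The tensor power tests every level separately, and equality of numbers is equality of
  all their digits.\<close>

lemma tpow_enc:
 assumes "N > 0" "K > 0"
 shows "i < N ^ l \<Longrightarrow> k < N ^ l \<Longrightarrow> k' < N ^ l \<Longrightarrow> j < N ^ l \<Longrightarrow> i' < N ^ l \<Longrightarrow> j' < N ^ l \<Longrightarrow> e < (2 * K - 1) ^ l \<Longrightarrow>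
  tpow (tbase N K) (N * N * K) (N * N * (2 * K - 1)) l (enc N K l i k a) (enc N K l k' j b)
   (enc N (2 * K - 1) l i' j' e) \<longleftrightarrow> i = i' \<and> k = k' \<and> j = j' \<and> e = dsum K l a b"
proof (induction l arbitrary: i k k' j i' j' a b e)
 case (Suc l)
 let ?b = "2 * K - 1"
 have b: "?b > 0" using assms by simp
 have dv: "i div N < N ^ l" "k div N < N ^ l" "k' div N < N ^ l" "j div N < N ^ l" "i' div N < N ^ l"
  "j' div N < N ^ l" "e div ?b < ?b ^ l"
  using Suc.prems by (auto simp: less_mult_imp_div_less mult.commute)
 have dg: "((i mod N * N + k mod N) * c + a mod c) div c = i mod N * N + k mod N"
   "((i mod N * N + k mod N) * c + a mod c) mod c = a mod c" if "c > 0" for i k a c :: nat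
  using that by auto
 have dN: "(i mod N * N + k mod N) div N = i mod N" "(i mod N * N + k mod N) mod N = k mod N" for i k
  using assms by auto
 have "tpow (tbase N K) (N * N * K) (N * N * ?b) (Suc l) (enc N K (Suc l) i k a) (enc N K (Suc l) k' j b)
   (enc N ?b (Suc l) i' j' e) \<longleftrightarrow>
  (i div N = i' div N \<and> k div N = k' div N \<and> j div N = j' div N \<and> e div ?b = dsum K l (a div K) (b div K)) \<and>
  (i mod N = i' mod N \<and> k mod N = k' mod N \<and> j mod N = j' mod N \<and> a mod K + b mod K = e mod ?b)"
  unfolding tpow.simps enc_Suc_mod[OF assms(1) b] enc_Suc_mod[OF assms] Suc.IH[OF dv]
   tbase_def tmm_def dg[OF b] dg[OF assms(2)] dN by auto
 also have "\<dots> \<longleftrightarrow> i = i' \<and> k = k' \<and> j = j' \<and> e = dsum K (Suc l) a b"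
  unfolding eq_div_mod[of i i' N] eq_div_mod[of k k' N] eq_div_mod[of j j' N]
   eq_div_mod[of e "dsum K (Suc l) a b" ?b] dsum_Suc_mod[OF assms(2)] by auto
 finally show ?case .
qed simp

text \<open>The exponents a and a' may differ: distinct positions never share an index, so the
  indicator vector of a partial matrix has exactly one 1 per present entry.\<close>

lemma enc_inj:
 assumes "N > 0" "b > 0"
 shows "i < N ^ l \<Longrightarrow> k < N ^ l \<Longrightarrow> i' < N ^ l \<Longrightarrow> k' < N ^ l \<Longrightarrow>
  enc N b l i k a = enc N b l i' k' a' \<Longrightarrow> i = i' \<and> k = k'"
proof (induction l arbitrary: i k i' k' a a')
 case (Suc l)
 have dv: "i div N < N ^ l" "k div N < N ^ l" "i' div N < N ^ l" "k' div N < N ^ l"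
  using Suc.prems by (auto simp: less_mult_imp_div_less mult.commute)
 have "((i mod N) * N + k mod N) * b + a mod b = ((i' mod N) * N + k' mod N) * b + a' mod b"
  "enc N b l (i div N) (k div N) (a div b) = enc N b l (i' div N) (k' div N) (a' div b)"
  using Suc.prems(5) enc_Suc_mod[OF assms, of l i k a] enc_Suc_mod[OF assms, of l i' k' a'] by metis+
 then have d: "i div N = i' div N" "k div N = k' div N"
  and *: "((i mod N) * N + k mod N) * b + a mod b = ((i' mod N) * N + k' mod N) * b + a' mod b"
  using Suc.IH[OF dv] by auto
 have "(((i mod N) * N + k mod N) * b + a mod b) div b = (((i' mod N) * N + k' mod N) * b + a' mod b) div b"
  using * by simp
 then have "(i mod N) * N + k mod N = (i' mod N) * N + k' mod N"
  using assms by simp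
 then have "((i mod N) * N + k mod N) div N = ((i' mod N) * N + k' mod N) div N"
  "((i mod N) * N + k mod N) mod N = ((i' mod N) * N + k' mod N) mod N" by simp_all
 then have "i mod N = i' mod N" "k mod N = k' mod N" using assms by simp_all
 with d show ?case using eq_div_mod[of i i' N] eq_div_mod[of k k' N] by simp
qed simp

subsection \<open>Counting by one tensor power\<close>

text \<open>The coefficient vector of a matrix that has the monomial with exponent f i k at the
  positions in P and the zero polynomial elsewhere.\<close>

definition ind :: "nat => nat => nat => (nat \<times> nat) set => (nat => nat => nat) => nat => nat" where
 "ind N K l P f x = of_bool (\<exists>i k. (i, k) \<in> P \<and> x = enc N K l i k (f i k))"

lemma sum_ind:
 fixes g :: "nat => int"
 assumes "N > 0" "K > 0" "P \<subseteq> {..<n} \<times> {..<n}" "n \<le> N ^ l"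
 shows "(\<Sum>x<(N * N * K) ^ l. g x * int (ind N K l P f x)) = (\<Sum>(i, k)\<in>P. g (enc N K l i k (f i k)))"
proof -
 let ?h = "\<lambda>(i, k). enc N K l i k (f i k)"
 have fin: "finite P" using assms(3) finite_subset by blast
 have inj: "inj_on ?h P"
 proof (rule inj_onI, clarify)
  fix i k i' k' assume "(i, k) \<in> P" "(i', k') \<in> P" "enc N K l i k (f i k) = enc N K l i' k' (f i' k')"
  moreover from this have "i < N ^ l" "k < N ^ l" "i' < N ^ l" "k' < N ^ l" using assms(3,4) by auto
  ultimately show "i = i' \<and> k = k'" using enc_inj[OF assms(1,2)] by blast
 qed
 have "(\<Sum>x<(N * N * K) ^ l. g x * int (ind N K l P f x)) = (\<Sum>x\<in>?h ` P. g x)"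
  by (rule sum.mono_neutral_cong_right) (auto simp: ind_def image_iff enc_less[OF assms(1,2)])
 also have "\<dots> = (\<Sum>(i, k)\<in>P. g (enc N K l i k (f i k)))"
  by (subst sum.reindex[OF inj]) (auto simp: case_prod_unfold)
 finally show ?thesis .
qed

text \<open>The left side is what the machine computes: transform both inputs, multiply pointwise,
  transform back. By the tensor identity it is D ^ l times the coefficient e in cell (i, j) of the
  product of the two matrices of monomials, and this coefficient counts the middle indices
  k.\<close>

lemma tensor_count:
 assumes ta: "tensor_alg (N * N * K) (N * N * (2 * K - 1)) R D al be ga (tbase N K)"
  and pos: "N > 0" "K > 0" and P: "PA \<subseteq> {..<n} \<times> {..<n}" "PB \<subseteq> {..<n} \<times> {..<n}" and n: "n \<le> N ^ l"
  and ij: "i < n" "j < n" and e: "e < (2 * K - 1) ^ l"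
 defines "q \<equiv> N * N * K" and "p \<equiv> N * N * (2 * K - 1)"
 shows "(\<Sum>r<R ^ l. kp ga p R l (enc N (2 * K - 1) l i j e) r *
   ((\<Sum>x<q ^ l. kp al R q l r x * int (ind N K l PA fa x)) *
    (\<Sum>y<q ^ l. kp be R q l r y * int (ind N K l PB fb y)))) =
  D ^ l * int (card {k. k < n \<and> (i, k) \<in> PA \<and> (k, j) \<in> PB \<and> e = dsum K l (fa i k) (fb k j)})"
proof -
 let ?z = "enc N (2 * K - 1) l i j e"
 let ?A = "\<lambda>x. int (ind N K l PA fa x)" and ?B = "\<lambda>y. int (ind N K l PB fb y)"
 have b: "2 * K - 1 > 0" using pos by simp
 have z: "?z < p ^ l" unfolding p_def by (rule enc_less[OF pos(1) b])
 have ta': "(\<Sum>r<R ^ l. kp ga p R l ?z r * (kp al R q l r x * kp be R q l r y)) = D ^ l * of_bool (tpow (tbase N K) q p l x y ?z)"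
  if "x < q ^ l" "y < q ^ l" for x y
  using tensor_alg_power[OF ta, of l] that z unfolding tensor_alg_def q_def p_def by blast
 have "(\<Sum>r<R ^ l. kp ga p R l ?z r * ((\<Sum>x<q ^ l. kp al R q l r x * ?A x) * (\<Sum>y<q ^ l. kp be R q l r y * ?B y))) =
   (\<Sum>r<R ^ l. \<Sum>x<q ^ l. \<Sum>y<q ^ l. (kp ga p R l ?z r * (kp al R q l r x * kp be R q l r y)) * (?A x * ?B y))"
  by (intro sum.cong refl, subst sum_product, unfold sum_distrib_left, intro sum.cong refl) (simp add: ac_simps)
 also have "\<dots> = (\<Sum>x<q ^ l. \<Sum>r<R ^ l. \<Sum>y<q ^ l. (kp ga p R l ?z r * (kp al R q l r x * kp be R q l r y)) * (?A x * ?B y))"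
  by (rule sum.swap)
 also have "\<dots> = (\<Sum>x<q ^ l. \<Sum>y<q ^ l. \<Sum>r<R ^ l. (kp ga p R l ?z r * (kp al R q l r x * kp be R q l r y)) * (?A x * ?B y))"
  by (intro sum.cong refl sum.swap)
 also have "\<dots> = (\<Sum>x<q ^ l. \<Sum>y<q ^ l. D ^ l * of_bool (tpow (tbase N K) q p l x y ?z) * (?A x * ?B y))"
  by (intro sum.cong refl) (simp only: sum_distrib_right[symmetric] ta' lessThan_iff)
 also have "\<dots> = D ^ l * (\<Sum>x<q ^ l. (\<Sum>y<q ^ l. of_bool (tpow (tbase N K) q p l x y ?z) * ?B y) * ?A x)"
  unfolding sum_distrib_left sum_distrib_right by (intro sum.cong refl) (simp add: ac_simps)
 also have "(\<Sum>x<q ^ l. (\<Sum>y<q ^ l. of_bool (tpow (tbase N K) q p l x y ?z) * ?B y) * ?A x) =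
   (\<Sum>(i', k)\<in>PA. \<Sum>(k', j')\<in>PB. of_bool (tpow (tbase N K) q p l (enc N K l i' k (fa i' k)) (enc N K l k' j' (fb k' j')) ?z))"
  unfolding q_def sum_ind[OF pos P(1) n] sum_ind[OF pos P(2) n] ..
 also have "\<dots> = (\<Sum>(i', k)\<in>PA. \<Sum>(k', j')\<in>PB. of_bool (i' = i \<and> k = k' \<and> j' = j \<and> e = dsum K l (fa i' k) (fb k' j')))"
 proof (intro sum.cong refl, clarify, intro sum.cong refl, clarify)
  fix i' k k' j' assume "(i', k) \<in> PA" "(k', j') \<in> PB"
  then have "i' < N ^ l" "k < N ^ l" "k' < N ^ l" "j' < N ^ l" "i < N ^ l" "j < N ^ l" using P n ij by auto
  then show "of_bool (tpow (tbase N K) q p l (enc N K l i' k (fa i' k)) (enc N K l k' j' (fb k' j')) ?z) =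
    (of_bool (i' = i \<and> k = k' \<and> j' = j \<and> e = dsum K l (fa i' k) (fb k' j')) :: int)"
   unfolding q_def p_def using tpow_enc[OF pos _ _ _ _ _ _ e] by simp
 qed
 also have "\<dots> = (\<Sum>(x, y)\<in>PA \<times> PB. of_bool (fst x = i \<and> snd x = fst y \<and> snd y = j \<and> e = dsum K l (fa (fst x) (snd x)) (fb (fst y) (snd y))))"
  by (simp add: sum.cartesian_product case_prod_unfold)
 also have "\<dots> = (\<Sum>(x, y)\<in>(\<lambda>k. ((i, k), (k, j))) ` {k. k < n \<and> (i, k) \<in> PA \<and> (k, j) \<in> PB \<and> e = dsum K l (fa i k) (fb k j)}. 1)"
 proof (rule sum.mono_neutral_cong_right)
  have "finite PA" "finite PB" using P finite_subset by blast+
  then show "finite (PA \<times> PB)" by simp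
  show "\<forall>x\<in>PA \<times> PB - (\<lambda>k. ((i, k), (k, j))) ` {k. k < n \<and> (i, k) \<in> PA \<and> (k, j) \<in> PB \<and> e = dsum K l (fa i k) (fb k j)}.
    (case x of (x, y) => of_bool (fst x = i \<and> snd x = fst y \<and> snd y = j \<and>
     e = dsum K l (fa (fst x) (snd x)) (fb (fst y) (snd y)))) = (0 :: int)"
   using P by (auto simp: image_iff)
 qed auto
 also have "\<dots> = int (card {k. k < n \<and> (i, k) \<in> PA \<and> (k, j) \<in> PB \<and> e = dsum K l (fa i k) (fb k j)})"
  by (simp add: card_image inj_on_def case_prod_unfold)
 finally show ?thesis .
qed

text \<open>Each k has exactly one exponent vector e, so the classes are disjoint. The third weight
  c joins only here; the polynomials are built from two of the three matrices.\<close>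

lemma card_residue:
 fixes n :: nat
 assumes "K > 0" "\<And>k. k < n \<Longrightarrow> Q k \<Longrightarrow> fa k < K ^ l" "\<And>k. k < n \<Longrightarrow> Q k \<Longrightarrow> fb k < K ^ l"
 shows "(\<Sum>e | e < (2 * K - 1) ^ l \<and> (sg K l e + c) mod m = s. card {k. k < n \<and> Q k \<and> e = dsum K l (fa k) (fb k)}) =
  card {k. k < n \<and> Q k \<and> (fa k + fb k + c) mod m = s}"
proof -
 let ?E = "{e. e < (2 * K - 1) ^ l \<and> (sg K l e + c) mod m = s}"
 have fin: "finite {k. k < n \<and> Q k \<and> e = dsum K l (fa k) (fb k)}" for e
  by (rule finite_subset[of _ "{..<n}"]) auto
 have "(\<Sum>e\<in>?E. card {k. k < n \<and> Q k \<and> e = dsum K l (fa k) (fb k)}) =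
   card (\<Union>e\<in>?E. {k. k < n \<and> Q k \<and> e = dsum K l (fa k) (fb k)})"
  using fin by (intro card_UN_disjoint[symmetric]) auto
 also have "(\<Union>e\<in>?E. {k. k < n \<and> Q k \<and> e = dsum K l (fa k) (fb k)}) =
   {k. k < n \<and> Q k \<and> (fa k + fb k + c) mod m = s}"
  using assms by (auto simp: sg_dsum dsum_less[unfolded One_nat_def])
 finally show ?thesis .
qed

section \<open>Choosing a modulus with few collisions\<close>

subsection \<open>A lower bound on the number of primes\<close>

lemma Lcm_atLeastAtMost_Suc: "Lcm {1..Suc n} = lcm (Suc n) (Lcm {1..n})"
 by (simp add: atLeastAtMostSuc_conv)

lemma Lcm_pos: "Lcm {1..n::nat} > 0"
proof -
 have "0 \<notin> {1..n}" by simp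
 then show ?thesis by (metis Lcm_0_iff finite_atLeastAtMost gr0I)
qed

text \<open>The numbers \<open>1 / (k * (n choose k))\<close> form the Leibniz harmonic triangle, in which neighbours in a
 row add up to the entry above; hence they are integer combinations of \<open>1, 1/2, \<dots>, 1/n\<close>.\<close>

lemma leibniz_triangle:
 assumes "1 \<le> k" "k \<le> n"
 shows "of_nat (Lcm {1..n}) / of_nat (k * (n choose k)) \<in> (\<int> :: rat set)"
 using assms
proof (induction n arbitrary: k)
 case (Suc n)
 let ?L = "\<lambda>n k. 1 / of_nat (k * (n choose k)) :: rat"
 have sc: "of_nat (Lcm {1..Suc n}) * ?L n k \<in> \<int>" if "1 \<le> k" "k \<le> n" for k
 proof -
  have "Lcm {1..n} dvd Lcm {1..Suc n}" unfolding Lcm_atLeastAtMost_Suc by simp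
  then obtain c where c: "Lcm {1..Suc n} = Lcm {1..n} * c" by (elim dvdE)
  have "of_nat c * (of_nat (Lcm {1..n}) / of_nat (k * (n choose k)) :: rat) \<in> \<int>"
   by (intro Ints_mult Suc.IH that) auto
  then show ?thesis unfolding c by (simp add: mult_ac)
 qed
 from Suc.prems(2) Suc.prems(1) have "of_nat (Lcm {1..Suc n}) * ?L (Suc n) k \<in> \<int>"
 proof (induction k rule: inc_induct)
  case base
  have "Suc n dvd Lcm {1..Suc n}" by (rule dvd_Lcm) simp
  then obtain c where c: "Lcm {1..Suc n} = Suc n * c" by (elim dvdE)
  have "of_nat (Lcm {1..Suc n}) * ?L (Suc n) (Suc n) = of_nat c" unfolding c by (simp del: of_nat_Suc mult_Suc)
  then show ?case by (metis Ints_of_nat)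
 next
  case (step k)
  have k: "k \<le> n" "k > 0" using step by auto
  have c1: "Suc k * (Suc n choose Suc k) = (Suc n - k) * (Suc n choose k)"
   using binomial_absorb_comp[of "Suc n" k] Suc_times_binomial[of k n] by simp
  have c2: "Suc n * (n choose k) = (Suc n - k) * (Suc n choose k)"
   using binomial_absorb_comp[of "Suc n" k] by simp
  define x where "x = (of_nat (Suc n choose k) :: rat)"
  define d where "d = (of_nat (Suc n - k) :: rat)"
  have pos: "x > 0" "d > 0" "of_nat k > (0 :: rat)" using k by (auto simp: x_def d_def)
  have d: "d = of_nat (Suc n) - of_nat k" using k by (simp add: d_def of_nat_diff)
  have b1: "of_nat (Suc k * (Suc n choose Suc k)) = d * x"
   unfolding c1 by (simp add: x_def d_def)
  have b2: "of_nat (Suc n) * of_nat (n choose k) = d * x"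
   unfolding x_def d_def of_nat_mult[symmetric] c2 ..
  then have b2': "of_nat (n choose k) = d * x / of_nat (Suc n)"
   by (simp add: field_simps)
  have "?L (Suc n) k = ?L n k - ?L (Suc n) (Suc k)"
  proof -
   define y where "y = (of_nat k :: rat)"
   have n: "(of_nat (Suc n) :: rat) = d + y" unfolding d y_def by simp
   have "?L (Suc n) k = 1 / (y * x)" by (simp add: x_def y_def)
   moreover have "?L n k = (d + y) / (y * (d * x))"
    unfolding of_nat_mult b2' y_def using n[unfolded y_def] by (simp del: of_nat_Suc)
   moreover have "?L (Suc n) (Suc k) = 1 / (d * x)" by (simp only: b1)
   ultimately show ?thesis using pos by (simp add: y_def[symmetric] field_simps)
  qed
  then have "of_nat (Lcm {1..Suc n}) * ?L (Suc n) k =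
    of_nat (Lcm {1..Suc n}) * ?L n k - of_nat (Lcm {1..Suc n}) * ?L (Suc n) (Suc k)"
   by (simp only: right_diff_distrib)
  then show ?case
   using sc[of k] k step.IH by (simp only:) (auto intro: Ints_diff)
 qed
 then show ?case by simp
qed simp

text \<open>By \<open>leibniz_triangle\<close> the quotient is an integer; being positive, it is at
  least 1.\<close>

lemma binomial_le_Lcm:
 assumes "1 \<le> k" "k \<le> n"
 shows "k * (n choose k) \<le> Lcm {1..n}"
proof -
 have pos: "k * (n choose k) > 0" using assms by simp
 obtain z :: int where z: "of_nat (Lcm {1..n}) / of_nat (k * (n choose k)) = (of_int z :: rat)"
  using leibniz_triangle[OF assms] by (auto elim: Ints_cases)
 have "(of_int z :: rat) > 0" using z pos Lcm_pos[of n] by (metis divide_pos_pos of_nat_0_less_iff)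
 then have "z \<ge> 1" by simp
 then have "(of_nat (Lcm {1..n}) / of_nat (k * (n choose k)) :: rat) \<ge> 1" unfolding z by simp
 then have "(of_nat (k * (n choose k)) :: rat) \<le> of_nat (Lcm {1..n})"
  using pos by (simp add: le_divide_eq del: of_nat_mult)
 then show ?thesis by (simp only: of_nat_le_iff)
qed

text \<open>Multiplicities in a least common multiple are maxima, so a prime power dividing it
  already divides one of the numbers up to n.\<close>

lemma prime_power_dvd_Lcm:
 fixes p :: nat
 assumes "prime p" "p ^ k dvd Lcm {1..n}" "k > 0"
 shows "p ^ k \<le> n"
 using assms(2)
proof (induction n)
 case 0
 then show ?case using assms by (simp add: prime_gt_1_nat)
next
 case (Suc n)
 let ?x = "Suc n" and ?y = "Lcm {1..n}"
 have nz: "?x \<noteq> 0" "?y \<noteq> 0" using Lcm_pos[of n] by auto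
 have "k \<le> multiplicity p (lcm ?x ?y)"
  using Suc.prems assms(1) nz unfolding Lcm_atLeastAtMost_Suc
  by (intro multiplicity_geI) (auto simp: lcm_eq_0_iff prime_gt_1_nat)
 also have "multiplicity p (lcm ?x ?y) = max (multiplicity p ?x) (multiplicity p ?y)"
  using nz assms(1) by (intro multiplicity_lcm) auto
 finally have "p ^ k dvd ?x \<or> p ^ k dvd ?y"
  using multiplicity_dvd' by (auto simp: max_def split: if_splits)
 then show ?case using Suc.IH by (auto dest: dvd_imp_le)
qed

text \<open>Every prime power in the factorisation of the least common multiple is at most n, and
  only primes up to n occur.\<close>

lemma Lcm_le_power: "Lcm {1..n :: nat} \<le> n ^ card {p. prime p \<and> p \<le> n}"
proof -
 let ?X = "Lcm {1..n}"
 have nz: "?X \<noteq> 0" using Lcm_pos[of n] by simp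
 have *: "p ^ multiplicity p ?X \<le> n" "p \<le> n" if "p \<in> prime_factors ?X" for p
 proof -
  have p: "prime p" "p dvd ?X" "multiplicity p ?X > 0"
   using that nz in_prime_factors_imp_dvd[OF that] by (auto simp: prime_factors_multiplicity)
  show "p ^ multiplicity p ?X \<le> n"
   using p by (intro prime_power_dvd_Lcm) (auto simp: multiplicity_dvd)
  show "p \<le> n" using prime_power_dvd_Lcm[OF p(1), of 1 n] p by simp
 qed
 have "?X = (\<Prod>p\<in>prime_factors ?X. p ^ multiplicity p ?X)"
  by (rule trans[OF _ prod_prime_factors[OF nz, symmetric]]) simp
 also have "\<dots> \<le> (\<Prod>p\<in>prime_factors ?X. n)"
  by (rule prod_mono) (blast intro: *(1) zero_le)
 also have "\<dots> = n ^ card (prime_factors ?X)" by simp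
 also have "\<dots> \<le> n ^ card {p. prime p \<and> p \<le> n}"
 proof (cases "n = 0")
  case False
  have "card (prime_factors ?X) \<le> card {p. prime p \<and> p \<le> n}"
  proof (rule card_mono)
   show "finite {p. prime p \<and> p \<le> n}" by (rule finite_subset[of _ "{..n}"]) auto
   show "prime_factors ?X \<subseteq> {p. prime p \<and> p \<le> n}"
    using *(2) in_prime_factors_imp_prime by blast
  qed
  then show ?thesis using False by (intro power_increasing) auto
 next
  case True
  then have "{p. prime p \<and> p \<le> n} = {}" by (auto dest: prime_gt_0_nat)
  then have c: "card {p. prime p \<and> p \<le> n} = 0" by (simp only: card.empty)
  show ?thesis using True unfolding c by simp
 qed
 finally show ?thesis .
qed

text \<open>A Chebyshev bound by Nair's method: the least common multiple of 1, ..., 2 k is at least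
  k times the central binomial coefficient, hence at least 4 ^ k / 2. Of the 2 in n - 2, one is lost
  by rounding n down to 2 k and one to the factor 1 / 2.\<close>

lemma prime_count_lower:
 assumes "n \<ge> 2"
 shows "(real n - 2) * ln 2 \<le> card {p. prime p \<and> p \<le> n} * ln n"
proof -
 define k where "k = n div 2"
 have k: "k > 0" "2 * k \<le> n" "real n - 1 \<le> 2 * real k" using assms by (auto simp: k_def)
 let ?c = "card {p. prime p \<and> p \<le> n}"
 have "4 ^ k / (2 * real k) \<le> real ((2 * k) choose k)"
  using k by (intro central_binomial_lower_bound) auto
 then have "4 ^ k \<le> 2 * real (k * ((2 * k) choose k))"
  using k by (simp add: field_simps)
 also have "\<dots> \<le> 2 * real (Lcm {1..2 * k})"
  using k binomial_le_Lcm[of k "2 * k"] by (simp only: mult_le_cancel_left_pos of_nat_le_iff zero_less_numeral)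
 also have "\<dots> \<le> 2 * real (n ^ ?c)"
 proof -
  have "Lcm {1..2 * k} dvd Lcm {1..n}" using k by (intro Lcm_subset) auto
  then have "Lcm {1..2 * k} \<le> Lcm {1..n}" using Lcm_pos by (intro dvd_imp_le)
  also have "\<dots> \<le> n ^ ?c" by (rule Lcm_le_power)
  finally show ?thesis by (simp only: mult_le_cancel_left_pos of_nat_le_iff zero_less_numeral)
 qed
 finally have "ln (4 ^ k) \<le> ln (2 * real n ^ ?c)"
  using assms by (subst ln_le_cancel_iff) auto
 then have "real k * ln 4 \<le> ln 2 + ?c * ln n"
  using assms by (simp add: ln_mult ln_realpow)
 moreover have "ln 4 = 2 * ln (2 :: real)"
  using ln_realpow[of "2 :: real" 2] by simp
 ultimately have "2 * real k * ln 2 \<le> ln 2 + ?c * ln n" by simp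
 moreover have "(real n - 1) * ln 2 \<le> 2 * real k * ln 2"
  using k by (intro mult_right_mono) auto
 ultimately show ?thesis by (simp add: algebra_simps)
qed

definition big_primes :: "nat => nat set" where
 "big_primes Q = {p. prime p \<and> p \<le> Q \<and> Q < p * p}"

lemma finite_big_primes [simp]: "finite (big_primes Q)"
 by (rule finite_subset[of _ "{..Q}"]) (auto simp: big_primes_def)

lemma card_big_primes:
 assumes "Q \<ge> 2"
 shows "(real Q - 2) * ln 2 / ln Q - sqrt Q \<le> card (big_primes Q)"
proof -
 let ?P = "{p. prime p \<and> p \<le> Q}" and ?S = "{p. prime p \<and> p * p \<le> Q}"
 have "?S \<subseteq> {1..nat \<lfloor>sqrt Q\<rfloor>}"
 proof
  fix p assume "p \<in> ?S"
  then have p: "prime p" "p * p \<le> Q" by auto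
  then have "real p * real p \<le> real Q" by (metis of_nat_le_iff of_nat_mult)
  then have "real p \<le> sqrt Q" by (simp add: real_le_rsqrt power2_eq_square)
  then show "p \<in> {1..nat \<lfloor>sqrt Q\<rfloor>}"
   using prime_ge_1_nat[OF p(1)] by (auto simp: le_nat_iff le_floor_iff)
 qed
 then have "card ?S \<le> nat \<lfloor>sqrt Q\<rfloor>"
  using card_mono[of "{1..nat \<lfloor>sqrt Q\<rfloor>}" ?S] by simp
 then have "real (card ?S) \<le> real (nat \<lfloor>sqrt Q\<rfloor>)" by (simp only: of_nat_le_iff)
 also have "\<dots> \<le> sqrt Q" by (rule of_nat_floor) simp
 finally have S: "real (card ?S) \<le> sqrt Q" .
 have "?P \<subseteq> big_primes Q \<union> ?S" by (auto simp: big_primes_def)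
 moreover have "finite ?S"
  by (rule finite_subset[OF \<open>?S \<subseteq> {1..nat \<lfloor>sqrt Q\<rfloor>}\<close>]) simp
 ultimately have "card ?P \<le> card (big_primes Q) + card ?S"
  by (meson card_Un_le card_mono finite_UnI finite_big_primes order.trans)
 moreover have "(real Q - 2) * ln 2 / ln Q \<le> card ?P"
  using prime_count_lower[OF assms] assms by (simp add: divide_le_eq)
 ultimately show ?thesis using S by linarith
qed

text \<open>The supply is at least of order Q / ln Q. The slack Q ^ \<theta> / ln Q absorbs the
  factor h, and the excluded primes, at most sqrt Q many, are negligible.\<close>

lemma prime_supply:
 assumes "\<theta> > 0" "h \<ge> 0"
 shows "\<exists>Q0. \<forall>Q\<ge>Q0. h * real Q powr (1 - \<theta>) \<le> card (big_primes Q)"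
proof -
 have "\<forall>\<^sub>F x in at_top. h * x powr (1 - \<theta>) \<le> (x - 2) * ln 2 / ln x - sqrt x"
  using assms by real_asymp
 then have "\<forall>\<^sub>F Q in sequentially. h * real Q powr (1 - \<theta>) \<le> (real Q - 2) * ln 2 / ln Q - sqrt Q"
  by (rule eventually_compose_filterlim[OF _ filterlim_real_sequentially])
 moreover have "\<forall>\<^sub>F Q in sequentially. (2 :: nat) \<le> Q" by (rule eventually_ge_at_top)
 ultimately have "\<forall>\<^sub>F Q in sequentially. h * real Q powr (1 - \<theta>) \<le> card (big_primes Q)"
  by eventually_elim (use card_big_primes order.trans in blast)
 then show ?thesis by (simp add: eventually_sequentially)
qed

subsection \<open>Greedy choice of factors\<close>

text \<open>Zeros of f are divisible by every modulus and stand for genuine equalities; only the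
  nonzero multiples of m are collisions that a good choice of m can avoid.\<close>

definition fcoll :: "'a set => ('a => int) => nat => nat" where
 "fcoll I f m = card {x \<in> I. f x \<noteq> 0 \<and> int m dvd f x}"

lemma prod_primes_dvd:
 fixes y :: nat
 assumes "finite S" "\<And>p. p \<in> S \<Longrightarrow> prime p \<and> p dvd y"
 shows "\<Prod>S dvd y"
 using assms
proof (induction S)
 case (insert p S)
 have "coprime p (\<Prod>S)"
  using insert by (intro prod_coprime_right) (metis insert_iff primes_coprime)
 then show ?case
  using insert by (simp add: divides_mult)
qed simp

text \<open>The product of these primes divides y and so is at most X, while its square is at least
  Q to the number of primes, because each of them has a square above Q.\<close>

lemma card_big_prime_divisors:
 assumes "y \<noteq> 0" "y \<le> X" "X * X \<le> Q ^ h" "Q \<ge> 2"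
 shows "card {p \<in> big_primes Q. p dvd y} \<le> h"
proof -
 let ?S = "{p \<in> big_primes Q. p dvd y}"
 have fin: "finite ?S" by simp
 have "\<Prod>?S dvd y"
  using fin by (rule prod_primes_dvd) (auto simp: big_primes_def)
 then have "\<Prod>?S \<le> X" using assms(1,2) by (meson dvd_imp_le gr0I le_trans)
 have "Q ^ card ?S = (\<Prod>p\<in>?S. Q)" by simp
 also have "\<dots> \<le> (\<Prod>p\<in>?S. p * p)"
  by (intro prod_mono) (auto simp: big_primes_def)
 also have "\<dots> = \<Prod>?S * \<Prod>?S" by (simp add: prod.distrib)
 also have "\<dots> \<le> X * X" using \<open>\<Prod>?S \<le> X\<close> by (intro mult_mono) auto
 finally have "Q ^ card ?S \<le> Q ^ h" using assms(3) by linarith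
 then show ?thesis using assms(4) by (simp add: power_le_imp_le_exp)
qed

text \<open>The minimum is at most the average over the big primes. Double counting makes the
  average small: a value divisible by m has, after division by m, at most h big prime
  divisors.\<close>

lemma greedy_step:
 assumes "finite I" "\<And>x. x \<in> I \<Longrightarrow> \<bar>f x\<bar> \<le> int X" "X * X \<le> Q ^ h" "Q \<ge> 2" "m \<ge> 1"
  and best: "\<And>p. p \<in> big_primes Q \<Longrightarrow> fcoll I f m' \<le> fcoll I f (m * p)"
 shows "card (big_primes Q) * fcoll I f m' \<le> h * fcoll I f m"
proof -
 let ?J = "{x \<in> I. f x \<noteq> 0 \<and> int m dvd f x}" and ?B = "big_primes Q"
 have finJ: "finite ?J" using assms(1) by simp
 have "card ?B * fcoll I f m' = (\<Sum>p\<in>?B. fcoll I f m')" by simp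
 also have "\<dots> \<le> (\<Sum>p\<in>?B. fcoll I f (m * p))"
  by (intro sum_mono best)
 also have "\<dots> = (\<Sum>p\<in>?B. card {x \<in> ?J. int (m * p) dvd f x})"
  unfolding fcoll_def by (intro sum.cong refl arg_cong[where f = card]) (auto elim: dvd_mult_left)
 also have "\<dots> = (\<Sum>p\<in>?B. \<Sum>x\<in>?J. of_bool (int (m * p) dvd f x))"
  using finJ by (intro sum.cong refl) (simp add: sum.If_cases of_bool_def Int_def conj_ac)
 also have "\<dots> = (\<Sum>x\<in>?J. \<Sum>p\<in>?B. of_bool (int (m * p) dvd f x))" by (rule sum.swap)
 also have "\<dots> \<le> (\<Sum>x\<in>?J. h)"
 proof (rule sum_mono)
  fix x assume x: "x \<in> ?J"
  then obtain y where y: "f x = int m * y" by auto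
  have y0: "nat \<bar>y\<bar> \<noteq> 0" using x y by auto
  have "\<bar>y\<bar> \<le> int m * \<bar>y\<bar>" using assms(5) by (simp add: mult_le_cancel_right1)
  also have "\<dots> = \<bar>f x\<bar>" using y by (simp add: abs_mult)
  also have "\<dots> \<le> int X" using x assms(2) by auto
  finally have yX: "nat \<bar>y\<bar> \<le> X" by simp
  have "int (m * p) dvd f x \<longleftrightarrow> p dvd nat \<bar>y\<bar>" for p
   using assms(5) unfolding y by (simp add: dvd_mult_cancel_left dvd_nat_abs_iff)
  then have "(\<Sum>p\<in>?B. of_bool (int (m * p) dvd f x)) = card {p \<in> ?B. p dvd nat \<bar>y\<bar>}"
   by (simp add: of_bool_def sum.If_cases Int_def conj_ac)
  also have "\<dots> \<le> h" by (rule card_big_prime_divisors[OF y0 yX assms(3,4)])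
  finally show "(\<Sum>p\<in>?B. of_bool (int (m * p) dvd f x)) \<le> h" .
 qed
 also have "\<dots> = h * fcoll I f m" by (simp add: fcoll_def)
 finally show ?thesis .
qed

section \<open>A structured language and its compilation to the word RAM\<close>

text \<open>Scalar variables, arrays, and the region at the bottom of the memory that holds the
  input and later the answers; the words of this region are regarded as signed integers.\<close>

record st =
 vr :: "nat => nat"
 ar :: "nat => nat => nat"
 io :: "nat => int"

datatype aop = OPlus | OMinus | OTimes | ODiv | OMod | OLess | OEq

datatype exp = V nat | N nat | Arr nat exp | Bin aop exp exp

abbreviation Plus_exp (infixl "\<^bold>+" 65) where "a \<^bold>+ b \<equiv> Bin OPlus a b"
abbreviation Minus_exp (infixl "\<^bold>-" 65) where "a \<^bold>- b \<equiv> Bin OMinus a b"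
abbreviation Times_exp (infixl "\<^bold>*" 70) where "a \<^bold>* b \<equiv> Bin OTimes a b"
abbreviation Div_exp (infixl "\<^bold>div" 70) where "a \<^bold>div b \<equiv> Bin ODiv a b"
abbreviation Mod_exp (infixl "\<^bold>mod" 70) where "a \<^bold>mod b \<equiv> Bin OMod a b"
abbreviation Less_exp (infix "\<^bold><" 50) where "a \<^bold>< b \<equiv> Bin OLess a b"
abbreviation Eq_exp (infix "\<^bold>=" 50) where "a \<^bold>= b \<equiv> Bin OEq a b"

fun aop_val :: "aop => nat => nat => nat" where
 "aop_val OPlus x y = x + y"
| "aop_val OMinus x y = x - y"
| "aop_val OTimes x y = x * y"
| "aop_val ODiv x y = x div y"
| "aop_val OMod x y = x mod y"
| "aop_val OLess x y = of_bool (x < y)"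
| "aop_val OEq x y = of_bool (x = y)"

fun eval :: "exp => st => nat" where
 "eval (V v) s = vr s v"
| "eval (N c) s = c"
| "eval (Arr a e) s = ar s a (eval e s)"
| "eval (Bin f a b) s = aop_val f (eval a s) (eval b s)"

text \<open>\<open>ReadAdd v e f\<close> sets \<open>v\<close> to the sum of the input word at \<open>e\<close>, read as a signed number, and
 \<open>f\<close>; \<open>ReadSub\<close> subtracts the input word from \<open>f\<close>.\<close>

datatype com =
  Skip
 | Assign nat exp (infix ":=:" 61)
 | Put nat exp exp
 | ReadAdd nat exp exp
 | ReadSub nat exp exp
 | Write exp exp
 | Seq com com (infixr ";;" 60)
 | If exp com com
 | For nat exp com

definition set_var :: "nat => nat => st => st" where
 "set_var v x s = s\<lparr>vr := (vr s)(v := x)\<rparr>"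

definition set_arr :: "nat => nat => nat => st => st" where
 "set_arr a i x s = s\<lparr>ar := (ar s)(a := (ar s a)(i := x))\<rparr>"

definition set_io :: "nat => int => st => st" where
 "set_io i x s = s\<lparr>io := (io s)(i := x)\<rparr>"

lemma set_simps [simp]:
 "vr (set_var v x s) u = (if u = v then x else vr s u)"
 "ar (set_var v x s) = ar s"
 "io (set_var v x s) = io s"
 "vr (set_arr a i x s) = vr s"
 "ar (set_arr a i x s) b = (if b = a then (ar s a)(i := x) else ar s b)"
 "io (set_arr a i x s) = io s"
 "vr (set_io i z s) = vr s"
 "ar (set_io i z s) = ar s"
 "io (set_io i z s) = (io s)(i := z)"
 by (simp_all add: set_var_def set_arr_def set_io_def)

primrec iter :: "(nat => 'a => 'a) => nat => 'a => 'a" where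
 "iter f 0 s = s"
| "iter f (Suc k) s = f k (iter f k s)"

fun ev :: "com => st => st" where
 "ev Skip s = s"
| "ev (v :=: e) s = set_var v (eval e s) s"
| "ev (Put a e f) s = set_arr a (eval e s) (eval f s) s"
| "ev (ReadAdd v e f) s = set_var v (nat (io s (eval e s) + int (eval f s))) s"
| "ev (ReadSub v e f) s = set_var v (nat (int (eval f s) - io s (eval e s))) s"
| "ev (Write e f) s = set_io (eval e s) (int (eval f s)) s"
| "ev (c ;; d) s = ev d (ev c s)"
| "ev (If e c d) s = (if eval e s \<noteq> 0 then ev c s else ev d s)"
| "ev (For v e c) s = iter (\<lambda>i s. ev c (set_var v i s)) (eval e s) s"

text \<open>An expression costs one unit whatever its length: the lengths are constants of the
  program and enter later through \<open>csize\<close>.\<close>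

fun tm :: "com => st => nat" where
 "tm (c ;; d) s = tm c s + tm d (ev c s)"
| "tm (If e c d) s = 1 + (if eval e s \<noteq> 0 then tm c s else tm d s)"
| "tm (For v e c) s = 1 + (\<Sum>i<eval e s.
   1 + tm c (set_var v i (iter (\<lambda>i s. ev c (set_var v i s)) i s)))"
| "tm _ s = 1"

text \<open>\<open>ok b Z c s\<close>: while \<open>c\<close> runs from \<open>s\<close>, every value that is assigned is at most \<open>Z\<close>, and the
 input is accessed below \<open>b\<close> only.\<close>

fun ok :: "nat => nat => com => st => bool" where
 "ok b Z Skip s = True"
| "ok b Z (v :=: e) s = (eval e s \<le> Z)"
| "ok b Z (Put a e f) s = (eval f s \<le> Z)"
| "ok b Z (ReadAdd v e f) s = (eval e s < b \<and> io s (eval e s) + int (eval f s) \<in> {0..int Z})"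
| "ok b Z (ReadSub v e f) s = (eval e s < b \<and> int (eval f s) - io s (eval e s) \<in> {0..int Z})"
| "ok b Z (Write e f) s = (eval e s < b \<and> eval f s \<le> Z)"
| "ok b Z (c ;; d) s = (ok b Z c s \<and> ok b Z d (ev c s))"
| "ok b Z (If e c d) s = (if eval e s \<noteq> 0 then ok b Z c s else ok b Z d s)"
| "ok b Z (For v e c) s = (eval e s \<le> Z \<and> (\<forall>i<eval e s.
   ok b Z c (set_var v i (iter (\<lambda>i s. ev c (set_var v i s)) i s))))"

definition bnd :: "nat => st => bool" where
 "bnd Z s \<longleftrightarrow> (\<forall>v. vr s v \<le> Z) \<and> (\<forall>a x. ar s a x \<le> Z)"

lemma bnd_set_var: "bnd Z s \<Longrightarrow> x \<le> Z \<Longrightarrow> bnd Z (set_var v x s)"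
 by (auto simp: bnd_def)

lemma bnd_ev: "bnd Z s \<Longrightarrow> ok b Z c s \<Longrightarrow> bnd Z (ev c s)"
proof (induction c arbitrary: s)
 case (For v e c)
 have "k \<le> eval e s \<Longrightarrow> bnd Z (iter (\<lambda>i s. ev c (set_var v i s)) k s)" for k
 proof (induction k)
  case (Suc k)
  then have "bnd Z (set_var v k (iter (\<lambda>i s. ev c (set_var v i s)) k s))"
   using For.prems by (intro bnd_set_var) auto
  then show ?case
   using For.IH[of "set_var v k (iter (\<lambda>i s. ev c (set_var v i s)) k s)"] For.prems Suc.prems
   by auto
 qed (use For.prems in auto)
 then show ?case by simp
qed (auto simp: bnd_def split: if_splits)

subsection \<open>Magnitude of expressions\<close>

text \<open>A polynomial degree: if all variables, cells and constants are at most Z, then the value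
  of e and of each subexpression is at most Z ^ dg e. This bounds the word size needed during
  evaluation.\<close>

fun dg :: "exp => nat" where
 "dg (Arr a e) = 1 + dg e"
| "dg (Bin f a b) = dg a + dg b"
| "dg _ = 1"

fun kmax :: "exp => nat" where
 "kmax (N c) = c"
| "kmax (Arr a e) = max a (kmax e)"
| "kmax (Bin f a b) = max (kmax a) (kmax b)"
| "kmax _ = 0"

lemma dg_pos: "dg e \<ge> 1"
 by (induction e) auto

lemma pow_add_le:
 fixes Z :: nat
 assumes "Z \<ge> 2" "a \<ge> 1" "b \<ge> 1"
 shows "Z ^ a + Z ^ b \<le> Z ^ (a + b)"
proof -
 have a: "2 \<le> Z ^ a" and b: "2 \<le> Z ^ b"
  using assms self_le_power[of Z a] self_le_power[of Z b] by auto
 then obtain x y where "Z ^ a = x + 2" "Z ^ b = y + 2"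
  by (metis add.commute le_Suc_ex)
 then show ?thesis
  by (auto simp: power_add algebra_simps)
qed

lemma eval_bound:
 assumes "bnd Z s" "kmax e \<le> Z" "Z \<ge> 2"
 shows "eval e s \<le> Z ^ dg e"
 using assms
proof (induction e)
 case (Arr a e)
 have "ar s a (eval e s) \<le> Z ^ 1"
  using Arr by (auto simp: bnd_def)
 also have "\<dots> \<le> Z ^ dg (Arr a e)"
  using Arr by (intro power_increasing) auto
 finally show ?case by simp
next
 case (Bin f a b)
 then have IH: "eval a s \<le> Z ^ dg a" "eval b s \<le> Z ^ dg b" by auto
 have Z: "Z \<ge> 2" by fact
 have p: "1 \<le> Z ^ (dg a + dg b)" "Z ^ dg a \<le> Z ^ (dg a + dg b)"
  using Z by (auto intro: power_increasing)
 show ?case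
 proof (cases f)
  case OPlus
  then show ?thesis
   using IH pow_add_le[OF Z dg_pos dg_pos, of a b] by simp
 next
  case OTimes
  then show ?thesis
   using mult_mono[OF IH] by (simp add: power_add)
 next
  case ODiv
  then show ?thesis
   using order.trans[OF div_le_dividend IH(1)] p(2) by (metis (no_types) aop_val.simps(4) dg.simps(2) eval.simps(4) order.trans)
 next
  case OMod
  then show ?thesis
   using order.trans[OF mod_less_eq_dividend IH(1)] p(2) by (metis (no_types) aop_val.simps(5) dg.simps(2) eval.simps(4) order.trans)
 next
  case OMinus
  then show ?thesis
   using IH(1) p(2) by simp
 qed (use p in \<open>auto simp: of_bool_def\<close>)
qed (auto simp: bnd_def)

subsection \<open>Compilation\<close>

text \<open>Registers are divided by residue modulo 3: program variables, temporaries of expression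
  evaluation, and hidden registers for the array base and the loop counters. Variable 0 is register
  0, where the machine delivers n.\<close>

definition usr :: "nat => nat" where "usr k = 3 * k"
definition tmp :: "nat => nat" where "tmp k = 3 * k + 1"
definition hid :: "nat => nat" where "hid k = 3 * k + 2"

lemma reg_simps [simp]:
 "usr k = usr l \<longleftrightarrow> k = l" "tmp k = tmp l \<longleftrightarrow> k = l" "hid k = hid l \<longleftrightarrow> k = l"
 "usr k \<noteq> tmp l" "usr k \<noteq> hid l" "tmp k \<noteq> usr l" "tmp k \<noteq> hid l" "hid k \<noteq> usr l" "hid k \<noteq> tmp l"
 unfolding usr_def tmp_def hid_def by presburger+

text \<open>Machine subtraction wraps around modulo 2 ^ w; multiplying by the bit y < x turns it
  into the truncated subtraction of the source language.\<close>

fun caop :: "nat => aop => instr list" where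
 "caop k OPlus = [BinOp Add (tmp k) (tmp k) (tmp (k + 1))]"
| "caop k OMinus = [BinOp Less (tmp (k + 2)) (tmp (k + 1)) (tmp k),
   BinOp Sub (tmp k) (tmp k) (tmp (k + 1)), BinOp Mul (tmp k) (tmp k) (tmp (k + 2))]"
| "caop k OTimes = [BinOp Mul (tmp k) (tmp k) (tmp (k + 1))]"
| "caop k ODiv = [BinOp Quot (tmp k) (tmp k) (tmp (k + 1))]"
| "caop k OMod = [BinOp Rem (tmp k) (tmp k) (tmp (k + 1))]"
| "caop k OLess = [BinOp Less (tmp k) (tmp k) (tmp (k + 1))]"
| "caop k OEq = [BinOp Equal (tmp k) (tmp k) (tmp (k + 1))]"

text \<open>Arrays are interleaved: cell \<open>x\<close> of array \<open>a < A\<close> is at address \<open>base + x * A + a\<close>, where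
 \<open>base\<close> is held in register \<open>hid 0\<close>.\<close>

definition caddr :: "nat => nat => nat => instr list" where
 "caddr A k a = [Const (tmp (k + 1)) A, BinOp Mul (tmp k) (tmp k) (tmp (k + 1)),
   BinOp Add (tmp k) (tmp k) (hid 0), Const (tmp (k + 1)) a,
   BinOp Add (tmp k) (tmp k) (tmp (k + 1))]"

fun cexp :: "nat => nat => exp => instr list" where
 "cexp A k (V v) = [Move (tmp k) (usr v)]"
| "cexp A k (N c) = [Const (tmp k) c]"
| "cexp A k (Arr a e) = cexp A k e @ caddr A k a @ [Load (tmp k) (tmp k)]"
| "cexp A k (Bin f a b) = cexp A k a @ cexp A (k + 1) b @ caop k f"

text \<open>Jump targets are absolute, hence the start address p. The number d is the first free
  hidden register: a loop keeps its counter in \<open>hid d\<close> and its bound in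
  \<open>hid (d + 1)\<close>, so the body may overwrite the loop variable and everything the bound
  was computed from.\<close>

fun ccom :: "nat => nat => nat => com => instr list" where
 "ccom A d p Skip = []"
| "ccom A d p (v :=: e) = cexp A 0 e @ [Move (usr v) (tmp 0)]"
| "ccom A d p (Put a e f) = cexp A 0 f @ cexp A 1 e @ caddr A 1 a @ [Store (tmp 1) (tmp 0)]"
| "ccom A d p (ReadAdd v e f) = cexp A 0 e @ cexp A 1 f @
   [Load (tmp 0) (tmp 0), BinOp Add (usr v) (tmp 0) (tmp 1)]"
| "ccom A d p (ReadSub v e f) = cexp A 0 e @ cexp A 1 f @
   [Load (tmp 0) (tmp 0), BinOp Sub (usr v) (tmp 1) (tmp 0)]"
| "ccom A d p (Write e f) = cexp A 0 e @ cexp A 1 f @ [Store (tmp 0) (tmp 1)]"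
| "ccom A d p (c ;; c') = (let l = ccom A d p c in l @ ccom A d (p + length l) c')"
| "ccom A d p (If e c c') = (let q = p + length (cexp A 0 e) + 1; l = ccom A d q c;
   q' = q + length l + 1; l' = ccom A d q' c' in
   cexp A 0 e @ [JumpZero (tmp 0) q'] @ l @ [Jump (q' + length l')] @ l')"
| "ccom A d p (For v e c) = (let q = p + length (cexp A 0 e) + 2;
   l = ccom A (d + 2) (q + 3) c in
   cexp A 0 e @ [Move (hid (d + 1)) (tmp 0), Const (hid d) 0,
    BinOp Less (tmp 0) (hid d) (hid (d + 1)), JumpZero (tmp 0) (q + length l + 6),
    Move (usr v) (hid d)] @ l @
   [Const (tmp 0) 1, BinOp Add (hid d) (hid d) (tmp 0), Jump q])"

fun straight :: "instr => bool" where
 "straight (Jump _) = False"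
| "straight (JumpZero _ _) = False"
| "straight _ = True"

abbreviation exec :: "nat => instr list => config => config" where
 "exec w is \<equiv> fold (exec_instr w) is"

definition embed :: "instr list => nat => instr list => bool" where
 "embed P p is \<longleftrightarrow> (\<exists>xs ys. P = xs @ is @ ys \<and> length xs = p)"

lemma embed_append: "embed P p (is @ js) \<longleftrightarrow> embed P p is \<and> embed P (p + length is) js"
proof
 assume "embed P p (is @ js)"
 then obtain xs ys where "P = xs @ is @ js @ ys" "length xs = p"
  by (auto simp: embed_def)
 then show "embed P p is \<and> embed P (p + length is) js"
  unfolding embed_def by (metis append.assoc length_append)
next
 assume "embed P p is \<and> embed P (p + length is) js"
 then obtain xs ys xs' ys' where P: "P = xs @ is @ ys" "length xs = p"
   "P = xs' @ js @ ys'" "length xs' = p + length is"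
  unfolding embed_def by blast
 then have "xs' = xs @ is" "js @ ys' = ys"
  by (metis append.assoc append_eq_append_conv length_append)+
 with P show "embed P p (is @ js)"
  unfolding embed_def by auto
qed

lemma embed_Nil: "embed P p [] \<longleftrightarrow> p \<le> length P"
proof
 assume "p \<le> length P"
 then show "embed P p []"
  unfolding embed_def by (intro exI[of _ "take p P"] exI[of _ "drop p P"]) simp
qed (auto simp: embed_def)

lemma embed_Cons: "embed P p (i # is) \<longleftrightarrow> p < length P \<and> P ! p = i \<and> embed P (Suc p) is"
proof -
 have *: "embed P p [i] \<longleftrightarrow> p < length P \<and> P ! p = i"
 proof
  assume "p < length P \<and> P ! p = i"
  then show "embed P p [i]"
   using id_take_nth_drop[of p P] unfolding embed_def
   by (intro exI[of _ "take p P"] exI[of _ "drop (Suc p) P"]) auto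
 qed (auto simp: embed_def nth_append)
 have "embed P p ([i] @ is) \<longleftrightarrow> p < length P \<and> P ! p = i \<and> embed P (Suc p) is"
  unfolding embed_append * by simp
 then show ?thesis
  by simp
qed

definition reach :: "nat => instr list => nat => config => config => bool" where
 "reach w P t c c' \<longleftrightarrow> (\<exists>t'\<le>t. run w P t' c = c')"

lemma reach_refl: "reach w P t c c"
 by (auto simp: reach_def run_def intro!: exI[of _ 0])

lemma reach_trans: "reach w P t c c' \<Longrightarrow> reach w P t' c' c'' \<Longrightarrow> reach w P (t + t') c c''"
proof -
 assume "reach w P t c c'" "reach w P t' c' c''"
 then obtain a b where "a \<le> t" "b \<le> t'" "run w P a c = c'" "run w P b c' = c''"
  by (auto simp: reach_def)
 then show ?thesis
  unfolding reach_def by (intro exI[of _ "b + a"]) (auto simp: run_def funpow_add)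
qed

lemma reach_mono: "reach w P t c c' \<Longrightarrow> t \<le> t' \<Longrightarrow> reach w P t' c c'"
 unfolding reach_def using order.trans by blast

lemma reach_instr:
 assumes "embed P (pc c) [i]"
 shows "reach w P 1 c (exec_instr w i c)"
 using assms unfolding reach_def run_def
 by (intro exI[of _ 1]) (auto simp: step_def halted_def embed_Cons)

lemma exec_pc: "\<forall>i\<in>set is. straight i \<Longrightarrow> pc (exec w is c) = pc c + length is"
proof (induction "is" arbitrary: c)
 case (Cons i "is")
 have "pc (exec_instr w i c) = pc c + 1"
  using Cons.prems by (cases i) (auto simp: set_reg_def)
 then show ?case
  using Cons by simp
qed simp

lemma reach_exec:
 assumes "\<forall>i\<in>set is. straight i" "embed P (pc c) is"
 shows "reach w P (length is) c (exec w is c)"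
 using assms
proof (induction "is" arbitrary: c)
 case Nil
 then show ?case by (simp add: reach_refl)
next
 case (Cons i "is")
 have "pc (exec_instr w i c) = Suc (pc c)"
  using exec_pc[of "[i]" w c] Cons.prems by simp
 then have "reach w P (1 + length is) c (exec w is (exec_instr w i c))"
  using Cons.prems embed_append[of P "pc c" "[i]" "is"]
  by (intro reach_trans[OF reach_instr Cons.IH]) auto
 then show ?case by simp
qed

lemma straight_cexp: "i \<in> set (cexp A k e) \<Longrightarrow> straight i"
proof (induction e arbitrary: k)
 case (Bin f a b)
 then show ?case by (cases f) auto
qed (auto simp: caddr_def)

fun amax :: "com => nat" where
 "amax (v :=: e) = kmax e"
| "amax (Put a e f) = max a (max (kmax e) (kmax f))"
| "amax (ReadAdd v e f) = max (kmax e) (kmax f)"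
| "amax (ReadSub v e f) = max (kmax e) (kmax f)"
| "amax (Write e f) = max (kmax e) (kmax f)"
| "amax (c ;; d) = max (amax c) (amax d)"
| "amax (If e c d) = max (kmax e) (max (amax c) (amax d))"
| "amax (For v e c) = max (kmax e) (amax c)"
| "amax Skip = 0"

fun dmax :: "com => nat" where
 "dmax (v :=: e) = dg e"
| "dmax (Put a e f) = dg e + dg f"
| "dmax (ReadAdd v e f) = dg e + dg f"
| "dmax (ReadSub v e f) = dg e + dg f"
| "dmax (Write e f) = dg e + dg f"
| "dmax (c ;; d) = dmax c + dmax d"
| "dmax (If e c d) = dg e + dmax c + dmax d"
| "dmax (For v e c) = dg e + dmax c"
| "dmax Skip = 0"

text \<open>A bound on the machine steps per unit of \<open>tm\<close>. The 2 counts the jumps of a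
  conditional; the 6 counts comparison, conditional jump, copy of the counter, two instructions for
  the increment, and the jump back in one loop round.\<close>

fun csize :: "nat => com => nat" where
 "csize A (c ;; d) = csize A c + csize A d"
| "csize A (If e c d) = length (cexp A 0 e) + 2 + csize A c + csize A d"
| "csize A (For v e c) = length (cexp A 0 e) + 6 + csize A c"
| "csize A c = length (ccom A 0 0 c)"

definition rel :: "nat => nat => nat => st => config => bool" where
 "rel w A b s c \<longleftrightarrow> (\<forall>v. regs c (usr v) = vr s v) \<and> regs c (hid 0) = b \<and>
   (\<forall>x<b. mem c x = nat (take_bit w (io s x))) \<and>
   (\<forall>a<A. \<forall>x. mem c (b + x * A + a) = ar s a x)"

text \<open>Evaluation at level k changes temporaries from k on only, so operands already computed
  at lower levels survive.\<close>

definition keep :: "nat => config => config => bool" where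
 "keep k c c' \<longleftrightarrow> (\<forall>j<k. regs c' (tmp j) = regs c (tmp j)) \<and>
   (\<forall>j. regs c' (hid j) = regs c (hid j)) \<and> (\<forall>j. regs c' (usr j) = regs c (usr j))"

lemma rel_cong: "rel w A b s c \<Longrightarrow> mem c' = mem c \<Longrightarrow> keep k c c' \<Longrightarrow> rel w A b s c'"
 by (auto simp: rel_def keep_def)

lemma take_bit_less: "x < 2 ^ w \<Longrightarrow> take_bit w x = (x::nat)"
 by (simp add: take_bit_nat_eq_self_iff)

lemma exec_caddr:
 assumes "regs c (tmp k) = x" "regs c (hid 0) = b" "b + x * A + a < 2 ^ w" "a < A"
 shows "regs (exec w (caddr A k a) c) (tmp k) = b + x * A + a"
  "mem (exec w (caddr A k a) c) = mem c"
  "keep k c (exec w (caddr A k a) c)"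
proof -
 have *: "take_bit w (x * A) = x * A" "take_bit w (b + x * A) = b + x * A"
  "take_bit w (b + x * A + a) = b + x * A + a" "take_bit w a = a"
  using assms by (auto intro!: take_bit_less)
 have A: "take_bit w A = A" if "x \<noteq> 0"
  using assms that by (intro take_bit_less) (cases x; simp)
 have **: "take_bit w (x * take_bit w A) = x * A"
  using A *(1) by (cases "x = 0") auto
 show "regs (exec w (caddr A k a) c) (tmp k) = b + x * A + a"
  using assms * ** by (simp add: caddr_def set_reg_def) (simp add: ac_simps)
 show "mem (exec w (caddr A k a) c) = mem c"
  by (simp add: caddr_def set_reg_def)
 show "keep k c (exec w (caddr A k a) c)"
  by (simp add: caddr_def set_reg_def keep_def)
qed

lemma exec_caop:
 assumes "regs c (tmp k) = x" "regs c (tmp (k + 1)) = y" "x < 2 ^ w" "y < 2 ^ w" "w > 0"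
  "aop_val f x y < 2 ^ w"
 shows "regs (exec w (caop k f) c) (tmp k) = aop_val f x y"
  "mem (exec w (caop k f) c) = mem c"
  "keep k c (exec w (caop k f) c)"
proof -
 have tb: "take_bit w (of_bool P :: nat) = of_bool P" for P
  using assms by (cases P) (auto simp: take_bit_Suc_0)
 have sub: "take_bit w (x + 2 ^ w - y) = x - y" if "y \<le> x"
 proof -
  have "x + 2 ^ w - y = (x - y) + 2 ^ w" using that by simp
  then show ?thesis using assms(3) that by (simp add: take_bit_eq_mod del: add_diff_assoc2)
 qed
 show "regs (exec w (caop k f) c) (tmp k) = aop_val f x y"
 proof (cases f)
  case OMinus
  then show ?thesis
   using assms tb sub by (cases "y < x") (auto simp: set_reg_def take_bit_less)
 qed (use assms tb in \<open>auto simp: set_reg_def take_bit_less\<close>)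
 show "mem (exec w (caop k f) c) = mem c"
  by (cases f) (auto simp: set_reg_def)
 show "keep k c (exec w (caop k f) c)"
  by (cases f) (auto simp: set_reg_def keep_def)
qed

lemma exec_cexp:
 assumes "rel w A b s c" "bnd Z s" "kmax e \<le> Z" "kmax e < A" "Z \<ge> 2"
  "b + (Z ^ dg e + 1) * A < 2 ^ w" "A > 0"
 shows "regs (exec w (cexp A k e) c) (tmp k) = eval e s \<and>
  mem (exec w (cexp A k e) c) = mem c \<and>
  keep k c (exec w (cexp A k e) c)"
 using assms
proof (induction e arbitrary: k c)
 case (V v)
 have "Z < 2 ^ w"
 proof -
  have "Z * 1 \<le> (Z ^ dg (V v) + 1) * A" using V by (intro mult_mono) auto
  then show ?thesis using V(6) by linarith
 qed
 then have "vr s v < 2 ^ w"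
  using V by (meson bnd_def order.strict_trans1)
 then have "take_bit w (vr s v) = vr s v" by (rule take_bit_less)
 moreover have "regs c (usr v) = vr s v" using V by (auto simp: rel_def)
 ultimately show ?case
  by (auto simp: set_reg_def keep_def)
next
 case (N x)
 have "x * 1 \<le> Z * A" using N by (intro mult_mono) auto
 then have "x < 2 ^ w" using N by simp
 then have "take_bit w x = x" by (rule take_bit_less)
 then show ?case
  by (auto simp: set_reg_def keep_def)
next
 case (Arr a e)
 let ?c = "exec w (cexp A k e) c"
 have le: "Z ^ dg e \<le> Z ^ dg (Arr a e)"
  using Arr.prems by (intro power_increasing) auto
 have "b + (Z ^ dg e + 1) * A \<le> b + (Z ^ dg (Arr a e) + 1) * A"
  using le by (intro add_left_mono mult_right_mono) auto
 then have "b + (Z ^ dg e + 1) * A < 2 ^ w"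
  using Arr.prems(6) by linarith
 with Arr.IH[of c k] Arr.prems have IH: "regs ?c (tmp k) = eval e s" "mem ?c = mem c"
  "keep k c ?c" by auto
 have "eval e s \<le> Z ^ dg e"
  using Arr.prems by (intro eval_bound) auto
 then have "eval e s * A \<le> Z ^ dg (Arr a e) * A"
  by (intro mult_right_mono order.trans[OF _ le]) auto
 moreover have "(Z ^ dg (Arr a e) + 1) * A = Z ^ dg (Arr a e) * A + A"
  by (simp only: add_mult_distrib mult_1)
 moreover have "a < A" using Arr.prems by simp
 ultimately have addr: "b + eval e s * A + a < 2 ^ w"
  using Arr.prems(6) by linarith
 have r2: "regs ?c (hid 0) = b"
  using IH(3) Arr.prems by (auto simp: rel_def keep_def)
 have "a < A" using Arr.prems by auto
 note ad = exec_caddr[OF IH(1) r2 addr this]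
 have m: "mem c (b + eval e s * A + a) = ar s a (eval e s)"
  using Arr.prems \<open>a < A\<close> by (auto simp: rel_def)
 have "Z \<le> Z ^ dg (Arr a e)"
  using Arr.prems(5) dg_pos[of "Arr a e"] by (intro self_le_power) auto
 also have "\<dots> \<le> (Z ^ dg (Arr a e) + 1) * A"
  using \<open>a < A\<close> by (cases A) auto
 finally have "Z < 2 ^ w"
  using le_less_trans[OF trans_le_add2 Arr.prems(6)] by blast
 then have "ar s a (eval e s) < 2 ^ w"
  using Arr.prems by (meson bnd_def order.strict_trans1)
 then have "take_bit w (ar s a (eval e s)) = ar s a (eval e s)" by (rule take_bit_less)
 then show ?case
  using ad IH m by (auto simp: set_reg_def keep_def)
next
 case (Bin f e1 e2)
 let ?c = "exec w (cexp A k e1) c"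
 let ?c' = "exec w (cexp A (k + 1) e2) ?c"
 have le: "Z ^ dg e1 \<le> Z ^ dg (Bin f e1 e2)" "Z ^ dg e2 \<le> Z ^ dg (Bin f e1 e2)"
  using Bin.prems by (auto intro: power_increasing)
 have "b + (Z ^ dg e1 + 1) * A \<le> b + (Z ^ dg (Bin f e1 e2) + 1) * A"
  "b + (Z ^ dg e2 + 1) * A \<le> b + (Z ^ dg (Bin f e1 e2) + 1) * A"
  using le by (intro add_left_mono mult_right_mono; auto)+
 then have B: "b + (Z ^ dg e1 + 1) * A < 2 ^ w" "b + (Z ^ dg e2 + 1) * A < 2 ^ w"
  using Bin.prems(6) by linarith+
 with Bin.IH(1)[of c k] Bin.prems have IH1: "regs ?c (tmp k) = eval e1 s" "mem ?c = mem c"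
  "keep k c ?c" by auto
 have "rel w A b s ?c"
  using Bin.prems(1) by (rule rel_cong) (use IH1 in auto)
 with Bin.IH(2)[of ?c "k + 1"] Bin.prems B
 have IH2: "regs ?c' (tmp (k + 1)) = eval e2 s" "mem ?c' = mem ?c"
  "keep (k + 1) ?c ?c'" by auto
 have less: "x < 2 ^ w" if "x \<le> Z ^ dg (Bin f e1 e2)" for x
 proof -
  have "x * 1 \<le> Z ^ dg (Bin f e1 e2) * A" using that Bin.prems by (intro mult_mono) auto
  then show ?thesis using Bin.prems by simp
 qed
 have b: "eval e1 s < 2 ^ w" "eval e2 s < 2 ^ w" "eval (Bin f e1 e2) s < 2 ^ w"
  using eval_bound[of Z s e1] eval_bound[of Z s e2] eval_bound[of Z s "Bin f e1 e2"] Bin.prems le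
  by (auto intro!: less intro: order.trans[OF _ le(1)] order.trans[OF _ le(2)] simp del: dg.simps(2))
 have "w > 0" using less[of 1] Bin.prems by (cases w) auto
 moreover have "regs ?c' (tmp k) = eval e1 s"
  using IH1 IH2(3) by (simp add: keep_def)
 ultimately have "regs (exec w (caop k f) ?c') (tmp k) = eval (Bin f e1 e2) s"
  "mem (exec w (caop k f) ?c') = mem ?c'"
  "keep k ?c' (exec w (caop k f) ?c')"
  using exec_caop[of ?c' k "eval e1 s" "eval e2 s" w f] IH2(1) b by auto
 then show ?case
  using IH1 IH2 by (auto simp: keep_def)
qed

lemma rel_exec_cexp:
 assumes "rel w A b s c" "bnd Z s" "kmax e \<le> Z" "kmax e < A" "Z \<ge> 2"
  "b + (Z ^ dg e + 1) * A < 2 ^ w" "A > 0"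
 shows "rel w A b s (exec w (cexp A k e) c)"
 using exec_cexp[OF assms, of k] by (auto intro: rel_cong[OF assms(1)])

text \<open>Two's complement is compatible with addition modulo 2 ^ w. The true sum lies in {0..Z}
  and fits into a word, so reduction recovers it even if z is negative.\<close>

lemma take_bit_read_add:
 assumes "z + int y \<in> {0..int Z}" "Z < 2 ^ w"
 shows "take_bit w (nat (take_bit w z) + y) = nat (z + int y)"
proof -
 have Z: "int Z < 2 ^ w"
  using assms(2) by (metis of_nat_less_iff of_nat_numeral of_nat_power)
 have "int (take_bit w (nat (take_bit w z) + y)) = (z + int y) mod 2 ^ w"
  by (simp add: take_bit_eq_mod zmod_int mod_simps)
 also have "\<dots> = z + int y"
  using assms(1) Z by (intro mod_pos_pos_trivial; simp only: atLeastAtMost_iff; linarith)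
 finally show ?thesis by simp
qed

lemma take_bit_read_sub:
 assumes "int y - z \<in> {0..int Z}" "Z < 2 ^ w"
 shows "take_bit w (y + 2 ^ w - nat (take_bit w z)) = nat (int y - z)"
proof -
 have Z: "int Z < 2 ^ w"
  using assms(2) by (metis of_nat_less_iff of_nat_numeral of_nat_power)
 have l: "nat (take_bit w z) \<le> 2 ^ w"
  using take_bit_int_less_exp[of w z] by (simp add: nat_le_iff less_imp_le)
 have "int (take_bit w (y + 2 ^ w - nat (take_bit w z))) = (int y + 2 ^ w - z mod 2 ^ w) mod 2 ^ w"
 proof -
  have "int (y + 2 ^ w - nat (take_bit w z)) = int (y + 2 ^ w) - int (nat (take_bit w z))"
   using l by (intro of_nat_diff) linarith
  then show ?thesis
   by (simp add: take_bit_eq_mod zmod_int)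
 qed
 also have "\<dots> = (int y - z) mod 2 ^ w"
  by (simp add: mod_simps) (metis mod_add_self2 diff_add_eq)
 also have "\<dots> = int y - z"
  using assms(1) Z by (intro mod_pos_pos_trivial; simp only: atLeastAtMost_iff; linarith)
 finally show ?thesis by simp
qed

text \<open>Loop counters of the enclosing loops live in the registers \<open>hid k\<close> with \<open>k < d\<close>.\<close>

lemma ccom_correct:
 assumes "embed P (pc cf) (ccom A d (pc cf) c)" "rel w A b s cf" "bnd Z s" "ok b Z c s"
  "amax c \<le> Z" "amax c < A" "Z \<ge> 2" "b + (Z ^ Suc (dmax c) + 1) * A < 2 ^ w" "d > 0"
 shows "\<exists>cf'. reach w P (csize A c * tm c s) cf cf' \<and> rel w A b (ev c s) cf' \<and>
  pc cf' = pc cf + length (ccom A d (pc cf) c) \<and>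
  (\<forall>k<d. regs cf' (hid k) = regs cf (hid k))"
 using assms
proof (induction c arbitrary: d s cf)
 case Skip
 then show ?case
  by (auto intro!: exI[of _ cf] reach_refl)
next
 case (Seq c1 c2)
 let ?l = "length (ccom A d (pc cf) c1)"
 have "Z ^ Suc (dmax c1) \<le> Z ^ Suc (dmax (c1 ;; c2))" "Z ^ Suc (dmax c2) \<le> Z ^ Suc (dmax (c1 ;; c2))"
  using Seq.prems by (auto intro: power_increasing simp del: power_Suc)
 then have "b + (Z ^ Suc (dmax c1) + 1) * A \<le> b + (Z ^ Suc (dmax (c1 ;; c2)) + 1) * A"
  "b + (Z ^ Suc (dmax c2) + 1) * A \<le> b + (Z ^ Suc (dmax (c1 ;; c2)) + 1) * A"
  by (intro add_left_mono mult_right_mono; simp del: power_Suc)+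
 then have B: "b + (Z ^ Suc (dmax c1) + 1) * A < 2 ^ w" "b + (Z ^ Suc (dmax c2) + 1) * A < 2 ^ w"
  using Seq.prems(8) by linarith+
 have em: "embed P (pc cf) (ccom A d (pc cf) c1)"
  "embed P (pc cf + ?l) (ccom A d (pc cf + ?l) c2)"
  using Seq.prems(1) by (auto simp: Let_def embed_append)
 obtain cf1 where 1: "reach w P (csize A c1 * tm c1 s) cf cf1" "rel w A b (ev c1 s) cf1"
  "pc cf1 = pc cf + ?l" "\<forall>k<d. regs cf1 (hid k) = regs cf (hid k)"
  using Seq.IH(1)[of cf d s] Seq.prems em B by auto
 have "bnd Z (ev c1 s)"
  using Seq.prems by (auto intro: bnd_ev)
 then obtain cf2 where 2: "reach w P (csize A c2 * tm c2 (ev c1 s)) cf1 cf2"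
  "rel w A b (ev c2 (ev c1 s)) cf2"
  "pc cf2 = pc cf1 + length (ccom A d (pc cf1) c2)" "\<forall>k<d. regs cf2 (hid k) = regs cf1 (hid k)"
  using Seq.IH(2)[of cf1 d "ev c1 s"] Seq.prems em B 1 by auto
 have "reach w P (csize A (c1 ;; c2) * tm (c1 ;; c2) s) cf cf2"
  by (rule reach_mono[OF reach_trans[OF 1(1) 2(1)]]) (auto simp: algebra_simps)
 then show ?case
  using 1 2 by (intro exI[of _ cf2]) (auto simp: Let_def)
next
 case (If e c1 c2)
 define q where "q = pc cf + length (cexp A 0 e) + 1"
 define q' where "q' = q + length (ccom A d q c1) + 1"
 have "Z ^ Suc (dmax c1) \<le> Z ^ Suc (dmax (If e c1 c2))" "Z ^ Suc (dmax c2) \<le> Z ^ Suc (dmax (If e c1 c2))"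
  "Z ^ dg e \<le> Z ^ Suc (dmax (If e c1 c2))"
  using If.prems by (auto intro: power_increasing simp del: power_Suc)
 then have "b + (Z ^ Suc (dmax c1) + 1) * A \<le> b + (Z ^ Suc (dmax (If e c1 c2)) + 1) * A"
  "b + (Z ^ Suc (dmax c2) + 1) * A \<le> b + (Z ^ Suc (dmax (If e c1 c2)) + 1) * A"
  "b + (Z ^ dg e + 1) * A \<le> b + (Z ^ Suc (dmax (If e c1 c2)) + 1) * A"
  by (intro add_left_mono mult_right_mono; simp del: power_Suc)+
 then have B: "b + (Z ^ Suc (dmax c1) + 1) * A < 2 ^ w" "b + (Z ^ Suc (dmax c2) + 1) * A < 2 ^ w"
  "b + (Z ^ dg e + 1) * A < 2 ^ w"
  using If.prems(8) by linarith+
 have em: "embed P (pc cf) (cexp A 0 e)" "embed P (pc cf + length (cexp A 0 e)) [JumpZero (tmp 0) q']"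
  "embed P q (ccom A d q c1)" "embed P (q' - 1) [Jump (q' + length (ccom A d q' c2))]"
  "embed P q' (ccom A d q' c2)"
  using If.prems(1) unfolding q'_def q_def
  by (simp_all add: Let_def embed_append embed_Cons embed_Nil)
 have A0: "A > 0" using If.prems by simp
 define cfe where "cfe = exec w (cexp A 0 e) cf"
 have e: "reach w P (length (cexp A 0 e)) cf cfe" "pc cfe = pc cf + length (cexp A 0 e)"
  "rel w A b s cfe" "regs cfe (tmp 0) = eval e s" "\<forall>k. regs cfe (hid k) = regs cf (hid k)"
  using If.prems B A0 em(1) straight_cexp exec_cexp[of w A b s cf Z e 0]
  unfolding cfe_def by (auto intro!: reach_exec exec_pc rel_exec_cexp simp: keep_def)
 define cfj where "cfj = exec_instr w (JumpZero (tmp 0) q') cfe"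
 have j: "reach w P 1 cfe cfj" "pc cfj = (if eval e s = 0 then q' else q)"
  "rel w A b s cfj" "\<forall>k. regs cfj (hid k) = regs cf (hid k)"
 proof -
  show "reach w P 1 cfe cfj"
   unfolding cfj_def using e(2) em(2) by (intro reach_instr) simp
 qed (use e in \<open>auto simp: cfj_def q_def rel_def\<close>)
 show ?case
 proof (cases "eval e s = 0")
  case True
  then obtain cf2 where 2: "reach w P (csize A c2 * tm c2 s) cfj cf2" "rel w A b (ev c2 s) cf2"
   "pc cf2 = q' + length (ccom A d q' c2)" "\<forall>k<d. regs cf2 (hid k) = regs cfj (hid k)"
   using If.IH(2)[of cfj d s] If.prems em B j by auto
  have "reach w P (csize A (If e c1 c2) * tm (If e c1 c2) s) cf cf2"
   by (rule reach_mono[OF reach_trans[OF reach_trans[OF e(1) j(1)] 2(1)]])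
    (use True in \<open>auto simp: algebra_simps\<close>)
  then show ?thesis
   using 2 j True by (intro exI[of _ cf2]) (auto simp: Let_def q_def q'_def)
 next
  case False
  then obtain cf1 where 1: "reach w P (csize A c1 * tm c1 s) cfj cf1" "rel w A b (ev c1 s) cf1"
   "pc cf1 = q + length (ccom A d q c1)" "\<forall>k<d. regs cf1 (hid k) = regs cfj (hid k)"
   using If.IH(1)[of cfj d s] If.prems em B j by auto
  define cf2 where "cf2 = exec_instr w (Jump (q' + length (ccom A d q' c2))) cf1"
  have 2: "reach w P 1 cf1 cf2" "pc cf2 = q' + length (ccom A d q' c2)"
   "rel w A b (ev c1 s) cf2" "regs cf2 = regs cf1"
  proof -
   show "reach w P 1 cf1 cf2"
    unfolding cf2_def using 1(3) em(4) by (intro reach_instr) (simp add: q'_def)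
  qed (use 1 in \<open>auto simp: cf2_def rel_def\<close>)
  have "reach w P (csize A (If e c1 c2) * tm (If e c1 c2) s) cf cf2"
   by (rule reach_mono[OF reach_trans[OF reach_trans[OF reach_trans[OF e(1) j(1)] 1(1)] 2(1)]])
    (use False in \<open>auto simp: algebra_simps\<close>)
  then show ?thesis
   using 1 2 j False by (intro exI[of _ cf2]) (auto simp: Let_def q_def q'_def)
 qed
next
 case (For v e c)
 define q where "q = pc cf + length (cexp A 0 e) + 2"
 define l where "l = ccom A (d + 2) (q + 3) c"
 define n where "n = eval e s"
 define S where "S = (\<lambda>k. iter (\<lambda>i s. ev c (set_var v i s)) k s)"
 have "Z ^ Suc (dmax c) \<le> Z ^ Suc (dmax (For v e c))"
  "Z ^ dg e \<le> Z ^ Suc (dmax (For v e c))" "Z ^ 1 \<le> Z ^ Suc (dmax (For v e c))"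
  by (intro power_increasing; use For.prems in simp)+
 then have "b + (Z ^ Suc (dmax c) + 1) * A \<le> b + (Z ^ Suc (dmax (For v e c)) + 1) * A"
  "b + (Z ^ dg e + 1) * A \<le> b + (Z ^ Suc (dmax (For v e c)) + 1) * A"
  "b + (Z ^ 1 + 1) * A \<le> b + (Z ^ Suc (dmax (For v e c)) + 1) * A"
  by (intro add_left_mono mult_right_mono; simp del: power_Suc)+
 then have B: "b + (Z ^ Suc (dmax c) + 1) * A < 2 ^ w"
  "b + (Z ^ dg e + 1) * A < 2 ^ w" "b + (Z ^ 1 + 1) * A < 2 ^ w"
  using For.prems(8) by linarith+
 have A0: "A > 0" using For.prems by simp
 have "Z + 1 \<le> (Z ^ 1 + 1) * A" using A0 by (cases A) auto
 then have Zw: "Z + 1 < 2 ^ w" using le_less_trans[OF trans_le_add2 B(3)] by blast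
 have nZ: "n \<le> Z" using For.prems(4) by (simp add: n_def)
 have em: "embed P (pc cf) (cexp A 0 e @ [Move (hid (d + 1)) (tmp 0), Const (hid d) 0])"
  "embed P q [BinOp Less (tmp 0) (hid d) (hid (d + 1))]"
  "embed P (q + 1) [JumpZero (tmp 0) (q + length l + 6)]"
  "embed P (q + 2) [Move (usr v) (hid d)]" "embed P (q + 3) l"
  "embed P (q + 3 + length l) [Const (tmp 0) 1, BinOp Add (hid d) (hid d) (tmp 0)]"
  "embed P (q + length l + 5) [Jump q]"
  using For.prems(1) unfolding l_def q_def
  by (simp_all add: Let_def embed_append embed_Cons embed_Nil eval_nat_numeral)
 \<comment> \<open>The state at the loop head. The counter register holds i whatever the body does
   to v, and the counters of the enclosing loops are intact.\<close>
 define Inv where "Inv = (\<lambda>i c'. rel w A b (S i) c' \<and> pc c' = q \<and>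
  regs c' (hid d) = i \<and> regs c' (hid (d + 1)) = n \<and> (\<forall>k<d. regs c' (hid k) = regs cf (hid k)))"
 let ?c0 = "exec w (cexp A 0 e @ [Move (hid (d + 1)) (tmp 0), Const (hid d) 0]) cf"
 have init: "reach w P (length (cexp A 0 e) + 2) cf ?c0" "Inv 0 ?c0"
 proof -
  have st: "\<forall>i\<in>set (cexp A 0 e @ [Move (hid (d + 1)) (tmp 0), Const (hid d) 0]). straight i"
   using straight_cexp by auto
  show "reach w P (length (cexp A 0 e) + 2) cf ?c0"
   using reach_exec[OF st em(1)] by simp
  have "pc ?c0 = q"
   using exec_pc[OF st] by (simp add: q_def)
  moreover have "rel w A b s (exec w (cexp A 0 e) cf)"
   using For.prems B A0 by (intro rel_exec_cexp) auto
  moreover have "take_bit w n = n" using nZ Zw by (intro take_bit_less) auto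
  ultimately show "Inv 0 ?c0"
   using exec_cexp[of w A b s cf Z e 0] For.prems B A0 \<open>d > 0\<close>
   by (auto simp: Inv_def S_def set_reg_def rel_def n_def keep_def)
 qed
 have stp: "\<exists>c''. reach w P (csize A c * tm c (set_var v i (S i)) + 6) c' c'' \<and> Inv (Suc i) c''"
  if i: "i < n" and c': "Inv i c'" for i c'
 proof -
  have iw: "take_bit w i = i" "take_bit w (Suc i) = Suc i" "take_bit w (1::nat) = 1"
   by (rule take_bit_less, use i nZ Zw in linarith)+
  define c1 where "c1 = exec_instr w (BinOp Less (tmp 0) (hid d) (hid (d + 1))) c'"
  define c2 where "c2 = exec_instr w (JumpZero (tmp 0) (q + length l + 6)) c1"
  define c3 where "c3 = exec_instr w (Move (usr v) (hid d)) c2"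
  have r1: "reach w P 1 c' c1" unfolding c1_def using c' em(2) by (intro reach_instr) (auto simp: Inv_def)
  have f1: "pc c1 = q + 1" "regs c1 (tmp 0) = 1"
   using c' i iw(3) by (auto simp: c1_def Inv_def set_reg_def)
  have r2: "reach w P 1 c1 c2" unfolding c2_def using f1 em(3) by (intro reach_instr) auto
  have f2: "pc c2 = q + 2" "regs c2 = regs c1" "mem c2 = mem c1" using f1 by (auto simp: c2_def)
  have r3: "reach w P 1 c2 c3" unfolding c3_def using f2 em(4) by (intro reach_instr) auto
  have f3: "pc c3 = q + 3" "rel w A b (set_var v i (S i)) c3" "regs c3 (hid d) = i"
   "regs c3 (hid (d + 1)) = n" "\<forall>k<d. regs c3 (hid k) = regs cf (hid k)"
   using c' i iw f2 unfolding c3_def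
   by (auto simp: Inv_def set_reg_def c1_def rel_def)
  have bs: "bnd Z (S i)"
  proof -
   have "k \<le> n \<Longrightarrow> bnd Z (S k)" for k
   proof (induction k)
    case (Suc k)
    then show ?case using For.prems(4) nZ
     by (auto simp: S_def n_def intro!: bnd_ev[of _ _ b] bnd_set_var)
   qed (use For.prems in \<open>auto simp: S_def\<close>)
   then show ?thesis using i by simp
  qed
  have "\<exists>c4. reach w P (csize A c * tm c (set_var v i (S i))) c3 c4 \<and>
    rel w A b (ev c (set_var v i (S i))) c4 \<and>
    pc c4 = pc c3 + length (ccom A (d + 2) (pc c3) c) \<and>
    (\<forall>k<d + 2. regs c4 (hid k) = regs c3 (hid k))"
  proof (rule For.IH)
   show "embed P (pc c3) (ccom A (d + 2) (pc c3) c)"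
    using em(5) f3(1) by (simp add: l_def)
   show "bnd Z (set_var v i (S i))"
    using bs nZ i by (intro bnd_set_var) auto
   show "ok b Z c (set_var v i (S i))"
    using For.prems(4) i by (auto simp: S_def n_def)
  qed (use For.prems B f3 in auto)
  then obtain c4 where c4: "reach w P (csize A c * tm c (set_var v i (S i))) c3 c4"
    "rel w A b (S (Suc i)) c4" "pc c4 = q + 3 + length l"
    "\<forall>k<d + 2. regs c4 (hid k) = regs c3 (hid k)"
   using f3(1) by (auto simp: S_def l_def)
  define c5 where "c5 = exec w [Const (tmp 0) 1, BinOp Add (hid d) (hid d) (tmp 0)] c4"
  have r5: "reach w P 2 c4 c5"
   using reach_exec[of "[Const (tmp 0) 1, BinOp Add (hid d) (hid d) (tmp 0)]" P c4 w] em(6) c4(3)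
   by (simp add: c5_def numeral_2_eq_2)
  have h: "regs c4 (hid d) = i" "regs c4 (hid (d + 1)) = n"
   using c4(4)[rule_format, of d] c4(4)[rule_format, of "d + 1"] f3 by auto
  have f5: "pc c5 = q + 5 + length l" "rel w A b (S (Suc i)) c5" "regs c5 (hid d) = Suc i"
   "regs c5 (hid (d + 1)) = n" "\<forall>k<d. regs c5 (hid k) = regs cf (hid k)"
   using c4 f3 iw h \<open>d > 0\<close> by (auto simp: c5_def set_reg_def rel_def)
  define c6 where "c6 = exec_instr w (Jump q) c5"
  have r6: "reach w P 1 c5 c6" unfolding c6_def using f5 em(7)
   by (intro reach_instr) (simp add: ac_simps)
  have "Inv (Suc i) c6"
   using f5 by (auto simp: c6_def Inv_def rel_def)
  moreover have "reach w P (csize A c * tm c (set_var v i (S i)) + 6) c' c6"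
   by (rule reach_mono[OF reach_trans[OF reach_trans[OF reach_trans[OF reach_trans[OF
    reach_trans[OF r1 r2] r3] c4(1)] r5] r6]]) simp
  ultimately show ?thesis by blast
 qed
 have "k \<le> n \<Longrightarrow> \<exists>c'. reach w P (length (cexp A 0 e) + 2 +
   (\<Sum>i<k. csize A c * tm c (set_var v i (S i)) + 6)) cf c' \<and> Inv k c'" for k
 proof (induction k)
  case 0
  then show ?case using init by auto
 next
  case (Suc k)
  then obtain c' where c': "reach w P (length (cexp A 0 e) + 2 +
   (\<Sum>i<k. csize A c * tm c (set_var v i (S i)) + 6)) cf c'" "Inv k c'" by auto
  obtain c'' where "reach w P (csize A c * tm c (set_var v k (S k)) + 6) c' c''" "Inv (Suc k) c''"
   using stp[OF _ c'(2)] Suc.prems by auto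
  then show ?case
   using reach_mono[OF reach_trans[OF c'(1)]] by (intro exI[of _ c'']) (auto simp: ac_simps)
 qed
 from this[of n] obtain c' where c': "reach w P (length (cexp A 0 e) + 2 +
   (\<Sum>i<n. csize A c * tm c (set_var v i (S i)) + 6)) cf c'" "Inv n c'" by auto
 define c1 where "c1 = exec_instr w (BinOp Less (tmp 0) (hid d) (hid (d + 1))) c'"
 define c2 where "c2 = exec_instr w (JumpZero (tmp 0) (q + length l + 6)) c1"
 have r1: "reach w P 1 c' c1" unfolding c1_def using c' em(2) by (intro reach_instr) (auto simp: Inv_def)
 have f1: "pc c1 = q + 1" "regs c1 (tmp 0) = 0"
  using c' by (auto simp: c1_def Inv_def set_reg_def)
 have r2: "reach w P 1 c1 c2" unfolding c2_def using f1 em(3) by (intro reach_instr) auto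
 have f2: "pc c2 = q + length l + 6" "rel w A b (S n) c2" "\<forall>k<d. regs c2 (hid k) = regs cf (hid k)"
  using f1 c' by (auto simp: c2_def c1_def Inv_def set_reg_def rel_def)
 have "(\<Sum>i<n. csize A c * tm c (set_var v i (S i)) + 6)
   \<le> (\<Sum>i<n. csize A (For v e c) * (1 + tm c (set_var v i (S i))))"
  by (intro sum_mono) (simp add: algebra_simps)
 also have "\<dots> = csize A (For v e c) * (\<Sum>i<n. 1 + tm c (set_var v i (S i)))"
  by (simp only: sum_distrib_left)
 finally have "length (cexp A 0 e) + 2 + (\<Sum>i<n. csize A c * tm c (set_var v i (S i)) + 6) + 1 + 1
   \<le> csize A (For v e c) + csize A (For v e c) * (\<Sum>i<n. 1 + tm c (set_var v i (S i)))"
  by simp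
 also have "\<dots> = csize A (For v e c) * tm (For v e c) s"
  by (simp add: n_def S_def)
 finally have "length (cexp A 0 e) + 2 + (\<Sum>i<n. csize A c * tm c (set_var v i (S i)) + 6) + 1 + 1
   \<le> csize A (For v e c) * tm (For v e c) s" .
 then have "reach w P (csize A (For v e c) * tm (For v e c) s) cf c2"
  by (rule reach_mono[OF reach_trans[OF reach_trans[OF c'(1) r1] r2]])
 then show ?case
  using f2 by (intro exI[of _ c2]) (auto simp: Let_def l_def q_def S_def n_def)
next
 case (Assign v e)
 have A0: "A > 0" using Assign.prems by simp
 have le: "Z ^ dg e \<le> Z ^ Suc (dg e)" "Z ^ dg e \<le> Z ^ Suc (dg e)"
  "Z ^ 1 \<le> Z ^ Suc (dg e)"
  by (intro power_increasing; use Assign.prems in simp)+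
 then have "b + (Z ^ dg e + 1) * A \<le> b + (Z ^ Suc (dg e) + 1) * A"
  "b + (Z ^ dg e + 1) * A \<le> b + (Z ^ Suc (dg e) + 1) * A"
  "b + (Z ^ 1 + 1) * A \<le> b + (Z ^ Suc (dg e) + 1) * A"
  by (intro add_left_mono mult_right_mono; simp del: power_Suc)+
 then have B: "b + (Z ^ dg e + 1) * A < 2 ^ w" "b + (Z ^ dg e + 1) * A < 2 ^ w"
  "b + (Z ^ 1 + 1) * A < 2 ^ w"
  using Assign.prems(8)[simplified dmax.simps] by linarith+
 have "Z + 1 \<le> (Z ^ 1 + 1) * A" using A0 by (cases A) auto
 then have Zw: "Z < 2 ^ w" using le_less_trans[OF trans_le_add2 B(3)] by fastforce
 define c1 where "c1 = exec w (cexp A 0 e) cf"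
 have 1: "regs c1 (tmp 0) = eval e s" "mem c1 = mem cf"
  "keep 0 cf c1"
  using exec_cexp[of w A b s cf Z e 0] Assign.prems B A0 by (auto simp: c1_def keep_def)
 have rel1: "rel w A b s c1"
  using Assign.prems(2) by (rule rel_cong) (use 1 in auto)
 have tb: "take_bit w (eval e s) = eval e s"
  using Assign.prems Zw by (intro take_bit_less) auto
 let ?code = "ccom A d (pc cf) (v :=: e)"
 have st: "\<forall>i\<in>set ?code. straight i"
  by (auto simp: caddr_def dest: straight_cexp)
 have "rel w A b (ev (v :=: e) s) (exec w ?code cf) \<and>
  (\<forall>k<d. regs (exec w ?code cf) (hid k) = regs cf (hid k))"
  using 1 rel1 tb by (auto simp: c1_def[symmetric] set_reg_def rel_def keep_def)
 then show ?case
  using reach_exec[OF st Assign.prems(1)] exec_pc[OF st]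
  by (intro exI[of _ "exec w ?code cf"]) auto
next
 case (Put a e f)
 have A0: "A > 0" using Put.prems by simp
 have le: "Z ^ dg e \<le> Z ^ Suc (dg e + dg f)" "Z ^ dg f \<le> Z ^ Suc (dg e + dg f)"
  "Z ^ 1 \<le> Z ^ Suc (dg e + dg f)"
  by (intro power_increasing; use Put.prems in simp)+
 then have "b + (Z ^ dg e + 1) * A \<le> b + (Z ^ Suc (dg e + dg f) + 1) * A"
  "b + (Z ^ dg f + 1) * A \<le> b + (Z ^ Suc (dg e + dg f) + 1) * A"
  "b + (Z ^ 1 + 1) * A \<le> b + (Z ^ Suc (dg e + dg f) + 1) * A"
  by (intro add_left_mono mult_right_mono; simp del: power_Suc)+
 then have B: "b + (Z ^ dg e + 1) * A < 2 ^ w" "b + (Z ^ dg f + 1) * A < 2 ^ w"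
  "b + (Z ^ 1 + 1) * A < 2 ^ w"
  using Put.prems(8)[simplified dmax.simps] by linarith+
 have "Z + 1 \<le> (Z ^ 1 + 1) * A" using A0 by (cases A) auto
 then have Zw: "Z < 2 ^ w" using le_less_trans[OF trans_le_add2 B(3)] by fastforce
 define c1 where "c1 = exec w (cexp A 0 f) cf"
 define c2 where "c2 = exec w (cexp A (Suc 0) e) c1"
 have 1: "regs c1 (tmp 0) = eval f s" "mem c1 = mem cf"
  "keep 0 cf c1"
  using exec_cexp[of w A b s cf Z f 0] Put.prems B A0 by (auto simp: c1_def keep_def)
 have rel1: "rel w A b s c1"
  using Put.prems(2) by (rule rel_cong) (use 1 in auto)
 have 2: "regs c2 (tmp 0) = eval f s" "regs c2 (tmp 1) = eval e s" "mem c2 = mem cf"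
  "keep 0 cf c2"
  using exec_cexp[of w A b s c1 Z e 1] Put.prems B A0 1 rel1 by (auto simp: c2_def keep_def)
 have rel2: "rel w A b s c2"
  using Put.prems(2) by (rule rel_cong) (use 2 in auto)
 have aA: "a < A" using Put.prems by auto
 have "eval e s \<le> Z ^ dg e"
  using Put.prems by (intro eval_bound) auto
 then have "eval e s * A \<le> Z ^ dg e * A"
  by (intro mult_right_mono) auto
 moreover have "(Z ^ dg e + 1) * A = Z ^ dg e * A + A"
  by (simp only: add_mult_distrib mult_1)
 ultimately have addr: "b + eval e s * A + a < 2 ^ w"
  using B(1) aA by linarith
 have r2: "regs c2 (hid 0) = b" using rel2 by (simp add: rel_def)
 note ad = exec_caddr[OF 2(2) r2 addr aA]
 \<comment> \<open>Interleaving is injective for array numbers below A, so the store changes a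
   single cell of a single array.\<close>
 have inj: "x * A + a = x' * A + a' \<longleftrightarrow> x = x' \<and> a = a'" if "a < A" "a' < A" for x x' a a'
  by (metis that add.commute add_left_cancel div_mult_self1 div_less mult.commute add_0_left
    not_less_zero mod_less mod_mult_self1)
 let ?code = "ccom A d (pc cf) (Put a e f)"
 have st: "\<forall>i\<in>set ?code. straight i"
  by (auto simp: caddr_def dest: straight_cexp)
 have "rel w A b (ev (Put a e f) s) (exec w ?code cf) \<and>
  (\<forall>k<d. regs (exec w ?code cf) (hid k) = regs cf (hid k))"
  using ad rel2 2 aA inj[OF aA] inj[OF _ aA] by (auto simp: c1_def[symmetric] c2_def[symmetric] rel_def keep_def add.assoc)
 then show ?case
  using reach_exec[OF st Put.prems(1)] exec_pc[OF st]
  by (intro exI[of _ "exec w ?code cf"]) auto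
next
 case (ReadAdd v e f)
 have A0: "A > 0" using ReadAdd.prems by simp
 have le: "Z ^ dg e \<le> Z ^ Suc (dg e + dg f)" "Z ^ dg f \<le> Z ^ Suc (dg e + dg f)"
  "Z ^ 1 \<le> Z ^ Suc (dg e + dg f)"
  by (intro power_increasing; use ReadAdd.prems in simp)+
 then have "b + (Z ^ dg e + 1) * A \<le> b + (Z ^ Suc (dg e + dg f) + 1) * A"
  "b + (Z ^ dg f + 1) * A \<le> b + (Z ^ Suc (dg e + dg f) + 1) * A"
  "b + (Z ^ 1 + 1) * A \<le> b + (Z ^ Suc (dg e + dg f) + 1) * A"
  by (intro add_left_mono mult_right_mono; simp del: power_Suc)+
 then have B: "b + (Z ^ dg e + 1) * A < 2 ^ w" "b + (Z ^ dg f + 1) * A < 2 ^ w"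
  "b + (Z ^ 1 + 1) * A < 2 ^ w"
  using ReadAdd.prems(8)[simplified dmax.simps] by linarith+
 have "Z + 1 \<le> (Z ^ 1 + 1) * A" using A0 by (cases A) auto
 then have Zw: "Z < 2 ^ w" using le_less_trans[OF trans_le_add2 B(3)] by fastforce
 define c1 where "c1 = exec w (cexp A 0 e) cf"
 define c2 where "c2 = exec w (cexp A (Suc 0) f) c1"
 have 1: "regs c1 (tmp 0) = eval e s" "mem c1 = mem cf"
  "keep 0 cf c1"
  using exec_cexp[of w A b s cf Z e 0] ReadAdd.prems B A0 by (auto simp: c1_def keep_def)
 have rel1: "rel w A b s c1"
  using ReadAdd.prems(2) by (rule rel_cong) (use 1 in auto)
 have 2: "regs c2 (tmp 0) = eval e s" "regs c2 (tmp 1) = eval f s" "mem c2 = mem cf"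
  "keep 0 cf c2"
  using exec_cexp[of w A b s c1 Z f 1] ReadAdd.prems B A0 1 rel1 by (auto simp: c2_def keep_def)
 have rel2: "rel w A b s c2"
  using ReadAdd.prems(2) by (rule rel_cong) (use 2 in auto)
 have mx: "mem cf (eval e s) = nat (take_bit w (io s (eval e s)))"
  using ReadAdd.prems by (auto simp: rel_def)
 have tt: "take_bit w (nat (take_bit w z)) = nat (take_bit w z)" for z
  by (rule take_bit_less) (simp add: nat_less_iff)
 let ?code = "ccom A d (pc cf) (ReadAdd v e f)"
 have st: "\<forall>i\<in>set ?code. straight i"
  by (auto simp: caddr_def dest: straight_cexp)
 have "rel w A b (ev (ReadAdd v e f) s) (exec w ?code cf) \<and>
  (\<forall>k<d. regs (exec w ?code cf) (hid k) = regs cf (hid k))"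
  using ReadAdd.prems(4) take_bit_read_add[OF _ Zw, of "io s (eval e s)" "eval f s"] rel2 2 mx tt
  by (auto simp: c1_def[symmetric] c2_def[symmetric] set_reg_def rel_def keep_def)
 then show ?case
  using reach_exec[OF st ReadAdd.prems(1)] exec_pc[OF st]
  by (intro exI[of _ "exec w ?code cf"]) auto
next
 case (ReadSub v e f)
 have A0: "A > 0" using ReadSub.prems by simp
 have le: "Z ^ dg e \<le> Z ^ Suc (dg e + dg f)" "Z ^ dg f \<le> Z ^ Suc (dg e + dg f)"
  "Z ^ 1 \<le> Z ^ Suc (dg e + dg f)"
  by (intro power_increasing; use ReadSub.prems in simp)+
 then have "b + (Z ^ dg e + 1) * A \<le> b + (Z ^ Suc (dg e + dg f) + 1) * A"
  "b + (Z ^ dg f + 1) * A \<le> b + (Z ^ Suc (dg e + dg f) + 1) * A"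
  "b + (Z ^ 1 + 1) * A \<le> b + (Z ^ Suc (dg e + dg f) + 1) * A"
  by (intro add_left_mono mult_right_mono; simp del: power_Suc)+
 then have B: "b + (Z ^ dg e + 1) * A < 2 ^ w" "b + (Z ^ dg f + 1) * A < 2 ^ w"
  "b + (Z ^ 1 + 1) * A < 2 ^ w"
  using ReadSub.prems(8)[simplified dmax.simps] by linarith+
 have "Z + 1 \<le> (Z ^ 1 + 1) * A" using A0 by (cases A) auto
 then have Zw: "Z < 2 ^ w" using le_less_trans[OF trans_le_add2 B(3)] by fastforce
 define c1 where "c1 = exec w (cexp A 0 e) cf"
 define c2 where "c2 = exec w (cexp A (Suc 0) f) c1"
 have 1: "regs c1 (tmp 0) = eval e s" "mem c1 = mem cf"
  "keep 0 cf c1"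
  using exec_cexp[of w A b s cf Z e 0] ReadSub.prems B A0 by (auto simp: c1_def keep_def)
 have rel1: "rel w A b s c1"
  using ReadSub.prems(2) by (rule rel_cong) (use 1 in auto)
 have 2: "regs c2 (tmp 0) = eval e s" "regs c2 (tmp 1) = eval f s" "mem c2 = mem cf"
  "keep 0 cf c2"
  using exec_cexp[of w A b s c1 Z f 1] ReadSub.prems B A0 1 rel1 by (auto simp: c2_def keep_def)
 have rel2: "rel w A b s c2"
  using ReadSub.prems(2) by (rule rel_cong) (use 2 in auto)
 have mx: "mem cf (eval e s) = nat (take_bit w (io s (eval e s)))"
  using ReadSub.prems by (auto simp: rel_def)
 have tt: "take_bit w (nat (take_bit w z)) = nat (take_bit w z)" for z
  by (rule take_bit_less) (simp add: nat_less_iff)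
 let ?code = "ccom A d (pc cf) (ReadSub v e f)"
 have st: "\<forall>i\<in>set ?code. straight i"
  by (auto simp: caddr_def dest: straight_cexp)
 have "rel w A b (ev (ReadSub v e f) s) (exec w ?code cf) \<and>
  (\<forall>k<d. regs (exec w ?code cf) (hid k) = regs cf (hid k))"
  using ReadSub.prems(4) take_bit_read_sub[OF _ Zw, of "eval f s" "io s (eval e s)"] rel2 2 mx tt
  by (auto simp: c1_def[symmetric] c2_def[symmetric] set_reg_def rel_def keep_def)
 then show ?case
  using reach_exec[OF st ReadSub.prems(1)] exec_pc[OF st]
  by (intro exI[of _ "exec w ?code cf"]) auto
next
 case (Write e f)
 have A0: "A > 0" using Write.prems by simp
 have le: "Z ^ dg e \<le> Z ^ Suc (dg e + dg f)" "Z ^ dg f \<le> Z ^ Suc (dg e + dg f)"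
  "Z ^ 1 \<le> Z ^ Suc (dg e + dg f)"
  by (intro power_increasing; use Write.prems in simp)+
 then have "b + (Z ^ dg e + 1) * A \<le> b + (Z ^ Suc (dg e + dg f) + 1) * A"
  "b + (Z ^ dg f + 1) * A \<le> b + (Z ^ Suc (dg e + dg f) + 1) * A"
  "b + (Z ^ 1 + 1) * A \<le> b + (Z ^ Suc (dg e + dg f) + 1) * A"
  by (intro add_left_mono mult_right_mono; simp del: power_Suc)+
 then have B: "b + (Z ^ dg e + 1) * A < 2 ^ w" "b + (Z ^ dg f + 1) * A < 2 ^ w"
  "b + (Z ^ 1 + 1) * A < 2 ^ w"
  using Write.prems(8)[simplified dmax.simps] by linarith+
 have "Z + 1 \<le> (Z ^ 1 + 1) * A" using A0 by (cases A) auto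
 then have Zw: "Z < 2 ^ w" using le_less_trans[OF trans_le_add2 B(3)] by fastforce
 define c1 where "c1 = exec w (cexp A 0 e) cf"
 define c2 where "c2 = exec w (cexp A (Suc 0) f) c1"
 have 1: "regs c1 (tmp 0) = eval e s" "mem c1 = mem cf"
  "keep 0 cf c1"
  using exec_cexp[of w A b s cf Z e 0] Write.prems B A0 by (auto simp: c1_def keep_def)
 have rel1: "rel w A b s c1"
  using Write.prems(2) by (rule rel_cong) (use 1 in auto)
 have 2: "regs c2 (tmp 0) = eval e s" "regs c2 (tmp 1) = eval f s" "mem c2 = mem cf"
  "keep 0 cf c2"
  using exec_cexp[of w A b s c1 Z f 1] Write.prems B A0 1 rel1 by (auto simp: c2_def keep_def)
 have rel2: "rel w A b s c2"
  using Write.prems(2) by (rule rel_cong) (use 2 in auto)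
 have tf: "nat (take_bit w (int (eval f s))) = eval f s"
  using Write.prems(4) Zw by (simp add: take_bit_eq_mod flip: zmod_int)
 let ?code = "ccom A d (pc cf) (Write e f)"
 have st: "\<forall>i\<in>set ?code. straight i"
  by (auto simp: caddr_def dest: straight_cexp)
 have "rel w A b (ev (Write e f) s) (exec w ?code cf) \<and>
  (\<forall>k<d. regs (exec w ?code cf) (hid k) = regs cf (hid k))"
  using Write.prems(4) rel2 2 tf
  by (auto simp: c1_def[symmetric] c2_def[symmetric] rel_def keep_def)
 then show ?case
  using reach_exec[OF st Write.prems(1)] exec_pc[OF st]
  by (intro exI[of _ "exec w ?code cf"]) auto
qed

subsection \<open>Running a compiled program\<close>

fun int_entry :: "int option => int list" where
 "int_entry None = [0, 0]"
| "int_entry (Some x) = [1, x]"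

definition int_mat :: "wmat => int list" where
 "int_mat M = concat (map (\<lambda>i. concat (map (\<lambda>j. int_entry (M $$ (i, j))) [0..<dim_col M]))
   [0..<dim_row M])"

lemma length_concat_uniform:
 "(\<And>x. x \<in> set xs \<Longrightarrow> length (f x) = k) \<Longrightarrow> length (concat (map f xs)) = length xs * k"
 by (induction xs) auto

lemma nth_concat_uniform:
 assumes "\<And>i. i < m \<Longrightarrow> length (f i) = k" "i < m" "r < k"
 shows "concat (map f [0..<m]) ! (i * k + r) = f i ! r"
 using assms
proof (induction m)
 case (Suc m)
 have l: "length (concat (map f [0..<m])) = m * k"
  using Suc.prems(1) by (subst length_concat_uniform[where k = k]) auto
 show ?case
 proof (cases "i < m")
  case True
  then have "i * k + r < m * k"
   using Suc.prems(3) by (metis add.commute mult_Suc Suc_leI mult_le_mono1 less_le_trans nat_add_left_cancel_less)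
  then show ?thesis
   using Suc True l by (simp add: nth_append)
 next
  case False
  then have "i = m" using Suc.prems by simp
  then show ?thesis
   using l Suc.prems by (simp add: nth_append)
 qed
qed simp

lemma length_int_entry [simp]: "length (int_entry x) = 2"
 by (cases x) auto

lemma int_mat_row_length:
 "length (concat (map (\<lambda>j. int_entry (M $$ (i, j))) [0..<n])) = n * 2"
 by (subst length_concat_uniform[where k = 2]) auto

lemma length_int_mat:
 assumes "M \<in> carrier_mat n n"
 shows "length (int_mat M) = 2 * n * n"
 using assms unfolding int_mat_def
 by (subst length_concat_uniform[where k = "n * 2"]) (auto simp: int_mat_row_length)

lemma nth_int_mat:
 assumes "M \<in> carrier_mat n n" "i < n" "j < n" "r < 2"
 shows "int_mat M ! (2 * (i * n + j) + r) = int_entry (M $$ (i, j)) ! r"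
proof -
 have "j * 2 + r < n * 2" using assms by auto
 moreover have "2 * (i * n + j) + r = i * (n * 2) + (j * 2 + r)" by simp
 ultimately have "int_mat M ! (2 * (i * n + j) + r) =
   concat (map (\<lambda>j. int_entry (M $$ (i, j))) [0..<n]) ! (j * 2 + r)"
  using assms(1,2) unfolding int_mat_def
  by (auto simp only: carrier_matD intro!: nth_concat_uniform int_mat_row_length)
 also have "\<dots> = int_entry (M $$ (i, j)) ! r"
  using assms by (intro nth_concat_uniform) auto
 finally show ?thesis .
qed

lemma encode_entry_ints: "w > 0 \<Longrightarrow> encode_entry w x = map (\<lambda>x. nat (take_bit w x)) (int_entry x)"
 by (cases x) (auto simp: take_bit_eq_mod mod_pos_pos_trivial)

lemma encode_mat_ints:
 assumes "w > 0"
 shows "encode_mat w M = map (\<lambda>x. nat (take_bit w x)) (int_mat M)"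
 unfolding encode_mat_def int_mat_def map_concat map_map comp_def encode_entry_ints[OF assms] ..

definition input_st :: "nat => wmat => wmat => wmat => st" where
 "input_st n A B C = \<lparr>vr = (\<lambda>_. 0)(0 := n), ar = (\<lambda>_ _. 0),
   io = (\<lambda>x. let l = int_mat A @ int_mat B @ int_mat C in if x < length l then l ! x else 0)\<rparr>"

lemma input_st_simps [simp]:
 "vr (input_st n A B C) v = (if v = 0 then n else 0)"
 "ar (input_st n A B C) = (\<lambda>_ _. 0)"
 by (auto simp: input_st_def)

lemma io_input_st:
 assumes "A \<in> carrier_mat n n" "B \<in> carrier_mat n n" "C \<in> carrier_mat n n" "i < n" "j < n" "r < 2"
 shows "io (input_st n A B C) (2 * (i * n + j) + r) = int_entry (A $$ (i, j)) ! r"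
  "io (input_st n A B C) (2 * (n * n) + (2 * (i * n + j) + r)) = int_entry (B $$ (i, j)) ! r"
  "io (input_st n A B C) (4 * (n * n) + (2 * (i * n + j) + r)) = int_entry (C $$ (i, j)) ! r"
proof -
 define k where "k = 2 * (i * n + j) + r"
 have "i * n + j < n * n"
  using assms(4,5) by (metis add.commute mult_Suc Suc_leI mult_le_mono1 less_le_trans nat_add_left_cancel_less)
 then have l: "k < 2 * n * n" using assms(6) by (simp add: k_def)
 note nth = nth_int_mat[OF assms(1,4-6)] nth_int_mat[OF assms(2,4-6)] nth_int_mat[OF assms(3,4-6)]
 note nth' = nth[folded k_def]
 note len = length_int_mat[OF assms(1)] length_int_mat[OF assms(2)] length_int_mat[OF assms(3)]
 have "io (input_st n A B C) k = int_entry (A $$ (i, j)) ! r"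
  using l nth' by (simp add: input_st_def Let_def nth_append len)
 moreover have "io (input_st n A B C) (2 * (n * n) + k) = int_entry (B $$ (i, j)) ! r"
  using l nth' by (simp add: input_st_def Let_def nth_append len)
 moreover have "io (input_st n A B C) (2 * n * n + (2 * n * n + k)) = int_entry (C $$ (i, j)) ! r"
  using l nth' by (simp add: input_st_def Let_def nth_append len)
 moreover have "4 * (n * n) + k = 2 * n * n + (2 * n * n + k)" by simp
 ultimately show "io (input_st n A B C) (2 * (i * n + j) + r) = int_entry (A $$ (i, j)) ! r"
  "io (input_st n A B C) (2 * (n * n) + (2 * (i * n + j) + r)) = int_entry (B $$ (i, j)) ! r"
  "io (input_st n A B C) (4 * (n * n) + (2 * (i * n + j) + r)) = int_entry (C $$ (i, j)) ! r"
  by (simp_all only: k_def[symmetric])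
qed

text \<open>The prologue computes the length 6 * n * n of the input into \<open>hid 0\<close>, the
  base address of the arrays. Therefore loops take hidden registers from 1 on and the code proper
  starts at address 3.\<close>

definition compile :: "com => instr list" where
 "compile c = [Const (tmp 0) 6, BinOp Mul (hid 0) (usr 0) (usr 0), BinOp Mul (hid 0) (hid 0) (tmp 0)] @
   ccom (Suc (amax c)) 1 3 c"

lemma compile_correct:
 assumes car: "A \<in> carrier_mat n n" "B \<in> carrier_mat n n" "C \<in> carrier_mat n n"
  and Z: "n \<le> Z" "amax c \<le> Z" "Z \<ge> 2"
  and w: "6 * n * n + (Z ^ Suc (dmax c) + 1) * Suc (amax c) < 2 ^ w" "(6::nat) < 2 ^ w"
  and ok: "ok (6 * n * n) Z c (input_st n A B C)"
 defines "s \<equiv> init_config w n (encode_mat w A @ encode_mat w B @ encode_mat w C)"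
  and "s' \<equiv> ev c (input_st n A B C)"
 shows "\<exists>t \<le> 3 + csize (Suc (amax c)) c * tm c (input_st n A B C).
  halted (compile c) (run w (compile c) t s) \<and>
  (\<forall>x<6 * n * n. mem (run w (compile c) t s) x = nat (take_bit w (io s' x)))"
proof -
 let ?A = "Suc (amax c)" and ?s0 = "input_st n A B C"
 let ?pre = "[Const (tmp 0) 6, BinOp Mul (hid 0) (usr 0) (usr 0), BinOp Mul (hid 0) (hid 0) (tmp 0)]"
 have w0: "w > 0" using w(2) by (cases w) auto
 define l where "l = int_mat A @ int_mat B @ int_mat C"
 have len: "length l = 6 * n * n"
  by (simp add: l_def length_int_mat[OF car(1)] length_int_mat[OF car(2)] length_int_mat[OF car(3)])
 have enc: "encode_mat w A @ encode_mat w B @ encode_mat w C = map (\<lambda>x. nat (take_bit w x)) l"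
  using encode_mat_ints[OF w0] by (simp add: l_def)
 have "Z \<le> Z ^ Suc (dmax c)" using Z by (intro self_le_power) auto
 also have "\<dots> \<le> (Z ^ Suc (dmax c) + 1) * ?A" by simp
 finally have "Z < 2 ^ w" using le_less_trans[OF trans_le_add2 w(1)] by blast
 then have nw: "take_bit w n = n" using Z by (intro take_bit_less) auto
 have "n * n \<le> 6 * n * n" "6 * n * n < 2 ^ w" using w(1) by auto
 then have nn: "take_bit w (n * n) = n * n" "take_bit w (n * n * 6) = n * n * 6"
  by (auto intro!: take_bit_less)
 have six: "take_bit w (6 :: nat) = 6" using w(2) by (intro take_bit_less)
 have tt: "take_bit w (nat (take_bit w z)) = nat (take_bit w z)" for z :: int
  by (rule take_bit_less) (simp add: nat_less_iff)
 define cf where "cf = exec w ?pre s"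
 have "usr v \<noteq> 0" if "v \<noteq> 0" for v using that by (simp add: usr_def)
 then have u: "regs s (usr v) = (if v = 0 then n else 0)" for v
  using nw by (auto simp: s_def init_config_def usr_def)
 have ms: "mem s = (\<lambda>a. if a < 6 * n * n then nat (take_bit w (l ! a)) else 0)"
  unfolding s_def enc init_config_def using tt len by auto
 have io: "io ?s0 x = l ! x" if "x < 6 * n * n" for x
  using that len by (simp add: input_st_def l_def[symmetric] Let_def)
 have rel: "rel w ?A (6 * n * n) ?s0 cf"
  using u nn six ms io by (auto simp: rel_def cf_def set_reg_def)
 have pc: "pc cf = 3"
  by (simp add: cf_def set_reg_def s_def init_config_def)
 have em: "embed (compile c) 0 ?pre" "embed (compile c) (pc cf) (ccom ?A 1 (pc cf) c)"
  unfolding pc compile_def embed_def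
  by simp (intro exI[of _ "?pre"] exI[of _ "[]"], simp)
 have r1: "reach w (compile c) 3 s cf"
 proof (rule reach_mono)
  show "reach w (compile c) (length ?pre) s cf"
   unfolding cf_def by (rule reach_exec) (use em(1) in \<open>auto simp: s_def init_config_def\<close>)
 qed simp
 have bnd: "bnd Z ?s0" using Z by (simp add: bnd_def)
 obtain cf' where cf': "reach w (compile c) (csize ?A c * tm c ?s0) cf cf'"
  "rel w ?A (6 * n * n) s' cf'" "pc cf' = 3 + length (ccom ?A 1 3 c)"
  using ccom_correct[OF em(2) rel bnd ok Z(2) _ Z(3) w(1)] pc unfolding s'_def by auto
 from reach_trans[OF r1 cf'(1)] obtain t where
  t: "t \<le> 3 + csize ?A c * tm c ?s0" "run w (compile c) t s = cf'"
  by (auto simp: reach_def)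
 then show ?thesis
  using cf' by (intro exI[of _ t]) (auto simp: halted_def compile_def rel_def)
qed

subsection \<open>Weakest preconditions\<close>

fun wv :: "com => nat set" where
 "wv (v :=: e) = {v}"
| "wv (ReadAdd v e f) = {v}"
| "wv (ReadSub v e f) = {v}"
| "wv (c ;; d) = wv c \<union> wv d"
| "wv (If e c d) = wv c \<union> wv d"
| "wv (For v e c) = insert v (wv c)"
| "wv _ = {}"

fun wa :: "com => nat set" where
 "wa (Put a e f) = {a}"
| "wa (c ;; d) = wa c \<union> wa d"
| "wa (If e c d) = wa c \<union> wa d"
| "wa (For v e c) = wa c"
| "wa _ = {}"

fun wio :: "com => bool" where
 "wio (Write e f) = True"
| "wio (c ;; d) = (wio c \<or> wio d)"
| "wio (If e c d) = (wio c \<or> wio d)"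
| "wio (For v e c) = wio c"
| "wio _ = False"

definition frame :: "com => st => st => bool" where
 "frame c s s' \<longleftrightarrow> (\<forall>v. v \<notin> wv c \<longrightarrow> vr s' v = vr s v) \<and>
   (\<forall>a. a \<notin> wa c \<longrightarrow> ar s' a = ar s a) \<and> (\<not> wio c \<longrightarrow> io s' = io s)"

lemma frame_iter:
 assumes "\<And>s. frame c s (ev c s)"
 shows "frame (For v e c) s (iter (\<lambda>i s. ev c (set_var v i s)) k s)"
proof (induction k)
 case (Suc k)
 then show ?case
  using assms[of "set_var v k (iter (\<lambda>i s. ev c (set_var v i s)) k s)"]
  by (auto simp: frame_def)
qed (auto simp: frame_def)

lemma frame_ev: "frame c s (ev c s)"
proof (induction c arbitrary: s)
 case (Seq c d)
 show ?case using Seq(1)[of s] Seq(2)[of "ev c s"] by (auto simp: frame_def)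
next
 case (If e c d)
 show ?case using If(1)[of s] If(2)[of s] by (auto simp: frame_def)
next
 case (For v e c)
 show ?case using frame_iter[OF For] by simp
qed (auto simp: frame_def)

text \<open>All programs of the language terminate, so the precondition amounts to the bounds on
  values and input addresses; the postcondition also speaks of the running time.\<close>

definition wp :: "nat => nat => com => st => (st => nat => bool) => bool" where
 "wp b Z c s Q \<longleftrightarrow> ok b Z c s \<and> Q (ev c s) (tm c s)"

text \<open>The frame condition comes for free; specifications therefore state only what a program
  changes.\<close>

lemma wp_conseq:
 "wp b Z c s Q' \<Longrightarrow> (\<And>s' t. Q' s' t \<Longrightarrow> frame c s s' \<Longrightarrow> Q s' t) \<Longrightarrow> wp b Z c s Q"
 using frame_ev by (auto simp: wp_def)

lemma wp_simps [simp]: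
 "wp b Z Skip s Q \<longleftrightarrow> Q s 1"
 "wp b Z (v :=: e) s Q \<longleftrightarrow> eval e s \<le> Z \<and> Q (set_var v (eval e s) s) 1"
 "wp b Z (Put a e f) s Q \<longleftrightarrow> eval f s \<le> Z \<and> Q (set_arr a (eval e s) (eval f s) s) 1"
 "wp b Z (ReadAdd v e f) s Q \<longleftrightarrow> eval e s < b \<and> io s (eval e s) + int (eval f s) \<in> {0..int Z} \<and>
   Q (set_var v (nat (io s (eval e s) + int (eval f s))) s) 1"
 "wp b Z (ReadSub v e f) s Q \<longleftrightarrow> eval e s < b \<and> int (eval f s) - io s (eval e s) \<in> {0..int Z} \<and>
   Q (set_var v (nat (int (eval f s) - io s (eval e s))) s) 1"
 "wp b Z (Write e f) s Q \<longleftrightarrow> eval e s < b \<and> eval f s \<le> Z \<and>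
   Q (set_io (eval e s) (int (eval f s)) s) 1"
 by (auto simp: wp_def)

lemma wp_Seq: "wp b Z (c ;; d) s Q \<longleftrightarrow> wp b Z c s (\<lambda>s' t. wp b Z d s' (\<lambda>s'' t'. Q s'' (t + t')))"
 by (auto simp: wp_def)

lemma wp_If: "wp b Z (If e c d) s Q \<longleftrightarrow>
  (if eval e s \<noteq> 0 then wp b Z c s (\<lambda>s' t. Q s' (Suc t)) else wp b Z d s (\<lambda>s' t. Q s' (Suc t)))"
 by (auto simp: wp_def)

text \<open>The invariant carries the time spent so far, with one unit charged per round and one for
  the loop itself. The frame refers to the state before the loop.\<close>

lemma wp_For:
 assumes "eval e s \<le> Z" "I 0 s 0"
  and "\<And>i s' t. i < eval e s \<Longrightarrow> I i s' t \<Longrightarrow> frame (For v e c) s s' \<Longrightarrow>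
   wp b Z c (set_var v i s') (\<lambda>s'' t'. I (Suc i) s'' (t + t' + 1))"
  and "\<And>s' t. I (eval e s) s' t \<Longrightarrow> frame (For v e c) s s' \<Longrightarrow> Q s' (t + 1)"
 shows "wp b Z (For v e c) s Q"
proof -
 let ?S = "\<lambda>k. iter (\<lambda>i s. ev c (set_var v i s)) k s"
 have fr: "frame (For v e c) s (?S k)" for k
  by (rule frame_iter) (rule frame_ev)
 have inv: "k \<le> eval e s \<Longrightarrow> I k (?S k) (\<Sum>i<k. 1 + tm c (set_var v i (?S i)))" for k
 proof (induction k)
  case (Suc k)
  then have "wp b Z c (set_var v k (?S k))
    (\<lambda>s'' t'. I (Suc k) s'' ((\<Sum>i<k. 1 + tm c (set_var v i (?S i))) + t' + 1))"
   by (intro assms(3)[OF _ _ fr]) auto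
  then show ?case
   by (simp add: wp_def)
 qed (use assms in auto)
 have "ok b Z c (set_var v k (?S k))" if "k < eval e s" for k
  using assms(3)[OF that inv[OF less_imp_le[OF that]] fr] by (auto simp: wp_def)
 then show ?thesis
  using assms(1) assms(4)[OF inv[OF order_refl] fr] by (auto simp: wp_def)
qed

section \<open>The program\<close>

text \<open>With u = n ^ c the main program keeps n in \<open>vN\<close>, u in \<open>vO\<close>,
  the sum 3 * u + 3 of an exact triangle in \<open>vS\<close>, the numbers of levels l1 and l = t *
  l1 in \<open>vL1\<close> and \<open>vL\<close>, K ^ l1 in \<open>vQ\<close>, R ^ l in
  \<open>vRL\<close>, (2 * K - 1) ^ l in \<open>vPC\<close>, D ^ l in \<open>vDL\<close>, the
  modulus of the counting arithmetic in \<open>vMOD\<close>, the capacity for weights in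
  \<open>vCap\<close>, (n0 * n0 * K) ^ l in \<open>vqL\<close>, the success of a role in
  \<open>vOk\<close>, the modulus m in \<open>vM\<close>, and the coefficients of the output address
  in \<open>vOy\<close>, \<open>vOx\<close>, \<open>vOz\<close>. The rest are loop variables and
  scratch.\<close>

abbreviation (input) vN :: nat where "vN \<equiv> 0"
abbreviation (input) vO :: nat where "vO \<equiv> 2"
abbreviation (input) vS :: nat where "vS \<equiv> 3"
abbreviation (input) vL1 :: nat where "vL1 \<equiv> 4"
abbreviation (input) vL :: nat where "vL \<equiv> 5"
abbreviation (input) vQ :: nat where "vQ \<equiv> 6"
abbreviation (input) vRL :: nat where "vRL \<equiv> 7"
abbreviation (input) vPC :: nat where "vPC \<equiv> 8"
abbreviation (input) vDL :: nat where "vDL \<equiv> 9"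
abbreviation (input) vMOD :: nat where "vMOD \<equiv> 10"
abbreviation (input) vCap :: nat where "vCap \<equiv> 11"
abbreviation (input) vqL :: nat where "vqL \<equiv> 12"
abbreviation (input) vOk :: nat where "vOk \<equiv> 13"
abbreviation (input) vM :: nat where "vM \<equiv> 14"
abbreviation (input) vOy :: nat where "vOy \<equiv> 15"
abbreviation (input) vOx :: nat where "vOx \<equiv> 16"
abbreviation (input) vOz :: nat where "vOz \<equiv> 17"
abbreviation (input) ix :: nat where "ix \<equiv> 20"
abbreviation (input) iy :: nat where "iy \<equiv> 21"
abbreviation (input) iz :: nat where "iz \<equiv> 22"
abbreviation (input) ig :: nat where "ig \<equiv> 23"
abbreviation (input) ia :: nat where "ia \<equiv> 24"
abbreviation (input) ib :: nat where "ib \<equiv> 25"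
abbreviation (input) ic :: nat where "ic \<equiv> 26"
abbreviation (input) id1 :: nat where "id1 \<equiv> 27"
abbreviation (input) ie :: nat where "ie \<equiv> 28"
abbreviation (input) ih :: nat where "ih \<equiv> 29"
abbreviation (input) ik :: nat where "ik \<equiv> 30"
abbreviation (input) il :: nat where "il \<equiv> 31"
abbreviation (input) im :: nat where "im \<equiv> 32"
abbreviation (input) iq :: nat where "iq \<equiv> 33"

text \<open>\<open>aA\<close>, \<open>aB\<close>, \<open>aC\<close> hold the normalised input and
  \<open>aU\<close>, \<open>aV\<close>, \<open>aW\<close> its copy in the current role;
  \<open>aLst\<close> and \<open>aCnt\<close> the distinct weights of the rows of U;
  \<open>aXA\<close>, \<open>aXB\<close>, \<open>aXC\<close> the layers of the transforms;
  \<open>aOut\<close> the counts. \<open>aGv\<close>, \<open>aGl\<close>, \<open>aMb\<close> store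
  the groups of a column of V, while \<open>aBkt\<close> has per residue the number of entries when
  m is chosen and the number of groups when false triangles are listed.\<close>

abbreviation (input) aA :: nat where "aA \<equiv> 2"
abbreviation (input) aB :: nat where "aB \<equiv> 3"
abbreviation (input) aC :: nat where "aC \<equiv> 4"
abbreviation (input) aU :: nat where "aU \<equiv> 5"
abbreviation (input) aV :: nat where "aV \<equiv> 6"
abbreviation (input) aW :: nat where "aW \<equiv> 7"
abbreviation (input) aLst :: nat where "aLst \<equiv> 8"
abbreviation (input) aCnt :: nat where "aCnt \<equiv> 9"
abbreviation (input) aBkt :: nat where "aBkt \<equiv> 10"
abbreviation (input) aXA :: nat where "aXA \<equiv> 11"
abbreviation (input) aXB :: nat where "aXB \<equiv> 12"
abbreviation (input) aXC :: nat where "aXC \<equiv> 13"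
abbreviation (input) aOut :: nat where "aOut \<equiv> 14"
abbreviation (input) aGl :: nat where "aGl \<equiv> 15"
abbreviation (input) aGv :: nat where "aGv \<equiv> 16"
abbreviation (input) aMb :: nat where "aMb \<equiv> 17"

subsection \<open>Parameters\<close>

definition powc :: "nat => nat => nat => com" where
 "powc r c v = (r :=: N 1 ;; For ix (V v) (r :=: V r \<^bold>* N c))"

lemma powc_writes [simp]: "wv (powc r c v) = {r, ix}" "wa (powc r c v) = {}" "wio (powc r c v) = False"
 by (auto simp: powc_def)

lemma wp_powc:
 assumes "v \<noteq> r" "v \<noteq> ix" "r \<noteq> ix" "vr s v = l" "c ^ l \<le> Z" "l \<le> Z" "c > 0"
 shows "wp b Z (powc r c v) s (\<lambda>s' t. vr s' r = c ^ l \<and> t \<le> 2 * l + 2)"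
 unfolding powc_def wp_Seq wp_simps
proof (intro conjI)
 have le: "c ^ i \<le> Z" if "i \<le> l" for i
  using power_increasing[OF that, of c] assms by linarith
 show "eval (N 1) s \<le> Z" using le[of 0] by simp
 show "wp b Z (For ix (V v) (r :=: V r \<^bold>* N c)) (set_var r (eval (N 1) s) s)
   (\<lambda>s'' t'. vr s'' r = c ^ l \<and> 1 + t' \<le> 2 * l + 2)"
 proof (rule wp_For[where I = "\<lambda>i s' t. vr s' r = c ^ i \<and> t \<le> 2 * i"], goal_cases)
  case (3 i s' t)
  then show ?case using assms le[of "Suc i"] by (simp add: mult.commute)
 qed (use assms in auto)
qed

text \<open>The number of rounds of a loop is fixed in advance, so n rounds are run that idle once
  the power has reached n; n rounds suffice because n < B ^ n.\<close>

definition levf :: "nat => com" where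
 "levf B = (ia :=: N 1 ;; vL1 :=: N 0 ;;
   For ix (V vN) (If (V ia \<^bold>< V vN) (ia :=: V ia \<^bold>* N B ;; vL1 :=: V vL1 \<^bold>+ N 1) Skip))"

lemma levf_writes [simp]: "wv (levf B) = {ia, vL1, ix}" "wa (levf B) = {}" "wio (levf B) = False"
 by (auto simp: levf_def)

definition lev :: "nat => nat => nat" where
 "lev B n = (LEAST l. n \<le> B ^ l)"

lemma less_power: "B \<ge> 2 \<Longrightarrow> n < B ^ n" for B :: nat
 using less_exp[of n] power_mono[of 2 B n] by linarith

lemma lev_le: "B \<ge> 2 \<Longrightarrow> n \<le> B ^ lev B n"
 unfolding lev_def by (rule LeastI[of _ n]) (simp add: less_imp_le less_power)

lemma lev_less: "l < lev B n \<Longrightarrow> B ^ l < n"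
 unfolding lev_def using not_less_Least by (metis not_le)

text \<open>One level less stays below n, so rounding n up to a power of B costs at most the factor
  B.\<close>

lemma lev_upper: "B \<ge> 2 \<Longrightarrow> n \<ge> 1 \<Longrightarrow> B ^ lev B n \<le> B * n"
 using lev_less[of "lev B n - 1" B n] by (cases "lev B n") auto

lemma wp_levf:
 assumes "vr s vN = n" "B \<ge> 2" "n \<ge> 1" "B * n \<le> Z"
 shows "wp b Z (levf B) s (\<lambda>s' t. vr s' vL1 = lev B n \<and> t \<le> 4 * n + 3)"
proof -
 have Z: "1 \<le> Z" "n \<le> Z"
  using assms by (auto intro: order.trans[of _ "B * n"])
 have "wp b Z (For ix (V vN) (If (V ia \<^bold>< V vN) (ia :=: V ia \<^bold>* N B ;; vL1 :=: V vL1 \<^bold>+ N 1) Skip))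
   (set_var vL1 0 (set_var ia 1 s)) (\<lambda>s' t. vr s' vL1 = lev B n \<and> 2 + t \<le> 4 * n + 3)"
 proof (rule wp_For[where I = "\<lambda>i s' t. vr s' ia = B ^ vr s' vL1 \<and> (\<forall>l<vr s' vL1. B ^ l < n) \<and>
   (n \<le> vr s' ia \<or> vr s' vL1 = i) \<and> vr s' vL1 \<le> i \<and> t \<le> 4 * i"], goal_cases)
  case (3 i s' t)
  have n: "vr s' vN = n" using 3(3) assms by (simp add: frame_def)
  have "vr s' ia < n \<Longrightarrow> vr s' ia * B \<le> Z"
   by (rule order.trans[OF mult_le_mono1[of _ n]]) (use assms(4) in \<open>auto simp: mult.commute\<close>)
  then show ?case
   using 3(1,2) n Z assms(1) by (auto simp: wp_If wp_Seq less_Suc_eq mult.commute)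
 next
  case (4 s' t)
  have "n < B ^ n" using assms(2) by (rule less_power)
  then have *: "n \<le> B ^ vr s' vL1" using 4 assms by auto
  have "lev B n = vr s' vL1"
   unfolding lev_def
  proof (rule Least_equality)
   show "n \<le> B ^ vr s' vL1" by (rule *)
   fix y assume "n \<le> B ^ y"
   then have "\<not> y < vr s' vL1" using 4(1) by fastforce
   then show "vr s' vL1 \<le> y" by simp
  qed
  then show ?case using 4 assms by auto
 qed (use assms Z in auto)
 then show ?thesis
  using Z by (simp add: levf_def wp_Seq)
qed

subsection \<open>Normalised input\<close>

text \<open>Present entries become positive, missing ones 0, and \<open>a + b = c\<close> becomes \<open>a' + b' + c' = 3 * u + 3\<close>, which is
 symmetric in the three matrices.\<close>

definition entA :: "int => wmat => nat => nat => nat" where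
 "entA u M i j = (case M $$ (i, j) of None => 0 | Some x => nat (x + u + 1))"

definition entC :: "int => wmat => nat => nat => nat" where
 "entC u M i j = (case M $$ (i, j) of None => 0 | Some x => nat (u + 1 - x))"

text \<open>A missing entry is not stored: the cell keeps its initial 0, which marks absence in all
  later parts. The flag \<open>neg\<close> serves the third matrix, whose entries change
  sign.\<close>

definition rdf :: "bool => exp => nat => com" where
 "rdf neg e a = (ReadAdd ib (e \<^bold>+ N 0) (N 0) ;;
   If (V ib) ((if neg then ReadSub else ReadAdd) ib (e \<^bold>+ N 1) (V vO \<^bold>+ N 1) ;; Put a (V ia) (V ib)) Skip)"

lemma rdf_writes [simp]: "wv (rdf neg e a) = {ib}" "wa (rdf neg e a) = {a}" "wio (rdf neg e a) = False"
 by (auto simp: rdf_def)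

lemma wp_rdf:
 assumes "\<And>v. eval e (set_var ib v s) = k" "eval e s = k" "k + 1 < b" "io s k = of_bool (x \<noteq> None)"
  "\<And>y. x = Some y \<Longrightarrow> io s (k + 1) = y \<and> - int u \<le> y \<and> y \<le> int u"
  "vr s vO = u" "ar s a (vr s ia) = 0" "2 * u + 1 \<le> Z"
 shows "wp b Z (rdf neg e a) s (\<lambda>s' t. ar s' a = (ar s a)(vr s ia :=
  (if neg then (case x of None => 0 | Some y => nat (int u + 1 - y))
   else (case x of None => 0 | Some y => nat (y + int u + 1)))) \<and> t \<le> 6)"
proof (cases x)
 case None
 then show ?thesis using assms by (simp add: rdf_def wp_Seq wp_If fun_upd_idem)
next
 case (Some y)
 then have "io s (k + 1) = y" "- int u \<le> y" "y \<le> int u" using assms(5) by auto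
 then show ?thesis
  using assms(1-4,6-8) Some by (auto simp: rdf_def wp_Seq wp_If nat_le_iff algebra_simps)
qed

definition normf :: com where
 "normf = For ix (V vN) (For iy (V vN) (
   ia :=: V ix \<^bold>* V vN \<^bold>+ V iy ;;
   rdf False (N 2 \<^bold>* V ia) aA ;;
   rdf False (N 2 \<^bold>* (V vN \<^bold>* V vN) \<^bold>+ N 2 \<^bold>* V ia) aB ;;
   rdf True (N 4 \<^bold>* (V vN \<^bold>* V vN) \<^bold>+ N 2 \<^bold>* V ia) aC))"

lemma normf_writes [simp]: "wv normf = {ix, iy, ia, ib}" "wa normf = {aA, aB, aC}" "wio normf = False"
 by (auto simp: normf_def)

lemma wp_normf:
 assumes car: "A \<in> carrier_mat n n" "B \<in> carrier_mat n n" "C \<in> carrier_mat n n"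
  and bd: "entries_bounded (int u) A" "entries_bounded (int u) B" "entries_bounded (int u) C"
  and s: "vr s vN = n" "vr s vO = u" "io s = io (input_st n A B C)" "\<And>a. ar s a = (\<lambda>_. 0)"
  and Z: "2 * u + 1 \<le> Z" "n * n \<le> Z" "n \<le> Z"
 shows "wp (6 * n * n) Z normf s (\<lambda>s' t. (\<forall>i<n. \<forall>j<n. ar s' aA (i * n + j) = entA u A i j \<and>
  ar s' aB (i * n + j) = entA u B i j \<and> ar s' aC (i * n + j) = entC u C i j) \<and> t \<le> n * (n * 20 + 2) + 1)"
proof -
 let ?P = "\<lambda>s' i j. ar s' aA (i * n + j) = entA u A i j \<and>
  ar s' aB (i * n + j) = entA u B i j \<and> ar s' aC (i * n + j) = entC u C i j"
 let ?Z = "\<lambda>s' k. \<forall>x\<ge>k. ar s' aA x = 0 \<and> ar s' aB x = 0 \<and> ar s' aC x = 0"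
 have ent: "int_entry x ! 0 = of_bool (x \<noteq> None)" "int_entry (Some y) ! 1 = y" for x y
  by (cases x) auto
 have bA: "A $$ (i, j) = Some x \<Longrightarrow> - int u \<le> x \<and> x \<le> int u" if "i < n" "j < n" for i j x
  using bd(1) car(1) that by (auto simp: entries_bounded_def)
 have bB: "B $$ (i, j) = Some x \<Longrightarrow> - int u \<le> x \<and> x \<le> int u" if "i < n" "j < n" for i j x
  using bd(2) car(2) that by (auto simp: entries_bounded_def)
 have bC: "C $$ (i, j) = Some x \<Longrightarrow> - int u \<le> x \<and> x \<le> int u" if "i < n" "j < n" for i j x
  using bd(3) car(3) that by (auto simp: entries_bounded_def)
 show ?thesis
  unfolding normf_def
 proof (rule wp_For[where I = "\<lambda>i s' t. (\<forall>i'<i. \<forall>j<n. ?P s' i' j) \<and> ?Z s' (i * n) \<and> t \<le> i * (n * 20 + 2)"], goal_cases)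
  case (3 i s1 t1)
  have f1: "vr s1 vN = n" "vr s1 vO = u" "io s1 = io (input_st n A B C)"
   using 3(3) s by (simp_all add: frame_def)
  have i: "i < n" using 3(1) s by simp
  note I1 = 3(2)
  show ?case
  proof (rule wp_For[where I = "\<lambda>j s' t. (\<forall>i'<i. \<forall>j<n. ?P s' i' j) \<and> (\<forall>j'<j. ?P s' i j') \<and> ?Z s' (i * n + j) \<and> t \<le> j * 20"], goal_cases)
   case (3 j s2 t2)
   have f2: "vr s2 vN = n" "vr s2 vO = u" "io s2 = io (input_st n A B C)" "vr s2 ix = i"
    using 3(3) f1 by (simp_all add: frame_def)
   have j: "j < n" using 3(1) f1 by simp
   have ij: "i * n + j < n * n" using i j by (rule mult_add_less)
   note io = io_input_st[OF car i j]
   note io0 = io[of 0, unfolded ent] io[of 1]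
   have old: "i' * n + j' \<noteq> i * n + j" if "i' < i" "j' < n" for i' j'
   proof -
    have "i' * n + j' < i * n" using that by (rule mult_add_less)
    then show ?thesis by simp
   qed
   have P0: "\<And>i' j'. i' < i \<Longrightarrow> j' < n \<Longrightarrow> ?P s2 i' j'" "\<And>j'. j' < j \<Longrightarrow> ?P s2 i j'" "?Z s2 (i * n + j)" "t2 \<le> j * 20"
    using 3(2) by auto
   have Zs: "i * n + j \<le> Z" using ij Z by auto
   define s3 where "s3 = set_var ia (i * n + j) (set_var iy j s2)"
   have f3: "vr s3 vN = n" "vr s3 vO = u" "io s3 = io (input_st n A B C)" "vr s3 ia = i * n + j"
    using f2 by (simp_all add: s3_def)
   have 1: "wp (6 * n * n) Z (rdf False (N 2 \<^bold>* V ia) aA) s3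
     (\<lambda>s' t. ar s' aA = (ar s3 aA)(vr s3 ia := entA u A i j) \<and> t \<le> 6)"
    using wp_rdf[of "N 2 \<^bold>* V ia" s3 "2 * (i * n + j)" "6 * n * n" "A $$ (i, j)" u aA Z False]
     f3 ij io0(1,4) bA[OF i j] ent P0(3) Z(1) by (auto simp: entA_def s3_def)
   have 2: "wp (6 * n * n) Z (rdf False (N 2 \<^bold>* (V vN \<^bold>* V vN) \<^bold>+ N 2 \<^bold>* V ia) aB) s4
     (\<lambda>s' t. ar s' aB = (ar s3 aB)(i * n + j := entA u B i j) \<and> t \<le> 6)"
    if "frame (rdf False (N 2 \<^bold>* V ia) aA) s3 s4" for s4
   proof -
    have "vr s4 vN = n" "vr s4 vO = u" "io s4 = io (input_st n A B C)" "vr s4 ia = i * n + j" "ar s4 aB = ar s3 aB"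
     using that f3 by (simp_all add: frame_def)
    then show ?thesis
     using wp_rdf[of "N 2 \<^bold>* (V vN \<^bold>* V vN) \<^bold>+ N 2 \<^bold>* V ia" s4 "2 * (n * n) + 2 * (i * n + j)"
      "6 * n * n" "B $$ (i, j)" u aB Z False]
     ij io0(2,5) bB[OF i j] ent P0(3) Z(1) by (auto simp: entA_def s3_def)
   qed
   have 3: "wp (6 * n * n) Z (rdf True (N 4 \<^bold>* (V vN \<^bold>* V vN) \<^bold>+ N 2 \<^bold>* V ia) aC) s5
     (\<lambda>s' t. ar s' aC = (ar s3 aC)(i * n + j := entC u C i j) \<and> t \<le> 6)"
    if "frame (rdf False (N 2 \<^bold>* V ia) aA) s3 s4"
     "frame (rdf False (N 2 \<^bold>* (V vN \<^bold>* V vN) \<^bold>+ N 2 \<^bold>* V ia) aB) s4 s5" for s4 s5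
   proof -
    have "vr s5 vN = n" "vr s5 vO = u" "io s5 = io (input_st n A B C)" "vr s5 ia = i * n + j" "ar s5 aC = ar s3 aC"
     using that f3 by (simp_all add: frame_def)
    then show ?thesis
     using wp_rdf[of "N 4 \<^bold>* (V vN \<^bold>* V vN) \<^bold>+ N 2 \<^bold>* V ia" s5 "4 * (n * n) + 2 * (i * n + j)"
      "6 * n * n" "C $$ (i, j)" u aC Z True]
     ij io0(3,6) bC[OF i j] ent P0(3) Z(1) by (auto simp: entC_def s3_def)
   qed
   have "wp (6 * n * n) Z (rdf False (N 2 \<^bold>* V ia) aA ;;
     rdf False (N 2 \<^bold>* (V vN \<^bold>* V vN) \<^bold>+ N 2 \<^bold>* V ia) aB ;;
     rdf True (N 4 \<^bold>* (V vN \<^bold>* V vN) \<^bold>+ N 2 \<^bold>* V ia) aC) s3 (\<lambda>s' t.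
      ar s' aA = (ar s2 aA)(i * n + j := entA u A i j) \<and> ar s' aB = (ar s2 aB)(i * n + j := entA u B i j) \<and>
      ar s' aC = (ar s2 aC)(i * n + j := entC u C i j) \<and> t \<le> 18)"
    unfolding wp_Seq
    by (rule wp_conseq[OF 1], rule wp_conseq[OF 2], assumption, rule wp_conseq[OF 3], assumption, assumption)
     (auto simp: frame_def s3_def)
   then show ?case
    unfolding wp_Seq[of _ _ "_ :=: _"] wp_simps
    using Zs f2 P0 old by (auto elim!: wp_conseq simp: s3_def[symmetric] less_Suc_eq)
  next
   case 1
   show ?case using f1 Z by simp
  next
   case 2
   show ?case using I1 by simp
  next
   case (4 s' t)
   then show ?case using I1 f1 by (simp add: less_Suc_eq algebra_simps)
  qed
 qed (use s Z in \<open>auto simp: algebra_simps\<close>)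
qed

subsection \<open>The three matrices in the role of few-weights matrix, second and third side\<close>

definition tix :: "bool => exp" where
 "tix tr = (if tr then V iy \<^bold>* V vN \<^bold>+ V ix else V ix \<^bold>* V vN \<^bold>+ V iy)"

definition rolef :: "nat => bool => nat => bool => nat => bool => com" where
 "rolef a1 t1 a2 t2 a3 t3 = For ix (V vN) (For iy (V vN) (
   Put aU (V ix \<^bold>* V vN \<^bold>+ V iy) (Arr a1 (tix t1)) ;;
   Put aV (V ix \<^bold>* V vN \<^bold>+ V iy) (Arr a2 (tix t2)) ;;
   Put aW (V ix \<^bold>* V vN \<^bold>+ V iy) (Arr a3 (tix t3))))"

lemma rolef_writes [simp]: "wv (rolef a1 t1 a2 t2 a3 t3) = {ix, iy}" "wa (rolef a1 t1 a2 t2 a3 t3) = {aU, aV, aW}"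
 "wio (rolef a1 t1 a2 t2 a3 t3) = False"
 by (auto simp: rolef_def)

definition pos_of :: "bool => nat => nat => nat => nat" where
 "pos_of tr n i j = (if tr then j * n + i else i * n + j)"

lemma wp_rolef:
 assumes s: "vr s vN = n" "n \<le> Z"
  and a: "a1 \<notin> {aU, aV, aW}" "a2 \<notin> {aU, aV, aW}" "a3 \<notin> {aU, aV, aW}"
  and Z: "\<And>a x. a \<in> {a1, a2, a3} \<Longrightarrow> x < n * n \<Longrightarrow> ar s a x \<le> Z"
 shows "wp b Z (rolef a1 t1 a2 t2 a3 t3) s (\<lambda>s' t. (\<forall>i<n. \<forall>j<n.
  ar s' aU (i * n + j) = ar s a1 (pos_of t1 n i j) \<and> ar s' aV (i * n + j) = ar s a2 (pos_of t2 n i j) \<and>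
  ar s' aW (i * n + j) = ar s a3 (pos_of t3 n i j)) \<and> t \<le> n * (n * 4 + 2) + 1)"
proof -
 let ?P = "\<lambda>s' i j. ar s' aU (i * n + j) = ar s a1 (pos_of t1 n i j) \<and> ar s' aV (i * n + j) = ar s a2 (pos_of t2 n i j) \<and>
  ar s' aW (i * n + j) = ar s a3 (pos_of t3 n i j)"
 show ?thesis
  unfolding rolef_def
 proof (rule wp_For[where I = "\<lambda>i s' t. (\<forall>i'<i. \<forall>j<n. ?P s' i' j) \<and> t \<le> i * (n * 4 + 2)"], goal_cases)
  case (3 i s1 t1')
  have f1: "vr s1 vN = n" "ar s1 a1 = ar s a1" "ar s1 a2 = ar s a2" "ar s1 a3 = ar s a3"
   using 3(3) s a by (simp_all add: frame_def)
  have i: "i < n" using 3(1) s by simp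
  note I1 = 3(2)
  show ?case
  proof (rule wp_For[where I = "\<lambda>j s' t. (\<forall>i'<i. \<forall>j<n. ?P s' i' j) \<and> (\<forall>j'<j. ?P s' i j') \<and> t \<le> j * 4"], goal_cases)
   case (3 j s2 t2')
   have f2: "vr s2 vN = n" "vr s2 ix = i" "ar s2 a1 = ar s a1" "ar s2 a2 = ar s a2" "ar s2 a3 = ar s a3"
    using 3(3) f1 a by (simp_all add: frame_def)
   have j: "j < n" using 3(1) f1 by simp
   have ij: "i * n + j < n * n" "j * n + i < n * n" using i j by (auto intro: mult_add_less)
   have old: "i' * n + j' \<noteq> i * n + j" if "i' < i" "j' < n" for i' j'
   proof -
    have "i' * n + j' < i * n" using that by (rule mult_add_less)
    then show ?thesis by simp
   qed
   have P0: "\<And>i' j'. i' < i \<Longrightarrow> j' < n \<Longrightarrow> ?P s2 i' j'" "\<And>j'. j' < j \<Longrightarrow> ?P s2 i j'" "t2' \<le> j * 4"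
    using 3(2) by auto
   have "eval (tix tr) s' = pos_of tr n i j" if "vr s' vN = n" "vr s' ix = i" "vr s' iy = j" for tr s'
    using that by (simp add: tix_def pos_of_def)
   moreover have "pos_of tr n i j < n * n" for tr using ij by (simp add: pos_of_def)
   ultimately show ?case
    using P0 old f2 a by (auto simp: wp_Seq Z less_Suc_eq)
  next
   case 1
   show ?case using f1 s by simp
  next
   case 2
   show ?case using I1 by simp
  next
   case (4 s' t)
   then show ?case using I1 f1 by (simp add: less_Suc_eq algebra_simps)
  qed
 qed (use s in \<open>auto simp: algebra_simps\<close>)
qed

subsection \<open>Distinct weights of each row\<close>

definition searchf :: com where
 "searchf = (ic :=: N 0 ;;
   For iz (V id1) (If (Arr aLst (V iy \<^bold>* V vN \<^bold>+ V iz) \<^bold>= V ib) (ic :=: N 1) Skip))"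

lemma searchf_writes [simp]: "wv searchf = {ic, iz}" "wa searchf = {}" "wio searchf = False"
 by (auto simp: searchf_def)

lemma wp_searchf:
 assumes "vr s vN = n" "vr s iy = y" "vr s id1 = k" "vr s ib = v" "k \<le> Z" "1 \<le> Z"
 shows "wp b Z searchf s (\<lambda>s' t. vr s' ic = of_bool (\<exists>z<k. ar s aLst (y * n + z) = v) \<and> t \<le> 3 * k + 2)"
proof -
 have "wp b Z (For iz (V id1) (If (Arr aLst (V iy \<^bold>* V vN \<^bold>+ V iz) \<^bold>= V ib) (ic :=: N 1) Skip)) (set_var ic 0 s)
   (\<lambda>s' t. vr s' ic = of_bool (\<exists>z<k. ar s aLst (y * n + z) = v) \<and> 1 + t \<le> 3 * k + 2)"
 proof (rule wp_For[where I = "\<lambda>i s' t. vr s' ic = of_bool (\<exists>z<i. ar s aLst (y * n + z) = v) \<and> t \<le> 3 * i"], goal_cases)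
  case (3 i s' t)
  have f: "vr s' vN = n" "vr s' iy = y" "vr s' ib = v" "ar s' aLst = ar s aLst"
   using 3(3) assms by (simp_all add: frame_def)
  show ?case using 3(2) f assms by (auto simp: wp_If less_Suc_eq)
 qed (use assms in auto)
 then show ?thesis using assms by (simp add: searchf_def wp_Seq)
qed

text \<open>Treats one more entry of row y. A new weight beyond the capacity e clears
  \<open>vOk\<close>, after which nothing happens any more; so a list never exceeds the capacity and
  searching it costs at most that much.\<close>

definition stepf :: "exp => com" where
 "stepf e = If (V vOk) (ib :=: Arr aU (V iy \<^bold>* V vN \<^bold>+ V ix) ;;
   If (V ib) (searchf ;;
    If (V ic) Skip
     (If (V id1 \<^bold>< e) (Put aLst (V iy \<^bold>* V vN \<^bold>+ V id1) (V ib) ;; id1 :=: V id1 \<^bold>+ N 1) (vOk :=: N 0))) Skip) Skip"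

lemma stepf_writes [simp]: "wv (stepf e) = {ib, ic, iz, id1, vOk}" "wa (stepf e) = {aLst}" "wio (stepf e) = False"
 by (auto simp: stepf_def)

definition distf :: "exp => com" where
 "distf e = (vOk :=: N 1 ;; For iy (V vN) (id1 :=: N 0 ;; For ix (V vN) (stepf e) ;; Put aCnt (V iy) (V id1)))"

lemma distf_writes [simp]: "wv (distf e) = {iy, ix, ib, ic, iz, id1, vOk}" "wa (distf e) = {aLst, aCnt}"
 "wio (distf e) = False"
 by (auto simp: distf_def)

text \<open>The distinct weights among the first k entries of row y; 0 is removed because it marks a
  missing entry.\<close>

definition rowv :: "(nat => nat) => nat => nat => nat => nat set" where
 "rowv U n y k = (\<lambda>x. U (y * n + x)) ` {..<k} - {0}"

lemma rowv_Suc: "rowv U n y (Suc k) = rowv U n y k \<union> ({U (y * n + k)} - {0})"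
 by (auto simp: rowv_def lessThan_Suc)

lemma finite_rowv [simp]: "finite (rowv U n y k)"
 by (simp add: rowv_def)

lemma rowv_mono: "k \<le> l \<Longrightarrow> card (rowv U n y k) \<le> card (rowv U n y l)"
 by (intro card_mono) (auto simp: rowv_def)

text \<open>Row y of an array with row length n starts with an enumeration of S without repetition,
  so that a loop over its cells computes a sum over S (\<open>listed_sum\<close>).\<close>

definition listed :: "(nat => nat) => nat => nat => nat => nat set => bool" where
 "listed Lst n y m S \<longleftrightarrow> inj_on (\<lambda>z. Lst (y * n + z)) {..<m} \<and> (\<lambda>z. Lst (y * n + z)) ` {..<m} = S"

lemma listed_card: "listed Lst n y m S \<Longrightarrow> card S = m"
 unfolding listed_def by (metis card_image card_lessThan)

lemma listed_cong:
 "listed Lst n y m S \<Longrightarrow> (\<And>z. z < m \<Longrightarrow> Lst' (y * n + z) = Lst (y * n + z)) \<Longrightarrow> listed Lst' n y m S"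
 unfolding listed_def by (auto simp: inj_on_def image_def)

lemma listed_Suc:
 assumes "listed Lst n y m S" "v \<notin> S"
 shows "listed (Lst(y * n + m := v)) n y (Suc m) (insert v S)"
 using assms unfolding listed_def by (auto simp: inj_on_def lessThan_Suc image_iff)

lemma wp_stepf:
 assumes "vr s vN = n" "vr s iy = y" "vr s ix = k" "k < n" "y < n" "n * n \<le> Z" "n \<le> Z"
  and e: "\<And>s'. vr s' vCap = vr s vCap \<Longrightarrow> vr s' vN = vr s vN \<Longrightarrow> eval e s' = cap"
  and U: "\<And>x. x < n * n \<Longrightarrow> ar s aU x \<le> Z"
  and I: "vr s id1 \<le> k" "vr s id1 \<le> cap" "vr s vOk \<le> 1" "vr s vOk = 1 \<Longrightarrow> listed (ar s aLst) n y (vr s id1) (rowv (ar s aU) n y k)"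
 shows "wp b Z (stepf e) s (\<lambda>s' t. vr s' id1 \<le> Suc k \<and> vr s' id1 \<le> cap \<and> vr s' vOk \<le> vr s vOk \<and>
  (vr s' vOk = 1 \<longrightarrow> listed (ar s' aLst) n y (vr s' id1) (rowv (ar s aU) n y (Suc k))) \<and>
  (vr s vOk = 1 \<longrightarrow> vr s' vOk = 0 \<longrightarrow> cap < card (rowv (ar s aU) n y n)) \<and>
  (\<forall>x. x < y * n \<longrightarrow> ar s' aLst x = ar s aLst x) \<and> t \<le> 3 * cap + 8)"
proof (cases "vr s vOk = 0 \<or> ar s aU (y * n + k) = 0")
 case True
 have yk: "y * n + k < n * n" using assms by (intro mult_add_less)
 then show ?thesis
  using True assms by (auto simp: stepf_def wp_Seq wp_If rowv_Suc)
next
 case False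
 then have ok: "vr s vOk = 1" using I by simp
 define v where "v = ar s aU (y * n + k)"
 have v: "v \<noteq> 0" using False v_def by simp
 have yk: "y * n + k < n * n" using assms by (intro mult_add_less)
 then have vZ: "v \<le> Z" using U v_def by simp
 define m where "m = vr s id1"
 have L: "listed (ar s aLst) n y m (rowv (ar s aU) n y k)" using I ok m_def by simp
 have ex: "(\<exists>z<m. ar s aLst (y * n + z) = v) \<longleftrightarrow> v \<in> rowv (ar s aU) n y k"
  using L unfolding listed_def by (metis (no_types, lifting) imageE image_eqI lessThan_iff)
 have rS: "rowv (ar s aU) n y (Suc k) = insert v (rowv (ar s aU) n y k)"
  using v by (auto simp: rowv_Suc v_def)
 have mk: "m < n" using I(1) assms(4) m_def by simp
 have "wp b Z searchf (set_var ib v s) (\<lambda>s' t. vr s' ic = of_bool (v \<in> rowv (ar s aU) n y k) \<and> t \<le> 3 * m + 2)"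
  using wp_searchf[of "set_var ib v s" n y m v Z b] assms mk ex by (simp add: m_def)
 then have "wp b Z (searchf ;;
    If (V ic) Skip (If (V id1 \<^bold>< e) (Put aLst (V iy \<^bold>* V vN \<^bold>+ V id1) (V ib) ;; id1 :=: V id1 \<^bold>+ N 1) (vOk :=: N 0)))
   (set_var ib v s) (\<lambda>s' t. vr s' id1 \<le> Suc k \<and> vr s' id1 \<le> cap \<and> vr s' vOk \<le> 1 \<and>
   (vr s' vOk = 1 \<longrightarrow> listed (ar s' aLst) n y (vr s' id1) (rowv (ar s aU) n y (Suc k))) \<and>
   (vr s' vOk = 0 \<longrightarrow> cap < card (rowv (ar s aU) n y n)) \<and>
   (\<forall>x. x < y * n \<longrightarrow> ar s' aLst x = ar s aLst x) \<and> t \<le> 3 * cap + 5)"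
  unfolding wp_Seq
 proof (rule wp_conseq, goal_cases)
  case (1 s' t)
  have f: "vr s' vN = n" "vr s' vCap = vr s vCap" "vr s' iy = y" "vr s' id1 = m" "vr s' ib = v" "vr s' vOk = 1"
   "ar s' aLst = ar s aLst" using 1(2) assms ok by (simp_all add: frame_def m_def)
  have ec: "eval e s' = cap" using e f assms by simp
  show ?case
  proof (cases "v \<in> rowv (ar s aU) n y k")
   case True
   then have "rowv (ar s aU) n y (Suc k) = rowv (ar s aU) n y k" using rS by auto
   then show ?thesis using 1(1) True f L I by (auto simp: wp_If m_def)
  next
   case no: False
   show ?thesis
   proof (cases "m < cap")
    case True
    then show ?thesis
     using 1(1) no f ec vZ listed_Suc[OF L no] mk assms I rS by (auto simp: wp_If wp_Seq m_def)
   next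
    case False
    \<comment> \<open>The list is full and v is new, so row y alone exhibits more weights than the
      capacity.\<close>
    have "Suc m = card (rowv (ar s aU) n y (Suc k))"
     using listed_card[OF L] no rS by simp
    also have "\<dots> \<le> card (rowv (ar s aU) n y n)" using assms(4) by (intro rowv_mono) simp
    finally show ?thesis
     using 1(1) no f ec False I L by (auto simp: wp_If m_def)
   qed
  qed
 qed
 then have "wp b Z (searchf ;;
    If (V ic) Skip (If (V id1 \<^bold>< e) (Put aLst (V iy \<^bold>* V vN \<^bold>+ V id1) (V ib) ;; id1 :=: V id1 \<^bold>+ N 1) (vOk :=: N 0)))
   (set_var ib v s) (\<lambda>s' t. vr s' id1 \<le> Suc k \<and> vr s' id1 \<le> cap \<and> vr s' vOk \<le> vr s vOk \<and>
  (vr s' vOk = 1 \<longrightarrow> listed (ar s' aLst) n y (vr s' id1) (rowv (ar s aU) n y (Suc k))) \<and>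
  (vr s vOk = 1 \<longrightarrow> vr s' vOk = 0 \<longrightarrow> cap < card (rowv (ar s aU) n y n)) \<and>
  (\<forall>x. x < y * n \<longrightarrow> ar s' aLst x = ar s aLst x) \<and> Suc (1 + Suc t) \<le> 3 * cap + 8)"
  by (rule wp_conseq) (use ok in auto)
 then show ?thesis
  using ok v vZ assms(1-3) by (simp add: stepf_def wp_Seq[of _ _ "_ :=: _"] wp_If[of _ _ "V _"] v_def[symmetric] del: wp_If)
qed

lemma wp_distf:
 assumes n: "vr s vN = n" "n * n \<le> Z" "n \<le> Z" "1 \<le> Z"
  and e: "\<And>s'. vr s' vCap = vr s vCap \<Longrightarrow> vr s' vN = vr s vN \<Longrightarrow> eval e s' = cap"
  and U: "\<And>x. x < n * n \<Longrightarrow> ar s aU x \<le> Z"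
 shows "wp b Z (distf e) s (\<lambda>s' t. vr s' vOk \<le> 1 \<and>
  (vr s' vOk = 1 \<longrightarrow> (\<forall>y<n. listed (ar s' aLst) n y (ar s' aCnt y) (rowv (ar s aU) n y n) \<and> ar s' aCnt y \<le> cap)) \<and>
  ((\<forall>y<n. card (rowv (ar s aU) n y n) \<le> cap) \<longrightarrow> vr s' vOk = 1) \<and> t \<le> n * (n * (3 * cap + 9) + 5) + 3)"
proof -
 let ?R = "\<lambda>y k. rowv (ar s aU) n y k"
 let ?bad = "\<lambda>s'. vr s' vOk = 0 \<longrightarrow> (\<exists>y<n. cap < card (?R y n))"
 let ?I = "\<lambda>y s'. vr s' vOk \<le> 1 \<and> (vr s' vOk = 1 \<longrightarrow> (\<forall>y'<y. listed (ar s' aLst) n y' (ar s' aCnt y') (?R y' n) \<and> ar s' aCnt y' \<le> cap)) \<and> ?bad s'"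
 have "wp b Z (For iy (V vN) (id1 :=: N 0 ;; For ix (V vN) (stepf e) ;; Put aCnt (V iy) (V id1))) (set_var vOk 1 s)
  (\<lambda>s' t. ?I n s' \<and> t \<le> n * (n * (3 * cap + 9) + 5) + 1)"
 proof (rule wp_For[where I = "\<lambda>y s' t. ?I y s' \<and> t \<le> y * (n * (3 * cap + 9) + 5)"], goal_cases)
  case (3 y s1 t1)
  have f1: "vr s1 vN = n" "vr s1 vCap = vr s vCap" "ar s1 aU = ar s aU"
   using 3(3) n by (simp_all add: frame_def)
  have y: "y < n" using 3(1) n by simp
  note I1 = 3(2)
  have lp: "wp b Z (For ix (V vN) (stepf e)) (set_var id1 0 (set_var iy y s1))
    (\<lambda>s' t. vr s' id1 \<le> n \<and> vr s' id1 \<le> cap \<and> ?I y s' \<and> (vr s' vOk = 1 \<longrightarrow> listed (ar s' aLst) n y (vr s' id1) (?R y n)) \<and> t \<le> n * (3 * cap + 9) + 1)"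
  proof (rule wp_For[where I = "\<lambda>k s' t. vr s' id1 \<le> k \<and> vr s' id1 \<le> cap \<and> ?I y s' \<and> (vr s' vOk = 1 \<longrightarrow> listed (ar s' aLst) n y (vr s' id1) (?R y k)) \<and> t \<le> k * (3 * cap + 9)"], goal_cases)
   case (3 k s2 t2)
   have f2: "vr s2 vN = n" "vr s2 vCap = vr s vCap" "ar s2 aU = ar s aU" "vr s2 iy = y" "ar s2 aCnt = ar s1 aCnt"
    using 3(3) f1 by (simp_all add: frame_def)
   have k: "k < n" using 3(1) f1 by simp
   note I2 = 3(2)
   have "wp b Z (stepf e) (set_var ix k s2) (\<lambda>s' t. vr s' id1 \<le> Suc k \<and> vr s' id1 \<le> cap \<and> vr s' vOk \<le> vr s2 vOk \<and>
    (vr s' vOk = 1 \<longrightarrow> listed (ar s' aLst) n y (vr s' id1) (?R y (Suc k))) \<and>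
    (vr s2 vOk = 1 \<longrightarrow> vr s' vOk = 0 \<longrightarrow> cap < card (?R y n)) \<and>
    (\<forall>x. x < y * n \<longrightarrow> ar s' aLst x = ar s2 aLst x) \<and> t \<le> 3 * cap + 8)"
    using wp_stepf[of "set_var ix k s2" n y k Z e cap b] f2 k y n U e I2 by simp
   then show ?case
   proof (rule wp_conseq, goal_cases)
    case (1 s' t)
    have f3: "ar s' aCnt = ar s2 aCnt" using 1(2) by (simp add: frame_def)
    \<comment> \<open>A row holds at most n weights, so the lists of earlier rows lie below address
      y * n and are untouched.\<close>
    have "listed (ar s' aLst) n y' (ar s' aCnt y') (?R y' n)" if "listed (ar s2 aLst) n y' (ar s2 aCnt y') (?R y' n)" "y' < y" for y'
    proof (rule listed_cong[OF that(1)[folded f3]])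
     fix z assume "z < ar s' aCnt y'"
     also have "\<dots> = card (?R y' n)" using listed_card[OF that(1)] f3 by simp
     also have "\<dots> \<le> n" unfolding rowv_def
      by (rule order.trans[OF card_mono[OF _ Diff_subset]]) (auto intro: order.trans[OF card_image_le])
     finally have "y' * n + z < y * n" using that(2) by (intro mult_add_less)
     then show "ar s' aLst (y' * n + z) = ar s2 aLst (y' * n + z)" using 1(1) by simp
    qed
    then show ?case using 1(1) I2 f3 y by (auto simp: le_Suc_eq)
   qed
  next
   case 1
   show ?case using f1 n by simp
  next
   case 2
   show ?case using I1 by (simp add: listed_def rowv_def)
  next
   case (4 s' t)
   then show ?case using f1 by simp
  qed
  show ?case
  proof (simp add: wp_Seq, rule wp_conseq[OF lp], goal_cases)
   case (1 s' t)
   have "vr s' vN = n" "vr s' iy = y" using 1(2) f1 by (simp_all add: frame_def)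
   then show ?case using 1 I1 n by (auto simp: less_Suc_eq)
  qed
 qed (use n in auto)
 then show ?thesis
  unfolding distf_def wp_Seq wp_simps using n(4)
  by (auto elim!: wp_conseq simp: not_less[symmetric] le_Suc_eq)
qed

subsection \<open>Choosing the modulus\<close>

definition cntb :: "(nat => nat) => nat => nat => nat => nat => nat" where
 "cntb Vf n z m r = card {x. x < n \<and> Vf (x * n + z) \<noteq> 0 \<and> Vf (x * n + z) mod m = r}"

text \<open>The residue that v must have for u + v + w to be congruent to S. Adding m * S first
  keeps the truncated subtraction exact as long as w + u is at most 2 * S.\<close>

definition tgt :: "nat => nat => nat => nat => nat" where
 "tgt S m w u = (S + m * S - w - u) mod m"

text \<open>For each entry of column z, the number of entries in this column with the same residue.
  Different values with equal residue lengthen the searches when the column is grouped.\<close>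

definition hcost1 :: "(nat => nat) => nat => nat => nat => nat" where
 "hcost1 Vf n z m = (\<Sum>x<n. if Vf (x * n + z) \<noteq> 0 then cntb Vf n z m (Vf (x * n + z) mod m) else 0)"

text \<open>For each y with W[y, z] present and each weight of row y, the number of entries in the
  bucket that has to be inspected.\<close>

definition hcost2 :: "(nat => nat) => (nat => nat) => nat => (nat => nat) => (nat => nat) => nat => nat => nat => nat" where
 "hcost2 Vf W S Lst Cnt n z m = (\<Sum>y<n. if W (y * n + z) \<noteq> 0
   then (\<Sum>g<Cnt y. cntb Vf n z m (tgt S m (W (y * n + z)) (Lst (y * n + g)))) else 0)"

text \<open>Genuine equalities are counted along with the collisions: bucket sizes are quick to
  compute, and the surplus is the same for all moduli, so that minimising this cost also minimises
  the collisions.\<close>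

definition hcost :: "(nat => nat) => (nat => nat) => nat => (nat => nat) => (nat => nat) => nat => nat => nat" where
 "hcost Vf W S Lst Cnt n m = (\<Sum>z<n. hcost1 Vf n z m + hcost2 Vf W S Lst Cnt n z m)"

lemma cntb_le: "cntb Vf n z m r \<le> n"
proof -
 have "cntb Vf n z m r \<le> card {..<n}" unfolding cntb_def by (rule card_mono) auto
 then show ?thesis by simp
qed

lemma hcost1_le: "hcost1 Vf n z m \<le> n * n"
 unfolding hcost1_def by (rule order.trans[OF sum_bounded_above[where K = n]]) (auto simp: cntb_le)

lemma hcost2_le:
 assumes "\<And>y. y < n \<Longrightarrow> Cnt y \<le> n"
 shows "hcost2 Vf W S Lst Cnt n z m \<le> n * (n * n)"
proof -
 have "(\<Sum>g<Cnt y. cntb Vf n z m (f g)) \<le> n * n" if "y < n" for y f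
 proof -
  have "(\<Sum>g<Cnt y. cntb Vf n z m (f g)) \<le> Cnt y * n"
   by (rule order.trans[OF sum_bounded_above[where K = n]]) (auto simp: cntb_le)
  also have "\<dots> \<le> n * n" using assms[OF that] by (rule mult_right_mono) simp
  finally show ?thesis .
 qed
 then show ?thesis
  unfolding hcost2_def by (intro order.trans[OF sum_bounded_above[where K = "n * n"]]) auto
qed

lemma cntb_Suc:
 "card {x. x < Suc k \<and> Vf (x * n + z) \<noteq> 0 \<and> Vf (x * n + z) mod m = r} =
  card {x. x < k \<and> Vf (x * n + z) \<noteq> 0 \<and> Vf (x * n + z) mod m = r} +
  of_bool (Vf (k * n + z) \<noteq> 0 \<and> Vf (k * n + z) mod m = r)" for Vf :: "nat => nat"
proof -
 have "{x. x < Suc k \<and> Vf (x * n + z) \<noteq> 0 \<and> Vf (x * n + z) mod m = r} =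
   {x. x < k \<and> Vf (x * n + z) \<noteq> 0 \<and> Vf (x * n + z) mod m = r} \<union>
   (if Vf (k * n + z) \<noteq> 0 \<and> Vf (k * n + z) mod m = r then {k} else {})"
  by (auto simp: less_Suc_eq)
 moreover have "finite {x. x < k \<and> Vf (x * n + z) \<noteq> 0 \<and> Vf (x * n + z) mod m = r}"
  by (rule finite_subset[of _ "{..<k}"]) auto
 ultimately show ?thesis by auto
qed

definition zerof :: "nat => com" where
 "zerof a = For ia (V iq) (Put a (V ia) (N 0))"

lemma zerof_writes [simp]: "wv (zerof a) = {ia}" "wa (zerof a) = {a}" "wio (zerof a) = False"
 by (auto simp: zerof_def)

lemma wp_zerof:
 assumes "vr s iq = m" "m \<le> Z"
 shows "wp b Z (zerof a) s (\<lambda>s' t. (\<forall>r<m. ar s' a r = 0) \<and> t \<le> 2 * m + 1)"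
 unfolding zerof_def
 by (rule wp_For[where I = "\<lambda>i s' t. (\<forall>r<i. ar s' a r = 0) \<and> t \<le> 2 * i"])
  (use assms in \<open>auto simp: less_Suc_eq\<close>)

definition fillf :: com where
 "fillf = For ix (V vN) (ib :=: Arr aV (V ix \<^bold>* V vN \<^bold>+ V iz) ;;
   If (V ib) (Put aBkt (V ib \<^bold>mod V iq) (Arr aBkt (V ib \<^bold>mod V iq) \<^bold>+ N 1)) Skip)"

lemma fillf_writes [simp]: "wv fillf = {ix, ib}" "wa fillf = {aBkt}" "wio fillf = False"
 by (auto simp: fillf_def)

lemma wp_fillf:
 assumes "vr s vN = n" "vr s iz = z" "vr s iq = m" "z < n" "n \<le> Z" "m > 0" "\<And>r. r < m \<Longrightarrow> ar s aBkt r = 0"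
  and V: "\<And>x. x < n * n \<Longrightarrow> ar s aV x \<le> Z"
 shows "wp b Z fillf s (\<lambda>s' t. (\<forall>r<m. ar s' aBkt r = cntb (ar s aV) n z m r) \<and> t \<le> 4 * n + 1)"
 unfolding fillf_def
proof (rule wp_For[where I = "\<lambda>k s' t. (\<forall>r<m. ar s' aBkt r =
  card {x. x < k \<and> ar s aV (x * n + z) \<noteq> 0 \<and> ar s aV (x * n + z) mod m = r}) \<and> t \<le> 4 * k"], goal_cases)
 case (3 k s' t)
 have f: "vr s' vN = n" "vr s' iz = z" "vr s' iq = m" "ar s' aV = ar s aV"
  using 3(3) assms by (simp_all add: frame_def)
 have k: "k < n" using 3(1) assms by simp
 have kz: "k * n + z < n * n" using k assms(4) by (rule mult_add_less)
 let ?v = "ar s aV (k * n + z)"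
 have "card {x. x < k \<and> ar s aV (x * n + z) \<noteq> 0 \<and> ar s aV (x * n + z) mod m = r} \<le> card {..<k}" for r
  by (rule card_mono) auto
 then have c: "card {x. x < k \<and> ar s aV (x * n + z) \<noteq> 0 \<and> ar s aV (x * n + z) mod m = r} < n" for r
  unfolding card_lessThan by (rule le_less_trans[OF _ k])
 have Bk: "ar s' aBkt r = card {x. x < k \<and> ar s aV (x * n + z) \<noteq> 0 \<and> ar s aV (x * n + z) mod m = r}" if "r < m" for r
  using 3(2) that by simp
 have mm: "?v mod m < m" using assms by simp
 have "Suc (ar s' aBkt (?v mod m)) \<le> Z" unfolding Bk[OF mm] using c[of "?v mod m"] assms(5) by linarith
 then show ?case
  using f V[OF kz] 3(2) mm by (auto simp: wp_Seq wp_If cntb_Suc[unfolded neq0_conv])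
qed (use assms in \<open>auto simp: cntb_def\<close>)

definition sum1f :: com where
 "sum1f = For ix (V vN) (ib :=: Arr aV (V ix \<^bold>* V vN \<^bold>+ V iz) ;;
   If (V ib) (ih :=: V ih \<^bold>+ Arr aBkt (V ib \<^bold>mod V iq)) Skip)"

lemma sum1f_writes [simp]: "wv sum1f = {ix, ib, ih}" "wa sum1f = {}" "wio sum1f = False"
 by (auto simp: sum1f_def)

lemma wp_sum1f:
 assumes "vr s vN = n" "vr s iz = z" "vr s iq = m" "z < n" "n \<le> Z" "m > 0"
  "\<And>r. r < m \<Longrightarrow> ar s aBkt r = cntb (ar s aV) n z m r" "vr s ih + n * n \<le> Z"
  and V: "\<And>x. x < n * n \<Longrightarrow> ar s aV x \<le> Z"
 shows "wp b Z sum1f s (\<lambda>s' t. vr s' ih = vr s ih + hcost1 (ar s aV) n z m \<and> t \<le> 4 * n + 1)"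
 unfolding sum1f_def
proof (rule wp_For[where I = "\<lambda>k s' t. vr s' ih = vr s ih + (\<Sum>x<k. if ar s aV (x * n + z) \<noteq> 0
   then cntb (ar s aV) n z m (ar s aV (x * n + z) mod m) else 0) \<and> t \<le> 4 * k"], goal_cases)
 case (3 k s' t)
 let ?f = "\<lambda>x. if ar s aV (x * n + z) \<noteq> 0 then cntb (ar s aV) n z m (ar s aV (x * n + z) mod m) else 0"
 have f: "vr s' vN = n" "vr s' iz = z" "vr s' iq = m" "ar s' aV = ar s aV" "ar s' aBkt = ar s aBkt"
  using 3(3) assms by (simp_all add: frame_def)
 have k: "k < n" using 3(1) assms by simp
 have kz: "k * n + z < n * n" using k assms(4) by (rule mult_add_less)
 have "(\<Sum>x<Suc k. ?f x) \<le> (\<Sum>x<n. ?f x)" using k by (intro sum_mono2) auto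
 also have "\<dots> \<le> n * n" using hcost1_le[of "ar s aV" n z m] by (simp add: hcost1_def)
 finally have "vr s ih + (\<Sum>x<Suc k. ?f x) \<le> Z" using assms(8) by linarith
 then show ?case
  using f V[OF kz] 3(2) assms(6,7) by (auto simp: wp_Seq wp_If)
qed (use assms in \<open>auto simp: hcost1_def\<close>)

definition tgte :: exp where
 "tgte = (V vS \<^bold>+ V iq \<^bold>* V vS \<^bold>- V ib \<^bold>- Arr aLst (V iy \<^bold>* V vN \<^bold>+ V ig)) \<^bold>mod V iq"

definition sum2f :: com where
 "sum2f = For iy (V vN) (ib :=: Arr aW (V iy \<^bold>* V vN \<^bold>+ V iz) ;;
   If (V ib) (For ig (Arr aCnt (V iy)) (ih :=: V ih \<^bold>+ Arr aBkt tgte)) Skip)"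

lemma sum2f_writes [simp]: "wv sum2f = {iy, ib, ig, ih}" "wa sum2f = {}" "wio sum2f = False"
 by (auto simp: sum2f_def)

lemma wp_sum2f:
 assumes "vr s vN = n" "vr s iz = z" "vr s iq = m" "vr s vS = S" "z < n" "n \<le> Z" "m > 0"
  "\<And>r. r < m \<Longrightarrow> ar s aBkt r = cntb Vf n z m r" "vr s ih + n * (n * n) \<le> Z"
  "\<And>y. y < n \<Longrightarrow> ar s aCnt y \<le> n" "\<And>y. y < n \<Longrightarrow> ar s aCnt y \<le> cap"
  and V: "\<And>x. x < n * n \<Longrightarrow> ar s aW x \<le> Z"
 shows "wp b Z sum2f s (\<lambda>s' t. vr s' ih = vr s ih + hcost2 Vf (ar s aW) S (ar s aLst) (ar s aCnt) n z m \<and> t \<le> n * (2 * cap + 5) + 1)"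
 unfolding sum2f_def
proof (rule wp_For[where I = "\<lambda>k s' t. vr s' ih = vr s ih + (\<Sum>y<k. if ar s aW (y * n + z) \<noteq> 0
   then (\<Sum>g<ar s aCnt y. cntb Vf n z m (tgt S m (ar s aW (y * n + z)) (ar s aLst (y * n + g)))) else 0) \<and> t \<le> k * (2 * cap + 5)"], goal_cases)
 case (3 k s1 t1)
 let ?h = "\<lambda>y g. cntb Vf n z m (tgt S m (ar s aW (y * n + z)) (ar s aLst (y * n + g)))"
 let ?f = "\<lambda>y. if ar s aW (y * n + z) \<noteq> 0 then (\<Sum>g<ar s aCnt y. ?h y g) else 0"
 have f: "vr s1 vN = n" "vr s1 iz = z" "vr s1 iq = m" "vr s1 vS = S" "ar s1 aW = ar s aW" "ar s1 aBkt = ar s aBkt"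
  "ar s1 aLst = ar s aLst" "ar s1 aCnt = ar s aCnt"
  using 3(3) assms by (simp_all add: frame_def)
 have k: "k < n" using 3(1) assms by simp
 have kz: "k * n + z < n * n" using k assms(5) by (rule mult_add_less)
 let ?s = "set_var ib (ar s aW (k * n + z)) (set_var iy k s1)"
 have I1: "vr s1 ih = vr s ih + (\<Sum>y<k. ?f y)" "t1 \<le> k * (2 * cap + 5)" using 3(2) by auto
 have cap: "ar s aCnt k \<le> cap" "ar s aCnt k \<le> Z" using assms(6,10,11) k by (auto intro: order.trans)
 have lp: "wp b Z (For ig (Arr aCnt (V iy)) (ih :=: V ih \<^bold>+ Arr aBkt tgte)) ?s
   (\<lambda>s' t. vr s' ih = vr s ih + (\<Sum>y<Suc k. ?f y) \<and> t \<le> 2 * cap + 1)" if nz: "ar s aW (k * n + z) \<noteq> 0"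
 proof (rule wp_For[where I = "\<lambda>g' s' t. vr s' ih = vr s ih + (\<Sum>y<k. ?f y) + (\<Sum>g<g'. ?h k g) \<and> t \<le> 2 * g'"], goal_cases)
  case (3 g' s2 t2)
  have f2: "vr s2 vN = n" "vr s2 iq = m" "vr s2 vS = S" "vr s2 iy = k" "vr s2 ib = ar s aW (k * n + z)"
   "ar s2 aBkt = ar s aBkt" "ar s2 aLst = ar s aLst"
   using 3(3) f by (simp_all add: frame_def)
  have g': "g' < ar s aCnt k" using 3(1) f by simp
  have "(\<Sum>y<k. ?f y) + (\<Sum>g<Suc g'. ?h k g) \<le> (\<Sum>y<k. ?f y) + (\<Sum>g<ar s aCnt k. ?h k g)"
   using g' by (intro add_left_mono sum_mono2) auto
  also have "\<dots> = (\<Sum>y<Suc k. ?f y)" using nz by simp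
  also have "\<dots> \<le> (\<Sum>y<n. ?f y)" using k by (intro sum_mono2) auto
  also have "\<dots> \<le> n * (n * n)"
   using hcost2_le[of n "ar s aCnt" Vf "ar s aW" S "ar s aLst" z m] assms(10) by (simp add: hcost2_def)
  finally have "vr s ih + (\<Sum>y<k. ?f y) + (\<Sum>g<Suc g'. ?h k g) \<le> Z" using assms(9) by linarith
  moreover have "tgt S m (ar s aW (k * n + z)) (ar s aLst (k * n + g')) < m" using assms(7) by (simp add: tgt_def)
  ultimately show ?case
   using f2 3(2) assms(8) by (simp add: tgte_def tgt_def)
 qed (use f I1 cap nz in auto)
 show ?case
 proof (cases "ar s aW (k * n + z) = 0")
  case True
  then show ?thesis using f I1 by (simp add: wp_Seq wp_If)
 next
  case False
  then show ?thesis using f I1 V[OF kz]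
   by (simp add: wp_Seq wp_If) (rule wp_conseq[OF lp], auto)
 qed
qed (use assms in \<open>auto simp: hcost2_def\<close>)

definition costf :: com where
 "costf = (ih :=: N 0 ;; For iz (V vN) (zerof aBkt ;; fillf ;; sum1f ;; sum2f))"

lemma costf_writes [simp]: "wv costf = {iz, ia, ix, iy, ib, ig, ih}" "wa costf = {aBkt}" "wio costf = False"
 by (auto simp: costf_def)

lemma wp_costf:
 assumes s: "vr s vN = n" "vr s iq = m" "vr s vS = S" "m \<le> Z" "n * (n * n + n * (n * n)) \<le> Z" "n \<le> Z" "m > 0"
  "\<And>y. y < n \<Longrightarrow> ar s aCnt y \<le> n" "\<And>y. y < n \<Longrightarrow> ar s aCnt y \<le> cap"
  and V: "\<And>x. x < n * n \<Longrightarrow> ar s aV x \<le> Z" "\<And>x. x < n * n \<Longrightarrow> ar s aW x \<le> Z"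
 shows "wp b Z costf s (\<lambda>s' t. vr s' ih = hcost (ar s aV) (ar s aW) S (ar s aLst) (ar s aCnt) n m \<and>
  t \<le> n * (2 * m + 8 * n + n * (2 * cap + 5) + 5) + 2)"
proof -
 let ?c = "\<lambda>z. hcost1 (ar s aV) n z m + hcost2 (ar s aV) (ar s aW) S (ar s aLst) (ar s aCnt) n z m"
 have "wp b Z (For iz (V vN) (zerof aBkt ;; fillf ;; sum1f ;; sum2f)) (set_var ih 0 s)
  (\<lambda>s' t. vr s' ih = (\<Sum>z<n. ?c z) \<and> t \<le> n * (2 * m + 8 * n + n * (2 * cap + 5) + 5) + 1)"
 proof (rule wp_For[where I = "\<lambda>k s' t. vr s' ih = (\<Sum>z<k. ?c z) \<and> t \<le> k * (2 * m + 8 * n + n * (2 * cap + 5) + 5)"], goal_cases)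
  case (3 z s1 t1)
  have f1: "vr s1 vN = n" "vr s1 iq = m" "vr s1 vS = S" "ar s1 aV = ar s aV" "ar s1 aW = ar s aW"
   "ar s1 aLst = ar s aLst" "ar s1 aCnt = ar s aCnt"
   using 3(3) s by (simp_all add: frame_def)
  have z: "z < n" using 3(1) s by simp
  have I1: "vr s1 ih = (\<Sum>z<z. ?c z)" "t1 \<le> z * (2 * m + 8 * n + n * (2 * cap + 5) + 5)" using 3(2) by auto
  have "?c z \<le> n * n + n * (n * n)" for z
   by (intro add_mono hcost1_le hcost2_le s(8))
  then have "(\<Sum>z<z. ?c z) \<le> z * (n * n + n * (n * n))"
   using sum_bounded_above[of "{..<z}" ?c "n * n + n * (n * n)"] by simp
  then have "(\<Sum>z<z. ?c z) + (n * n + n * (n * n)) \<le> Suc z * (n * n + n * (n * n))" by simp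
  also have "\<dots> \<le> n * (n * n + n * (n * n))" using z by (intro mult_right_mono) auto
  finally have Zb: "vr s1 ih + (n * n + n * (n * n)) \<le> Z" using s(5) I1 by linarith
  have h1: "hcost1 (ar s aV) n z m \<le> n * n" by (rule hcost1_le)
  show ?case
   unfolding wp_Seq
  proof (rule wp_conseq[OF wp_zerof[of _ m]], goal_cases)
   case (3 s2 t2)
   have f2: "vr s2 vN = n" "vr s2 iq = m" "vr s2 vS = S" "vr s2 iz = z" "vr s2 ih = vr s1 ih" "ar s2 aV = ar s aV" "ar s2 aW = ar s aW"
    "ar s2 aLst = ar s aLst" "ar s2 aCnt = ar s aCnt" "\<And>r. r < m \<Longrightarrow> ar s2 aBkt r = 0" "t2 \<le> 2 * m + 1"
    using 3 f1 by (simp_all add: frame_def)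
   show ?case
   proof (rule wp_conseq[OF wp_fillf[of _ n z m]], goal_cases)
    case (9 s3 t3)
    have f3: "vr s3 vN = n" "vr s3 iq = m" "vr s3 vS = S" "vr s3 iz = z" "vr s3 ih = vr s1 ih" "ar s3 aV = ar s aV" "ar s3 aW = ar s aW"
     "ar s3 aLst = ar s aLst" "ar s3 aCnt = ar s aCnt" "\<And>r. r < m \<Longrightarrow> ar s3 aBkt r = cntb (ar s aV) n z m r" "t3 \<le> 4 * n + 1"
     using 9 f2 by (simp_all add: frame_def)
    show ?case
    proof (rule wp_conseq[OF wp_sum1f[of _ n z m]], goal_cases)
     case (10 s4 t4)
     have f4: "vr s4 vN = n" "vr s4 iq = m" "vr s4 vS = S" "vr s4 iz = z" "vr s4 ih = vr s1 ih + hcost1 (ar s aV) n z m"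
      "ar s4 aV = ar s aV" "ar s4 aW = ar s aW"
      "ar s4 aLst = ar s aLst" "ar s4 aCnt = ar s aCnt" "\<And>r. r < m \<Longrightarrow> ar s4 aBkt r = cntb (ar s aV) n z m r" "t4 \<le> 4 * n + 1"
      using 10 f3 by (simp_all add: frame_def)
     show ?case
     proof (rule wp_conseq[OF wp_sum2f[of _ n z m S _ "ar s aV" cap]], goal_cases)
      case (13 s5 t5)
      then show ?case using f4 f3 f2 I1 by (simp add: algebra_simps)
     qed (use f4 z s V Zb h1 in \<open>auto intro: order.trans\<close>)
    qed (use f3 z s V Zb in auto)
   qed (use f2 z s V in auto)
  qed (use f1 s in auto)
 qed (use s in auto)
 then show ?thesis
  by (simp add: costf_def wp_Seq hcost_def)
qed

text \<open>The moduli that may be reached after i rounds for a cost function H; ties are left open.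
  The competition runs over all q in {1..Q}, prime or not.\<close>

fun greedy :: "(nat => nat) => nat => nat => nat => bool" where
 "greedy H Q 0 m \<longleftrightarrow> m = 1"
| "greedy H Q (Suc i) m \<longleftrightarrow> (\<exists>m0. greedy H Q i m0 \<and> (\<exists>q\<in>{1..Q}. m = m0 * q) \<and> (\<forall>q\<in>{1..Q}. H m \<le> H (m0 * q)))"

lemma greedy_bounds: "greedy H Q i m \<Longrightarrow> 1 \<le> m \<and> m \<le> Q ^ i"
proof (induction i arbitrary: m)
 case (Suc i)
 then obtain m0 q where m: "greedy H Q i m0" "q \<in> {1..Q}" "m = m0 * q" by auto
 have "m0 * q \<le> Q ^ i * Q" using Suc.IH[OF m(1)] m(2) by (intro mult_le_mono) auto
 with Suc.IH[OF m(1)] m show ?case by (auto simp: mult.commute)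
qed simp

text \<open>\<open>ik\<close> is the best factor so far, with 0 for none, and \<open>im\<close> its
  cost. The candidate is \<open>il + 1\<close>, as loop variables start at 0.\<close>

definition selstepf :: com where
 "selstepf = (ik :=: N 0 ;; im :=: N 0 ;; For il (V vQ) (iq :=: V vM \<^bold>* (V il \<^bold>+ N 1) ;; costf ;;
   If (V ik) (If (V ih \<^bold>< V im) (im :=: V ih ;; ik :=: V il \<^bold>+ N 1) Skip) (im :=: V ih ;; ik :=: V il \<^bold>+ N 1)) ;;
   vM :=: V vM \<^bold>* V ik)"

lemma selstepf_writes [simp]: "wv selstepf = {ik, im, il, iq, vM, iz, ia, ix, iy, ib, ig, ih}"
 "wa selstepf = {aBkt}" "wio selstepf = False"
 by (auto simp: selstepf_def)

lemma hcost_le: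
 assumes "\<And>y. y < n \<Longrightarrow> Cnt y \<le> n"
 shows "hcost Vf W S Lst Cnt n m \<le> n * (n * n + n * (n * n))"
proof -
 have "hcost1 Vf n z m + hcost2 Vf W S Lst Cnt n z m \<le> n * n + n * (n * n)" for z
  by (intro add_mono hcost1_le hcost2_le assms)
 then show ?thesis
  unfolding hcost_def
  using sum_bounded_above[of "{..<n}" "\<lambda>z. hcost1 Vf n z m + hcost2 Vf W S Lst Cnt n z m" "n * n + n * (n * n)"] by simp
qed

lemma wp_selstepf:
 assumes s: "vr s vN = n" "vr s vQ = Q" "vr s vM = m" "vr s vS = S" "m * Q \<le> Z" "n * (n * n + n * (n * n)) \<le> Z" "n \<le> Z" "m > 0" "Q > 0"
  "\<And>y. y < n \<Longrightarrow> ar s aCnt y \<le> n" "\<And>y. y < n \<Longrightarrow> ar s aCnt y \<le> cap"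
  and V: "\<And>x. x < n * n \<Longrightarrow> ar s aV x \<le> Z" "\<And>x. x < n * n \<Longrightarrow> ar s aW x \<le> Z"
 defines "H \<equiv> hcost (ar s aV) (ar s aW) S (ar s aLst) (ar s aCnt) n"
 shows "wp b Z selstepf s (\<lambda>s' t. (\<exists>q\<in>{1..Q}. vr s' vM = m * q) \<and> (\<forall>q\<in>{1..Q}. H (vr s' vM) \<le> H (m * q)) \<and>
  t \<le> Q * (n * (2 * (m * Q) + 8 * n + n * (2 * cap + 5) + 5) + 8) + 4)"
proof -
 let ?T = "n * (2 * (m * Q) + 8 * n + n * (2 * cap + 5) + 5) + 8"
 have QZ: "Q \<le> Z" using s(5,8) by (metis (no_types) le_trans mult_le_mono1 nat_mult_1 Suc_leI One_nat_def)
 have loop: "wp b Z (For il (V vQ) (iq :=: V vM \<^bold>* (V il \<^bold>+ N 1) ;; costf ;;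
   If (V ik) (If (V ih \<^bold>< V im) (im :=: V ih ;; ik :=: V il \<^bold>+ N 1) Skip) (im :=: V ih ;; ik :=: V il \<^bold>+ N 1)))
   (set_var im 0 (set_var ik 0 s)) (\<lambda>s' t. vr s' ik \<in> {1..Q} \<and> (\<forall>q\<in>{1..Q}. H (m * vr s' ik) \<le> H (m * q)) \<and> t \<le> Q * ?T + 1)"
 proof (rule wp_For[where I = "\<lambda>k s' t. (if k = 0 then vr s' ik = 0 else vr s' ik \<in> {1..k} \<and> vr s' im = H (m * vr s' ik)) \<and>
   (\<forall>q\<in>{1..k}. H (m * vr s' ik) \<le> H (m * q)) \<and> t \<le> k * ?T"], goal_cases)
  case (3 k s1 t1)
  have f1: "vr s1 vN = n" "vr s1 vQ = Q" "vr s1 vM = m" "vr s1 vS = S" "ar s1 aV = ar s aV" "ar s1 aW = ar s aW"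
   "ar s1 aLst = ar s aLst" "ar s1 aCnt = ar s aCnt"
   using 3(3) s by (simp_all add: frame_def)
  have k: "k < Q" using 3(1) s by simp
  note I1 = 3(2)
  have mq: "m * Suc k \<le> m * Q" using k by (intro mult_le_mono2) simp
  then have mqZ: "m * Suc k \<le> Z" using s(5) by linarith
  have HZ: "H x \<le> Z" for x unfolding H_def using hcost_le[of n "ar s aCnt"] s(6,10) order.trans by blast
  have c0: "wp b Z costf (set_var iq (m * Suc k) (set_var il k s1)) (\<lambda>s' t. vr s' ih = H (m * Suc k) \<and>
    t \<le> n * (2 * (m * Suc k) + 8 * n + n * (2 * cap + 5) + 5) + 2)"
   using wp_costf[of "set_var iq (m * Suc k) (set_var il k s1)" n "m * Suc k" S Z cap b] f1 s V mqZ by (simp add: H_def)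
  have le: "n * (2 * (m * Suc k) + 8 * n + n * (2 * cap + 5) + 5) + 2 \<le> ?T - 6"
  proof -
   have "n * (2 * (m * Suc k) + 8 * n + n * (2 * cap + 5) + 5) \<le> n * (2 * (m * Q) + 8 * n + n * (2 * cap + 5) + 5)"
    using mq by (intro mult_left_mono) auto
   then show ?thesis by linarith
  qed
  have "wp b Z costf (set_var iq (m * Suc k) (set_var il k s1)) (\<lambda>s' t. vr s' ih = H (m * Suc k) \<and> t \<le> ?T - 6)"
   by (rule wp_conseq[OF c0]) (elim conjE, intro conjI, assumption, erule order.trans, rule le)
  note c = this[unfolded mult_Suc_right]
  have best: "\<forall>q\<in>{1..Suc k}. H (m * Suc k) \<le> H (m * q)" if "k = 0 \<or> H (m * Suc k) < H (m * vr s1 ik)"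
  proof
   fix q assume q: "q \<in> {1..Suc k}"
   show "H (m * Suc k) \<le> H (m * q)"
   proof (cases "q = Suc k")
    case False
    then have "k \<noteq> 0" "q \<in> {1..k}" using q by auto
    then have "H (m * vr s1 ik) \<le> H (m * q)" using I1 by simp
    then show ?thesis using that \<open>k \<noteq> 0\<close> by linarith
   qed simp
  qed
  show ?case
   using f1 mqZ
  proof (simp add: wp_Seq, intro wp_conseq[OF c], goal_cases)
   case (1 s' t)
   have f2: "vr s' ih = H (m * Suc k)" "vr s' im = vr s1 im" "vr s' ik = vr s1 ik" "vr s' il = k" "t \<le> ?T - 6"
    using 1 by (simp_all add: frame_def)
   show ?case
   proof (cases "k = 0")
    case True
    then show ?thesis using f2 best I1 HZ[of m] k QZ by (simp add: wp_If wp_Seq)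
   next
    case False
    then have "vr s1 ik \<noteq> 0" "vr s1 ik \<le> k" "vr s1 im = H (m * vr s1 ik)" using I1 by auto
    then show ?thesis
     using f2 best I1 HZ[of "m + m * k"] k QZ False by (auto simp: wp_If wp_Seq le_Suc_eq)
   qed
  qed
 next
  case (4 s' t)
  then show ?case using s by auto
 qed (use s QZ in auto)
 show ?thesis
  unfolding selstepf_def
 proof (simp add: wp_Seq, rule wp_conseq[OF loop[unfolded One_nat_def]], goal_cases)
  case (1 s' t)
  have f: "vr s' vM = m" using 1(2) s by (simp add: frame_def)
  have "m * vr s' ik \<le> m * Q" using 1 by (intro mult_le_mono2) auto
  then have "m * vr s' ik \<le> Z" using s(5) by linarith
  then show ?case using 1 f by auto
 qed
qed

definition self :: "nat => com" where
 "self t = (vM :=: N 1 ;; For id1 (N t) selstepf)"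

lemma self_writes [simp]: "wv (self t) = {id1, ik, im, il, iq, vM, iz, ia, ix, iy, ib, ig, ih}"
 "wa (self t) = {aBkt}" "wio (self t) = False"
 by (auto simp: self_def)

lemma wp_self:
 assumes s: "vr s vN = n" "vr s vQ = Q" "vr s vS = S" "Q ^ t \<le> Z" "t \<le> Z" "n * (n * n + n * (n * n)) \<le> Z" "n \<le> Z" "Q > 0"
  "\<And>y. y < n \<Longrightarrow> ar s aCnt y \<le> n" "\<And>y. y < n \<Longrightarrow> ar s aCnt y \<le> cap"
  and V: "\<And>x. x < n * n \<Longrightarrow> ar s aV x \<le> Z" "\<And>x. x < n * n \<Longrightarrow> ar s aW x \<le> Z"
 defines "H \<equiv> hcost (ar s aV) (ar s aW) S (ar s aLst) (ar s aCnt) n"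
 shows "wp b Z (self t) s (\<lambda>s' t'. greedy H Q t (vr s' vM) \<and>
  t' \<le> t * (Q * (n * (2 * Q ^ t + 8 * n + n * (2 * cap + 5) + 5) + 8) + 5) + 2)"
proof -
 let ?T = "Q * (n * (2 * Q ^ t + 8 * n + n * (2 * cap + 5) + 5) + 8) + 5"
 have Z1: "1 \<le> Z" using s(4,8) by (metis One_nat_def Suc_leI le_trans zero_less_power)
 have "wp b Z (For id1 (N t) selstepf) (set_var vM 1 s) (\<lambda>s' t'. greedy H Q t (vr s' vM) \<and> t' \<le> t * ?T + 1)"
 proof (rule wp_For[where I = "\<lambda>i s' t'. greedy H Q i (vr s' vM) \<and> t' \<le> i * ?T"], goal_cases)
  case (3 i s1 t1)
  define m where "m = vr s1 vM"
  have f1: "vr s1 vN = n" "vr s1 vQ = Q" "vr s1 vS = S" "ar s1 aV = ar s aV" "ar s1 aW = ar s aW"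
   "ar s1 aLst = ar s aLst" "ar s1 aCnt = ar s aCnt"
   using 3(3) s by (simp_all add: frame_def)
  have i: "i < t" using 3(1) by simp
  have g: "greedy H Q i m" using 3(2) by (simp add: m_def)
  have m: "1 \<le> m" "m \<le> Q ^ i" using greedy_bounds[OF g] by auto
  have "m * Q \<le> Q ^ Suc i" using m(2) by (simp add: mult.commute)
  also have "\<dots> \<le> Q ^ t" using i s(8) by (intro power_increasing) auto
  finally have mQ: "m * Q \<le> Q ^ t" .
  have le: "Q * (n * (2 * (m * Q) + 8 * n + n * (2 * cap + 5) + 5) + 8) + 4 \<le> ?T - 1"
   using mQ by auto
  have sp: "wp b Z selstepf (set_var id1 i s1) (\<lambda>s' t. (\<exists>q\<in>{1..Q}. vr s' vM = m * q) \<and> (\<forall>q\<in>{1..Q}. H (vr s' vM) \<le> H (m * q)) \<and>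
   t \<le> Q * (n * (2 * (m * Q) + 8 * n + n * (2 * cap + 5) + 5) + 8) + 4)"
   using wp_selstepf[of "set_var id1 i s1" n Q m S Z cap b] f1 s V m mQ
   by (simp add: H_def m_def)
  have "wp b Z selstepf (set_var id1 i s1) (\<lambda>s' t. (\<exists>q\<in>{1..Q}. vr s' vM = m * q) \<and> (\<forall>q\<in>{1..Q}. H (vr s' vM) \<le> H (m * q)) \<and>
   t \<le> ?T - 1)"
   by (rule wp_conseq[OF sp]) (elim conjE, intro conjI, assumption, assumption, erule order.trans, rule le)
  then show ?case
  proof (rule wp_conseq, goal_cases)
   case (1 s' t)
   then show ?case using 3(2) g by auto
  qed
 qed (use s in auto)
 then show ?thesis using Z1 by (simp add: self_def wp_Seq)
qed

subsection \<open>Index computations\<close>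

definition encf :: "nat => nat => com" where
 "encf n0 b = (ie :=: N 0 ;; id1 :=: N 1 ;; For il (V vL) (
   ie :=: V ie \<^bold>+ V id1 \<^bold>* ((V ia \<^bold>mod N n0 \<^bold>* N n0 \<^bold>+ V ib \<^bold>mod N n0) \<^bold>* N b \<^bold>+ V ic \<^bold>mod N b) ;;
   id1 :=: V id1 \<^bold>* N (n0 * n0 * b) ;;
   ia :=: V ia \<^bold>div N n0 ;; ib :=: V ib \<^bold>div N n0 ;; ic :=: V ic \<^bold>div N b))"

lemma encf_writes [simp]: "wv (encf n0 b) = {ie, id1, il, ia, ib, ic}" "wa (encf n0 b) = {}" "wio (encf n0 b) = False"
 by (auto simp: encf_def)

lemma wp_encf:
 assumes "vr s vL = l" "vr s ia = i" "vr s ib = k" "vr s ic = a" "n0 > 0" "b > 0" "(n0 * n0 * b) ^ l \<le> Z" "l \<le> Z"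
  "i \<le> Z" "k \<le> Z" "a \<le> Z"
 shows "wp bb Z (encf n0 b) s (\<lambda>s' t. vr s' ie = enc n0 b l i k a \<and> t \<le> 6 * l + 3)"
proof -
 let ?q = "n0 * n0 * b"
 have q: "?q > 0" using assms by simp
 have pl: "?q ^ j \<le> Z" if "j \<le> l" for j
  using power_increasing[OF that, of ?q] q assms(7) by linarith
 have Z1: "1 \<le> Z" using pl[of 0] by simp
 have "wp bb Z (For il (V vL) (
   ie :=: V ie \<^bold>+ V id1 \<^bold>* ((V ia \<^bold>mod N n0 \<^bold>* N n0 \<^bold>+ V ib \<^bold>mod N n0) \<^bold>* N b \<^bold>+ V ic \<^bold>mod N b) ;;
   id1 :=: V id1 \<^bold>* N (n0 * n0 * b) ;;
   ia :=: V ia \<^bold>div N n0 ;; ib :=: V ib \<^bold>div N n0 ;; ic :=: V ic \<^bold>div N b)) (set_var id1 1 (set_var ie 0 s))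
  (\<lambda>s' t. vr s' ie = enc n0 b l i k a \<and> t \<le> 6 * l + 1)"
 \<comment> \<open>The digits already processed are collected in \<open>ie\<close>; what remains of
   the arguments is still to be encoded with weight \<open>id1\<close>.\<close>
 proof (rule wp_For[where I = "\<lambda>j s' t. j \<le> l \<and> vr s' ie + vr s' id1 * enc n0 b (l - j) (vr s' ia) (vr s' ib) (vr s' ic) = enc n0 b l i k a \<and>
   vr s' id1 = ?q ^ j \<and> vr s' ia \<le> Z \<and> vr s' ib \<le> Z \<and> vr s' ic \<le> Z \<and> t \<le> 6 * j"], goal_cases)
  case (3 j s' t)
  have j: "j < l" using 3(1) assms by simp
  then obtain r where r: "l - j = Suc r" "l - Suc j = r" by (metis Suc_diff_Suc)
  define d where "d = (vr s' ia mod n0 * n0 + vr s' ib mod n0) * b + vr s' ic mod b"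
  define e where "e = enc n0 b r (vr s' ia div n0) (vr s' ib div n0) (vr s' ic div b)"
  have I: "vr s' ie + ?q ^ j * (d + ?q * e) = enc n0 b l i k a" "vr s' id1 = ?q ^ j"
   using 3(2) unfolding r enc.simps d_def e_def by auto
  have E: "vr s' ie + ?q ^ j * d + ?q ^ Suc j * e = enc n0 b l i k a"
   using I(1) by (simp add: algebra_simps)
  have "vr s' ie + ?q ^ j * d \<le> enc n0 b l i k a" using E by linarith
  also have "\<dots> \<le> Z" using enc_less[OF assms(5,6), of l i k a] assms(7) by linarith
  finally have 1: "vr s' ie + ?q ^ j * d \<le> Z" .
  have 2: "?q ^ j * ?q \<le> Z" using pl[of "Suc j"] j by (simp add: mult.commute)
  have 3: "vr s' ia div n0 \<le> Z" "vr s' ib div n0 \<le> Z" "vr s' ic div b \<le> Z"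
   using 3(2) order.trans[OF div_le_dividend] by blast+
  show ?case
   using 1 2 3 I(2) E \<open>j \<le> l \<and> _\<close> j unfolding wp_Seq wp_simps
   by (simp add: r(2) d_def[symmetric] e_def[symmetric] mult.commute[of "?q ^ j"])
 qed (use assms Z1 in auto)
 then show ?thesis using Z1 unfolding encf_def wp_Seq wp_simps
  by (auto elim!: wp_conseq)
qed

definition sgf :: "nat => com" where
 "sgf K = (ig :=: N 0 ;; id1 :=: N 1 ;; ia :=: V iz ;; For il (V vL) (
   ig :=: V ig \<^bold>+ V id1 \<^bold>* (V ia \<^bold>mod N (2 * K - 1)) ;; id1 :=: V id1 \<^bold>* N K ;; ia :=: V ia \<^bold>div N (2 * K - 1)))"

lemma sgf_writes [simp]: "wv (sgf K) = {ig, id1, ia, il}" "wa (sgf K) = {}" "wio (sgf K) = False"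
 by (auto simp: sgf_def)

text \<open>The maximum 2 * K ^ l - 2 is attained when all digits are 2 * K - 2.\<close>

lemma sg_le: "K > 0 \<Longrightarrow> sg K l e + 2 \<le> 2 * K ^ l"
proof (induction l arbitrary: e)
 case (Suc l)
 have "e mod (2 * K - 1) < 2 * K - 1" using Suc.prems by simp
 moreover have "K * (sg K l (e div (2 * K - 1)) + 2) \<le> K * (2 * K ^ l)"
  by (rule mult_le_mono2[OF Suc.IH[OF Suc.prems]])
 ultimately show ?case by (simp add: algebra_simps)
qed simp

lemma wp_sgf:
 assumes "vr s vL = l" "vr s iz = e" "K > 0" "2 * K ^ l \<le> Z" "l \<le> Z" "e \<le> Z"
 shows "wp bb Z (sgf K) s (\<lambda>s' t. vr s' ig = sg K l e \<and> t \<le> 4 * l + 4)"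
proof -
 have pl: "K ^ j \<le> Z" if "j \<le> l" for j
  using power_increasing[OF that, of K] assms(3,4) by linarith
 have Z1: "1 \<le> Z" using pl[of 0] by simp
 have "wp bb Z (For il (V vL) (
   ig :=: V ig \<^bold>+ V id1 \<^bold>* (V ia \<^bold>mod N (2 * K - 1)) ;; id1 :=: V id1 \<^bold>* N K ;; ia :=: V ia \<^bold>div N (2 * K - 1)))
   (set_var ia e (set_var id1 1 (set_var ig 0 s)))
  (\<lambda>s' t. vr s' ig = sg K l e \<and> t \<le> 4 * l + 1)"
 proof (rule wp_For[where I = "\<lambda>j s' t. j \<le> l \<and> vr s' ig + vr s' id1 * sg K (l - j) (vr s' ia) = sg K l e \<and>
   vr s' id1 = K ^ j \<and> vr s' ia \<le> Z \<and> t \<le> 4 * j"], goal_cases)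
  case (3 j s' t)
  have j: "j < l" using 3(1) assms by simp
  then obtain r where r: "l - j = Suc r" "l - Suc j = r" by (metis Suc_diff_Suc)
  define d where "d = vr s' ia mod (2 * K - 1)"
  define f where "f = sg K r (vr s' ia div (2 * K - 1))"
  have I: "vr s' ig + K ^ j * (d + K * f) = sg K l e" "vr s' id1 = K ^ j"
   using 3(2) unfolding r sg.simps d_def f_def by auto
  have E: "vr s' ig + K ^ j * d + K ^ Suc j * f = sg K l e"
   using I(1) by (simp add: algebra_simps)
  have "vr s' ig + K ^ j * d \<le> sg K l e" using E by linarith
  also have "\<dots> \<le> Z" using sg_le[OF assms(3), of l e] assms(4) by linarith
  finally have 1: "vr s' ig + K ^ j * d \<le> Z" .
  have 2: "K ^ j * K \<le> Z" using pl[of "Suc j"] j by (simp add: mult.commute)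
  have 3: "vr s' ia div (2 * K - 1) \<le> Z"
   using 3(2) order.trans[OF div_le_dividend] by blast
  show ?case
   using 1 2 3 I(2) E \<open>j \<le> l \<and> _\<close> j unfolding wp_Seq wp_simps
   by (simp add: r(2) d_def[symmetric, simplified] f_def[symmetric, simplified] mult.commute[of "K ^ j"])
 qed (use assms Z1 in auto)
 then show ?thesis using Z1 assms unfolding sgf_def wp_Seq wp_simps
  by (auto elim!: wp_conseq)
qed

subsection \<open>Indicator arrays\<close>

definition buildf :: "nat => nat => nat => nat => com" where
 "buildf n0 K E X = For ix (V vN) (For iy (V vN) (ih :=: Arr E (V ix \<^bold>* V vN \<^bold>+ V iy) ;;
   If (V ih) (ia :=: V ix ;; ib :=: V iy ;; ic :=: V ih \<^bold>mod V vM ;; encf n0 K ;; Put X (V ie) (N 1)) Skip))"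

lemma buildf_writes [simp]: "wv (buildf n0 K E X) = {ix, iy, ih, ie, id1, il, ia, ib, ic}" "wa (buildf n0 K E X) = {X}"
 "wio (buildf n0 K E X) = False"
 by (auto simp: buildf_def)

lemma ind_insert: "ind n0 K l (insert (i, k) P) f = (ind n0 K l P f)(enc n0 K l i k (f i k) := 1)"
 by (auto simp: ind_def fun_eq_iff)

lemma ind_empty: "ind n0 K l {} f = (\<lambda>_. 0)"
 by (auto simp: ind_def)

definition pres :: "(nat => nat) => nat => (nat \<times> nat) set" where
 "pres E n = {(i, k). i < n \<and> k < n \<and> E (i * n + k) \<noteq> 0}"

lemma wp_buildf:
 assumes s: "vr s vN = n" "vr s vL = l" "vr s vM = m" "n0 > 0" "K > 0" "(n0 * n0 * K) ^ l \<le> Z" "l \<le> Z" "n \<le> Z" "m > 0" "m \<le> Z"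
  and E: "E \<noteq> X" "\<And>x. x < n * n \<Longrightarrow> ar s E x \<le> Z" "ar s X = (\<lambda>_. 0)"
 shows "wp bb Z (buildf n0 K E X) s (\<lambda>s' t. ar s' X = ind n0 K l (pres (ar s E) n) (\<lambda>i k. ar s E (i * n + k) mod m) \<and>
  t \<le> n * (n * (6 * l + 10) + 2) + 1)"
proof -
 let ?f = "\<lambda>i k. ar s E (i * n + k) mod m"
 let ?P = "\<lambda>i j. {(i', k). (i', k) \<in> pres (ar s E) n \<and> (i' < i \<or> i' = i \<and> k < j)}"
 have Z1: "1 \<le> Z" using s(9,10) by simp
 show ?thesis
  unfolding buildf_def
 proof (rule wp_For[where I = "\<lambda>i s' t. ar s' X = ind n0 K l (?P i 0) ?f \<and> t \<le> i * (n * (6 * l + 10) + 2)"], goal_cases)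
  case (3 i s1 t1)
  have f1: "vr s1 vN = n" "vr s1 vL = l" "vr s1 vM = m" "ar s1 E = ar s E"
   using 3(3) s E by (simp_all add: frame_def)
  have i: "i < n" using 3(1) s by simp
  note I1 = 3(2)
  show ?case
  proof (rule wp_For[where I = "\<lambda>j s' t. ar s' X = ind n0 K l (?P i j) ?f \<and> t \<le> j * (6 * l + 10)"], goal_cases)
   case (3 j s2 t2)
   have f2: "vr s2 vN = n" "vr s2 vL = l" "vr s2 vM = m" "ar s2 E = ar s E" "vr s2 ix = i"
    using 3(3) f1 E by (simp_all add: frame_def)
   have j: "j < n" using 3(1) f1 by simp
   have ij: "i * n + j < n * n" using i j by (rule mult_add_less)
   note I2 = 3(2)
   let ?e = "ar s E (i * n + j)"
   show ?case
   proof (cases "?e = 0")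
    case True
    then have "?P i (Suc j) = ?P i j" by (auto simp: pres_def less_Suc_eq)
    then show ?thesis using True I2 f2 by (simp add: wp_Seq wp_If)
   next
    case False
    then have P: "?P i (Suc j) = insert (i, j) (?P i j)" using i j by (auto simp: pres_def less_Suc_eq)
    let ?s = "set_var ic (?e mod m) (set_var ib j (set_var ia i (set_var ih ?e (set_var iy j s2))))"
    have "?e mod m \<le> Z" using s(9,10) mod_less_divisor[of m ?e] by linarith
    then have en: "wp bb Z (encf n0 K) ?s (\<lambda>s' t. vr s' ie = enc n0 K l i j (?e mod m) \<and> t \<le> 6 * l + 3)"
     using i j s f2 by (intro wp_encf) auto
    show ?thesis
     using False f2 i j s(8) E(2)[OF ij] \<open>?e mod m \<le> Z\<close>
    proof (simp add: wp_Seq wp_If, intro wp_conseq[OF en], goal_cases)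
     case (1 s' t)
     have "ar s' X = ar s2 X" using 1 by (simp add: frame_def)
     then show ?case using 1 I2 Z1 P by (simp add: ind_insert)
    qed
   qed
  next
   case 1
   show ?case using f1 s by simp
  next
   case 2
   show ?case using I1 by simp
  next
   case (4 s' t)
   have "?P (Suc i) 0 = ?P i n" using i by (auto simp: pres_def less_Suc_eq)
   then show ?case using 4 I1 f1 by (simp add: algebra_simps)
  qed
 next
  case (4 s' t)
  have "?P n 0 = pres (ar s E) n" by (auto simp: pres_def)
  then show ?case using 4 s by simp
 qed (use s E in \<open>auto simp: ind_empty\<close>)
qed

subsection \<open>Linear transforms by Yates's algorithm\<close>

text \<open>The language has no negative numbers: a constant -k becomes M * k - k, which is
  nonnegative and congruent to it modulo M.\<close>

definition coefe :: "int => exp" where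
 "coefe z = (if z \<ge> 0 then N (nat z) else V vMOD \<^bold>* N (nat (- z)) \<^bold>- N (nat (- z)))"

text \<open>One row f of the small coefficient matrix applied to q entries of layer
  \<open>iz\<close> that are \<open>im\<close> cells apart.\<close>

fun line :: "nat => (nat => int) => nat => exp" where
 "line X f 0 = N 0"
| "line X f (Suc c) = line X f c \<^bold>+ coefe (f c) \<^bold>* Arr X (V iz \<^bold>* V vRL \<^bold>+ N c \<^bold>* V im \<^bold>+ V ix)"

fun putsf :: "nat => (nat => nat => int) => nat => nat => nat => com" where
 "putsf X M p q 0 = Skip"
| "putsf X M p q (Suc r) = putsf X M p q r ;;
   Put X ((V iz \<^bold>+ N 1) \<^bold>* V vRL \<^bold>+ (V ix \<^bold>* N p \<^bold>+ N r)) (line X (M r) q \<^bold>mod V vMOD)"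

text \<open>Every stage writes a layer of its own, layer z starting at z times the value of
  \<open>vRL\<close>. A stage replaces one base-q digit of the index by one base-p digit, so layer z
  has q ^ (l - z) * p ^ z entries; \<open>ik\<close> is the length of the current layer and
  \<open>im\<close> the number of small transforms of the stage.\<close>

definition yatesf :: "nat => (nat => nat => int) => nat => nat => nat => com" where
 "yatesf X M p q v = (ik :=: V v ;; For iz (V vL) (im :=: V ik \<^bold>div N q ;;
   For ix (V im) (putsf X M p q p) ;; ik :=: V im \<^bold>* N p))"

lemma putsf_writes [simp]: "wv (putsf X M p q r) = {}" "wa (putsf X M p q r) = (if r = 0 then {} else {X})" "wio (putsf X M p q r) = False"
 by (induction r) auto

lemma yatesf_writes [simp]: "wv (yatesf X M p q v) = {ik, iz, im, ix}" "a \<noteq> X \<Longrightarrow> a \<notin> wa (yatesf X M p q v)" "wio (yatesf X M p q v) = False"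
 by (auto simp: yatesf_def split: if_splits)

lemma coefe_cong:
 assumes "vr s vMOD = M" "M > 0"
 shows "[int (eval (coefe z) s) = z] (mod int M)"
proof (cases "z \<ge> 0")
 case False
 have "nat (- z) \<le> M * nat (- z)" using assms(2) by simp
 then have "int (eval (coefe z) s) = int M * int (nat (- z)) - int (nat (- z))"
  using False assms(1) by (simp add: coefe_def of_nat_diff)
 also have "\<dots> = z + int M * (- z)" using False by simp
 finally show ?thesis by (simp add: cong_iff_dvd_diff)
qed (simp add: coefe_def)

lemma line_cong:
 assumes "vr s vMOD = M" "M > 0" "vr s iz = z" "vr s vRL = RL" "vr s im = S" "vr s ix = b"
 shows "[int (eval (line X f q) s) = (\<Sum>c<q. f c * int (ar s X (z * RL + c * S + b)))] (mod int M)"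
proof (induction q)
 case (Suc q)
 have "[int (eval (line X f (Suc q)) s) = int (eval (line X f q) s) + int (eval (coefe (f q)) s) * int (ar s X (z * RL + q * S + b))] (mod int M)"
  using assms by (simp add: cong_def)
 also have "[int (eval (line X f q) s) + int (eval (coefe (f q)) s) * int (ar s X (z * RL + q * S + b)) =
   (\<Sum>c<q. f c * int (ar s X (z * RL + c * S + b))) + f q * int (ar s X (z * RL + q * S + b))] (mod int M)"
  by (intro cong_add cong_mult Suc.IH coefe_cong[OF assms(1,2)] cong_refl)
 finally show ?case by simp
qed simp

lemma wp_putsf:
 assumes "vr s vMOD = M" "M > 0" "vr s iz = z" "vr s vRL = RL" "vr s im = S" "vr s ix = b" "M \<le> Z" "b < S" "q * S \<le> RL"
 shows "wp bb Z (putsf X T p q r) s (\<lambda>s' t. (\<forall>r'<r. [int (ar s' X ((z + 1) * RL + (b * p + r'))) =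
   (\<Sum>c<q. T r' c * int (ar s X (z * RL + c * S + b)))] (mod int M)) \<and>
   (\<forall>x. x < (z + 1) * RL + b * p \<longrightarrow> ar s' X x = ar s X x) \<and> t = Suc r)"
proof (induction r)
 case (Suc r)
 show ?case
  unfolding putsf.simps wp_Seq
 proof (rule wp_conseq[OF Suc], goal_cases)
  case (1 s1 t1)
  have f: "vr s1 vMOD = M" "vr s1 iz = z" "vr s1 vRL = RL" "vr s1 im = S" "vr s1 ix = b"
   using 1(2) assms by (simp_all add: frame_def)
  have old: "ar s1 X (z * RL + c * S + b) = ar s X (z * RL + c * S + b)" if "c < q" for c
  proof -
   have "c * S + b < q * S" using that assms(8) by (rule mult_add_less)
   then have "z * RL + c * S + b < (z + 1) * RL + b * p" using assms(9) by (simp add: algebra_simps)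
   then show ?thesis using 1(1) by simp
  qed
  have "[int (eval (line X (T r) q) s1 mod M) = int (eval (line X (T r) q) s1)] (mod int M)"
   by (simp add: cong_def zmod_int)
  also have "[int (eval (line X (T r) q) s1) = (\<Sum>c<q. T r c * int (ar s1 X (z * RL + c * S + b)))] (mod int M)"
   using f assms(2) by (intro line_cong)
  also have "(\<Sum>c<q. T r c * int (ar s1 X (z * RL + c * S + b))) = (\<Sum>c<q. T r c * int (ar s X (z * RL + c * S + b)))"
   by (intro sum.cong refl) (simp add: old)
  finally have v: "[int (eval (line X (T r) q) s1 mod M) = (\<Sum>c<q. T r c * int (ar s X (z * RL + c * S + b)))] (mod int M)" .
  have "eval (line X (T r) q) s1 mod M \<le> Z"
   using mod_less_divisor[OF assms(2), of "eval (line X (T r) q) s1"] assms(7) by linarith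
  then show ?case
   using 1(1) v f by (auto simp: less_Suc_eq)
 qed
qed simp

lemma wp_yatesf:
 assumes s: "vr s vMOD = M" "M > 0" "vr s vRL = RL" "vr s vL = l" "vr s v = q ^ l" "v \<notin> {ik, iz, im, ix}" "M \<le> Z" "l \<le> Z" "RL \<le> Z"
  and pq: "p > 0" "q > 0" and RL: "\<And>z. z \<le> l \<Longrightarrow> q ^ (l - z) * p ^ z \<le> RL"
 shows "wp bb Z (yatesf X T p q v) s (\<lambda>s' t. (\<forall>r<p ^ l. [int (ar s' X (l * RL + r)) =
   (\<Sum>c<q ^ l. kp T p q l r c * int (ar s X c))] (mod int M)) \<and> t \<le> l * (RL * (p + 2) + 5) + 2)"
proof -
 let ?X0 = "\<lambda>c. int (ar s X c)"
 \<comment> \<open>In layer z the z leading input digits c have been transformed into the output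
   digits r, while b collects the input digits still untouched.\<close>
 let ?J = "\<lambda>z s'. \<forall>b<q ^ (l - z). \<forall>r<p ^ z. [int (ar s' X (z * RL + (b * p ^ z + r))) =
   (\<Sum>c<q ^ z. kp T p q z r c * ?X0 (c * q ^ (l - z) + b))] (mod int M)"
 let ?body = "im :=: V ik \<^bold>div N q ;; For ix (V im) (putsf X T p q p) ;; ik :=: V im \<^bold>* N p"
 have loop: "wp bb Z (For iz (V vL) ?body) (set_var ik (q ^ l) s)
   (\<lambda>s' t. ?J l s' \<and> t \<le> l * (RL * (p + 2) + 5) + 1)"
 proof (rule wp_For[where I = "\<lambda>z s' t. z \<le> l \<and> vr s' ik = q ^ (l - z) * p ^ z \<and> ?J z s' \<and> t \<le> z * (RL * (p + 2) + 5)"], goal_cases)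
  case (3 z s1 t1)
  have f1: "vr s1 vMOD = M" "vr s1 vRL = RL" using 3(3) s by (simp_all add: frame_def)
  have z: "z < l" using 3(1) s by simp
  define k where "k = l - Suc z"
  have lz: "l - z = Suc k" using z by (simp add: k_def)
  define S where "S = q ^ k * p ^ z"
  have J: "?J z s1" and t1: "t1 \<le> z * (RL * (p + 2) + 5)" using 3(2) by auto
  have ik: "vr s1 ik = q * S" using 3(2) by (simp add: lz S_def)
  have S: "vr s1 ik div q = S" "q * S \<le> RL" "S * p \<le> RL"
   using ik pq RL[of z] RL[of "Suc z"] z by (auto simp: lz S_def k_def[symmetric] ac_simps)
  have SR: "S \<le> RL" using S(3) pq(1) by (cases p) auto
  let ?s = "set_var im S (set_var iz z s1)"
  have inner: "wp bb Z (For ix (V im) (putsf X T p q p)) ?s (\<lambda>s' t. (\<forall>b<S. \<forall>r<p. [int (ar s' X ((z + 1) * RL + (b * p + r))) =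
    (\<Sum>c<q. T r c * int (ar s1 X (z * RL + c * S + b)))] (mod int M)) \<and> t \<le> S * (p + 2) + 1)"
  proof (rule wp_For[where I = "\<lambda>i s' t. (\<forall>b<i. \<forall>r<p. [int (ar s' X ((z + 1) * RL + (b * p + r))) =
    (\<Sum>c<q. T r c * int (ar s1 X (z * RL + c * S + b)))] (mod int M)) \<and> (\<forall>x<(z + 1) * RL. ar s' X x = ar s1 X x) \<and> t \<le> i * (p + 2)"], goal_cases)
   case (3 b s2 t2)
   have f2: "vr s2 vMOD = M" "vr s2 vRL = RL" "vr s2 iz = z" "vr s2 im = S"
    using 3(3) f1 by (simp_all add: frame_def)
   have b: "b < S" using 3(1) by simp
   have old: "ar s2 X (z * RL + c * S + b) = ar s1 X (z * RL + c * S + b)" if "c < q" for c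
   proof -
    have "c * S + b < q * S" using that b by (rule mult_add_less)
    then have "z * RL + c * S + b < (z + 1) * RL" using S(2) by (simp add: algebra_simps)
    then show ?thesis using 3(2) by simp
   qed
   have I2: "\<And>b' r. b' < b \<Longrightarrow> r < p \<Longrightarrow> [int (ar s2 X ((z + 1) * RL + (b' * p + r))) =
     (\<Sum>c<q. T r c * int (ar s1 X (z * RL + c * S + b')))] (mod int M)"
    "\<And>x. x < (z + 1) * RL \<Longrightarrow> ar s2 X x = ar s1 X x" "t2 \<le> b * (p + 2)"
    using 3(2) by auto
   have "wp bb Z (putsf X T p q p) (set_var ix b s2) (\<lambda>s' t. (\<forall>r'<p. [int (ar s' X ((z + 1) * RL + (b * p + r'))) =
     (\<Sum>c<q. T r' c * int (ar s2 X (z * RL + c * S + b)))] (mod int M)) \<and>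
     (\<forall>x. x < (z + 1) * RL + b * p \<longrightarrow> ar s' X x = ar s2 X x) \<and> t = Suc p)"
    using wp_putsf[of "set_var ix b s2" M z RL S b Z q bb X T p p] f2 s b S by simp
   then show ?case
   proof (rule wp_conseq, goal_cases)
    case (1 s' t)
    have new: "\<And>r. r < p \<Longrightarrow> [int (ar s' X ((z + 1) * RL + (b * p + r))) =
      (\<Sum>c<q. T r c * int (ar s1 X (z * RL + c * S + b)))] (mod int M)"
    proof -
     fix r assume "r < p"
     then have "[int (ar s' X ((z + 1) * RL + (b * p + r))) = (\<Sum>c<q. T r c * int (ar s2 X (z * RL + c * S + b)))] (mod int M)"
      using 1(1) by blast
     also have "(\<Sum>c<q. T r c * int (ar s2 X (z * RL + c * S + b))) = (\<Sum>c<q. T r c * int (ar s1 X (z * RL + c * S + b)))"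
      by (intro sum.cong refl) (simp add: old)
     finally show "[int (ar s' X ((z + 1) * RL + (b * p + r))) = (\<Sum>c<q. T r c * int (ar s1 X (z * RL + c * S + b)))] (mod int M)" .
    qed
    have keep: "ar s' X ((z + 1) * RL + (b' * p + r)) = ar s2 X ((z + 1) * RL + (b' * p + r))" if "b' < b" "r < p" for b' r
    proof -
     have "b' * p + r < b * p" using that by (rule mult_add_less)
     then show ?thesis using 1(1) by simp
    qed
    show ?case
    proof (intro conjI allI impI)
     fix b' r assume b': "b' < Suc b" and r: "r < p"
     show "[int (ar s' X ((z + 1) * RL + (b' * p + r))) = (\<Sum>c<q. T r c * int (ar s1 X (z * RL + c * S + b')))] (mod int M)"
     proof (cases "b' = b")
      case False
      then have "b' < b" using b' by simp
      then show ?thesis using I2(1)[OF _ r] keep[OF _ r] by simp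
     qed (simp only: new[OF r])
    next
     fix x assume "x < (z + 1) * RL"
     then show "ar s' X x = ar s1 X x" using 1(1) I2(2) by simp
    next
     show "t2 + t + 1 \<le> Suc b * (p + 2)" using 1(1) I2(3) by simp
    qed
   qed
  qed (use SR s(9) in auto)
  have Jn: "?J (Suc z) s'" if new: "\<forall>b<S. \<forall>r<p. [int (ar s' X ((z + 1) * RL + (b * p + r))) =
    (\<Sum>c<q. T r c * int (ar s1 X (z * RL + c * S + b)))] (mod int M)" for s'
  proof (intro allI impI)
   fix b r assume b: "b < q ^ (l - Suc z)" and r: "r < p ^ Suc z"
   \<comment> \<open>The remaining input digits b and the z output digits r div p form a passive
     index; the stage transforms only the leading untouched digit, into r mod p.\<close>
   define b1 where "b1 = b * p ^ z + r div p"
   have rd: "r div p < p ^ z" using r by (simp add: less_mult_imp_div_less mult.commute)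
   have b1: "b1 < S" unfolding b1_def S_def using b rd k_def by (intro mult_add_less) auto
   have idx: "b * p ^ Suc z + r = b1 * p + r mod p"
    unfolding b1_def by (simp add: algebra_simps)
   have "[int (ar s' X (Suc z * RL + (b * p ^ Suc z + r))) = (\<Sum>c<q. T (r mod p) c * int (ar s1 X (z * RL + c * S + b1)))] (mod int M)"
    unfolding idx using new b1 pq(1) by simp
   also have "[(\<Sum>c<q. T (r mod p) c * int (ar s1 X (z * RL + c * S + b1))) =
     (\<Sum>c<q. T (r mod p) c * (\<Sum>c'<q ^ z. kp T p q z (r div p) c' * ?X0 (c' * q ^ Suc k + (c * q ^ k + b))))] (mod int M)"
   proof (intro cong_sum cong_mult cong_refl)
    fix c assume "c \<in> {..<q}"
    then have c: "c < q" by simp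
    have cb: "c * q ^ k + b < q ^ (l - z)" unfolding lz power_Suc
     by (rule mult_add_less[OF c]) (use b in \<open>simp add: k_def\<close>)
    have "z * RL + c * S + b1 = z * RL + ((c * q ^ k + b) * p ^ z + r div p)"
     unfolding b1_def S_def by (simp add: algebra_simps)
    then show "[int (ar s1 X (z * RL + c * S + b1)) = (\<Sum>c'<q ^ z. kp T p q z (r div p) c' * ?X0 (c' * q ^ Suc k + (c * q ^ k + b)))] (mod int M)"
     using J[rule_format, OF cb rd] unfolding lz by (simp only:)
   qed
   also have "(\<Sum>c<q. T (r mod p) c * (\<Sum>c'<q ^ z. kp T p q z (r div p) c' * ?X0 (c' * q ^ Suc k + (c * q ^ k + b)))) =
     (\<Sum>c'<q ^ z. \<Sum>c<q. kp T p q (Suc z) r (c' * q + c) * ?X0 ((c' * q + c) * q ^ k + b))"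
    unfolding sum_distrib_left by (subst sum.swap, intro sum.cong refl) (simp add: algebra_simps)
   also have "\<dots> = (\<Sum>c<q ^ z * q. kp T p q (Suc z) r c * ?X0 (c * q ^ k + b))"
    by (rule sum_lessThan_times[symmetric])
   finally show "[int (ar s' X (Suc z * RL + (b * p ^ Suc z + r))) =
     (\<Sum>c<q ^ Suc z. kp T p q (Suc z) r c * ?X0 (c * q ^ (l - Suc z) + b))] (mod int M)"
    by (simp add: k_def[symmetric] mult.commute)
  qed
  have SZ: "S \<le> Z" "S * p \<le> Z" using SR S s(9) by auto
  have tt: "S * (p + 2) \<le> RL * (p + 2)" using SR by (rule mult_le_mono1)
  show ?case
   unfolding wp_Seq wp_simps
  proof (intro conjI, goal_cases)
   case 2
   have e: "eval (V ik \<^bold>div N q) (set_var iz z s1) = S" using S by simp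
   show ?case
    unfolding e
   proof (rule wp_conseq[OF inner], goal_cases)
    case (1 s' t)
    have "vr s' im = S" using 1(2) by (simp add: frame_def)
    moreover have "?J (Suc z) (set_var ik (S * p) s')" using Jn[of s'] 1(1) by simp
    ultimately show ?case
     using 1(1) SZ t1 tt z by (simp add: S_def k_def)
   qed
  qed (use S SZ in simp)
 next
  case 2
  show ?case by (simp add: cong_def)
 qed (use s in \<open>auto\<close>)
 have qZ: "q ^ l \<le> Z" using RL[of 0] s(9) by simp
 show ?thesis
  unfolding yatesf_def wp_Seq wp_simps
 proof (intro conjI, goal_cases)
  case 2
  have e: "eval (V v) s = q ^ l" using s by simp
  show ?case unfolding e by (rule wp_conseq[OF loop]) auto
 qed (use s qZ in simp)
qed

subsection \<open>Counting the triangles modulo the chosen modulus\<close>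

definition pointf :: com where
 "pointf = For ix (V vRL) (Put aXC (V ix)
   ((Arr aXA (V vL \<^bold>* V vRL \<^bold>+ V ix) \<^bold>* Arr aXB (V vL \<^bold>* V vRL \<^bold>+ V ix)) \<^bold>mod V vMOD))"

lemma pointf_writes [simp]: "wv pointf = {ix}" "wa pointf = {aXC}" "wio pointf = False"
 by (auto simp: pointf_def)

lemma wp_pointf:
 assumes "vr s vRL = RL" "vr s vL = l" "vr s vMOD = M" "M > 0" "M \<le> Z" "RL \<le> Z"
 shows "wp bb Z pointf s (\<lambda>s' t. (\<forall>r<RL. ar s' aXC r = ar s aXA (l * RL + r) * ar s aXB (l * RL + r) mod M) \<and> t \<le> 2 * RL + 1)"
 unfolding pointf_def
proof (rule wp_For[where I = "\<lambda>i s' t. (\<forall>r<i. ar s' aXC r = ar s aXA (l * RL + r) * ar s aXB (l * RL + r) mod M) \<and> t \<le> 2 * i"], goal_cases)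
 case (3 i s' t)
 have f: "vr s' vRL = RL" "vr s' vL = l" "vr s' vMOD = M" "ar s' aXA = ar s aXA" "ar s' aXB = ar s aXB"
  using 3(3) assms by (simp_all add: frame_def)
 have "x mod M \<le> Z" for x using mod_less_divisor[OF assms(4), of x] assms(5) by linarith
 then show ?case using f 3(2) by (auto simp: less_Suc_eq)
qed (use assms in auto)

definition cellf :: "nat => nat => com" where
 "cellf n0 K = (ih :=: Arr aC (V ix \<^bold>* V vN \<^bold>+ V iy) ;;
   If (V ih) (If ((V ig \<^bold>+ V ih) \<^bold>mod V vM \<^bold>= V vS \<^bold>mod V vM)
    (ia :=: V ix ;; ib :=: V iy ;; ic :=: V iz ;; encf n0 (2 * K - 1) ;;
    Put aOut (V ix \<^bold>* V vN \<^bold>+ V iy)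
     ((Arr aOut (V ix \<^bold>* V vN \<^bold>+ V iy) \<^bold>+ Arr aXC (V vL \<^bold>* V vRL \<^bold>+ V ie)) \<^bold>mod V vMOD)) Skip) Skip)"

text \<open>A coefficient is added to the count of a cell if the exponent e together with the entry
  of C has the right residue. The loop over e is the outer one, so \<open>sg\<close> is evaluated
  once per exponent vector.\<close>

definition extractf :: "nat => nat => com" where
 "extractf n0 K = For iz (V vPC) (sgf K ;; For ix (V vN) (For iy (V vN) (cellf n0 K)))"

lemma cellf_writes [simp]: "wv (cellf n0 K) = {ih, ie, id1, il, ia, ib, ic}" "wa (cellf n0 K) = {aOut}" "wio (cellf n0 K) = False"
 by (auto simp: cellf_def)

lemma extractf_writes [simp]: "wv (extractf n0 K) = {iz, ix, iy, ig, ih, ie, id1, il, ia, ib, ic}"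
 "wa (extractf n0 K) = {aOut}" "wio (extractf n0 K) = False"
 by (auto simp: extractf_def)

lemma idx_eq: "j < n \<Longrightarrow> j' < n \<Longrightarrow> i * n + j = i' * n + j' \<longleftrightarrow> i = i' \<and> j = j'" for i j n :: nat
 by (metis add.commute add_left_cancel div_less div_mult_self1 add_0_left not_less_zero mult.commute)

definition cterm :: "nat => nat => nat => nat => nat => (nat => nat) => nat => (nat => nat) => nat => nat => nat => int" where
 "cterm n0 K l m S C n X e i j = (if C (i * n + j) \<noteq> 0 \<and> (sg K l e + C (i * n + j)) mod m = S mod m
   then int (X (enc n0 (2 * K - 1) l i j e)) else 0)"

lemma wp_cellf:
 assumes s: "vr s vN = n" "vr s vL = l" "vr s vM = m" "vr s vS = S" "vr s vMOD = M" "vr s vRL = RL" "M > 0" "M \<le> Z"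
  "vr s ix = i" "vr s iy = j" "vr s iz = e" "vr s ig = sg K l e" "i < n" "j < n" "e \<le> Z" "n \<le> Z" "l \<le> Z"
  and k: "n0 > 0" "K > 0" "(n0 * n0 * (2 * K - 1)) ^ l \<le> Z" and C: "\<And>x. x < n * n \<Longrightarrow> ar s aC x \<le> Z"
 shows "wp bb Z (cellf n0 K) s (\<lambda>s' t. \<exists>v. ar s' aOut = (ar s aOut)(i * n + j := v) \<and>
   [int v = int (ar s aOut (i * n + j)) + cterm n0 K l m S (ar s aC) n (\<lambda>x. ar s aXC (l * RL + x)) e i j] (mod int M) \<and> t \<le> 6 * l + 10)"
proof -
 let ?c = "ar s aC (i * n + j)"
 have ij: "i * n + j < n * n" using s by (intro mult_add_less)
 show ?thesis
 proof (cases "?c \<noteq> 0 \<and> (sg K l e + ?c) mod m = S mod m")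
  case False
  then show ?thesis
   using s C[OF ij] by (auto simp: cellf_def wp_Seq wp_If cterm_def intro!: exI[of _ "ar s aOut (i * n + j)"])
 next
  case True
  let ?s = "set_var ic e (set_var ib j (set_var ia i (set_var ih ?c s)))"
  have en: "wp bb Z (encf n0 (2 * K - 1)) ?s (\<lambda>s' t. vr s' ie = enc n0 (2 * K - 1) l i j e \<and> t \<le> 6 * l + 3)"
   using s k by (intro wp_encf) auto
  let ?v = "(ar s aOut (i * n + j) + ar s aXC (l * RL + enc n0 (2 * K - 1) l i j e)) mod M"
  have vZ: "?v \<le> Z" using mod_less_divisor[OF s(7)] s(8) by (meson less_imp_le order.trans)
  have "[int ?v = int (ar s aOut (i * n + j)) + cterm n0 K l m S (ar s aC) n (\<lambda>x. ar s aXC (l * RL + x)) e i j] (mod int M)"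
   using True by (simp add: cterm_def cong_def zmod_int)
  note v = this
  show ?thesis
   unfolding cellf_def using True s C[OF ij]
  proof (simp add: wp_Seq wp_If, intro wp_conseq[OF en[unfolded One_nat_def]], goal_cases)
   case (1 s' t)
   have f: "vr s' vN = n" "vr s' vL = l" "vr s' vRL = RL" "vr s' vMOD = M" "vr s' ix = i" "vr s' iy = j"
    "ar s' aOut = ar s aOut" "ar s' aXC = ar s aXC"
    using 1 s by (simp_all add: frame_def)
   show ?case
    using f 1 vZ v by (auto intro!: exI[of _ "?v"])
  qed
 qed
qed

lemma wp_extractf:
 assumes s: "vr s vN = n" "vr s vL = l" "vr s vM = m" "vr s vS = S" "vr s vMOD = M" "vr s vRL = RL" "vr s vPC = (2 * K - 1) ^ l" "M > 0" "M \<le> Z"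
  "n \<le> Z" "l \<le> Z" "ar s aOut = (\<lambda>_. 0)"
  and k: "n0 > 0" "K > 0" "(n0 * n0 * (2 * K - 1)) ^ l \<le> Z" "(2 * K - 1) ^ l \<le> Z" "2 * K ^ l \<le> Z"
  and C: "\<And>x. x < n * n \<Longrightarrow> ar s aC x \<le> Z"
 shows "wp bb Z (extractf n0 K) s (\<lambda>s' t. (\<forall>i<n. \<forall>j<n. [int (ar s' aOut (i * n + j)) =
   (\<Sum>e<(2 * K - 1) ^ l. cterm n0 K l m S (ar s aC) n (\<lambda>x. ar s aXC (l * RL + x)) e i j)] (mod int M)) \<and>
   t \<le> (2 * K - 1) ^ l * (n * (n * (6 * l + 11) + 2) + 4 * l + 6) + 1)"
proof -
 let ?g = "cterm n0 K l m S (ar s aC) n (\<lambda>x. ar s aXC (l * RL + x))"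
 let ?T = "n * (n * (6 * l + 11) + 2) + 4 * l + 6"
 show ?thesis
  unfolding extractf_def
 proof (rule wp_For[where I = "\<lambda>e s' t. (\<forall>i<n. \<forall>j<n. [int (ar s' aOut (i * n + j)) = (\<Sum>e<e. ?g e i j)] (mod int M)) \<and> t \<le> e * ?T"], goal_cases)
  case (3 e s1 t1)
  have f1: "vr s1 vN = n" "vr s1 vL = l" "vr s1 vM = m" "vr s1 vS = S" "vr s1 vMOD = M" "vr s1 vRL = RL"
   "ar s1 aC = ar s aC" "ar s1 aXC = ar s aXC" using 3(3) s by (simp_all add: frame_def)
  have e: "e < (2 * K - 1) ^ l" using 3(1) s by simp
  then have eZ: "e \<le> Z" using k by linarith
  have I1: "\<And>i j. i < n \<Longrightarrow> j < n \<Longrightarrow> [int (ar s1 aOut (i * n + j)) = (\<Sum>e<e. ?g e i j)] (mod int M)" "t1 \<le> e * ?T" using 3(2) by auto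
  have sgw: "wp bb Z (sgf K) (set_var iz e s1) (\<lambda>s' t. vr s' ig = sg K l e \<and> t \<le> 4 * l + 4)"
   using f1 s k eZ by (intro wp_sgf) auto
  show ?case
   unfolding wp_Seq
  proof (rule wp_conseq[OF sgw], goal_cases)
   case (1 s2 t2)
   have f2: "vr s2 vN = n" "vr s2 vL = l" "vr s2 vM = m" "vr s2 vS = S" "vr s2 vMOD = M" "vr s2 vRL = RL" "vr s2 iz = e" "vr s2 ig = sg K l e"
    "ar s2 aC = ar s aC" "ar s2 aXC = ar s aXC" "ar s2 aOut = ar s1 aOut" "t2 \<le> 4 * l + 4" using 1 f1 by (simp_all add: frame_def)
   let ?J = "\<lambda>i j s'. \<forall>i'<n. \<forall>j'<n. [int (ar s' aOut (i' * n + j')) = int (ar s1 aOut (i' * n + j')) +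
    (if i' < i \<or> i' = i \<and> j' < j then ?g e i' j' else 0)] (mod int M)"
   have lp: "wp bb Z (For ix (V vN) (For iy (V vN) (cellf n0 K))) s2 (\<lambda>s' t. ?J n 0 s' \<and> t \<le> n * (n * (6 * l + 11) + 2) + 1)"
   proof (rule wp_For[where I = "\<lambda>i s' t. ?J i 0 s' \<and> t \<le> i * (n * (6 * l + 11) + 2)"], goal_cases)
    case (3 i s3 t3)
    have f3: "vr s3 vN = n" "vr s3 vL = l" "vr s3 vM = m" "vr s3 vS = S" "vr s3 vMOD = M" "vr s3 vRL = RL" "vr s3 iz = e" "vr s3 ig = sg K l e"
     "ar s3 aC = ar s aC" "ar s3 aXC = ar s aXC" using 3(3) f2 by (simp_all add: frame_def)
    have i: "i < n" using 3(1) f2 by simp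
    note I3 = 3(2)
    show ?case
    proof (rule wp_For[where I = "\<lambda>j s' t. ?J i j s' \<and> t \<le> j * (6 * l + 11)"], goal_cases)
     case (3 j s4 t4)
     have f4: "vr s4 vN = n" "vr s4 vL = l" "vr s4 vM = m" "vr s4 vS = S" "vr s4 vMOD = M" "vr s4 vRL = RL" "vr s4 iz = e" "vr s4 ig = sg K l e"
      "vr s4 ix = i" "ar s4 aC = ar s aC" "ar s4 aXC = ar s aXC" using 3(3) f3 by (simp_all add: frame_def)
     have j: "j < n" using 3(1) f3 by simp
     note I4 = 3(2)
     have "wp bb Z (cellf n0 K) (set_var iy j s4) (\<lambda>s' t. \<exists>v. ar s' aOut = (ar s4 aOut)(i * n + j := v) \<and>
       [int v = int (ar s4 aOut (i * n + j)) + ?g e i j] (mod int M) \<and> t \<le> 6 * l + 10)"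
      using wp_cellf[of "set_var iy j s4" n l m S M RL Z i j e K n0 bb] f4 s k C i j eZ by simp
     then show ?case
     proof (rule wp_conseq, goal_cases)
      case (1 s5 t5)
      then obtain v where v: "ar s5 aOut = (ar s4 aOut)(i * n + j := v)" "[int v = int (ar s4 aOut (i * n + j)) + ?g e i j] (mod int M)" "t5 \<le> 6 * l + 10" by auto
      show ?case
      proof (intro conjI allI impI)
       fix i' j' assume ij': "i' < n" "j' < n"
       show "[int (ar s5 aOut (i' * n + j')) = int (ar s1 aOut (i' * n + j')) + (if i' < i \<or> i' = i \<and> j' < Suc j then ?g e i' j' else 0)] (mod int M)"
       proof (cases "i' = i \<and> j' = j")
        case True
        have "[int (ar s4 aOut (i * n + j)) + ?g e i j = int (ar s1 aOut (i * n + j)) + 0 + ?g e i j] (mod int M)"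
         using conjunct1[OF I4, rule_format, OF i j] by (intro cong_add cong_refl) simp
        then show ?thesis using v True by (auto intro: cong_trans)
       next
        case False
        then have "i' * n + j' \<noteq> i * n + j" using idx_eq[OF ij'(2) j, of i' i] by simp
        moreover have "(i' < i \<or> i' = i \<and> j' < Suc j) \<longleftrightarrow> (i' < i \<or> i' = i \<and> j' < j)" using False by auto
        ultimately show ?thesis using v I4 ij' by simp
       qed
      next
       show "t4 + t5 + 1 \<le> Suc j * (6 * l + 11)" using v I4 by simp
      qed
     qed
    next
     case (4 s' t)
     have "(i' < Suc i \<or> i' = Suc i \<and> j' < 0) \<longleftrightarrow> (i' < i \<or> i' = i \<and> j' < n)" if "j' < n" for i' j' using that by auto
     then show ?case using 4 I3 f3 by simp
    qed (use f3 s I3 in auto)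
   qed (use f2 s in auto)
   show ?case
   proof (rule wp_conseq[OF lp], goal_cases)
    case (1 s' t)
    have "[int (ar s' aOut (i * n + j)) = (\<Sum>e<Suc e. ?g e i j)] (mod int M)" if "i < n" "j < n" for i j
    proof -
     have "[int (ar s' aOut (i * n + j)) = int (ar s1 aOut (i * n + j)) + ?g e i j] (mod int M)"
      using 1(1) that by simp
     also have "[int (ar s1 aOut (i * n + j)) + ?g e i j = (\<Sum>e<e. ?g e i j) + ?g e i j] (mod int M)"
      using I1(1)[OF that] by (intro cong_add cong_refl)
     finally show ?thesis by simp
    qed
    then show ?case using 1(1) f2(12) I1(2) by simp
   qed
  qed
 qed (use s k in auto)
qed

definition mmf :: "nat => nat => nat => (nat => nat => int) => (nat => nat => int) => (nat => nat => int) => com" where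
 "mmf n0 K R al be ga = (buildf n0 K aA aXA ;; buildf n0 K aB aXB ;;
   yatesf aXA al R (n0 * n0 * K) vqL ;; yatesf aXB be R (n0 * n0 * K) vqL ;; pointf ;;
   yatesf aXC ga (n0 * n0 * (2 * K - 1)) R vRL ;; extractf n0 K)"

lemma mmf_writes:
 "wv (mmf n0 K R al be ga) \<subseteq> {ix, iy, iz, ig, ih, ie, id1, il, ia, ib, ic, ik, im}"
 "wa (mmf n0 K R al be ga) \<subseteq> {aXA, aXB, aXC, aOut}" "wio (mmf n0 K R al be ga) = False"
 using yatesf_writes(2) by (auto simp: mmf_def)

lemma frame_yatesf:
 assumes "frame (yatesf X M p q v) s s'"
 shows "u \<notin> {ik, iz, im, ix} \<Longrightarrow> vr s' u = vr s u" "a \<noteq> X \<Longrightarrow> ar s' a = ar s a" "io s' = io s"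
 using assms by (auto simp: frame_def)

text \<open>The transforms are needed only modulo M, so coefficients may be negative and stored
  words stay below M. The outcome counts all triangles that are exact modulo m, each with weight D ^
  l. Only the entries of A and B are reduced to exponents below K ^ l.\<close>

lemma wp_mmf:
 assumes ta: "tensor_alg (n0 * n0 * K) (n0 * n0 * (2 * K - 1)) R (int D) al be ga (tbase n0 K)"
  and s: "vr s vN = n" "vr s vL = l" "vr s vM = m" "vr s vS = S" "vr s vMOD = M" "vr s vRL = R ^ l" "vr s vPC = (2 * K - 1) ^ l"
   "vr s vqL = (n0 * n0 * K) ^ l" "ar s aXA = (\<lambda>_. 0)" "ar s aXB = (\<lambda>_. 0)" "ar s aOut = (\<lambda>_. 0)"
  and Z: "M \<le> Z" "n \<le> Z" "l \<le> Z" "R ^ l \<le> Z" "2 * K ^ l \<le> Z" "\<And>a x. a \<in> {aA, aB, aC} \<Longrightarrow> x < n * n \<Longrightarrow> ar s a x \<le> Z"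
  and k: "n0 > 0" "K > 0" "n0 * n0 * (2 * K - 1) \<le> R" "M > 0" "m > 0" "m \<le> K ^ l" "n \<le> n0 ^ l"
 shows "wp bb Z (mmf n0 K R al be ga) s (\<lambda>s' t. (\<forall>i<n. \<forall>j<n. [int (ar s' aOut (i * n + j)) =
   int (D ^ l) * (if ar s aC (i * n + j) = 0 then 0 else int (card {k. k < n \<and> (ar s aA (i * n + k) \<noteq> 0 \<and> ar s aB (k * n + j) \<noteq> 0) \<and>
    (ar s aA (i * n + k) mod m + ar s aB (k * n + j) mod m + ar s aC (i * n + j)) mod m = S mod m}))] (mod int M)) \<and>
   t \<le> 2 * (n * (n * (6 * l + 10) + 2)) + 3 * (l * (R ^ l * (R + 2) + 5)) + 2 * R ^ l +
    (2 * K - 1) ^ l * (n * (n * (6 * l + 11) + 2) + 4 * l + 6) + 10)"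
proof -
 let ?q = "n0 * n0 * K" and ?p = "n0 * n0 * (2 * K - 1)" and ?RL = "R ^ l"
 have b: "2 * K - 1 > 0" using k by simp
 have p0: "?p > 0" "?q > 0" using k b by simp_all
 have "K \<le> 2 * K - 1" using k by simp
 then have qp: "?q \<le> ?p" by (rule mult_le_mono2)
 then have qR: "?q \<le> R" using k by linarith
 have R0: "R > 0" using p0 k by linarith
 \<comment> \<open>Every layer of each transform fits into R ^ l cells, as both digit bases are at
   most R.\<close>
 have pw: "x ^ (l - z) * y ^ z \<le> ?RL" if "x \<le> R" "y \<le> R" "z \<le> l" for x y z
 proof -
  have "x ^ (l - z) * y ^ z \<le> R ^ (l - z) * R ^ z" using that by (intro mult_le_mono power_mono) auto
  also have "\<dots> = ?RL" using that by (simp add: power_add[symmetric])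
  finally show ?thesis .
 qed
 have qlZ: "?q ^ l \<le> Z" using power_mono[OF qR, of l] Z by simp
 have plZ: "?p ^ l \<le> Z" using power_mono[OF k(3), of l] Z by simp
 have "2 * K - 1 \<le> ?p" using k by (metis mult_le_mono1 nat_mult_1 Suc_leI One_nat_def nat_0_less_mult_iff)
 then have PZ: "(2 * K - 1) ^ l \<le> Z" using power_mono[of "2 * K - 1" ?p l] plZ by linarith
 have mZ: "m \<le> Z" using k Z by linarith
 let ?fa = "\<lambda>i k. ar s aA (i * n + k) mod m" and ?fb = "\<lambda>i k. ar s aB (i * n + k) mod m"
 let ?PA = "pres (ar s aA) n" and ?PB = "pres (ar s aB) n"
 let ?TA = "\<lambda>r. \<Sum>x<?q ^ l. kp al R ?q l r x * int (ind n0 K l ?PA ?fa x)"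
 let ?TB = "\<lambda>r. \<Sum>x<?q ^ l. kp be R ?q l r x * int (ind n0 K l ?PB ?fb x)"
 show ?thesis
  unfolding mmf_def wp_Seq
 proof (rule wp_conseq[OF wp_buildf[of s n l m]], goal_cases)
  case (14 s1 t1)
  note g = s Z k
  have f1: "vr s1 vN = n" "vr s1 vL = l" "vr s1 vM = m" "vr s1 vS = S" "vr s1 vMOD = M" "vr s1 vRL = R ^ l" "vr s1 vPC = (2 * K - 1) ^ l"
   "vr s1 vqL = ?q ^ l" "ar s1 aXA = ind n0 K l ?PA ?fa" "ar s1 aXB = (\<lambda>_. 0)" "ar s1 aOut = (\<lambda>_. 0)"
   "ar s1 aA = ar s aA" "ar s1 aB = ar s aB" "ar s1 aC = ar s aC" "t1 \<le> n * (n * (6 * l + 10) + 2) + 1"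
   using 14 s by (simp_all add: frame_def)
  show ?case
  proof (rule wp_conseq[OF wp_buildf[of s1 n l m]], goal_cases)
   case (14 s2 t2)
   have f2: "vr s2 vN = n" "vr s2 vL = l" "vr s2 vM = m" "vr s2 vS = S" "vr s2 vMOD = M" "vr s2 vRL = R ^ l" "vr s2 vPC = (2 * K - 1) ^ l"
    "vr s2 vqL = ?q ^ l" "ar s2 aXA = ind n0 K l ?PA ?fa" "ar s2 aXB = ind n0 K l ?PB ?fb" "ar s2 aOut = (\<lambda>_. 0)"
    "ar s2 aC = ar s aC" "t2 \<le> n * (n * (6 * l + 10) + 2) + 1"
    using 14 f1 by (simp_all add: frame_def)
   show ?case
   proof (rule wp_conseq[OF wp_yatesf[of s2 M ?RL l vqL ?q Z R]], goal_cases)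
    case (13 s3 t3)
    note fr = frame_yatesf[OF 13(2)]
    have f3: "vr s3 vN = n" "vr s3 vL = l" "vr s3 vM = m" "vr s3 vS = S" "vr s3 vMOD = M" "vr s3 vRL = R ^ l" "vr s3 vPC = (2 * K - 1) ^ l"
     "vr s3 vqL = ?q ^ l" "ar s3 aXB = ind n0 K l ?PB ?fb" "ar s3 aOut = (\<lambda>_. 0)" "ar s3 aC = ar s aC" "t3 \<le> l * (?RL * (R + 2) + 5) + 2"
     using 13(1) f2 fr by simp_all
    have XA: "\<And>r. r < ?RL \<Longrightarrow> [int (ar s3 aXA (l * ?RL + r)) = ?TA r] (mod int M)"
     using 13(1) f2 by simp
    show ?case
    proof (rule wp_conseq[OF wp_yatesf[of s3 M ?RL l vqL ?q Z R]], goal_cases)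
     case (13 s4 t4)
     note fr = frame_yatesf[OF 13(2)]
     have f4: "vr s4 vN = n" "vr s4 vL = l" "vr s4 vM = m" "vr s4 vS = S" "vr s4 vMOD = M" "vr s4 vRL = R ^ l" "vr s4 vPC = (2 * K - 1) ^ l"
      "ar s4 aXA = ar s3 aXA" "ar s4 aOut = (\<lambda>_. 0)" "ar s4 aC = ar s aC" "t4 \<le> l * (?RL * (R + 2) + 5) + 2"
      using 13(1) f3 fr by simp_all
     have XB: "\<And>r. r < ?RL \<Longrightarrow> [int (ar s4 aXB (l * ?RL + r)) = ?TB r] (mod int M)"
      using 13(1) f3 by simp
     show ?case
     proof (rule wp_conseq[OF wp_pointf[of s4 ?RL l M]], goal_cases)
      case (7 s5 t5)
      have f5: "vr s5 vN = n" "vr s5 vL = l" "vr s5 vM = m" "vr s5 vS = S" "vr s5 vMOD = M" "vr s5 vRL = R ^ l" "vr s5 vPC = (2 * K - 1) ^ l"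
       "ar s5 aOut = (\<lambda>_. 0)" "ar s5 aC = ar s aC" "t5 \<le> 2 * ?RL + 1"
       using 7 f4 by (simp_all add: frame_def)
      have XC: "[int (ar s5 aXC r) = ?TA r * ?TB r] (mod int M)" if "r < ?RL" for r
      proof -
       have "[int (ar s5 aXC r) = int (ar s4 aXA (l * ?RL + r)) * int (ar s4 aXB (l * ?RL + r))] (mod int M)"
        using 7(1) that by (simp add: cong_def zmod_int)
       also have "[int (ar s4 aXA (l * ?RL + r)) * int (ar s4 aXB (l * ?RL + r)) = ?TA r * ?TB r] (mod int M)"
        using XA[OF that] XB[OF that] f4(8) by (intro cong_mult) auto
       finally show ?thesis .
      qed
      show ?case
      proof (rule wp_conseq[OF wp_yatesf[of s5 M ?RL l vRL R Z ?p]], goal_cases)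
       case (13 s6 t6)
       note fr = frame_yatesf[OF 13(2)]
       have f6: "vr s6 vN = n" "vr s6 vL = l" "vr s6 vM = m" "vr s6 vS = S" "vr s6 vMOD = M" "vr s6 vRL = R ^ l" "vr s6 vPC = (2 * K - 1) ^ l"
        "ar s6 aOut = (\<lambda>_. 0)" "ar s6 aC = ar s aC"
        using f5 fr by simp_all
       have "l * (?RL * (?p + 2) + 5) \<le> l * (?RL * (R + 2) + 5)"
        using k(3) by (intro mult_le_mono2 add_le_mono1) auto
       then have t6: "t6 \<le> l * (?RL * (R + 2) + 5) + 2" using 13(1) by linarith
       have X6: "[int (ar s6 aXC (l * ?RL + enc n0 (2 * K - 1) l i j e)) = int D ^ l *
         int (card {k. k < n \<and> (i, k) \<in> ?PA \<and> (k, j) \<in> ?PB \<and> e = dsum K l (?fa i k) (?fb k j)})] (mod int M)"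
        if ij: "i < n" "j < n" and e: "e < (2 * K - 1) ^ l" for i j e
       proof -
        let ?z = "enc n0 (2 * K - 1) l i j e"
        have "?z < ?p ^ l" by (rule enc_less[OF k(1) b])
        then have "[int (ar s6 aXC (l * ?RL + ?z)) = (\<Sum>r<?RL. kp ga ?p R l ?z r * int (ar s5 aXC r))] (mod int M)"
         using 13(1) by simp
        also have "[(\<Sum>r<?RL. kp ga ?p R l ?z r * int (ar s5 aXC r)) = (\<Sum>r<?RL. kp ga ?p R l ?z r * (?TA r * ?TB r))] (mod int M)"
         by (intro cong_sum cong_mult cong_refl XC) simp
        also have "(\<Sum>r<?RL. kp ga ?p R l ?z r * (?TA r * ?TB r)) = int D ^ l *
         int (card {k. k < n \<and> (i, k) \<in> ?PA \<and> (k, j) \<in> ?PB \<and> e = dsum K l (?fa i k) (?fb k j)})"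
         by (rule tensor_count[OF ta k(1,2) _ _ k(7) ij e]) (auto simp: pres_def)
        finally show ?thesis .
       qed
       show ?case
       proof (rule wp_conseq[OF wp_extractf[of s6 n l m S M ?RL K]], goal_cases)
        case (19 s7 t7)
        have "[int (ar s7 aOut (i * n + j)) =
          int (D ^ l) * (if ar s aC (i * n + j) = 0 then 0 else int (card {k. k < n \<and> (ar s aA (i * n + k) \<noteq> 0 \<and> ar s aB (k * n + j) \<noteq> 0) \<and>
           (?fa i k + ?fb k j + ar s aC (i * n + j)) mod m = S mod m}))] (mod int M)" if ij: "i < n" "j < n" for i j
        proof -
         let ?c = "ar s aC (i * n + j)"
         let ?Qk = "\<lambda>k. ar s aA (i * n + k) \<noteq> 0 \<and> ar s aB (k * n + j) \<noteq> 0"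
         let ?E = "{e. e < (2 * K - 1) ^ l \<and> (sg K l e + ?c) mod m = S mod m}"
         let ?card = "\<lambda>e. card {k. k < n \<and> ?Qk k \<and> e = dsum K l (?fa i k) (?fb k j)}"
         have fin: "finite ?E" by (rule finite_subset[of _ "{..<(2 * K - 1) ^ l}"]) auto
         have c1: "{k. k < n \<and> (i, k) \<in> ?PA \<and> (k, j) \<in> ?PB \<and> e = dsum K l (?fa i k) (?fb k j)} =
           {k. k < n \<and> ?Qk k \<and> e = dsum K l (?fa i k) (?fb k j)}" for e
          using ij by (auto simp: pres_def)
         have "[int (ar s7 aOut (i * n + j)) = (\<Sum>e<(2 * K - 1) ^ l. cterm n0 K l m S (ar s aC) n (\<lambda>x. ar s6 aXC (l * ?RL + x)) e i j)] (mod int M)"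
          using 19(1) ij f6 by simp
         also have "[(\<Sum>e<(2 * K - 1) ^ l. cterm n0 K l m S (ar s aC) n (\<lambda>x. ar s6 aXC (l * ?RL + x)) e i j) =
           (\<Sum>e<(2 * K - 1) ^ l. if ?c \<noteq> 0 \<and> (sg K l e + ?c) mod m = S mod m then int D ^ l * int (?card e) else 0)] (mod int M)"
          by (intro cong_sum) (use X6[OF ij] in \<open>auto simp: cterm_def c1\<close>)
         also have "(\<Sum>e<(2 * K - 1) ^ l. if ?c \<noteq> 0 \<and> (sg K l e + ?c) mod m = S mod m then int D ^ l * int (?card e) else 0) =
           (if ?c = 0 then 0 else \<Sum>e\<in>?E. int D ^ l * int (?card e))"
          by (auto simp: sum.If_cases Int_def)
         also have "\<dots> = int (D ^ l) * (if ?c = 0 then 0 else int (\<Sum>e\<in>?E. ?card e))"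
          by (simp add: sum_distrib_left)
         also have "(\<Sum>e\<in>?E. ?card e) = card {k. k < n \<and> ?Qk k \<and> (?fa i k + ?fb k j + ?c) mod m = S mod m}"
          by (rule card_residue[OF k(2)]) (use k(5,6) in \<open>auto intro: less_le_trans[OF mod_less_divisor]\<close>)
         finally show ?thesis .
        qed
        moreover have "t1 + (t2 + (t3 + (t4 + (t5 + (t6 + t7))))) \<le> 2 * (n * (n * (6 * l + 10) + 2)) + 3 * (l * (R ^ l * (R + 2) + 5)) + 2 * R ^ l +
           (2 * K - 1) ^ l * (n * (n * (6 * l + 11) + 2) + 4 * l + 6) + 10"
         using 19(1) f1(15) f2(13) f3(12) f4(11) f5(10) t6 by linarith
        ultimately show ?case by blast
       qed (use f6 g plZ PZ in auto)
      qed (use f5 g p0 R0 pw k(3) in auto)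
     qed (use f4 g in auto)
    qed (use f3 g p0 R0 pw qR in auto)
   qed (use f2 g p0 R0 pw qR in auto)
  qed (use f1 s Z k qlZ mZ in auto)
 qed (use s Z k qlZ mZ in auto)
qed

subsection \<open>Listing the false triangles\<close>

text \<open>A two-level index of a column: bucket r has \<open>Gb r\<close> groups with distinct
  values \<open>Gv\<close>, and each group has \<open>Gl\<close> members stored in
  \<open>Mb\<close>. A r is the set of values in bucket r, B v the set of rows with value v. In
  plain buckets, a frequent exact value would have to be passed over one row at a time.\<close>

definition grp :: "(nat => nat) => (nat => nat) => (nat => nat) => (nat => nat) => nat => nat =>
  (nat => nat set) => (nat => nat set) => bool" where
 "grp Gb Gv Gl Mb n m A B \<longleftrightarrow> (\<forall>r<m. listed Gv n r (Gb r) (A r) \<and>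
   (\<forall>g<Gb r. listed Mb n (r * n + g) (Gl (r * n + g)) (B (Gv (r * n + g)))))"

lemma listed_mem:
 assumes "listed L n y m S"
 shows "v \<in> S \<longleftrightarrow> (\<exists>z<m. L (y * n + z) = v)"
proof -
 have "v \<in> S \<longleftrightarrow> v \<in> (\<lambda>z. L (y * n + z)) ` {..<m}" using assms by (simp add: listed_def)
 also have "\<dots> \<longleftrightarrow> (\<exists>z<m. L (y * n + z) = v)" by blast
 finally show ?thesis .
qed

lemma grp_new:
 assumes "grp Gb Gv Gl Mb n m A B" "r < m" "v \<notin> A r" "B v = {}" "\<And>r. r < m \<Longrightarrow> card (A r) < n"
 shows "grp (Gb(r := Suc (Gb r))) (Gv(r * n + Gb r := v)) (Gl(r * n + Gb r := 0)) Mb n m (A(r := insert v (A r))) B"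
 unfolding grp_def
proof (intro allI impI conjI)
 fix r' assume r': "r' < m"
 have L: "listed Gv n r' (Gb r') (A r')" "\<And>g. g < Gb r' \<Longrightarrow> listed Mb n (r' * n + g) (Gl (r' * n + g)) (B (Gv (r' * n + g)))"
  using assms(1) r' by (auto simp: grp_def)
 have Gb: "Gb x < n" if "x < m" for x
  using listed_card[of Gv n x "Gb x" "A x"] assms(1) assms(5)[OF that] that by (simp add: grp_def)
 have ne: "r' * n + g \<noteq> r * n + Gb r" if "g < Gb r'" for g
  using idx_eq[of g n "Gb r" r' r] Gb[OF r'] Gb[OF assms(2)] that by auto
 show "listed (Gv(r * n + Gb r := v)) n r' ((Gb(r := Suc (Gb r))) r') ((A(r := insert v (A r))) r')"
 proof (cases "r' = r")
  case True
  then show ?thesis using listed_Suc[OF L(1)] assms(3) by simp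
 next
  case False
  then show ?thesis using ne listed_cong[OF L(1), of "Gv(r * n + Gb r := v)"] by simp
 qed
 fix g assume g: "g < (Gb(r := Suc (Gb r))) r'"
 show "listed Mb n (r' * n + g) ((Gl(r * n + Gb r := 0)) (r' * n + g)) (B ((Gv(r * n + Gb r := v)) (r' * n + g)))"
 proof (cases "r' = r \<and> g = Gb r")
  case True
  then show ?thesis using assms(4) by (simp add: listed_def)
 next
  case False
  then have "g < Gb r'" using g by (auto split: if_splits)
  then show ?thesis using ne L(2) by simp
 qed
qed

text \<open>The value v lives in a single bucket, and there in a single group, so enlarging B v
  affects one list only.\<close>

lemma grp_add:
 assumes "grp Gb Gv Gl Mb n m A B" "r < m" "g < Gb r" "Gv (r * n + g) = v" "k \<notin> B v"
  "\<And>r. r < m \<Longrightarrow> card (A r) \<le> n" "\<And>v. card (B v) \<le> n" "card (B v) < n" "\<And>r'. r' < m \<Longrightarrow> r' \<noteq> r \<Longrightarrow> v \<notin> A r'"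
 shows "grp Gb Gv (Gl(r * n + g := Suc (Gl (r * n + g)))) (Mb((r * n + g) * n + Gl (r * n + g) := k)) n m A (B(v := insert k (B v)))"
 unfolding grp_def
proof (intro allI impI conjI)
 fix r' assume r': "r' < m"
 have L: "listed Gv n r' (Gb r') (A r')" "\<And>g. g < Gb r' \<Longrightarrow> listed Mb n (r' * n + g) (Gl (r' * n + g)) (B (Gv (r' * n + g)))"
  using assms(1) r' by (auto simp: grp_def)
 then show "listed Gv n r' (Gb r') (A r')" by simp
 have Gb: "Gb x \<le> n" if "x < m" for x
  using listed_card[of Gv n x "Gb x" "A x"] assms(1) assms(6)[OF that] that by (simp add: grp_def)
 have Lg: "listed Mb n (r * n + g) (Gl (r * n + g)) (B v)" using assms(1-4) by (auto simp: grp_def)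
 have Gl: "Gl (r * n + g) < n" using listed_card[OF Lg] assms(8) by simp
 fix g' assume g': "g' < Gb r'"
 show "listed (Mb((r * n + g) * n + Gl (r * n + g) := k)) n (r' * n + g') ((Gl(r * n + g := Suc (Gl (r * n + g)))) (r' * n + g'))
   ((B(v := insert k (B v))) (Gv (r' * n + g')))"
 proof (cases "r' = r \<and> g' = g")
  case True
  then show ?thesis using listed_Suc[OF Lg assms(5)] assms(4) by simp
 next
  case False
  have ne: "r' * n + g' \<noteq> r * n + g"
   using idx_eq[of g' n g r' r] Gb[OF r'] Gb[OF assms(2)] g' assms(3) False by auto
  have "Gv (r' * n + g') \<noteq> v"
  proof (cases "r' = r")
   case True
   then show ?thesis using L(1) assms(3,4) g' False by (auto simp: listed_def inj_on_def)
  next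
   case False
   have "Gv (r' * n + g') \<in> A r'" using L(1) g' by (auto simp: listed_def)
   then show ?thesis using assms(9)[OF r' False] by auto
  qed
  moreover have "listed (Mb((r * n + g) * n + Gl (r * n + g) := k)) n (r' * n + g') (Gl (r' * n + g')) (B (Gv (r' * n + g')))"
  proof (rule listed_cong[OF L(2)[OF g']])
   fix z assume "z < Gl (r' * n + g')"
   then have "z < n" using listed_card[OF L(2)[OF g']] assms(7)[of "Gv (r' * n + g')"] by linarith
   then show "(Mb((r * n + g) * n + Gl (r * n + g) := k)) ((r' * n + g') * n + z) = Mb ((r' * n + g') * n + z)"
    using idx_eq[of z n "Gl (r * n + g)" "r' * n + g'" "r * n + g"] Gl ne by simp
  qed
  ultimately show ?thesis using ne by simp
 qed
qed

section \<open>Grouping a column of V by residue and value\<close>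

definition vals :: "(nat => nat) => nat => nat => nat => nat => nat => nat set" where
 "vals Vf n z m k r = {v. v \<noteq> 0 \<and> v mod m = r \<and> (\<exists>x<k. Vf (x * n + z) = v)}"

definition mems :: "(nat => nat) => nat => nat => nat => nat => nat set" where
 "mems Vf n z k v = {x. x < k \<and> v \<noteq> 0 \<and> Vf (x * n + z) = v}"

definition coll1 :: "(nat => nat) => nat => nat => nat => nat => nat" where
 "coll1 Vf n z m x = card {x'. x' < n \<and> Vf (x * n + z) \<noteq> 0 \<and> Vf (x' * n + z) \<noteq> 0 \<and> Vf (x' * n + z) mod m = Vf (x * n + z) mod m \<and>
   Vf (x' * n + z) \<noteq> Vf (x * n + z)}"

lemma finite_vals [simp]: "finite (vals Vf n z m k r)"
 by (rule finite_subset[of _ "(\<lambda>x. Vf (x * n + z)) ` {..<k}"]) (auto simp: vals_def)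

lemma finite_mems [simp]: "finite (mems Vf n z k v)"
 by (rule finite_subset[of _ "{..<k}"]) (auto simp: mems_def)

lemma card_vals: "card (vals Vf n z m k r) \<le> k"
proof -
 have "card (vals Vf n z m k r) \<le> card ((\<lambda>x. Vf (x * n + z)) ` {..<k})"
  by (intro card_mono) (auto simp: vals_def)
 also have "\<dots> \<le> k" using card_image_le[of "{..<k}" "\<lambda>x. Vf (x * n + z)"] by simp
 finally show ?thesis .
qed

lemma card_mems: "card (mems Vf n z k v) \<le> k"
proof -
 have "card (mems Vf n z k v) \<le> card {..<k}" by (intro card_mono) (auto simp: mems_def)
 then show ?thesis by simp
qed

text \<open>The bucket of entry x contains its own value and otherwise only values of entries that
  collide with x. This charges the linear search for a group to the collisions.\<close>

lemma card_vals_coll: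
 assumes "k \<le> n" "Vf (x * n + z) \<noteq> 0"
 shows "card (vals Vf n z m k (Vf (x * n + z) mod m)) \<le> Suc (coll1 Vf n z m x)"
proof -
 let ?C = "{x'. x' < n \<and> Vf (x * n + z) \<noteq> 0 \<and> Vf (x' * n + z) \<noteq> 0 \<and> Vf (x' * n + z) mod m = Vf (x * n + z) mod m \<and> Vf (x' * n + z) \<noteq> Vf (x * n + z)}"
 have fin: "finite ?C" by (rule finite_subset[of _ "{..<n}"]) auto
 have "vals Vf n z m k (Vf (x * n + z) mod m) \<subseteq> insert (Vf (x * n + z)) ((\<lambda>x. Vf (x * n + z)) ` ?C)"
 proof
  fix v assume "v \<in> vals Vf n z m k (Vf (x * n + z) mod m)"
  then obtain x' where "x' < k" "Vf (x' * n + z) = v" "v \<noteq> 0" "v mod m = Vf (x * n + z) mod m"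
   unfolding vals_def by blast
  moreover from this have "x' < n" using assms by simp
  moreover note assms(2)
  ultimately show "v \<in> insert (Vf (x * n + z)) ((\<lambda>x. Vf (x * n + z)) ` ?C)"
   by (cases "v = Vf (x * n + z)") (auto intro!: image_eqI[of _ _ x'])
 qed
 then have "card (vals Vf n z m k (Vf (x * n + z) mod m)) \<le> card (insert (Vf (x * n + z)) ((\<lambda>x. Vf (x * n + z)) ` ?C))"
  using fin by (intro card_mono) auto
 also have "\<dots> \<le> Suc (card ((\<lambda>x. Vf (x * n + z)) ` ?C))" using fin by (simp add: card_insert_if)
 also have "\<dots> \<le> Suc (coll1 Vf n z m x)" unfolding coll1_def using card_image_le[OF fin] by simp
 finally show ?thesis .
qed

lemma vals_Suc: "vals Vf n z m (Suc k) = (\<lambda>r. if Vf (k * n + z) \<noteq> 0 \<and> Vf (k * n + z) mod m = r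
  then insert (Vf (k * n + z)) (vals Vf n z m k r) else vals Vf n z m k r)"
 by (rule ext) (auto simp: vals_def less_Suc_eq)

lemma mems_Suc: "mems Vf n z (Suc k) = (\<lambda>v. if v \<noteq> 0 \<and> Vf (k * n + z) = v then insert k (mems Vf n z k v) else mems Vf n z k v)"
 by (rule ext) (auto simp: mems_def less_Suc_eq)

text \<open>If the value is absent the answer is the number of groups, which is the place where a
  new group will be opened.\<close>

definition findf :: com where
 "findf = (ig :=: V ie ;; For il (V ie) (If (Arr aGv (V ic \<^bold>* V vN \<^bold>+ V il) \<^bold>= V ib) (ig :=: V il) Skip))"

lemma findf_writes [simp]: "wv findf = {ig, il}" "wa findf = {}" "wio findf = False"
 by (auto simp: findf_def)

lemma wp_findf:
 assumes "vr s vN = n" "vr s ie = k" "vr s ic = r" "vr s ib = v" "k \<le> Z"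
 shows "wp bb Z findf s (\<lambda>s' t. (if \<exists>g<k. ar s aGv (r * n + g) = v then vr s' ig < k \<and> ar s aGv (r * n + vr s' ig) = v else vr s' ig = k) \<and>
  t \<le> 3 * k + 2)"
proof -
 have "wp bb Z (For il (V ie) (If (Arr aGv (V ic \<^bold>* V vN \<^bold>+ V il) \<^bold>= V ib) (ig :=: V il) Skip)) (set_var ig k s)
  (\<lambda>s' t. (if \<exists>g<k. ar s aGv (r * n + g) = v then vr s' ig < k \<and> ar s aGv (r * n + vr s' ig) = v else vr s' ig = k) \<and> t \<le> 3 * k + 1)"
 proof (rule wp_For[where I = "\<lambda>i s' t. (if \<exists>g<i. ar s aGv (r * n + g) = v then vr s' ig < i \<and> ar s aGv (r * n + vr s' ig) = v else vr s' ig = k) \<and> t \<le> 3 * i"], goal_cases)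
  case (3 i s' t)
  have f: "vr s' vN = n" "vr s' ic = r" "vr s' ib = v" "ar s' aGv = ar s aGv" using 3(3) assms by (simp_all add: frame_def)
  show ?case using 3(1,2) f assms by (auto simp: wp_If less_Suc_eq split: if_splits)
 next
  case (4 s' t)
  then show ?case using assms by (cases "\<exists>g<k. ar s aGv (r * n + g) = v") simp_all
 qed (use assms in auto)
 then show ?thesis using assms by (simp add: findf_def wp_Seq)
qed

definition insf :: com where
 "insf = (ib :=: Arr aV (V ix \<^bold>* V vN \<^bold>+ V iz) ;;
   If (V ib) (ic :=: V ib \<^bold>mod V iq ;; ie :=: Arr aBkt (V ic) ;; findf ;;
    If (V ig \<^bold>= V ie) (Put aGv (V ic \<^bold>* V vN \<^bold>+ V ig) (V ib) ;; Put aGl (V ic \<^bold>* V vN \<^bold>+ V ig) (N 0) ;;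
     Put aBkt (V ic) (V ie \<^bold>+ N 1)) Skip ;;
    ih :=: Arr aGl (V ic \<^bold>* V vN \<^bold>+ V ig) ;;
    Put aMb ((V ic \<^bold>* V vN \<^bold>+ V ig) \<^bold>* V vN \<^bold>+ V ih) (V ix) ;;
    Put aGl (V ic \<^bold>* V vN \<^bold>+ V ig) (V ih \<^bold>+ N 1)) Skip)"

lemma insf_writes [simp]: "wv insf = {ib, ic, ie, ig, il, ih}" "wa insf = {aGv, aGl, aBkt, aMb}" "wio insf = False"
 by (auto simp: insf_def)

lemma wp_insf:
 assumes s: "vr s vN = n" "vr s iz = z" "vr s iq = m" "vr s ix = k" "k < n" "z < n" "n \<le> Z" "m > 0" "m \<le> Z"
  and Vf: "ar s aV = Vf" "\<And>x. x < n * n \<Longrightarrow> Vf x \<le> Z"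
  and G: "grp (ar s aBkt) (ar s aGv) (ar s aGl) (ar s aMb) n m (vals Vf n z m k) (mems Vf n z k)"
 shows "wp bb Z insf s (\<lambda>s' t. grp (ar s' aBkt) (ar s' aGv) (ar s' aGl) (ar s' aMb) n m (vals Vf n z m (Suc k)) (mems Vf n z (Suc k)) \<and>
   t \<le> 3 * coll1 Vf n z m k + 17)"
proof -
 let ?v = "Vf (k * n + z)" and ?A = "vals Vf n z m k" and ?B = "mems Vf n z k"
 let ?r = "?v mod m"
 have kz: "k * n + z < n * n" using s by (intro mult_add_less)
 show ?thesis
 proof (cases "?v = 0")
  case True
  then have "vals Vf n z m (Suc k) = ?A" "mems Vf n z (Suc k) = ?B" by (auto simp: vals_Suc mems_Suc fun_eq_iff)
  then show ?thesis using True s Vf G by (simp add: insf_def wp_Seq wp_If)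
 next
  case False
  have r: "?r < m" using s by simp
  let ?k = "ar s aBkt ?r"
  have L: "listed (ar s aGv) n ?r ?k (?A ?r)" using G r by (auto simp: grp_def)
  have k: "?k = card (?A ?r)" using listed_card[OF L] by simp
  have kn: "?k \<le> k" using card_vals[of Vf n z m k ?r] k by simp
  have kc: "?k \<le> Suc (coll1 Vf n z m k)" using card_vals_coll[of k n Vf k z m] False s k by simp
  have ex: "(\<exists>g<?k. ar s aGv (?r * n + g) = ?v) \<longleftrightarrow> ?v \<in> ?A ?r"
   using listed_mem[OF L] by simp
  have mB: "mems Vf n z (Suc k) = ?B(?v := insert k (?B ?v))" using False by (auto simp: mems_Suc fun_eq_iff)
  have vA: "vals Vf n z m (Suc k) = ?A(?r := insert ?v (?A ?r))" using False by (auto simp: vals_Suc fun_eq_iff)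
  have oth: "?v \<notin> ?A r'" if "r' \<noteq> ?r" for r' using that by (auto simp: vals_def)
  have kB: "k \<notin> ?B v" "card (?B v) \<le> n" "card (?B v) < n" for v
   using card_mems[of Vf n z k v] s by (auto simp: mems_def)
  have rZ: "?r \<le> Z" using r s by linarith
  have kZ: "?k \<le> Z" using kn s by linarith
  let ?s = "set_var ie ?k (set_var ic ?r (set_var ib ?v s))"
  have fd: "wp bb Z findf ?s (\<lambda>s' t. (if ?v \<in> ?A ?r then vr s' ig < ?k \<and> ar s aGv (?r * n + vr s' ig) = ?v else vr s' ig = ?k) \<and> t \<le> 3 * ?k + 2)"
   using wp_findf[of ?s n ?k ?r ?v Z bb] s kZ ex by (simp cong: if_cong)
  show ?thesis
   unfolding insf_def wp_Seq[of _ _ "ib :=: _"] wp_simps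
  proof (intro conjI, goal_cases)
   case 2
   have e: "eval (Arr aV (V ix \<^bold>* V vN \<^bold>+ V iz)) s = ?v" using s Vf by simp
   show ?case
    unfolding e wp_If wp_Seq wp_simps
   proof (subst if_P, simp add: False, intro conjI, goal_cases)
    case 3
    have e1: "eval (V ib \<^bold>mod V iq) (set_var ib ?v s) = ?r" using s by simp
    have e2: "eval (Arr aBkt (V ic)) (set_var ic ?r (set_var ib ?v s)) = ?k" by simp
    show ?case
     unfolding e1 e2
    proof (rule wp_conseq[OF fd], goal_cases)
     case (1 s1 t1)
     have f: "vr s1 vN = n" "vr s1 ie = ?k" "vr s1 ic = ?r" "vr s1 ib = ?v" "vr s1 ix = k"
      "ar s1 aBkt = ar s aBkt" "ar s1 aGv = ar s aGv" "ar s1 aGl = ar s aGl" "ar s1 aMb = ar s aMb"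
      using 1(2) s by (simp_all add: frame_def)
     define g where "g = vr s1 ig"
     have kZ': "Suc k \<le> Z" "k \<le> Z" using s by auto
     show ?case
     proof (cases "?v \<in> ?A ?r")
      case True
      then have g: "g < ?k" "ar s aGv (?r * n + g) = ?v" using 1(1) by (auto simp: g_def)
      have A: "vals Vf n z m (Suc k) = ?A" unfolding vA using True by (auto simp: fun_eq_iff)
      have "listed (ar s aMb) n (?r * n + g) (ar s aGl (?r * n + g)) (?B (ar s aGv (?r * n + g)))"
       using G r g(1) by (simp add: grp_def)
      then have "listed (ar s aMb) n (?r * n + g) (ar s aGl (?r * n + g)) (?B ?v)"
       unfolding g(2) .
      then have Gl: "ar s aGl (?r * n + g) \<le> k" using listed_card card_mems[of Vf n z k ?v] by metis
      have ca: "card (?A r) \<le> n" for r using card_vals[of Vf n z m k r] s by simp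
      have "grp (ar s aBkt) (ar s aGv) ((ar s aGl)(?r * n + g := Suc (ar s aGl (?r * n + g))))
        ((ar s aMb)((?r * n + g) * n + ar s aGl (?r * n + g) := k)) n m ?A (?B(?v := insert k (?B ?v)))"
       by (rule grp_add[OF G r g kB(1) ca kB(2,3)]) (use oth in auto)
      then show ?thesis
       using g f 1(1) s kc Gl kZ' unfolding A mB
       by (simp add: wp_If wp_Seq g_def[symmetric])
     next
      case nin: False
      then have g: "g = ?k" using 1(1) by (simp add: g_def)
      have ca: "card (?A r) < n" for r using card_vals[of Vf n z m k r] s by simp
      \<comment> \<open>A value not yet present in its bucket has no members among the rows before
        k, so the new group correctly starts with length 0.\<close>
      have Be: "?B ?v = {}" using nin False by (auto simp: mems_def vals_def)
      have G1: "grp ((ar s aBkt)(?r := Suc ?k)) ((ar s aGv)(?r * n + ?k := ?v)) ((ar s aGl)(?r * n + ?k := 0)) (ar s aMb) n m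
        (?A(?r := insert ?v (?A ?r))) ?B"
       by (rule grp_new[OF G r nin Be ca])
      have ca2: "card ((?A(?r := insert ?v (?A ?r))) r') \<le> n" for r'
       using ca[of r'] ca[of ?r] by (auto simp: card_insert_if)
      have G2: "grp ((ar s aBkt)(?r := Suc ?k)) ((ar s aGv)(?r * n + ?k := ?v))
        (((ar s aGl)(?r * n + ?k := 0))(?r * n + ?k := Suc (((ar s aGl)(?r * n + ?k := 0)) (?r * n + ?k))))
        ((ar s aMb)((?r * n + ?k) * n + ((ar s aGl)(?r * n + ?k := 0)) (?r * n + ?k) := k)) n m
        (?A(?r := insert ?v (?A ?r))) (?B(?v := insert k (?B ?v)))"
       by (rule grp_add[OF G1 r _ _ kB(1) ca2 kB(2,3)]) (use oth in auto)
      have vZ: "?v \<le> Z" using Vf kz by simp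
      show ?thesis
       using g f 1(1) s kc kZ' kn vZ nin G2 unfolding vA mB
       by (simp add: wp_If wp_Seq g_def[symmetric])
     qed
    qed
   qed (use s Vf kz rZ kZ in auto)
  qed (use s Vf kz in auto)
 qed
qed

definition grpf :: com where
 "grpf = (zerof aBkt ;; For ix (V vN) insf)"

lemma grpf_writes [simp]: "wv grpf = {ia, ix, ib, ic, ie, ig, il, ih}" "wa grpf = {aBkt, aGv, aGl, aMb}" "wio grpf = False"
 by (auto simp: grpf_def)

lemma wp_grpf:
 assumes s: "vr s vN = n" "vr s iz = z" "vr s iq = m" "z < n" "n \<le> Z" "m > 0" "m \<le> Z"
  and Vf: "ar s aV = Vf" "\<And>x. x < n * n \<Longrightarrow> Vf x \<le> Z"
 shows "wp bb Z grpf s (\<lambda>s' t. grp (ar s' aBkt) (ar s' aGv) (ar s' aGl) (ar s' aMb) n m (vals Vf n z m n) (mems Vf n z n) \<and>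
   t \<le> 2 * m + 2 + (\<Sum>x<n. 3 * coll1 Vf n z m x + 18))"
 unfolding grpf_def wp_Seq
proof (rule wp_conseq[OF wp_zerof[of s m]], goal_cases)
 case (3 s1 t1)
 have f1: "vr s1 vN = n" "vr s1 iz = z" "vr s1 iq = m" "ar s1 aV = Vf" "\<And>r. r < m \<Longrightarrow> ar s1 aBkt r = 0" "t1 \<le> 2 * m + 1"
  using 3 s Vf by (simp_all add: frame_def)
 show ?case
 proof (rule wp_For[where I = "\<lambda>k s' t. grp (ar s' aBkt) (ar s' aGv) (ar s' aGl) (ar s' aMb) n m (vals Vf n z m k) (mems Vf n z k) \<and>
   t \<le> (\<Sum>x<k. 3 * coll1 Vf n z m x + 18)"], goal_cases)
  case (3 k s2 t2)
  have f2: "vr s2 vN = n" "vr s2 iz = z" "vr s2 iq = m" "ar s2 aV = Vf" using 3(3) f1 by (simp_all add: frame_def)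
  have k: "k < n" using 3(1) f1 by simp
  have "wp bb Z insf (set_var ix k s2) (\<lambda>s' t. grp (ar s' aBkt) (ar s' aGv) (ar s' aGl) (ar s' aMb) n m (vals Vf n z m (Suc k)) (mems Vf n z (Suc k)) \<and>
    t \<le> 3 * coll1 Vf n z m k + 17)"
   using f2 s k Vf 3(2) by (intro wp_insf) auto
  then show ?case by (rule wp_conseq) (use 3(2) in auto)
 next
  case 2
  have "vals Vf n z m 0 r = {}" for r by (simp add: vals_def)
  then show ?case using f1 by (simp add: grp_def listed_def)
 next
  case (4 s' t)
  then show ?case using f1 by simp
 qed (use f1 s in auto)
qed (use s in auto)

subsection \<open>Subtracting the false triangles\<close>

text \<open>F' arises from F by removing c k false triangles from each cell k; every triangle weighs
  D, which will be D ^ l for the constant D of the tensor.\<close>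

definition dec :: "nat => nat => (nat => nat) => (nat => nat) => (nat => nat) => bool" where
 "dec M D F F' c \<longleftrightarrow> (\<forall>k. [int (F' k) = int (F k) - int D * int (c k)] (mod int M))"

lemma dec_refl: "dec M D F F (\<lambda>_. 0)"
 by (simp add: dec_def)

lemma dec_trans: "dec M D F F' c \<Longrightarrow> dec M D F' F'' c' \<Longrightarrow> dec M D F F'' (\<lambda>k. c k + c' k)"
 unfolding dec_def
proof
 fix k assume *: "\<forall>k. [int (F' k) = int (F k) - int D * int (c k)] (mod int M)" "\<forall>k. [int (F'' k) = int (F' k) - int D * int (c' k)] (mod int M)"
 have "[int (F'' k) = int (F' k) - int D * int (c' k)] (mod int M)" using * by simp
 also have "[int (F' k) - int D * int (c' k) = (int (F k) - int D * int (c k)) - int D * int (c' k)] (mod int M)"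
  using * by (intro cong_diff cong_refl) simp
 finally show "[int (F'' k) = int (F k) - int D * int (c k + c' k)] (mod int M)"
  by (simp add: algebra_simps)
qed

lemma dec_step:
 assumes "D \<le> M"
 shows "dec M D F (F(i := (F i + (M - D)) mod M)) (\<lambda>k. of_bool (k = i))"
 unfolding dec_def
proof
 fix k
 have "(int (F i) + int (M - D)) mod int M = (int (F i) - int D + int M) mod int M"
  using assms by (simp add: of_nat_diff algebra_simps)
 then show "[int ((F(i := (F i + (M - D)) mod M)) k) = int (F k) - int D * int (of_bool (k = i))] (mod int M)"
  by (simp add: cong_def zmod_int)
qed

lemma listed_sum:
 assumes "listed L n y m S"
 shows "(\<Sum>z<m. f (L (y * n + z))) = (\<Sum>v\<in>S. f v)"
proof -
 have "(\<Sum>v\<in>(\<lambda>z. L (y * n + z)) ` {..<m}. f v) = (\<Sum>z<m. f (L (y * n + z)))"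
  using assms by (subst sum.reindex) (auto simp: listed_def)
 then show ?thesis using assms by (simp add: listed_def)
qed

text \<open>All rows x of a group share the value v, but only those with U[y, x] = u give a triangle
  with the weights u, v, w. The others cost time without effect; \<open>coll2\<close> counts them as
  well.\<close>

definition memf :: com where
 "memf = For ie (Arr aGl (V ic \<^bold>* V vN \<^bold>+ V il)) (ix :=: Arr aMb ((V ic \<^bold>* V vN \<^bold>+ V il) \<^bold>* V vN \<^bold>+ V ie) ;;
   If (Arr aU (V iy \<^bold>* V vN \<^bold>+ V ix) \<^bold>= V ia)
    (ih :=: V vOy \<^bold>* V iy \<^bold>+ V vOx \<^bold>* V ix \<^bold>+ V vOz \<^bold>* V iz ;;
    Put aOut (V ih) ((Arr aOut (V ih) \<^bold>+ (V vMOD \<^bold>- V vDL)) \<^bold>mod V vMOD)) Skip)"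

lemma memf_writes [simp]: "wv memf = {ie, ix, ih}" "wa memf = {aOut}" "wio memf = False"
 by (auto simp: memf_def)

lemma wp_memf:
 assumes s: "vr s vN = n" "vr s iy = y" "vr s iz = z" "vr s ic = r" "vr s il = g" "vr s ia = u" "vr s vOy = oy" "vr s vOx = ox" "vr s vOz = oz"
   "vr s vMOD = M" "vr s vDL = D" "D \<le> M" "M > 0" "M \<le> Z" "n \<le> Z"
  and B: "listed (ar s aMb) n (r * n + g) (ar s aGl (r * n + g)) B" "B \<subseteq> {..<n}"
  and o: "\<And>x. x < n \<Longrightarrow> oy * y + ox * x + oz * z \<le> Z"
 shows "wp bb Z memf s (\<lambda>s' t. dec M D (ar s aOut) (ar s' aOut)
   (\<lambda>k. \<Sum>x\<in>B. of_bool (ar s aU (y * n + x) = u \<and> k = oy * y + ox * x + oz * z)) \<and> t \<le> 5 * card B + 1)"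
proof -
 let ?m = "ar s aGl (r * n + g)" and ?x = "\<lambda>e. ar s aMb ((r * n + g) * n + e)"
 let ?c = "\<lambda>x k. of_bool (ar s aU (y * n + x) = u \<and> k = oy * y + ox * x + oz * z) :: nat"
 have m: "?m = card B" using listed_card[OF B(1)] by simp
 have "card B \<le> card {..<n}" using B(2) by (intro card_mono) auto
 then have mn: "?m \<le> n" using m by simp
 have xB: "?x e < n" if "e < ?m" for e using B that by (auto simp: listed_def)
 have sm: "(\<Sum>e<?m. ?c (?x e) k) = (\<Sum>x\<in>B. ?c x k)" for k by (rule listed_sum[OF B(1)])
 show ?thesis
  unfolding memf_def
 proof (rule wp_For[where I = "\<lambda>i s' t. dec M D (ar s aOut) (ar s' aOut) (\<lambda>k. \<Sum>e<i. ?c (?x e) k) \<and> t \<le> 5 * i"], goal_cases)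
  case (3 i s1 t1)
  have f: "vr s1 vN = n" "vr s1 iy = y" "vr s1 iz = z" "vr s1 ic = r" "vr s1 il = g" "vr s1 ia = u" "vr s1 vOy = oy" "vr s1 vOx = ox" "vr s1 vOz = oz"
   "vr s1 vMOD = M" "vr s1 vDL = D" "ar s1 aMb = ar s aMb" "ar s1 aU = ar s aU"
   using 3(3) s by (simp_all add: frame_def)
  have i: "i < ?m" using 3(1) s by simp
  have x: "?x i < n" using xB i by simp
  have I: "dec M D (ar s aOut) (ar s1 aOut) (\<lambda>k. \<Sum>e<i. ?c (?x e) k)" "t1 \<le> 5 * i" using 3(2) by auto
  let ?i = "oy * y + ox * ?x i + oz * z"
  have mz: "v mod M \<le> Z" for v using mod_less_divisor[OF s(13), of v] s(14) by linarith
  have xZ: "?x i \<le> Z" using x s by linarith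
  show ?case
  proof (cases "ar s aU (y * n + ?x i) = u")
   case True
   have "dec M D (ar s aOut) ((ar s1 aOut)(?i := (ar s1 aOut ?i + (M - D)) mod M)) (\<lambda>k. \<Sum>e<Suc i. ?c (?x e) k)"
    using dec_trans[OF I(1) dec_step[OF s(12)], of ?i] True by simp
   then show ?thesis using f True I(2) mz o[OF x] xZ by (simp add: wp_Seq wp_If)
  next
   case False
   then show ?thesis using f I xZ by (simp add: wp_Seq wp_If)
  qed
 next
  case (4 s' t)
  then show ?case using s sm m by simp
 qed (use s mn in \<open>auto simp: dec_refl\<close>)
qed

definition coll2 :: "(nat => nat) => nat => nat => nat => nat => nat => nat => nat set" where
 "coll2 Vf n z m S w u = {x. x < n \<and> Vf (x * n + z) \<noteq> 0 \<and> Vf (x * n + z) mod m = tgt S m w u \<and> Vf (x * n + z) + u + w \<noteq> S}"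

lemma finite_coll2 [simp]: "finite (coll2 Vf n z m S w u)"
 by (rule finite_subset[of _ "{..<n}"]) (auto simp: coll2_def)

text \<open>Inspects the groups in the bucket of the target residue. In the group with u + v + w = S
  there is nothing to subtract, and it is skipped as a whole.\<close>

definition bucketf :: com where
 "bucketf = (ia :=: Arr aLst (V iy \<^bold>* V vN \<^bold>+ V ig) ;; ic :=: tgte ;; For il (Arr aBkt (V ic)) (
   If (Arr aGv (V ic \<^bold>* V vN \<^bold>+ V il) \<^bold>+ V ia \<^bold>+ V ib \<^bold>= V vS) Skip memf))"

lemma bucketf_writes [simp]: "wv bucketf = {ia, ic, il, ie, ix, ih}" "wa bucketf = {aOut}" "wio bucketf = False"
 by (auto simp: bucketf_def)

lemma wp_bucketf:
 assumes s: "vr s vN = n" "vr s iy = y" "vr s iz = z" "vr s ig = g" "vr s ib = w" "vr s iq = m" "vr s vS = S" "vr s vOy = oy" "vr s vOx = ox" "vr s vOz = oz"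
   "vr s vMOD = M" "vr s vDL = D" "D \<le> M" "M > 0" "M \<le> Z" "n \<le> Z" "m > 0" "m \<le> Z"
  and G: "grp (ar s aBkt) (ar s aGv) (ar s aGl) (ar s aMb) n m (vals Vf n z m n) (mems Vf n z n)"
  and u: "ar s aLst (y * n + g) = u" "u \<le> Z"
  and o: "\<And>x. x < n \<Longrightarrow> oy * y + ox * x + oz * z \<le> Z"
 shows "wp bb Z bucketf s (\<lambda>s' t. dec M D (ar s aOut) (ar s' aOut)
   (\<lambda>k. \<Sum>x\<in>coll2 Vf n z m S w u. of_bool (ar s aU (y * n + x) = u \<and> k = oy * y + ox * x + oz * z)) \<and>
   t \<le> 9 * card (coll2 Vf n z m S w u) + 6)"
proof -
 let ?r = "tgt S m w u" and ?C = "coll2 Vf n z m S w u"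
 let ?c = "\<lambda>x k. of_bool (ar s aU (y * n + x) = u \<and> k = oy * y + ox * x + oz * z) :: nat"
 have r: "?r < m" using s by (simp add: tgt_def)
 let ?k = "ar s aBkt ?r" and ?v = "\<lambda>l. ar s aGv (?r * n + l)"
 have L: "listed (ar s aGv) n ?r ?k (vals Vf n z m n ?r)" using G r by (auto simp: grp_def)
 have k: "?k \<le> n" using listed_card[OF L] card_vals[of Vf n z m n ?r] by simp
 let ?s = "set_var ic ?r (set_var ia u s)"
 let ?A = "{v \<in> vals Vf n z m n ?r. v + u + w \<noteq> S}"
 have grpsum: "(\<Sum>v\<in>?A. \<Sum>x\<in>mems Vf n z n v. f x) = (\<Sum>x\<in>?C. f x)" for f :: "nat => nat"
 proof -
  have "mems Vf n z n v = {x \<in> ?C. Vf (x * n + z) = v}" if "v \<in> ?A" for v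
   using that by (auto simp: mems_def coll2_def vals_def)
  then have "(\<Sum>v\<in>?A. \<Sum>x\<in>mems Vf n z n v. f x) = (\<Sum>v\<in>?A. \<Sum>x\<in>{x \<in> ?C. Vf (x * n + z) = v}. f x)"
   by (intro sum.cong) auto
  also have "\<dots> = (\<Sum>x\<in>?C. f x)"
   by (rule sum.group) (auto simp: coll2_def vals_def)
  finally show ?thesis .
 qed
 have tot: "(\<Sum>l<?k. if ?v l + u + w = S then 0 else \<Sum>x\<in>mems Vf n z n (?v l). f x) = (\<Sum>x\<in>?C. f x)" for f :: "nat => nat"
 proof -
  have "(\<Sum>l<?k. if ?v l + u + w = S then 0 else \<Sum>x\<in>mems Vf n z n (?v l). f x) =
    (\<Sum>v\<in>vals Vf n z m n ?r. if v + u + w = S then 0 else \<Sum>x\<in>mems Vf n z n v. f x)"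
   by (rule listed_sum[OF L])
  also have "\<dots> = (\<Sum>v\<in>?A. \<Sum>x\<in>mems Vf n z n v. f x)"
   by (rule sum.mono_neutral_cong_right) auto
  finally show ?thesis using grpsum by simp
 qed
 \<comment> \<open>Groups have distinct values and only v = S - w - u is exact. So at most one group
   per visit is skipped, at constant cost.\<close>
 have few: "(\<Sum>l<?k. of_bool (?v l + u + w = S)) \<le> (1 :: nat)"
 proof -
  have "(\<Sum>l<?k. of_bool (?v l + u + w = S)) = (\<Sum>v\<in>vals Vf n z m n ?r. of_bool (v + u + w = S) :: nat)"
   by (rule listed_sum[OF L])
  also have "\<dots> = card {v \<in> vals Vf n z m n ?r. v + u + w = S}"
   by (simp add: of_bool_def sum.If_cases Int_def conj_ac)
  also have "\<dots> \<le> card {S - w - u}"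
   by (rule card_mono) auto
  finally show ?thesis by simp
 qed
 have loop: "wp bb Z (For il (Arr aBkt (V ic)) (If (Arr aGv (V ic \<^bold>* V vN \<^bold>+ V il) \<^bold>+ V ia \<^bold>+ V ib \<^bold>= V vS) Skip memf)) ?s
   (\<lambda>s' t. dec M D (ar s aOut) (ar s' aOut) (\<lambda>k. \<Sum>x\<in>?C. ?c x k) \<and> t \<le> 9 * card ?C + 4)"
 proof (rule wp_For[where I = "\<lambda>i s' t. dec M D (ar s aOut) (ar s' aOut)
    (\<lambda>k. \<Sum>l<i. if ?v l + u + w = S then 0 else \<Sum>x\<in>mems Vf n z n (?v l). ?c x k) \<and>
   t \<le> (\<Sum>l<i. if ?v l + u + w = S then 0 else \<Sum>x\<in>mems Vf n z n (?v l). 9) + 3 * (\<Sum>l<i. of_bool (?v l + u + w = S))"], goal_cases)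
  case (3 i s1 t1)
  have f: "vr s1 vN = n" "vr s1 iy = y" "vr s1 iz = z" "vr s1 ic = ?r" "vr s1 ia = u" "vr s1 ib = w" "vr s1 vS = S" "vr s1 vOy = oy" "vr s1 vOx = ox" "vr s1 vOz = oz"
   "vr s1 vMOD = M" "vr s1 vDL = D" "ar s1 aMb = ar s aMb" "ar s1 aU = ar s aU" "ar s1 aGv = ar s aGv" "ar s1 aGl = ar s aGl"
   using 3(3) s by (simp_all add: frame_def)
  have i: "i < ?k" using 3(1) by simp
  note I = 3(2)
  show ?case
  proof (cases "?v i + u + w = S")
   case True
   then show ?thesis using f I by (simp add: wp_If)
  next
   case False
   have vi: "?v i \<in> vals Vf n z m n ?r" using L i by (auto simp: listed_def)
   have B: "listed (ar s aMb) n (?r * n + i) (ar s aGl (?r * n + i)) (mems Vf n z n (?v i))"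
    using G r i by (auto simp: grp_def)
   \<comment> \<open>Groups of a column are never empty, so the overhead of an inspected group is
     paid by its members.\<close>
   have "mems Vf n z n (?v i) \<noteq> {}" using vi by (auto simp: vals_def mems_def)
   then have c1: "1 \<le> card (mems Vf n z n (?v i))" by (simp add: Suc_le_eq card_gt_0_iff)
   have "wp bb Z memf (set_var il i s1) (\<lambda>s' t. dec M D (ar s1 aOut) (ar s' aOut) (\<lambda>k. \<Sum>x\<in>mems Vf n z n (?v i). ?c x k) \<and>
     t \<le> 5 * card (mems Vf n z n (?v i)) + 1)"
    using wp_memf[of "set_var il i s1" n y z ?r i u oy ox oz M D Z "mems Vf n z n (?v i)" bb] f s B o by (auto simp: mems_def)
   then have "wp bb Z memf (set_var il i s1) (\<lambda>s' t. dec M D (ar s aOut) (ar s' aOut)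
     (\<lambda>k. \<Sum>l<Suc i. if ?v l + u + w = S then 0 else \<Sum>x\<in>mems Vf n z n (?v l). ?c x k) \<and>
     t1 + Suc t + 1 \<le> (\<Sum>l<Suc i. if ?v l + u + w = S then 0 else \<Sum>x\<in>mems Vf n z n (?v l). 9) + 3 * (\<Sum>l<Suc i. of_bool (?v l + u + w = S)))"
   proof (rule wp_conseq, goal_cases)
    case (1 s' t)
    then show ?case using dec_trans[OF conjunct1[OF I] conjunct1[OF 1(1)]] I False c1 by simp
   qed
   then show ?thesis using f False by (simp add: wp_If del: sum.lessThan_Suc)
  qed
 next
  case (4 s' t)
  have "t \<le> 9 * card ?C + 3" using 4(1) tot[of "\<lambda>_. 9"] few by simp
  moreover have "dec M D (ar s aOut) (ar s' aOut) (\<lambda>k. \<Sum>x\<in>?C. ?c x k)" using 4(1) tot[of "\<lambda>x. ?c x _"] by simp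
  ultimately show ?case by simp
 qed (use s k in \<open>auto simp: dec_refl\<close>)
 have rZ: "?r \<le> Z" using r s by linarith
 show ?thesis
  unfolding bucketf_def wp_Seq wp_simps
 proof (intro conjI, goal_cases)
  case 3
  have e: "eval (Arr aLst (V iy \<^bold>* V vN \<^bold>+ V ig)) s = u" "eval tgte (set_var ia u s) = ?r"
   using s u by (simp_all add: tgte_def tgt_def)
  show ?case unfolding e by (rule wp_conseq[OF loop]) auto
 qed (use s u rZ in \<open>auto simp: tgte_def tgt_def\<close>)
qed

definition rowlf :: com where
 "rowlf = For iy (V vN) (ib :=: Arr aW (V iy \<^bold>* V vN \<^bold>+ V iz) ;; If (V ib) (For ig (Arr aCnt (V iy)) bucketf) Skip)"

lemma rowlf_writes [simp]: "wv rowlf = {iy, ib, ig, ia, ic, il, ie, ix, ih}" "wa rowlf = {aOut}" "wio rowlf = False"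
 by (auto simp: rowlf_def)

definition cost2 :: "(nat => nat) => (nat => nat) => nat => (nat => nat) => (nat => nat) => nat => nat => nat => nat" where
 "cost2 Vf Wf S Lst Cnt n m z = (\<Sum>y<n. if Wf (y * n + z) \<noteq> 0
   then (\<Sum>g<Cnt y. card (coll2 Vf n z m S (Wf (y * n + z)) (Lst (y * n + g)))) else 0)"

definition ffalse :: "nat => nat => nat => nat => nat => bool" where
 "ffalse S m u v w \<longleftrightarrow> u \<noteq> 0 \<and> v \<noteq> 0 \<and> w \<noteq> 0 \<and> (u + v + w) mod m = S mod m \<and> u + v + w \<noteq> S"

lemma ffalse_rotate: "ffalse S m u v w \<longleftrightarrow> ffalse S m v w u" "ffalse S m u v w \<longleftrightarrow> ffalse S m u w v"
 by (auto simp: ffalse_def ac_simps)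

lemma tgt_iff:
 assumes "w + u \<le> 2 * S" "m > 0"
 shows "v mod m = tgt S m w u \<longleftrightarrow> (u + v + w) mod m = S mod m"
proof -
 let ?x = "S + m * S - w - u"
 have "1 * S \<le> m * S" using assms(2) by (intro mult_le_mono1) simp
 then have x: "?x + (w + u) = S + m * S" using assms(1) by linarith
 have "v mod m = tgt S m w u \<longleftrightarrow> [v = ?x] (mod m)" by (simp add: tgt_def unique_euclidean_semiring_class.cong_def)
 also have "\<dots> \<longleftrightarrow> [v + (w + u) = ?x + (w + u)] (mod m)" by (simp only: cong_add_rcancel_nat)
 also have "\<dots> \<longleftrightarrow> (u + v + w) mod m = S mod m" unfolding x by (simp add: unique_euclidean_semiring_class.cong_def ac_simps)
 finally show ?thesis .
qed

lemma wp_rowlf: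
 assumes s: "vr s vN = n" "vr s iz = z" "vr s iq = m" "vr s vS = S" "vr s vOy = oy" "vr s vOx = ox" "vr s vOz = oz"
   "vr s vMOD = M" "vr s vDL = D" "D \<le> M" "M > 0" "M \<le> Z" "n \<le> Z" "m > 0" "m \<le> Z" "z < n"
  and G: "grp (ar s aBkt) (ar s aGv) (ar s aGl) (ar s aMb) n m (vals Vf n z m n) (mems Vf n z n)"
  and L: "\<And>y. y < n \<Longrightarrow> listed (ar s aLst) n y (ar s aCnt y) (rowv (ar s aU) n y n)" "\<And>y. y < n \<Longrightarrow> ar s aCnt y \<le> cap" "\<And>y. y < n \<Longrightarrow> ar s aCnt y \<le> n"
  and Z: "\<And>x. x < n * n \<Longrightarrow> ar s aU x \<le> B" "\<And>x. x < n * n \<Longrightarrow> ar s aW x \<le> B" "B \<le> Z" "B \<le> S"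
  and o: "\<And>x y. x < n \<Longrightarrow> y < n \<Longrightarrow> oy * y + ox * x + oz * z \<le> Z"
 shows "wp bb Z rowlf s (\<lambda>s' t. dec M D (ar s aOut) (ar s' aOut)
   (\<lambda>k. \<Sum>y<n. \<Sum>x<n. of_bool (ffalse S m (ar s aU (y * n + x)) (Vf (x * n + z)) (ar s aW (y * n + z)) \<and> k = oy * y + ox * x + oz * z)) \<and>
   t \<le> 9 * cost2 Vf (ar s aW) S (ar s aLst) (ar s aCnt) n m z + n * (7 * cap + 5) + 1)"
proof -
 let ?w = "\<lambda>y. ar s aW (y * n + z)" and ?u = "\<lambda>y g. ar s aLst (y * n + g)"
 let ?o = "\<lambda>y x. oy * y + ox * x + oz * z"
 let ?c = "\<lambda>y k u. \<Sum>x\<in>coll2 Vf n z m S (?w y) u. of_bool (ar s aU (y * n + x) = u \<and> k = ?o y x) :: nat"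
 let ?C = "\<lambda>y. if ?w y \<noteq> 0 then (\<Sum>g<ar s aCnt y. card (coll2 Vf n z m S (?w y) (?u y g))) else 0"
 \<comment> \<open>A present entry U[y, x] is a listed weight, and it is listed exactly once; hence
   going through the list finds every false triangle (y, x, z) exactly once.\<close>
 have conv: "(if ?w y \<noteq> 0 then (\<Sum>g<ar s aCnt y. ?c y k (?u y g)) else 0) =
   (\<Sum>x<n. of_bool (ffalse S m (ar s aU (y * n + x)) (Vf (x * n + z)) (?w y) \<and> k = ?o y x))" if y: "y < n" for y k
 proof (cases "?w y = 0")
  case True
  then show ?thesis by (simp add: ffalse_def)
 next
  case False
  let ?R = "rowv (ar s aU) n y n"
  have wB: "?w y \<le> B" using Z(2) mult_add_less[OF y s(16)] by simp
  have uB: "u \<le> B" if "u \<in> ?R" for u using that Z(1) y mult_add_less[OF y] by (auto simp: rowv_def)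
  have tg: "v mod m = tgt S m (?w y) u \<longleftrightarrow> (u + v + ?w y) mod m = S mod m" if "u \<in> ?R" for u v
   using tgt_iff[of "?w y" u S m v] wB uB[OF that] Z(4) s(14) by simp
  have c: "?c y k u = (\<Sum>x<n. of_bool (ar s aU (y * n + x) = u \<and> ffalse S m (ar s aU (y * n + x)) (Vf (x * n + z)) (?w y) \<and> k = ?o y x))"
   if u: "u \<in> ?R" for u
  proof (rule sum.mono_neutral_cong_left)
   show "\<forall>x\<in>{..<n} - coll2 Vf n z m S (?w y) u. of_bool (ar s aU (y * n + x) = u \<and> ffalse S m (ar s aU (y * n + x)) (Vf (x * n + z)) (?w y) \<and> k = ?o y x) = (0 :: nat)"
    using tg[OF u] by (auto simp: coll2_def ffalse_def ac_simps)
   fix x assume "x \<in> coll2 Vf n z m S (?w y) u"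
   then show "of_bool (ar s aU (y * n + x) = u \<and> k = ?o y x) = (of_bool (ar s aU (y * n + x) = u \<and> ffalse S m (ar s aU (y * n + x)) (Vf (x * n + z)) (?w y) \<and> k = ?o y x) :: nat)"
    using tg[OF u] u False by (auto simp: coll2_def ffalse_def rowv_def ac_simps)
  qed (auto simp: coll2_def)
  have "(\<Sum>g<ar s aCnt y. ?c y k (?u y g)) = (\<Sum>u\<in>?R. ?c y k u)"
   by (rule listed_sum[OF L(1)[OF y]])
  also have "\<dots> = (\<Sum>u\<in>?R. \<Sum>x<n. of_bool (ar s aU (y * n + x) = u \<and> ffalse S m (ar s aU (y * n + x)) (Vf (x * n + z)) (?w y) \<and> k = ?o y x))"
   by (intro sum.cong refl c)
  also have "\<dots> = (\<Sum>x<n. \<Sum>u\<in>?R. of_bool (ar s aU (y * n + x) = u \<and> ffalse S m (ar s aU (y * n + x)) (Vf (x * n + z)) (?w y) \<and> k = ?o y x))"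
   by (rule sum.swap)
  also have "\<dots> = (\<Sum>x<n. of_bool (ffalse S m (ar s aU (y * n + x)) (Vf (x * n + z)) (?w y) \<and> k = ?o y x))"
  proof (intro sum.cong refl)
   fix x assume x: "x \<in> {..<n}"
   have "(\<Sum>u\<in>?R. of_bool (ar s aU (y * n + x) = u \<and> ffalse S m (ar s aU (y * n + x)) (Vf (x * n + z)) (?w y) \<and> k = ?o y x)) =
     (\<Sum>u\<in>?R. if ar s aU (y * n + x) = u then of_bool (ffalse S m (ar s aU (y * n + x)) (Vf (x * n + z)) (?w y) \<and> k = ?o y x) else 0 :: nat)"
    by (intro sum.cong) auto
   also have "\<dots> = of_bool (ffalse S m (ar s aU (y * n + x)) (Vf (x * n + z)) (?w y) \<and> k = ?o y x)"
    using x by (auto simp: rowv_def ffalse_def)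
   finally show "(\<Sum>u\<in>?R. of_bool (ar s aU (y * n + x) = u \<and> ffalse S m (ar s aU (y * n + x)) (Vf (x * n + z)) (?w y) \<and> k = ?o y x)) =
     (of_bool (ffalse S m (ar s aU (y * n + x)) (Vf (x * n + z)) (?w y) \<and> k = ?o y x) :: nat)" .
  qed
  finally show ?thesis using False by simp
 qed
 show ?thesis
  unfolding rowlf_def
 proof (rule wp_For[where I = "\<lambda>i s' t. dec M D (ar s aOut) (ar s' aOut) (\<lambda>k. \<Sum>y<i. if ?w y \<noteq> 0 then (\<Sum>g<ar s aCnt y. ?c y k (?u y g)) else 0) \<and>
   t \<le> 9 * (\<Sum>y<i. ?C y) + i * (7 * cap + 5)"], goal_cases)
  case (3 y s1 t1)
  have f1: "vr s1 vN = n" "vr s1 iz = z" "vr s1 iq = m" "vr s1 vS = S" "vr s1 vOy = oy" "vr s1 vOx = ox" "vr s1 vOz = oz"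
   "vr s1 vMOD = M" "vr s1 vDL = D" "ar s1 aBkt = ar s aBkt" "ar s1 aGv = ar s aGv" "ar s1 aGl = ar s aGl" "ar s1 aMb = ar s aMb"
   "ar s1 aLst = ar s aLst" "ar s1 aCnt = ar s aCnt" "ar s1 aU = ar s aU" "ar s1 aW = ar s aW"
   using 3(3) s by (simp_all add: frame_def)
  have y: "y < n" using 3(1) s by simp
  have yz: "y * n + z < n * n" using y s by (intro mult_add_less)
  have wZ: "?w y \<le> Z" using Z yz order.trans by blast
  note I1 = 3(2)
  show ?case
  proof (cases "?w y = 0")
   case True
   then show ?thesis using f1 I1 wZ by (simp add: wp_Seq wp_If)
  next
   case False
   let ?s = "set_var ib (?w y) (set_var iy y s1)"
   have lp: "wp bb Z (For ig (Arr aCnt (V iy)) bucketf) ?s (\<lambda>s' t. dec M D (ar s1 aOut) (ar s' aOut) (\<lambda>k. \<Sum>g<ar s aCnt y. ?c y k (?u y g)) \<and>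
     t \<le> 9 * (\<Sum>g<ar s aCnt y. card (coll2 Vf n z m S (?w y) (?u y g))) + 7 * ar s aCnt y + 1)"
   proof (rule wp_For[where I = "\<lambda>i s' t. dec M D (ar s1 aOut) (ar s' aOut) (\<lambda>k. \<Sum>g<i. ?c y k (?u y g)) \<and>
     t \<le> 9 * (\<Sum>g<i. card (coll2 Vf n z m S (?w y) (?u y g))) + 7 * i"], goal_cases)
    case (3 g s2 t2)
    have f2: "vr s2 vN = n" "vr s2 iz = z" "vr s2 iy = y" "vr s2 ib = ?w y" "vr s2 iq = m" "vr s2 vS = S" "vr s2 vOy = oy" "vr s2 vOx = ox" "vr s2 vOz = oz"
     "vr s2 vMOD = M" "vr s2 vDL = D" "ar s2 aBkt = ar s aBkt" "ar s2 aGv = ar s aGv" "ar s2 aGl = ar s aGl" "ar s2 aMb = ar s aMb"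
     "ar s2 aLst = ar s aLst" "ar s2 aU = ar s aU"
     using 3(3) f1 by (simp_all add: frame_def)
    have g: "g < ar s aCnt y" using 3(1) f1 by simp
    have "?u y g \<in> rowv (ar s aU) n y n" using L(1)[OF y] g by (auto simp: listed_def)
    then have "?u y g \<le> B" using Z(1) mult_add_less[OF y] by (auto simp: rowv_def)
    then have uZ: "?u y g \<le> Z" using Z by linarith
    have "wp bb Z bucketf (set_var ig g s2) (\<lambda>s' t. dec M D (ar s2 aOut) (ar s' aOut) (\<lambda>k. ?c y k (?u y g)) \<and>
      t \<le> 9 * card (coll2 Vf n z m S (?w y) (?u y g)) + 6)"
     using wp_bucketf[of "set_var ig g s2" n y z g "?w y" m S oy ox oz M D Z Vf "?u y g" bb] f2 s G uZ o y by simp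
    then show ?case
    proof (rule wp_conseq, goal_cases)
     case (1 s' t)
     show ?case using dec_trans[OF conjunct1[OF 3(2)] conjunct1[OF 1(1)]] 3(2) 1(1) by simp
    qed
   next
    case 1
    show ?case using f1 L(3)[OF y] s by simp
   next
    case (4 s' t)
    then show ?case using f1 by simp
   qed (simp add: dec_refl)
   have "7 * ar s aCnt y \<le> 7 * cap" using L(2)[OF y] by simp
   then show ?thesis
    using f1 False wZ
   proof (simp add: wp_Seq wp_If, intro wp_conseq[OF lp], goal_cases)
    case (1 s' t)
    have d: "dec M D (ar s1 aOut) (ar s' aOut) (\<lambda>k. \<Sum>g<ar s aCnt y. ?c y k (?u y g))" using 1 by simp
    show ?case using dec_trans[OF conjunct1[OF I1] d] I1 1 False by simp
   qed
  qed
 next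
  case (4 s' t)
  have "(\<lambda>k. \<Sum>y<n. if ?w y \<noteq> 0 then (\<Sum>g<ar s aCnt y. ?c y k (?u y g)) else 0) =
   (\<lambda>k. \<Sum>y<n. \<Sum>x<n. of_bool (ffalse S m (ar s aU (y * n + x)) (Vf (x * n + z)) (?w y) \<and> k = ?o y x))"
   by (intro ext sum.cong refl conv) simp
  then show ?case using 4(1) s by (simp add: cost2_def)
 qed (use s in \<open>auto simp: dec_refl\<close>)
qed

definition falsef :: com where
 "falsef = (iq :=: V vM ;; For iz (V vN) (grpf ;; rowlf))"

lemma falsef_writes [simp]: "wv falsef = {iq, iz, iy, ib, ig, ia, ic, il, ie, ix, ih}" "wa falsef = {aBkt, aGv, aGl, aMb, aOut}" "wio falsef = False"
 by (auto simp: falsef_def)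

lemma wp_falsef:
 assumes s: "vr s vN = n" "vr s vM = m" "vr s vS = S" "vr s vOy = oy" "vr s vOx = ox" "vr s vOz = oz"
   "vr s vMOD = M" "vr s vDL = D" "D \<le> M" "M > 0" "M \<le> Z" "n \<le> Z" "m > 0" "m \<le> Z"
  and L: "\<And>y. y < n \<Longrightarrow> listed (ar s aLst) n y (ar s aCnt y) (rowv (ar s aU) n y n)" "\<And>y. y < n \<Longrightarrow> ar s aCnt y \<le> cap" "\<And>y. y < n \<Longrightarrow> ar s aCnt y \<le> n"
  and Z: "\<And>x. x < n * n \<Longrightarrow> ar s aU x \<le> B" "\<And>x. x < n * n \<Longrightarrow> ar s aV x \<le> B" "\<And>x. x < n * n \<Longrightarrow> ar s aW x \<le> B" "B \<le> Z" "B \<le> S"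
  and o: "\<And>x y z. x < n \<Longrightarrow> y < n \<Longrightarrow> z < n \<Longrightarrow> oy * y + ox * x + oz * z \<le> Z"
 shows "wp bb Z falsef s (\<lambda>s' t. dec M D (ar s aOut) (ar s' aOut)
   (\<lambda>k. \<Sum>z<n. \<Sum>y<n. \<Sum>x<n. of_bool (ffalse S m (ar s aU (y * n + x)) (ar s aV (x * n + z)) (ar s aW (y * n + z)) \<and> k = oy * y + ox * x + oz * z)) \<and>
   t \<le> 9 * (\<Sum>z<n. (\<Sum>x<n. coll1 (ar s aV) n z m x) + cost2 (ar s aV) (ar s aW) S (ar s aLst) (ar s aCnt) n m z) +
    n * (2 * m + 18 * n + n * (7 * cap + 5) + 4) + 2)"
proof -
 let ?f = "\<lambda>z k. \<Sum>y<n. \<Sum>x<n. of_bool (ffalse S m (ar s aU (y * n + x)) (ar s aV (x * n + z)) (ar s aW (y * n + z)) \<and> k = oy * y + ox * x + oz * z) :: nat"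
 let ?c = "\<lambda>z. (\<Sum>x<n. coll1 (ar s aV) n z m x) + cost2 (ar s aV) (ar s aW) S (ar s aLst) (ar s aCnt) n m z"
 let ?T = "2 * m + 18 * n + n * (7 * cap + 5) + 4"
 have "wp bb Z (For iz (V vN) (grpf ;; rowlf)) (set_var iq m s) (\<lambda>s' t. dec M D (ar s aOut) (ar s' aOut) (\<lambda>k. \<Sum>z<n. ?f z k) \<and>
   t \<le> 9 * (\<Sum>z<n. ?c z) + n * ?T + 1)"
 proof (rule wp_For[where I = "\<lambda>i s' t. dec M D (ar s aOut) (ar s' aOut) (\<lambda>k. \<Sum>z<i. ?f z k) \<and> t \<le> 9 * (\<Sum>z<i. ?c z) + i * ?T"], goal_cases)
  case (3 z s1 t1)
  have f1: "vr s1 vN = n" "vr s1 iq = m" "vr s1 vS = S" "vr s1 vOy = oy" "vr s1 vOx = ox" "vr s1 vOz = oz"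
   "vr s1 vMOD = M" "vr s1 vDL = D" "ar s1 aLst = ar s aLst" "ar s1 aCnt = ar s aCnt" "ar s1 aU = ar s aU" "ar s1 aV = ar s aV" "ar s1 aW = ar s aW"
   using 3(3) s by (simp_all add: frame_def)
  have z: "z < n" using 3(1) s by simp
  note I1 = 3(2)
  note BZ = Z(1-3)[THEN order.trans[OF _ Z(4)]]
  show ?case
   unfolding wp_Seq
  proof (rule wp_conseq[OF wp_grpf[of _ n z m Z "ar s aV"]], goal_cases)
   case (10 s2 t2)
   have f2: "vr s2 vN = n" "vr s2 iz = z" "vr s2 iq = m" "vr s2 vS = S" "vr s2 vOy = oy" "vr s2 vOx = ox" "vr s2 vOz = oz"
    "vr s2 vMOD = M" "vr s2 vDL = D" "ar s2 aLst = ar s aLst" "ar s2 aCnt = ar s aCnt" "ar s2 aU = ar s aU" "ar s2 aV = ar s aV" "ar s2 aW = ar s aW" "ar s2 aOut = ar s1 aOut"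
    using 10(2) f1 by (simp_all add: frame_def)
   have "wp bb Z rowlf s2 (\<lambda>s' t. dec M D (ar s1 aOut) (ar s' aOut) (?f z) \<and>
     t \<le> 9 * cost2 (ar s aV) (ar s aW) S (ar s aLst) (ar s aCnt) n m z + n * (7 * cap + 5) + 1)"
    using wp_rowlf[of s2 n z m S oy ox oz M D Z "ar s aV" cap B bb] f2 s L Z o z 10(1) by simp
   then show ?case
   proof (rule wp_conseq, goal_cases)
    case (1 s' t)
    have "t2 \<le> 2 * m + 2 + (3 * (\<Sum>x<n. coll1 (ar s aV) n z m x) + 18 * n)"
     using 10(1) by (simp add: sum.distrib sum_distrib_left)
    then show ?case using dec_trans[OF conjunct1[OF I1] conjunct1[OF 1(1)]] I1 1(1) by simp
   qed
  qed (use f1 s z BZ in auto)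
 qed (use s in \<open>auto simp: dec_refl\<close>)
 then show ?thesis using s unfolding falsef_def wp_Seq wp_simps by (auto elim!: wp_conseq)
qed

subsection \<open>Selecting the role\<close>

text \<open>In \<open>Role a1 t1 a2 t2 a3 t3 ey ex ez\<close> the arrays \<open>a1\<close>, \<open>a2\<close>, \<open>a3\<close>, transposed where the flag \<open>t1\<close>, \<open>t2\<close>, \<open>t3\<close> is set,
 are used as \<open>U[y, x]\<close>, \<open>V[x, z]\<close>, \<open>W[y, z]\<close> with few weights in each row of \<open>U\<close>; the triangle \<open>(y, x, z)\<close>
 belongs to the output cell \<open>ey * y + ex * x + ez * z\<close>.\<close>

datatype role = Role nat bool nat bool nat bool exp exp exp

fun tryf :: "role => com" where
 "tryf (Role a1 t1 a2 t2 a3 t3 ey ex ez) = (rolef a1 t1 a2 t2 a3 t3 ;; vOy :=: ey ;; vOx :=: ex ;; vOz :=: ez ;; distf (V vCap))"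

fun rself :: "role list => com" where
 "rself [] = Skip"
| "rself (r # rs) = (tryf r ;; If (V vOk) Skip (rself rs))"

text \<open>One role for each of the six matrices in \<open>d_weights\<close>. The names (y, x, z)
  run through all permutations of (i, k, j), and the last three expressions rebuild the address i *
  n + j.\<close>

definition roles :: "role list" where
 "roles = [Role aA False aB False aC False (V vN) (N 0) (N 1), Role aA True aC False aB False (N 0) (V vN) (N 1),
   Role aB False aC True aA True (N 0) (N 1) (V vN), Role aB True aA True aC True (N 1) (N 0) (V vN),
   Role aC False aB True aA False (V vN) (N 1) (N 0), Role aC True aA False aB True (N 1) (V vN) (N 0)]"

lemma tryf_writes [simp]: "wv (tryf r) = {ix, iy, vOy, vOx, vOz, ib, ic, iz, id1, vOk}" "wa (tryf r) = {aU, aV, aW, aLst, aCnt}" "wio (tryf r) = False"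
 by (cases r; auto)+

lemma rself_writes: "wv (rself rs) \<subseteq> {ix, iy, vOy, vOx, vOz, ib, ic, iz, id1, vOk}" "wa (rself rs) \<subseteq> {aU, aV, aW, aLst, aCnt}" "wio (rself rs) = False"
 by (induction rs) auto

fun few :: "nat => nat => st => role => bool" where
 "few n cap s (Role a1 t1 a2 t2 a3 t3 ey ex ez) \<longleftrightarrow>
   (\<forall>y<n. card ((\<lambda>x. ar s a1 (pos_of t1 n y x)) ` {..<n} - {0}) \<le> cap)"

fun loaded :: "nat => st => st => role => bool" where
 "loaded n s s' (Role a1 t1 a2 t2 a3 t3 ey ex ez) \<longleftrightarrow> (\<forall>i<n. \<forall>j<n.
   ar s' aU (i * n + j) = ar s a1 (pos_of t1 n i j) \<and> ar s' aV (i * n + j) = ar s a2 (pos_of t2 n i j) \<and>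
   ar s' aW (i * n + j) = ar s a3 (pos_of t3 n i j)) \<and> vr s' vOy = eval ey s \<and> vr s' vOx = eval ex s \<and> vr s' vOz = eval ez s"

fun okrole :: "role => bool" where
 "okrole (Role a1 t1 a2 t2 a3 t3 ey ex ez) \<longleftrightarrow> {a1, a2, a3} = {aA, aB, aC} \<and> {ey, ex, ez} \<subseteq> {V vN, N 0, N 1}"

lemma pos_of_less: "i < n \<Longrightarrow> j < n \<Longrightarrow> pos_of tr n i j < n * n"
 by (auto simp: pos_of_def intro: mult_add_less)

lemma rowv_le: "card (rowv Uf n y n) \<le> n"
proof -
 have "card (rowv Uf n y n) \<le> card ((\<lambda>x. Uf (y * n + x)) ` {..<n})" unfolding rowv_def by (intro card_mono) auto
 also have "\<dots> \<le> n" using card_image_le[of "{..<n}" "\<lambda>x. Uf (y * n + x)"] by simp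
 finally show ?thesis .
qed

definition trytime :: "nat => nat => nat" where
 "trytime n cap = n * (n * 4 + 2) + n * (n * (3 * cap + 9) + 5) + 7"

lemma wp_tryf:
 assumes s: "vr s vN = n" "vr s vCap = cap" "n \<le> Z" "n * n \<le> Z" "1 \<le> Z" "okrole r"
  and Z: "\<And>a x. a \<in> {aA, aB, aC} \<Longrightarrow> x < n * n \<Longrightarrow> ar s a x \<le> Z"
 shows "wp bb Z (tryf r) s (\<lambda>s' t. loaded n s s' r \<and> vr s' vOk \<le> 1 \<and> (few n cap s r \<longrightarrow> vr s' vOk = 1) \<and>
   (vr s' vOk = 1 \<longrightarrow> (\<forall>y<n. listed (ar s' aLst) n y (ar s' aCnt y) (rowv (ar s' aU) n y n) \<and> ar s' aCnt y \<le> cap)) \<and> t \<le> trytime n cap)"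
proof (cases r)
 case (Role a1 t1 a2 t2 a3 t3 ey ex ez)
 have a: "a1 \<in> {aA, aB, aC}" "a2 \<in> {aA, aB, aC}" "a3 \<in> {aA, aB, aC}" "ey \<in> {V vN, N 0, N 1}" "ex \<in> {V vN, N 0, N 1}" "ez \<in> {V vN, N 0, N 1}"
  using s(6) unfolding Role by auto
 have ee: "eval e s' = eval e s \<and> eval e s \<le> Z" if "e \<in> {V vN, N 0, N 1}" "vr s' vN = vr s vN" for e s' using that s by auto
 have na: "a1 \<notin> {aU, aV, aW}" "a2 \<notin> {aU, aV, aW}" "a3 \<notin> {aU, aV, aW}" using a(1) a(2) a(3) by simp_all presburger+
 have aZ: "\<And>a x. a \<in> {a1, a2, a3} \<Longrightarrow> x < n * n \<Longrightarrow> ar s a x \<le> Z" using a(1-3) Z by blast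
 show ?thesis
  unfolding Role tryf.simps wp_Seq
 proof (rule wp_conseq[OF wp_rolef[of s n]], goal_cases)
  case (7 s1 t1')
  have f1: "vr s1 vN = n" "vr s1 vCap = cap" using 7(2) s by (simp_all add: frame_def)
  let ?s = "set_var vOz (eval ez s) (set_var vOx (eval ex s) (set_var vOy (eval ey s) s1))"
  have UZ: "ar s1 aU x \<le> Z" if "x < n * n" for x
  proof -
   have n: "n > 0" using that by (auto intro: Nat.gr0I)
   have "x div n < n" "x mod n < n" using that n by (auto simp: less_mult_imp_div_less)
   then have "ar s1 aU (x div n * n + x mod n) = ar s a1 (pos_of t1 n (x div n) (x mod n))" "pos_of t1 n (x div n) (x mod n) < n * n"
    using conjunct1[OF 7(1), rule_format, THEN conjunct1] by (blast intro: pos_of_less)+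
   then show ?thesis using Z a by simp
  qed
  have dw: "wp bb Z (distf (V vCap)) ?s (\<lambda>s' t. vr s' vOk \<le> 1 \<and>
   (vr s' vOk = 1 \<longrightarrow> (\<forall>y<n. listed (ar s' aLst) n y (ar s' aCnt y) (rowv (ar s1 aU) n y n) \<and> ar s' aCnt y \<le> cap)) \<and>
   ((\<forall>y<n. card (rowv (ar s1 aU) n y n) \<le> cap) \<longrightarrow> vr s' vOk = 1) \<and> t \<le> n * (n * (3 * cap + 9) + 5) + 3)"
   using wp_distf[of ?s n Z "V vCap" cap bb] f1 s UZ by simp
  have rv: "rowv (ar s1 aU) n y n = (\<lambda>x. ar s a1 (pos_of t1 n y x)) ` {..<n} - {0}" if "y < n" for y
   unfolding rowv_def using 7(1) that by (intro arg_cong[where f = "\<lambda>X. X - {0}"] image_cong) auto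
  have e: "eval ey s1 = eval ey s" "eval ex (set_var vOy (eval ey s) s1) = eval ex s" "eval ez (set_var vOx (eval ex s) (set_var vOy (eval ey s) s1)) = eval ez s"
   "eval ey s \<le> Z" "eval ex s \<le> Z" "eval ez s \<le> Z"
   using ee[OF a(4), of s1] ee[OF a(5), of "set_var vOy (eval ey s) s1"] ee[OF a(6), of "set_var vOx (eval ex s) (set_var vOy (eval ey s) s1)"] f1 s
   by simp_all
  show ?case
   unfolding wp_simps e
  proof (intro conjI e(4-6), rule wp_conseq[OF dw], goal_cases)
   case (1 s' t)
   have f: "ar s' aU = ar s1 aU" "ar s' aV = ar s1 aV" "ar s' aW = ar s1 aW" "vr s' vOy = eval ey s" "vr s' vOx = eval ex s" "vr s' vOz = eval ez s"
    using 1(2) by (simp_all add: frame_def)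
   show ?case
    using 1(1) f 7(1) rv by (auto simp: trytime_def)
  qed
 qed (fact s na aZ)+
qed

text \<open>A failing role overwrites working arrays only and leaves the normalised input intact, so
  the next role starts afresh.\<close>

lemma wp_rself:
 assumes "vr s vN = n" "vr s vCap = cap" "n \<le> Z" "n * n \<le> Z" "1 \<le> Z" "\<And>r. r \<in> set rs \<Longrightarrow> okrole r"
  and Z: "\<And>a x. a \<in> {aA, aB, aC} \<Longrightarrow> x < n * n \<Longrightarrow> ar s a x \<le> Z"
  and few: "\<exists>r\<in>set rs. few n cap s r"
 shows "wp bb Z (rself rs) s (\<lambda>s' t. (\<exists>r\<in>set rs. loaded n s s' r) \<and>
   (\<forall>y<n. listed (ar s' aLst) n y (ar s' aCnt y) (rowv (ar s' aU) n y n) \<and> ar s' aCnt y \<le> cap) \<and> t \<le> length rs * (trytime n cap + 2))"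
 using assms
proof (induction rs arbitrary: s)
 case (Cons r rs)
 have w: "wp bb Z (tryf r) s (\<lambda>s' t. loaded n s s' r \<and> vr s' vOk \<le> 1 \<and> (few n cap s r \<longrightarrow> vr s' vOk = 1) \<and>
   (vr s' vOk = 1 \<longrightarrow> (\<forall>y<n. listed (ar s' aLst) n y (ar s' aCnt y) (rowv (ar s' aU) n y n) \<and> ar s' aCnt y \<le> cap)) \<and> t \<le> trytime n cap)"
  using Cons.prems by (intro wp_tryf) auto
 show ?case
  unfolding rself.simps wp_Seq
 proof (rule wp_conseq[OF w], goal_cases)
  case (1 s1 t1)
  have f: "vr s1 vN = n" "vr s1 vCap = cap" "\<And>a. a \<in> {aA, aB, aC} \<Longrightarrow> ar s1 a = ar s a" using 1(2) Cons.prems by (auto simp: frame_def)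
  have okr: "okrole r'" if "r' \<in> set rs" for r' using Cons.prems(6) that by simp
  have fe: "few n cap s1 r' = few n cap s r'" if "okrole r'" for r'
  proof (cases r')
   case (Role a1 t1 a2 t2 a3 t3 ey ex ez)
   have "a1 \<in> {aA, aB, aC}" using that unfolding Role by auto
   then show ?thesis using f(3)[of a1] unfolding Role by simp
  qed
  have lo: "loaded n s1 s' r' = loaded n s s' r'" if ok: "okrole r'" for r' s'
  proof (cases r')
   case (Role a1 t1 a2 t2 a3 t3 ey ex ez)
   have a: "a1 \<in> {aA, aB, aC}" "a2 \<in> {aA, aB, aC}" "a3 \<in> {aA, aB, aC}" using ok unfolding Role by auto
   have E: "ey \<in> {V vN, N 0, N 1}" "ex \<in> {V vN, N 0, N 1}" "ez \<in> {V vN, N 0, N 1}" using ok unfolding Role by simp_all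
   have "eval e s1 = eval e s" if "e \<in> {V vN, N 0, N 1}" for e using that f(1) Cons.prems(1) by auto
   from this[OF E(1)] this[OF E(2)] this[OF E(3)] have "eval ey s1 = eval ey s" "eval ex s1 = eval ex s" "eval ez s1 = eval ez s" .
   then show ?thesis using f(3)[OF a(1)] f(3)[OF a(2)] f(3)[OF a(3)] unfolding Role by simp
  qed
  show ?case
  proof (cases "vr s1 vOk = 0")
   case False
   then show ?thesis using 1(1) by (auto simp: wp_If)
  next
   case True
   then have nf: "\<not> few n cap s r" using 1(1) by auto
   then have ex: "\<exists>r'\<in>set rs. few n cap s1 r'" using Cons.prems(8) fe okr by auto
   have "wp bb Z (rself rs) s1 (\<lambda>s' t. (\<exists>r\<in>set rs. loaded n s1 s' r) \<and>
     (\<forall>y<n. listed (ar s' aLst) n y (ar s' aCnt y) (rowv (ar s' aU) n y n) \<and> ar s' aCnt y \<le> cap) \<and> t \<le> length rs * (trytime n cap + 2))"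
    using f Cons.prems okr ex by (intro Cons.IH) auto
   then have "wp bb Z (rself rs) s1 (\<lambda>s' t. (\<exists>r\<in>set (r # rs). loaded n s s' r) \<and>
     (\<forall>y<n. listed (ar s' aLst) n y (ar s' aCnt y) (rowv (ar s' aU) n y n) \<and> ar s' aCnt y \<le> cap) \<and> t1 + Suc t \<le> length (r # rs) * (trytime n cap + 2))"
    by (rule wp_conseq) (use 1(1) lo okr in auto)
   then show ?thesis using True by (simp add: wp_If)
  qed
 qed
qed simp

section \<open>Counting false triangles independently of the role\<close>

lemma sum3_swap: "(\<Sum>z<n. \<Sum>y<n. \<Sum>x<n. f z y x) = (\<Sum>z<n. \<Sum>y<n. \<Sum>x<n. f y z x)"
 "(\<Sum>z<n. \<Sum>y<n. \<Sum>x<n. f z y x) = (\<Sum>z<n. \<Sum>y<n. \<Sum>x<n. f z x y)" for f :: "nat => nat => nat => nat"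
 by (rule sum.swap) (intro sum.cong refl sum.swap)

lemma sum3_collapse:
 fixes F :: "nat => nat => nat => bool"
 assumes "i < n" "j < n"
 shows "(\<Sum>i'<n. \<Sum>k<n. \<Sum>j'<n. of_bool (F i' k j' \<and> i * n + j = i' * n + j')) = card {k. k < n \<and> F i k j}"
proof -
 have "(\<Sum>i'<n. \<Sum>k<n. \<Sum>j'<n. of_bool (F i' k j' \<and> i * n + j = i' * n + j')) =
   (\<Sum>i'<n. if i' = i then \<Sum>k<n. \<Sum>j'<n. if j' = j then of_bool (F i' k j') else 0 else 0)"
  by (intro sum.cong refl, split if_split, intro conjI impI sum.cong refl sum.neutral ballI)
   (use assms idx_eq[of j n _ i] in auto)
 also have "\<dots> = (\<Sum>k<n. of_bool (F i k j))" using assms by simp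
 also have "\<dots> = card {k. k < n \<and> F i k j}" by (simp add: of_bool_def sum.If_cases Int_def lessThan_def)
 finally show ?thesis .
qed

text \<open>A role only renames the three summation indices and permutes the three weights, in which
  \<open>ffalse\<close> is symmetric.\<close>

lemma false_count:
 assumes "r \<in> set roles" "loaded n s s' r" "vr s vN = n" "i < n" "j < n"
 shows "(\<Sum>z<n. \<Sum>y<n. \<Sum>x<n. of_bool (ffalse S m (ar s' aU (y * n + x)) (ar s' aV (x * n + z)) (ar s' aW (y * n + z)) \<and>
   i * n + j = vr s' vOy * y + vr s' vOx * x + vr s' vOz * z)) =
  card {k. k < n \<and> ffalse S m (ar s aA (i * n + k)) (ar s aB (k * n + j)) (ar s aC (i * n + j))}"
proof -
 let ?G = "\<lambda>i k j. ffalse S m (ar s aA (i * n + k)) (ar s aB (k * n + j)) (ar s aC (i * n + j))"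
 let ?g = "\<lambda>i' k j'. of_bool (?G i' k j' \<and> i * n + j = i' * n + j') :: nat"
 let ?L = "\<lambda>z y x. of_bool (ffalse S m (ar s' aU (y * n + x)) (ar s' aV (x * n + z)) (ar s' aW (y * n + z)) \<and>
   i * n + j = vr s' vOy * y + vr s' vOx * x + vr s' vOz * z) :: nat"
 note rot = ffalse_rotate
 have t: "(\<Sum>z<n. \<Sum>y<n. \<Sum>x<n. ?L z y x) = (\<Sum>z<n. \<Sum>y<n. \<Sum>x<n. h z y x)"
  if "\<And>z y x. z < n \<Longrightarrow> y < n \<Longrightarrow> x < n \<Longrightarrow> ?L z y x = h z y x" for h
  using that by (intro sum.cong refl) auto
 have c: "(\<Sum>i'<n. \<Sum>k<n. \<Sum>j'<n. ?g i' k j') = card {k. k < n \<and> ?G i k j}" by (rule sum3_collapse[OF assms(4,5)])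
 have p1: "(\<Sum>z<n. \<Sum>y<n. \<Sum>x<n. ?g y x z) = (\<Sum>i'<n. \<Sum>k<n. \<Sum>j'<n. ?g i' k j')"
  by (subst sum3_swap(1)) (rule sum3_swap(2))
 have p2: "(\<Sum>z<n. \<Sum>y<n. \<Sum>x<n. ?g x y z) = (\<Sum>i'<n. \<Sum>k<n. \<Sum>j'<n. ?g i' k j')"
  by (subst sum3_swap(2)) (rule p1)
 have p3: "(\<Sum>z<n. \<Sum>y<n. \<Sum>x<n. ?g z x y) = (\<Sum>i'<n. \<Sum>k<n. \<Sum>j'<n. ?g i' k j')"
  by (rule sum3_swap(2))
 have p4: "(\<Sum>z<n. \<Sum>y<n. \<Sum>x<n. ?g y z x) = (\<Sum>i'<n. \<Sum>k<n. \<Sum>j'<n. ?g i' k j')"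
  by (rule sum3_swap(1))
 have p5: "(\<Sum>z<n. \<Sum>y<n. \<Sum>x<n. ?g x z y) = (\<Sum>i'<n. \<Sum>k<n. \<Sum>j'<n. ?g i' k j')"
  by (subst sum3_swap(1)) (rule p2)
 consider "r = Role aA False aB False aC False (V vN) (N 0) (N 1)" | "r = Role aA True aC False aB False (N 0) (V vN) (N 1)"
  | "r = Role aB False aC True aA True (N 0) (N 1) (V vN)" | "r = Role aB True aA True aC True (N 1) (N 0) (V vN)"
  | "r = Role aC False aB True aA False (V vN) (N 1) (N 0)" | "r = Role aC True aA False aB True (N 1) (V vN) (N 0)"
  using assms(1) by (auto simp: roles_def)
 then show ?thesis
 proof cases
  case 1
  have "?L z y x = ?g y x z" if zyx: "z < n" "y < n" "x < n" for z y x
  proof -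
   have o: "vr s' vOy * y + vr s' vOx * x + vr s' vOz * z = y * n + z"
    using assms(2,3) unfolding 1 by (simp add: mult.commute)
   note l = assms(2)[unfolded 1 loaded.simps, THEN conjunct1, rule_format]
   show ?thesis
    unfolding o using l[OF zyx(2,3)] l[OF zyx(3,1)] l[OF zyx(2,1)]  by (simp add: pos_of_def)
  qed
  then show ?thesis using t[of "\<lambda>z y x. ?g y x z"] p1 c by simp
 next
  case 2
  have "?L z y x = ?g x y z" if zyx: "z < n" "y < n" "x < n" for z y x
  proof -
   have o: "vr s' vOy * y + vr s' vOx * x + vr s' vOz * z = x * n + z"
    using assms(2,3) unfolding 2 by (simp add: mult.commute)
   note l = assms(2)[unfolded 2 loaded.simps, THEN conjunct1, rule_format]
   show ?thesis
    unfolding o using l[OF zyx(2,3)] l[OF zyx(3,1)] l[OF zyx(2,1)] rot(2)[of S m "ar s aA (x * n + y)"] by (simp add: pos_of_def)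
  qed
  then show ?thesis using t[of "\<lambda>z y x. ?g x y z"] p2 c by simp
 next
  case 3
  have "?L z y x = ?g z y x" if zyx: "z < n" "y < n" "x < n" for z y x
  proof -
   have o: "vr s' vOy * y + vr s' vOx * x + vr s' vOz * z = z * n + x"
    using assms(2,3) unfolding 3 by (simp add: mult.commute)
   note l = assms(2)[unfolded 3 loaded.simps, THEN conjunct1, rule_format]
   show ?thesis
    unfolding o using l[OF zyx(2,3)] l[OF zyx(3,1)] l[OF zyx(2,1)] rot(1)[of S m "ar s aA (z * n + y)"] by (simp add: pos_of_def)
  qed
  then show ?thesis using t[of "\<lambda>z y x. ?g z y x"] c by simp
 next
  case 4
  have "?L z y x = ?g z x y" if zyx: "z < n" "y < n" "x < n" for z y x
  proof -
   have o: "vr s' vOy * y + vr s' vOx * x + vr s' vOz * z = z * n + y"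
    using assms(2,3) unfolding 4 by (simp add: mult.commute)
   note l = assms(2)[unfolded 4 loaded.simps, THEN conjunct1, rule_format]
   show ?thesis
    unfolding o using l[OF zyx(2,3)] l[OF zyx(3,1)] l[OF zyx(2,1)] rot(1)[of S m "ar s aA (z * n + x)"] rot(2)[of S m "ar s aB (x * n + y)"] by (simp add: pos_of_def)
  qed
  then show ?thesis using t[of "\<lambda>z y x. ?g z x y"] p3 c by simp
 next
  case 5
  have "?L z y x = ?g y z x" if zyx: "z < n" "y < n" "x < n" for z y x
  proof -
   have o: "vr s' vOy * y + vr s' vOx * x + vr s' vOz * z = y * n + x"
    using assms(2,3) unfolding 5 by (simp add: mult.commute)
   note l = assms(2)[unfolded 5 loaded.simps, THEN conjunct1, rule_format]
   show ?thesis
    unfolding o using l[OF zyx(2,3)] l[OF zyx(3,1)] l[OF zyx(2,1)] rot(1)[of S m "ar s aA (y * n + z)"] rot(1)[of S m "ar s aB (z * n + x)"] rot(2)[of S m "ar s aC (y * n + x)"] by (simp add: pos_of_def)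
  qed
  then show ?thesis using t[of "\<lambda>z y x. ?g y z x"] p4 c by simp
 next
  case 6
  have "?L z y x = ?g x z y" if zyx: "z < n" "y < n" "x < n" for z y x
  proof -
   have o: "vr s' vOy * y + vr s' vOx * x + vr s' vOz * z = x * n + y"
    using assms(2,3) unfolding 6 by (simp add: mult.commute)
   note l = assms(2)[unfolded 6 loaded.simps, THEN conjunct1, rule_format]
   show ?thesis
    unfolding o using l[OF zyx(2,3)] l[OF zyx(3,1)] l[OF zyx(2,1)] rot(1)[of S m "ar s aC (x * n + y)"] by (simp add: pos_of_def)
  qed
  then show ?thesis using t[of "\<lambda>z y x. ?g x z y"] p5 c by simp
 qed
qed

text \<open>The answers overwrite the encoding of the first matrix, which has been copied to an
  array long before.\<close>

definition outf :: com where
 "outf = For ix (V vN \<^bold>* V vN) (If (Arr aOut (V ix) \<^bold>mod V vMOD) (Write (V ix) (N 1)) (Write (V ix) (N 0)))"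

lemma wp_outf:
 assumes "vr s vN = n" "vr s vMOD = M" "n * n \<le> Z" "1 \<le> Z"
 shows "wp (6 * n * n) Z outf s (\<lambda>s' t. (\<forall>x<n * n. io s' x = of_bool (ar s aOut x mod M \<noteq> 0)) \<and> t \<le> 3 * (n * n) + 1)"
 unfolding outf_def
proof (rule wp_For[where I = "\<lambda>i s' t. (\<forall>x<i. io s' x = of_bool (ar s aOut x mod M \<noteq> 0)) \<and> t \<le> 3 * i"], goal_cases)
 case (3 i s' t)
 have f: "ar s' aOut = ar s aOut" "vr s' vMOD = M" using 3(3) assms by (simp_all add: frame_def)
 have "i < n * n" using 3(1) assms by simp
 then have "i < 6 * n * n" by simp
 then show ?case using 3(2) f assms by (auto simp: wp_If less_Suc_eq)
qed (use assms in auto)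

section \<open>The normalised instance compared with the original one\<close>

lemma ent_triangle:
 assumes car: "A \<in> carrier_mat n n" "B \<in> carrier_mat n n" "C \<in> carrier_mat n n"
  and bd: "entries_bounded (int u) A" "entries_bounded (int u) B" "entries_bounded (int u) C"
  and ikj: "i < n" "k < n" "j < n"
 shows "entA u A i k \<noteq> 0 \<and> entA u B k j \<noteq> 0 \<and> entC u C i j \<noteq> 0 \<and> entA u A i k + entA u B k j + entC u C i j = 3 * u + 3 \<longleftrightarrow>
  exact_triangle A B C i k j"
proof -
 have bA: "A $$ (i, k) = Some x \<Longrightarrow> - int u \<le> x \<and> x \<le> int u" for x using bd(1) car ikj by (auto simp: entries_bounded_def)
 have bB: "B $$ (k, j) = Some x \<Longrightarrow> - int u \<le> x \<and> x \<le> int u" for x using bd(2) car ikj by (auto simp: entries_bounded_def)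
 have bC: "C $$ (i, j) = Some x \<Longrightarrow> - int u \<le> x \<and> x \<le> int u" for x using bd(3) car ikj by (auto simp: entries_bounded_def)
 show ?thesis
 proof (cases "A $$ (i, k)"; cases "B $$ (k, j)"; cases "C $$ (i, j)")
  fix a b c assume e: "A $$ (i, k) = Some a" "B $$ (k, j) = Some b" "C $$ (i, j) = Some c"
  show ?thesis using e bA[OF e(1)] bB[OF e(2)] bC[OF e(3)] by (auto simp: exact_triangle_def entA_def entC_def)
 qed (auto simp: exact_triangle_def entA_def entC_def)
qed

lemma ent_le:
 assumes "M \<in> carrier_mat n n" "entries_bounded (int u) M" "i < n" "j < n"
 shows "entA u M i j \<le> 2 * u + 1" "entC u M i j \<le> 2 * u + 1"
proof -
 have "M $$ (i, j) = Some x \<Longrightarrow> - int u \<le> x \<and> x \<le> int u" for x using assms by (auto simp: entries_bounded_def)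
 then show "entA u M i j \<le> 2 * u + 1" "entC u M i j \<le> 2 * u + 1"
  by (cases "M $$ (i, j)"; fastforce simp: entA_def entC_def)+
qed

text \<open>A recoding g can only identify weights, and a missing entry goes to the excluded value
  0.\<close>

lemma card_row_image:
 assumes "y < dim_row M" "g None = (0 :: nat)"
 shows "card ((\<lambda>x. g (M $$ (y, x))) ` {..<dim_col M} - {0}) \<le> card (row_weights M y)"
proof -
 have fin: "finite (row_weights M y)"
  by (rule finite_subset[of _ "(\<lambda>x. the (M $$ (y, x))) ` {..<dim_col M}"]) (force simp: row_weights_def)+
 have "(\<lambda>x. g (M $$ (y, x))) ` {..<dim_col M} - {0} \<subseteq> (\<lambda>w. g (Some w)) ` row_weights M y"
 proof
  fix v assume v: "v \<in> (\<lambda>x. g (M $$ (y, x))) ` {..<dim_col M} - {0}"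
  then obtain x where x: "x < dim_col M" "v = g (M $$ (y, x))" "v \<noteq> 0" by auto
  then obtain w where w: "M $$ (y, x) = Some w" using assms(2) by (cases "M $$ (y, x)") auto
  then have "w \<in> row_weights M y" using x by (auto simp: row_weights_def)
  then show "v \<in> (\<lambda>w. g (Some w)) ` row_weights M y" using x w by simp
 qed
 then have "card ((\<lambda>x. g (M $$ (y, x))) ` {..<dim_col M} - {0}) \<le> card ((\<lambda>w. g (Some w)) ` row_weights M y)"
  using fin by (intro card_mono) auto
 also have "\<dots> \<le> card (row_weights M y)" by (rule card_image_le[OF fin])
 finally show ?thesis .
qed

lemma few_d_weights:
 fixes u :: nat
 assumes car: "A \<in> carrier_mat n n" "B \<in> carrier_mat n n" "C \<in> carrier_mat n n"
  and d: "d_weights d A B C" "d \<le> real cap"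
  and s: "\<And>i j. i < n \<Longrightarrow> j < n \<Longrightarrow> ar s aA (i * n + j) = entA u A i j"
   "\<And>i j. i < n \<Longrightarrow> j < n \<Longrightarrow> ar s aB (i * n + j) = entA u B i j"
   "\<And>i j. i < n \<Longrightarrow> j < n \<Longrightarrow> ar s aC (i * n + j) = entC u C i j"
 shows "\<exists>r\<in>set roles. few n cap s r"
proof -
 have main: "card ((\<lambda>x. ar s a (pos_of tr n y x)) ` {..<n} - {0}) \<le> cap"
  if M: "few_row_weights d (if tr then transpose_mat M else M)" "M \<in> carrier_mat n n" "g None = 0"
   and a: "\<And>i j. i < n \<Longrightarrow> j < n \<Longrightarrow> ar s a (i * n + j) = g (M $$ (i, j))" and y: "y < n" for a tr M y and g :: "int option => nat"
 proof -
  let ?M = "if tr then transpose_mat M else M"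
  have dim: "dim_row ?M = n" "dim_col ?M = n" using M(2) by auto
  have "(\<lambda>x. ar s a (pos_of tr n y x)) ` {..<n} = (\<lambda>x. g (?M $$ (y, x))) ` {..<dim_col ?M}"
   unfolding dim using a y M(2) by (intro image_cong) (auto simp: pos_of_def)
  then have "card ((\<lambda>x. ar s a (pos_of tr n y x)) ` {..<n} - {0}) \<le> card (row_weights ?M y)"
   using card_row_image[of y ?M g] M(3) y dim by simp
  moreover have "real (card (row_weights ?M y)) \<le> d" using M(1) y dim unfolding few_row_weights_def by auto
  ultimately show ?thesis using d(2) by linarith
 qed
 let ?gA = "case_option 0 (\<lambda>x. nat (x + int u + 1))" and ?gC = "case_option 0 (\<lambda>x. nat (int u + 1 - x))"
 note mA = main[of False A ?gA aA] main[of True A ?gA aA]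
 note mB = main[of False B ?gA aB] main[of True B ?gA aB]
 note mC = main[of False C ?gC aC] main[of True C ?gC aC]
 from d(1) consider "few_row_weights d A" | "few_row_weights d (transpose_mat A)" | "few_row_weights d B"
  | "few_row_weights d (transpose_mat B)" | "few_row_weights d C" | "few_row_weights d (transpose_mat C)"
  by (auto simp: d_weights_def)
 then show ?thesis
 proof cases
  case 1
  have "few n cap s (Role aA False aB False aC False (V vN) (N 0) (N 1))"
   using mA(1) 1 car s by (simp add: entA_def)
  then show ?thesis by (simp add: roles_def)
 next
  case 2
  have "few n cap s (Role aA True aC False aB False (N 0) (V vN) (N 1))"
   using mA(2) 2 car s by (simp add: entA_def)
  then show ?thesis by (simp add: roles_def)
 next
  case 3
  have "few n cap s (Role aB False aC True aA True (N 0) (N 1) (V vN))"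
   using mB(1) 3 car s by (simp add: entA_def)
  then show ?thesis by (simp add: roles_def)
 next
  case 4
  have "few n cap s (Role aB True aA True aC True (N 1) (N 0) (V vN))"
   using mB(2) 4 car s by (simp add: entA_def)
  then show ?thesis by (simp add: roles_def)
 next
  case 5
  have "few n cap s (Role aC False aB True aA False (V vN) (N 1) (N 0))"
   using mC(1) 5 car s by (simp add: entC_def)
  then show ?thesis by (simp add: roles_def)
 next
  case 6
  have "few n cap s (Role aC True aA False aB True (N 1) (V vN) (N 0))"
   using mC(2) 6 car s by (simp add: entC_def)
  then show ?thesis by (simp add: roles_def)
 qed
qed

subsection \<open>The main program\<close>

fun powe :: "exp => nat => exp" where
 "powe e 0 = N 1"
| "powe e (Suc i) = powe e i \<^bold>* e"

lemma eval_powe [simp]: "eval (powe e i) s = eval e s ^ i"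
 by (induction i) auto

text \<open>All sizes are powers of constants with exponents derived from the number of levels,
  since real powers of n cannot be evaluated by the program. The modulus \<open>vMOD\<close> exceeds
  every count scaled by D ^ l, as counts are at most n.\<close>

definition paramf :: "nat => nat => nat => nat => nat => nat => nat => com" where
 "paramf n0 K R D t b c = (vO :=: powe (V vN) c ;; vS :=: N 3 \<^bold>* V vO \<^bold>+ N 3 ;; levf (n0 ^ t) ;; vL :=: N t \<^bold>* V vL1 ;;
   powc vQ K vL1 ;; powc vRL R vL ;; powc vPC (2 * K - 1) vL ;; powc vDL D vL ;; powc vqL (n0 * n0 * K) vL ;;
   vCap :=: powe (V vQ) b ;; vMOD :=: V vDL \<^bold>* V vN \<^bold>+ N 1)"

lemma paramf_writes [simp]: "wv (paramf n0 K R D t b c) = {vO, vS, ia, vL1, ix, vL, vQ, vRL, vPC, vDL, vqL, vCap, vMOD}"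
  "wa (paramf n0 K R D t b c) = {}" "wio (paramf n0 K R D t b c) = False"
 by (auto simp: paramf_def)

lemma wp_paramf:
 assumes s: "vr s vN = n" "n \<ge> 1" "n0 ^ t \<ge> 2" "K > 0" "R > 0" "D > 0" "n0 > 0" "l1 = lev (n0 ^ t) n" "l = t * l1"
  and Z: "3 * n ^ c + 3 \<le> Z" "n0 ^ t * n \<le> Z" "l1 \<le> Z" "l \<le> Z" "K ^ l1 \<le> Z" "R ^ l \<le> Z" "(2 * K - 1) ^ l \<le> Z" "(n0 * n0 * K) ^ l \<le> Z"
   "(K ^ l1) ^ b \<le> Z" "D ^ l * n + 1 \<le> Z"
 shows "wp bb Z (paramf n0 K R D t b c) s (\<lambda>s' tt. (vr s' vO = n ^ c \<and> vr s' vS = 3 * n ^ c + 3 \<and> vr s' vL = l \<and> vr s' vQ = K ^ l1 \<and> vr s' vRL = R ^ l \<and>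
  vr s' vPC = (2 * K - 1) ^ l \<and> vr s' vDL = D ^ l \<and> vr s' vqL = (n0 * n0 * K) ^ l \<and> vr s' vCap = (K ^ l1) ^ b \<and> vr s' vMOD = D ^ l * n + 1) \<and>
  tt \<le> 4 * n + 2 * l1 + 8 * l + 18)" (is "wp _ _ _ _ (\<lambda>s' tt. ?P s' \<and> _ tt)")
proof -
 have uZ: "n ^ c \<le> Z" using Z(1) by linarith
 have DZ: "D ^ l \<le> Z" using Z(10) s(2) by (metis Suc_eq_plus1 Suc_leD le_square mult.commute mult_le_mono2 nat_mult_1_right order.trans)
 let ?s = "set_var vS (3 * n ^ c + 3) (set_var vO (n ^ c) s)"
 have "wp bb Z (levf (n0 ^ t) ;; vL :=: N t \<^bold>* V vL1 ;;
   powc vQ K vL1 ;; powc vRL R vL ;; powc vPC (2 * K - 1) vL ;; powc vDL D vL ;; powc vqL (n0 * n0 * K) vL ;;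
   vCap :=: powe (V vQ) b ;; vMOD :=: V vDL \<^bold>* V vN \<^bold>+ N 1) ?s
   (\<lambda>s' tt. ?P s' \<and>
  tt \<le> 4 * n + 2 * l1 + 8 * l + 16)"
  unfolding wp_Seq
 proof (rule wp_conseq[OF wp_levf[of _ n]], goal_cases)
  case (5 s1 t1)
  have f1: "vr s1 vN = n" "vr s1 vO = n ^ c" "vr s1 vS = 3 * n ^ c + 3" "vr s1 vL1 = l1" "t1 \<le> 4 * n + 3" using 5 s by (simp_all add: frame_def)
  have e: "eval (N t \<^bold>* V vL1) s1 = l" using f1 s by simp
  show ?case
   unfolding wp_simps e
  proof (intro conjI Z(4), rule wp_conseq[OF wp_powc[of _ _ _ l1]], goal_cases)
   case (8 s2 t2)
   have f2: "vr s2 vN = n" "vr s2 vO = n ^ c" "vr s2 vS = 3 * n ^ c + 3" "vr s2 vL = l" "vr s2 vQ = K ^ l1" "t2 \<le> 2 * l1 + 2"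
    using 8 f1 by (simp_all add: frame_def)
   show ?case
   proof (rule wp_conseq[OF wp_powc[of _ _ _ l]], goal_cases)
    case (8 s3 t3)
    have f3: "vr s3 vN = n" "vr s3 vO = n ^ c" "vr s3 vS = 3 * n ^ c + 3" "vr s3 vL = l" "vr s3 vQ = K ^ l1" "vr s3 vRL = R ^ l" "t3 \<le> 2 * l + 2"
     using 8 f2 by (simp_all add: frame_def)
    show ?case
    proof (rule wp_conseq[OF wp_powc[of _ _ _ l]], goal_cases)
     case (8 s4 t4)
     have f4: "vr s4 vN = n" "vr s4 vO = n ^ c" "vr s4 vS = 3 * n ^ c + 3" "vr s4 vL = l" "vr s4 vQ = K ^ l1" "vr s4 vRL = R ^ l" "vr s4 vPC = (2 * K - 1) ^ l" "t4 \<le> 2 * l + 2"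
      using 8 f3 by (simp_all add: frame_def)
     show ?case
     proof (rule wp_conseq[OF wp_powc[of _ _ _ l]], goal_cases)
      case (8 s5 t5)
      have f5: "vr s5 vN = n" "vr s5 vO = n ^ c" "vr s5 vS = 3 * n ^ c + 3" "vr s5 vL = l" "vr s5 vQ = K ^ l1" "vr s5 vRL = R ^ l" "vr s5 vPC = (2 * K - 1) ^ l"
       "vr s5 vDL = D ^ l" "t5 \<le> 2 * l + 2"
       using 8 f4 by (simp_all add: frame_def)
      show ?case
      proof (rule wp_conseq[OF wp_powc[of _ _ _ l]], goal_cases)
       case (8 s6 t6)
       have f6: "vr s6 vN = n" "vr s6 vO = n ^ c" "vr s6 vS = 3 * n ^ c + 3" "vr s6 vL = l" "vr s6 vQ = K ^ l1" "vr s6 vRL = R ^ l" "vr s6 vPC = (2 * K - 1) ^ l"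
        "vr s6 vDL = D ^ l" "vr s6 vqL = (n0 * n0 * K) ^ l" "t6 \<le> 2 * l + 2"
        using 8 f5 by (simp_all add: frame_def)
       show ?case using f1(5) f2(6) f3(7) f4(8) f5(9) f6 Z(9,10) by simp
      qed (use f5 s Z in auto)
     qed (use f4 s Z DZ in auto)
    qed (use f3 s Z in auto)
   qed (use f2 s Z in auto)
  qed (use f1 s Z in auto)
 qed (use s Z in auto)
 then show ?thesis
  unfolding paramf_def wp_Seq wp_simps using uZ Z(1) s(1)
  by (intro conjI) (auto elim!: wp_conseq simp: numeral_eq_Suc)
qed

definition mainf :: "nat => nat => nat => nat => (nat => nat => int) => (nat => nat => int) => (nat => nat => int) => nat => nat => nat => com" where
 "mainf n0 K R D al be ga t b c = (paramf n0 K R D t b c ;; normf ;; rself roles ;; self t ;; mmf n0 K R al be ga ;; falsef ;; outf)"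

text \<open>One bracket for each part of \<open>mainf\<close>, in the same order; the time spent on
  collisions is kept apart.\<close>

definition maintime :: "nat => nat => nat => nat => nat => nat => nat => nat" where
 "maintime n l Q t cap R K = (4 * n + 10 * l + 18) + (n * (n * 20 + 2) + 1) + 6 * (trytime n cap + 2) +
   (t * (Q * (n * (2 * Q ^ t + 8 * n + n * (2 * cap + 5) + 5) + 8) + 5) + 2) +
   (2 * (n * (n * (6 * l + 10) + 2)) + 3 * (l * (R ^ l * (R + 2) + 5)) + 2 * R ^ l + (2 * K - 1) ^ l * (n * (n * (6 * l + 11) + 2) + 4 * l + 6) + 10) +
   (n * (2 * Q ^ t + 18 * n + n * (7 * cap + 5) + 4) + 2) + (3 * (n * n) + 1)"

definition ncoll :: "(nat => nat) => (nat => nat) => nat => (nat => nat) => (nat => nat) => nat => nat => nat" where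
 "ncoll Vf Wf S Lst Cnt n m = (\<Sum>z<n. (\<Sum>x<n. coll1 Vf n z m x) + cost2 Vf Wf S Lst Cnt n m z)"

lemma roles_ok: "r \<in> set roles \<Longrightarrow> okrole r"
 by (auto simp: roles_def)

lemma loaded_bounds:
 assumes r: "okrole r" and l: "loaded n s s' r" and s: "vr s vN = n"
  and B: "\<And>a x. a \<in> {aA, aB, aC} \<Longrightarrow> x < n * n \<Longrightarrow> ar s a x \<le> B"
 shows "\<And>x. x < n * n \<Longrightarrow> ar s' aU x \<le> B \<and> ar s' aV x \<le> B \<and> ar s' aW x \<le> B"
proof -
 obtain a1 t1 a2 t2 a3 t3 ey ex ez where Role: "r = Role a1 t1 a2 t2 a3 t3 ey ex ez" by (cases r)
 have a: "a1 \<in> {aA, aB, aC}" "a2 \<in> {aA, aB, aC}" "a3 \<in> {aA, aB, aC}" using r unfolding Role by auto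
 fix x assume x: "x < n * n"
 have n: "n > 0" using x by (auto intro: Nat.gr0I)
 have ij: "x div n < n" "x mod n < n" using x n by (auto simp: less_mult_imp_div_less)
 have "ar s' aU (x div n * n + x mod n) \<le> B \<and> ar s' aV (x div n * n + x mod n) \<le> B \<and> ar s' aW (x div n * n + x mod n) \<le> B"
  using l[unfolded Role loaded.simps, THEN conjunct1, rule_format, OF ij] B[OF a(1) pos_of_less[OF ij]] B[OF a(2) pos_of_less[OF ij]] B[OF a(3) pos_of_less[OF ij]]
  by simp
 then show "ar s' aU x \<le> B \<and> ar s' aV x \<le> B \<and> ar s' aW x \<le> B" by simp
qed

lemma roles_index:
 assumes r: "r \<in> set roles" and l: "loaded n s s' r" and s: "vr s vN = n" and "x < n" "y < n" "z < n"
 shows "vr s' vOy * y + vr s' vOx * x + vr s' vOz * z \<le> n * n"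
proof -
 have *: "n * i + j \<le> n * n" if "i < n" "j < n" for i j
  using mult_add_less[OF that] by (simp add: mult.commute)
 have v: "vr s' vOy = n \<and> vr s' vOx = 0 \<and> vr s' vOz = 1 \<or> vr s' vOy = 0 \<and> vr s' vOx = n \<and> vr s' vOz = 1 \<or>
   vr s' vOy = 0 \<and> vr s' vOx = 1 \<and> vr s' vOz = n \<or> vr s' vOy = 1 \<and> vr s' vOx = 0 \<and> vr s' vOz = n \<or>
   vr s' vOy = n \<and> vr s' vOx = 1 \<and> vr s' vOz = 0 \<or> vr s' vOy = 1 \<and> vr s' vOx = n \<and> vr s' vOz = 0"
  using r unfolding roles_def by (simp, elim disjE) (use l s in simp_all)
 show ?thesis using v *[OF assms(4,5)] *[OF assms(4,6)] *[OF assms(5,4)] *[OF assms(5,6)] *[OF assms(6,4)] *[OF assms(6,5)]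
  by (elim disjE) (simp_all add: add.commute)
qed

text \<open>The triangles that are exact modulo m split into exact and false ones. After the
  subtraction, DL times the number of exact ones remains; it is at most DL * n, hence below M, so it
  is nonzero modulo M iff an exact triangle exists.\<close>

lemma count_decode:
 assumes x: "[int x = int DL * (if w = 0 then 0 else int (card {k. k < n \<and> (f k \<noteq> 0 \<and> g k \<noteq> 0) \<and>
   (f k mod m + g k mod m + w) mod m = S mod m}))] (mod int M)"
  and y: "[int y = int x - int DL * int (card {k. k < n \<and> ffalse S m (f k) (g k) w})] (mod int M)"
  and M: "M = DL * n + 1" "DL > 0"
 shows "y mod M \<noteq> 0 \<longleftrightarrow> (\<exists>k<n. f k \<noteq> 0 \<and> g k \<noteq> 0 \<and> w \<noteq> 0 \<and> f k + g k + w = S)"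
proof -
 let ?T = "{k. k < n \<and> f k \<noteq> 0 \<and> g k \<noteq> 0 \<and> w \<noteq> 0 \<and> f k + g k + w = S}"
 let ?F = "{k. k < n \<and> ffalse S m (f k) (g k) w}"
 let ?H = "{k. k < n \<and> (f k \<noteq> 0 \<and> g k \<noteq> 0) \<and> (f k mod m + g k mod m + w) mod m = S mod m}"
 have mm: "(f k mod m + g k mod m + w) mod m = (f k + g k + w) mod m" for k by (metis mod_add_eq mod_add_left_eq)
 have h: "(if w = 0 then 0 else int (card ?H)) = int (card ?T) + int (card ?F)"
 proof (cases "w = 0")
  case False
  have "?H = ?T \<union> ?F" unfolding mm using False by (auto simp: ffalse_def)
  then have "card ?H = card ?T + card ?F" by (simp, intro card_Un_disjoint) (auto simp: ffalse_def)
  then show ?thesis using False by simp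
 qed (simp add: ffalse_def)
 have "[int y = int DL * (int (card ?T) + int (card ?F)) - int DL * int (card ?F)] (mod int M)"
  using cong_trans[OF y cong_diff[OF x cong_refl]] unfolding h .
 then have "[int y = int (DL * card ?T)] (mod int M)" by (simp add: algebra_simps)
 then have "y mod M = DL * card ?T mod M" unfolding cong_int_iff by (simp add: unique_euclidean_semiring_class.cong_def)
 moreover have "card ?T \<le> n" using card_mono[of "{..<n}" ?T] by auto
 then have "DL * card ?T < M" unfolding M(1) by (simp add: le_imp_less_Suc)
 ultimately have "y mod M \<noteq> 0 \<longleftrightarrow> card ?T \<noteq> 0" using M(2) by simp
 also have "\<dots> \<longleftrightarrow> ?T \<noteq> {}" by (subst card_eq_0_iff) auto
 finally show ?thesis by auto
qed

lemma frame_sub: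
 assumes "frame c s s'" "wv c \<subseteq> X" "wa c \<subseteq> Y"
 shows "v \<notin> X \<Longrightarrow> vr s' v = vr s v" "a \<notin> Y \<Longrightarrow> ar s' a = ar s a"
 using assms by (auto simp: frame_def)

text \<open>The existential exposes the arrays and the modulus that the run arrives at, with just
  enough about them to bound the collisions afterwards by pure counting.\<close>

lemma wp_mainf:
 assumes ta: "tensor_alg (n0 * n0 * K) (n0 * n0 * (2 * K - 1)) R (int D) al be ga (tbase n0 K)"
  and k: "n0 \<ge> 2" "t > 0" "K > 0" "D > 0" "n0 * n0 * (2 * K - 1) \<le> R" "n \<ge> 1"
  and l: "l1 = lev (n0 ^ t) n" "l = t * l1" "Q = K ^ l1" "cap = Q ^ b" "u = n ^ c" "S = 3 * u + 3"
  and car: "A \<in> carrier_mat n n" "B \<in> carrier_mat n n" "C \<in> carrier_mat n n"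
  and bd: "entries_bounded (int u) A" "entries_bounded (int u) B" "entries_bounded (int u) C"
  and dw: "d_weights d A B C" "d \<le> real cap"
  and Z: "3 * u + 3 \<le> Z" "n0 ^ t * n \<le> Z" "l \<le> Z" "2 * R ^ l \<le> Z" "cap \<le> Z" "D ^ l * n + 1 \<le> Z" "n * (n * n + n * (n * n)) \<le> Z" "t \<le> Z"
 shows "wp (6 * n * n) Z (mainf n0 K R D al be ga t b c) (input_st n A B C) (\<lambda>s' tt.
   (\<forall>i<n. \<forall>j<n. io s' (i * n + j) = of_bool (\<exists>k<n. exact_triangle A B C i k j)) \<and>
   (\<exists>Vf Wf Lst Cnt m. greedy (hcost Vf Wf S Lst Cnt n) Q t m \<and> (\<forall>x<n * n. Vf x \<le> 2 * u + 1 \<and> Wf x \<le> 2 * u + 1) \<and>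
    (\<forall>y<n. Cnt y \<le> cap \<and> (\<forall>g<Cnt y. Lst (y * n + g) \<le> 2 * u + 1)) \<and>
    tt \<le> maintime n l Q t cap R K + 9 * ncoll Vf Wf S Lst Cnt n m))"
proof -
 let ?s0 = "input_st n A B C" and ?M = "D ^ l * n + 1" and ?B = "2 * u + 1"
 have K1: "1 \<le> 2 * K - 1" "K \<le> 2 * K - 1" using k by simp_all
 have n00: "1 \<le> n0 * n0" using k by simp
 have le: "2 * K - 1 \<le> R" "n0 * n0 * K \<le> R" "K \<le> R" "R > 0"
 proof -
  have "1 * (2 * K - 1) \<le> n0 * n0 * (2 * K - 1)" using n00 by (rule mult_le_mono1)
  then show "2 * K - 1 \<le> R" using k(5) by linarith
  then show "K \<le> R" "R > 0" using K1 by simp_all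
  have "n0 * n0 * K \<le> n0 * n0 * (2 * K - 1)" using K1(2) by (rule mult_le_mono2)
  then show "n0 * n0 * K \<le> R" using k(5) by linarith
 qed
 have RZ: "R ^ l \<le> Z" using Z(4) by simp
 have l1l: "l1 \<le> l" using k l by simp
 have l1Z: "l1 \<le> Z" using l1l Z(3) by linarith
 have KZ: "K ^ l \<le> R ^ l" using le by (intro power_mono) auto
 have "K ^ l1 \<le> K ^ l" using l1l k by (intro power_increasing) auto
 then have QZ: "K ^ l1 \<le> Z" using KZ RZ by simp
 have "n * n * 1 \<le> n * n * (n + n * n)" using k by (intro mult_le_mono2) simp
 then have nn: "n * n \<le> Z" using Z(7) by (simp add: algebra_simps)
 have nZ: "n \<le> Z" using nn k by (metis le_square order.trans)
 have BZ: "?B \<le> Z" "?B \<le> S" using Z(1) l(6) by linarith+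
 note BS = BZ(2)
 have "D ^ l * 1 \<le> D ^ l * n" using k(6) by (rule mult_le_mono2)
 then have DM: "D ^ l \<le> ?M" by linarith
 have Z1: "1 \<le> Z" using nZ k by simp
 have nt2: "n0 ^ t \<ge> 2" using k self_le_power[of n0 t] by simp
 have nN: "n \<le> n0 ^ l" using lev_le[OF nt2, of n] by (simp add: l power_mult)
 have Qt: "Q ^ t = K ^ l" unfolding l by (simp add: power_mult[symmetric] mult.commute)
 have Q0: "Q > 0" using k l by simp
 have wZ: "(2 * K - 1) ^ l \<le> Z" "(n0 * n0 * K) ^ l \<le> Z"
  using power_mono[OF le(1), of l] power_mono[OF le(2), of l] RZ by simp_all
 show ?thesis
  unfolding mainf_def wp_Seq
 proof (rule wp_conseq[OF wp_paramf[of ?s0 n n0 t K R D l1 l c Z b]], goal_cases)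
  case (20 s1 t1)
  have f1: "vr s1 vN = n" "vr s1 vO = u" "vr s1 vS = S" "vr s1 vL = l" "vr s1 vQ = Q" "vr s1 vRL = R ^ l" "vr s1 vPC = (2 * K - 1) ^ l" "vr s1 vDL = D ^ l"
   "vr s1 vqL = (n0 * n0 * K) ^ l" "vr s1 vCap = cap" "vr s1 vMOD = ?M" "io s1 = io ?s0" "\<And>a. ar s1 a = (\<lambda>_. 0)"
   using 20 l(3-6) by (simp_all add: frame_def)
  have t1: "t1 \<le> 4 * n + 10 * l + 18" using conjunct2[OF 20(1)] l1l by linarith
  show ?case
  proof (rule wp_conseq[OF wp_normf[of A n B C u]], goal_cases)
   case (14 s2 t2)
   have f2: "vr s2 vN = n" "vr s2 vS = S" "vr s2 vL = l" "vr s2 vQ = Q" "vr s2 vRL = R ^ l" "vr s2 vPC = (2 * K - 1) ^ l" "vr s2 vDL = D ^ l"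
    "vr s2 vqL = (n0 * n0 * K) ^ l" "vr s2 vCap = cap" "vr s2 vMOD = ?M" "ar s2 aXA = (\<lambda>_. 0)" "ar s2 aXB = (\<lambda>_. 0)" "ar s2 aOut = (\<lambda>_. 0)"
    using 14(2) f1 by (simp_all add: frame_def)
   have g: "\<And>i j. i < n \<Longrightarrow> j < n \<Longrightarrow> ar s2 aA (i * n + j) = entA u A i j" "\<And>i j. i < n \<Longrightarrow> j < n \<Longrightarrow> ar s2 aB (i * n + j) = entA u B i j"
    "\<And>i j. i < n \<Longrightarrow> j < n \<Longrightarrow> ar s2 aC (i * n + j) = entC u C i j" using 14(1) by blast+
   have aB: "ar s2 a x \<le> ?B" if "a \<in> {aA, aB, aC}" "x < n * n" for a x
   proof -
    have ij: "x div n < n" "x mod n < n" using that k by (auto simp: less_mult_imp_div_less)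
    have "ar s2 a (x div n * n + x mod n) \<le> ?B"
     using that(1) g[OF ij] ent_le(1)[OF car(1) bd(1) ij] ent_le(1)[OF car(2) bd(2) ij] ent_le(2)[OF car(3) bd(3) ij] by (elim insertE) simp_all
    then show ?thesis by simp
   qed
   have aZ: "ar s2 a x \<le> Z" if "a \<in> {aA, aB, aC}" "x < n * n" for a x using aB[OF that] Z(1) by linarith
   have few: "\<exists>r\<in>set roles. few n cap s2 r" by (rule few_d_weights[OF car dw g])
   show ?case
   proof (rule wp_conseq[OF wp_rself[of s2 n cap Z roles]], goal_cases)
    case (9 s3 t3)
    note fr = frame_sub[OF 9(2) rself_writes(1,2)]
    have f3: "vr s3 vN = n" "vr s3 vS = S" "vr s3 vL = l" "vr s3 vQ = Q" "vr s3 vRL = R ^ l" "vr s3 vPC = (2 * K - 1) ^ l" "vr s3 vDL = D ^ l"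
     "vr s3 vqL = (n0 * n0 * K) ^ l" "vr s3 vMOD = ?M" "ar s3 aXA = (\<lambda>_. 0)" "ar s3 aXB = (\<lambda>_. 0)" "ar s3 aOut = (\<lambda>_. 0)"
     "ar s3 aA = ar s2 aA" "ar s3 aB = ar s2 aB" "ar s3 aC = ar s2 aC"
     using fr f2 by simp_all
    have L: "\<And>y. y < n \<Longrightarrow> listed (ar s3 aLst) n y (ar s3 aCnt y) (rowv (ar s3 aU) n y n)" "\<And>y. y < n \<Longrightarrow> ar s3 aCnt y \<le> cap"
     "t3 \<le> 6 * (trytime n cap + 2)"
     using 9(1) by (auto simp: roles_def)
    have Ln: "ar s3 aCnt y \<le> n" if "y < n" for y using listed_card[OF L(1)[OF that]] rowv_le[of "ar s3 aU" n y] by simp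
    obtain r where r: "r \<in> set roles" "loaded n s2 s3 r" using 9(1) by blast
    have ub: "ar s3 aU x \<le> ?B \<and> ar s3 aV x \<le> ?B \<and> ar s3 aW x \<le> ?B" if "x < n * n" for x
     using loaded_bounds[OF roles_ok[OF r(1)] r(2) f2(1), of ?B, OF aB that] .
    have LB: "ar s3 aLst (y * n + g) \<le> ?B" if "y < n" "g < ar s3 aCnt y" for y g
    proof -
     have "ar s3 aLst (y * n + g) \<in> rowv (ar s3 aU) n y n" using L(1)[OF that(1)] that(2) by (auto simp: listed_def)
     then show ?thesis using ub mult_add_less[OF that(1)] by (auto simp: rowv_def)
    qed
    have uZ: "ar s3 aV x \<le> Z" "ar s3 aW x \<le> Z" if "x < n * n" for x using ub[OF that] Z(1) by linarith+
    show ?case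
    proof (rule wp_conseq[OF wp_self[of s3 n Q S t Z cap]], goal_cases)
     case (13 s4 t4)
     let ?H = "hcost (ar s3 aV) (ar s3 aW) S (ar s3 aLst) (ar s3 aCnt) n"
     define m where "m = vr s4 vM"
     have gr: "greedy ?H Q t m" "t4 \<le> t * (Q * (n * (2 * Q ^ t + 8 * n + n * (2 * cap + 5) + 5) + 8) + 5) + 2" using 13(1) by (auto simp: m_def)
     have m: "m > 0" "m \<le> K ^ l" using greedy_bounds[OF gr(1)] Qt by auto
     have mZ: "m \<le> Z" using m(2) KZ RZ by linarith
     have ri: "vr s3 vOy * y + vr s3 vOx * x + vr s3 vOz * z \<le> Z" if "x < n" "y < n" "z < n" for x y z
      using roles_index[OF r f2(1) that] nn by linarith
     have f4: "vr s4 vN = n" "vr s4 vS = S" "vr s4 vL = l" "vr s4 vRL = R ^ l" "vr s4 vPC = (2 * K - 1) ^ l" "vr s4 vDL = D ^ l" "vr s4 vM = m"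
      "vr s4 vqL = (n0 * n0 * K) ^ l" "vr s4 vMOD = ?M" "ar s4 aXA = (\<lambda>_. 0)" "ar s4 aXB = (\<lambda>_. 0)" "ar s4 aOut = (\<lambda>_. 0)"
      "ar s4 aA = ar s2 aA" "ar s4 aB = ar s2 aB" "ar s4 aC = ar s2 aC" "ar s4 aU = ar s3 aU" "ar s4 aV = ar s3 aV" "ar s4 aW = ar s3 aW"
      "ar s4 aLst = ar s3 aLst" "ar s4 aCnt = ar s3 aCnt" "vr s4 vOy = vr s3 vOy" "vr s4 vOx = vr s3 vOx" "vr s4 vOz = vr s3 vOz"
      using 13(2) f3 by (simp_all add: frame_def m_def)
     have a4Z: "ar s4 a x \<le> Z" if a: "a \<in> {aA, aB, aC}" and x: "x < n * n" for a x
     proof -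
      have "ar s4 a = ar s2 a" using a f4(13-15) by (elim insertE) simp_all
      then show ?thesis using aZ[OF a x] by simp
     qed
     show ?case
     proof (rule wp_conseq[OF wp_mmf[OF ta, of s4 n l m S ?M Z]], goal_cases)
      case (25 s5 t5)
      note fr = frame_sub[OF 25(2) mmf_writes(1,2)]
      have f5: "vr s5 vN = n" "vr s5 vS = S" "vr s5 vDL = D ^ l" "vr s5 vM = m"
       "vr s5 vMOD = ?M" "ar s5 aU = ar s3 aU" "ar s5 aV = ar s3 aV" "ar s5 aW = ar s3 aW"
       "ar s5 aLst = ar s3 aLst" "ar s5 aCnt = ar s3 aCnt" "vr s5 vOy = vr s3 vOy" "vr s5 vOx = vr s3 vOx" "vr s5 vOz = vr s3 vOz"
       using fr f4 by simp_all
      note h5 = 25(1)[unfolded f4]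
      show ?case
      proof (rule wp_conseq[OF wp_falsef[of s5 n m S "vr s3 vOy" "vr s3 vOx" "vr s3 vOz" ?M "D ^ l" Z cap ?B]], goal_cases)
       case (24 s6 t6)
       have f6: "vr s6 vN = n" "vr s6 vMOD = ?M" using 24(2) f5 by (simp_all add: frame_def)
       note h6 = 24(1)[unfolded f5]
       show ?case
       proof (rule wp_conseq[OF wp_outf[of s6 n ?M]], goal_cases)
        case (5 s7 t7)
        have "io s7 (i * n + j) = of_bool (\<exists>k<n. exact_triangle A B C i k j)" if ij: "i < n" "j < n" for i j
        proof -
         have "[int (ar s6 aOut (i * n + j)) = int (ar s5 aOut (i * n + j)) -
           int (D ^ l) * int (card {k. k < n \<and> ffalse S m (ar s2 aA (i * n + k)) (ar s2 aB (k * n + j)) (ar s2 aC (i * n + j))})] (mod int ?M)"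
          using conjunct1[OF h6, unfolded dec_def, rule_format, of "i * n + j", unfolded false_count[OF r f2(1) ij, of S m]] .
         then have "ar s6 aOut (i * n + j) mod ?M \<noteq> 0 \<longleftrightarrow> (\<exists>k<n. ar s2 aA (i * n + k) \<noteq> 0 \<and> ar s2 aB (k * n + j) \<noteq> 0 \<and> ar s2 aC (i * n + j) \<noteq> 0 \<and>
           ar s2 aA (i * n + k) + ar s2 aB (k * n + j) + ar s2 aC (i * n + j) = S)"
          using k(4) by (intro count_decode[OF conjunct1[OF h5, rule_format, OF ij]]) simp_all
         also have "\<dots> \<longleftrightarrow> (\<exists>k<n. exact_triangle A B C i k j)"
          unfolding l(6) using ent_triangle[OF car bd ij(1) _ ij(2)] g(1)[OF ij(1)] g(2)[OF _ ij(2)] g(3)[OF ij] by (intro ex_cong1 conj_cong refl) simp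
         finally show ?thesis using conjunct1[OF 5(1), rule_format, OF mult_add_less[OF ij]] by simp
        qed
        moreover have "t1 + (t2 + (t3 + (t4 + (t5 + (t6 + t7))))) \<le> maintime n l Q t cap R K + 9 * ncoll (ar s3 aV) (ar s3 aW) S (ar s3 aLst) (ar s3 aCnt) n m"
        proof -
         have "t6 \<le> 9 * ncoll (ar s3 aV) (ar s3 aW) S (ar s3 aLst) (ar s3 aCnt) n m + n * (2 * m + 18 * n + n * (7 * cap + 5) + 4) + 2"
          using conjunct2[OF h6] unfolding ncoll_def .
         moreover have "n * (2 * m + 18 * n + n * (7 * cap + 5) + 4) \<le> n * (2 * Q ^ t + 18 * n + n * (7 * cap + 5) + 4)"
          using m Qt by (intro mult_le_mono2 add_mono) auto
         ultimately show ?thesis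
          using t1 conjunct2[OF 14(1)] L(3) gr(2) conjunct2[OF h5] conjunct2[OF 5(1)] unfolding maintime_def by linarith
        qed
        moreover have "\<forall>x<n * n. ar s3 aV x \<le> ?B \<and> ar s3 aW x \<le> ?B" using ub by blast
        moreover have "\<forall>y<n. ar s3 aCnt y \<le> cap \<and> (\<forall>g<ar s3 aCnt y. ar s3 aLst (y * n + g) \<le> ?B)" using L(2) LB by blast
        ultimately show ?case using gr(1) by blast
       qed (use f6 nn Z1 in simp_all)
      qed (use f5 Z(6) nZ m(1) L(1,2) Ln ub mZ BZ BS DM ri in simp_all)
     qed (use f4 Z(3,4,6) nZ m RZ KZ a4Z k(1,3,5) nN in simp_all)
    qed (use f3 Z nZ Q0 Ln L uZ KZ RZ Qt in auto)
   qed (use f2 nZ nn Z1 roles_ok aZ few in auto)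
  qed (use f1 car bd Z nn nZ in auto)
 qed (use k nt2 l l1Z Z RZ QZ wZ le in auto)
qed

subsection \<open>Bounding the collisions\<close>

lemma card_filter_Sigma:
 assumes "finite A" "\<And>a. a \<in> A \<Longrightarrow> finite (B a)"
 shows "card {p \<in> Sigma A B. P p} = (\<Sum>a\<in>A. card {b \<in> B a. P (a, b)})"
proof -
 have "{p \<in> Sigma A B. P p} = Sigma A (\<lambda>a. {b \<in> B a. P (a, b)})" by auto
 then show ?thesis using assms by simp
qed

lemma card_filter_Sigma_if:
 fixes n :: nat
 assumes "\<And>a. a < n \<Longrightarrow> finite (B a)"
 shows "card {p \<in> Sigma {a. a < n \<and> R a} B. P p} = (\<Sum>a<n. if R a then card {b \<in> B a. P (a, b)} else 0)"
proof -
 have e: "{a. a < n \<and> R a} = {a \<in> {..<n}. R a}" by auto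
 have "finite {a \<in> {..<n}. R a}" by (rule finite_subset[of _ "{..<n}"]) auto
 then have "card {p \<in> Sigma {a. a < n \<and> R a} B. P p} = (\<Sum>a\<in>{a \<in> {..<n}. R a}. card {b \<in> B a. P (a, b)})"
  unfolding e by (rule card_filter_Sigma) (use assms in auto)
 then show ?thesis by (simp only: sum.inter_filter[OF finite_lessThan])
qed

text \<open>Index set and integer values for which divisibility by m means an equal residue as
  counted by \<open>hcost1\<close>; \<open>ci2\<close> and \<open>cf2\<close> play the same part for
  \<open>hcost2\<close>.\<close>

definition ci1 :: "(nat => nat) => nat => (nat \<times> nat \<times> nat) set" where
 "ci1 Vf n = (SIGMA z:{..<n}. SIGMA x:{x. x < n \<and> Vf (x * n + z) \<noteq> 0}. {x'. x' < n \<and> Vf (x' * n + z) \<noteq> 0})"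

definition cf1 :: "(nat => nat) => nat => nat \<times> nat \<times> nat => int" where
 "cf1 Vf n = (\<lambda>(z, x, x'). int (Vf (x' * n + z)) - int (Vf (x * n + z)))"

definition ci2 :: "(nat => nat) => (nat => nat) => (nat => nat) => nat => (nat \<times> nat \<times> nat \<times> nat) set" where
 "ci2 Vf Wf Cnt n = (SIGMA z:{..<n}. SIGMA y:{y. y < n \<and> Wf (y * n + z) \<noteq> 0}. SIGMA g:{..<Cnt y}. {x. x < n \<and> Vf (x * n + z) \<noteq> 0})"

definition cf2 :: "(nat => nat) => (nat => nat) => nat => (nat => nat) => nat => nat \<times> nat \<times> nat \<times> nat => int" where
 "cf2 Vf Wf S Lst n = (\<lambda>(z, y, g, x). int (Vf (x * n + z) + Lst (y * n + g) + Wf (y * n + z)) - int S)"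

lemma finite_ci: "finite (ci1 Vf n)" "finite (ci2 Vf Wf Cnt n)"
 unfolding ci1_def ci2_def by (intro finite_SigmaI; simp)+

lemma card_ci1: "card {p \<in> ci1 Vf n. P p} = (\<Sum>z<n. \<Sum>x<n. if Vf (x * n + z) \<noteq> 0 then card {x'. x' < n \<and> Vf (x' * n + z) \<noteq> 0 \<and> P (z, x, x')} else 0)"
proof -
 have "card {p \<in> ci1 Vf n. P p} = (\<Sum>z<n. card {p \<in> (SIGMA x:{x. x < n \<and> Vf (x * n + z) \<noteq> 0}. {x'. x' < n \<and> Vf (x' * n + z) \<noteq> 0}). P (z, p)})"
  unfolding ci1_def by (rule card_filter_Sigma) auto
 also have "\<dots> = (\<Sum>z<n. \<Sum>x<n. if Vf (x * n + z) \<noteq> 0 then card {x'. x' < n \<and> Vf (x' * n + z) \<noteq> 0 \<and> P (z, x, x')} else 0)"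
  by (subst card_filter_Sigma_if) (auto simp: conj_assoc cong: if_cong)
 finally show ?thesis .
qed

lemma card_ci2: "card {p \<in> ci2 Vf Wf Cnt n. P p} = (\<Sum>z<n. \<Sum>y<n. if Wf (y * n + z) \<noteq> 0 then
  (\<Sum>g<Cnt y. card {x. x < n \<and> Vf (x * n + z) \<noteq> 0 \<and> P (z, y, g, x)}) else 0)"
proof -
 have "card {p \<in> ci2 Vf Wf Cnt n. P p} = (\<Sum>z<n. card {p \<in> (SIGMA y:{y. y < n \<and> Wf (y * n + z) \<noteq> 0}. SIGMA g:{..<Cnt y}. {x. x < n \<and> Vf (x * n + z) \<noteq> 0}). P (z, p)})"
  unfolding ci2_def by (rule card_filter_Sigma) auto
 also have "\<dots> = (\<Sum>z<n. \<Sum>y<n. if Wf (y * n + z) \<noteq> 0 then card {p \<in> (SIGMA g:{..<Cnt y}. {x. x < n \<and> Vf (x * n + z) \<noteq> 0}). P (z, y, p)} else 0)"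
  by (subst card_filter_Sigma_if) auto
 also have "\<dots> = (\<Sum>z<n. \<Sum>y<n. if Wf (y * n + z) \<noteq> 0 then
  (\<Sum>g<Cnt y. card {x. x < n \<and> Vf (x * n + z) \<noteq> 0 \<and> P (z, y, g, x)}) else 0)"
  by (subst card_filter_Sigma) (auto simp: conj_assoc cong: if_cong)
 finally show ?thesis .
qed

lemma card_dvd_fcoll:
 assumes "finite I"
 shows "card {x \<in> I. int m dvd f x} = fcoll I f m + card {x \<in> I. f x = 0}"
proof -
 have "{x \<in> I. int m dvd f x} = {x \<in> I. f x \<noteq> 0 \<and> int m dvd f x} \<union> {x \<in> I. f x = 0}" by auto
 then show ?thesis unfolding fcoll_def using assms by (simp, intro card_Un_disjoint) auto
qed

lemma fcoll_Plus:
 assumes "finite I" "finite J"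
 shows "fcoll (I <+> J) (case_sum f g) m = fcoll I f m + fcoll J g m"
proof -
 have "{x \<in> I <+> J. case_sum f g x \<noteq> 0 \<and> int m dvd case_sum f g x} =
   {x \<in> I. f x \<noteq> 0 \<and> int m dvd f x} <+> {x \<in> J. g x \<noteq> 0 \<and> int m dvd g x}" by auto
 then show ?thesis unfolding fcoll_def using assms by (simp add: card_Plus)
qed

lemma dvd_diff_mod: "int m dvd int a - int b \<longleftrightarrow> a mod m = b mod m"
 by (metis mod_eq_dvd_iff of_nat_eq_iff zmod_int)

context
 fixes Vf Wf Lst Cnt :: "nat => nat" and S n B cap :: nat
 assumes VW: "\<And>x. x < n * n \<Longrightarrow> Vf x \<le> B \<and> Wf x \<le> B"
  and LC: "\<And>y. y < n \<Longrightarrow> Cnt y \<le> cap" "\<And>y g. y < n \<Longrightarrow> g < Cnt y \<Longrightarrow> Lst (y * n + g) \<le> B"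
  and BS: "B \<le> S"
begin

lemma target_dvd:
 assumes "z < n" "y < n" "g < Cnt y" "m \<ge> 1"
 shows "v mod m = tgt S m (Wf (y * n + z)) (Lst (y * n + g)) \<longleftrightarrow> int m dvd int (v + Lst (y * n + g) + Wf (y * n + z)) - int S"
proof -
 have "Wf (y * n + z) + Lst (y * n + g) \<le> 2 * S"
  using VW[OF mult_add_less[OF assms(2,1)]] LC(2)[OF assms(2,3)] BS by linarith
 from tgt_iff[OF this, of m v] show ?thesis unfolding dvd_diff_mod using assms(4) by (simp add: ac_simps)
qed

lemma hcost_dvd:
 assumes "m \<ge> 1"
 shows "hcost Vf Wf S Lst Cnt n m = card {p \<in> ci1 Vf n. int m dvd cf1 Vf n p} + card {p \<in> ci2 Vf Wf Cnt n. int m dvd cf2 Vf Wf S Lst n p}"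
proof -
 have "(\<Sum>z<n. hcost1 Vf n z m) = card {p \<in> ci1 Vf n. int m dvd cf1 Vf n p}"
  unfolding card_ci1 hcost1_def cntb_def cf1_def by (simp add: dvd_diff_mod cong: if_cong)
 moreover have "(\<Sum>z<n. hcost2 Vf Wf S Lst Cnt n z m) = card {p \<in> ci2 Vf Wf Cnt n. int m dvd cf2 Vf Wf S Lst n p}"
  unfolding card_ci2 hcost2_def cntb_def cf2_def prod.case
  by (intro sum.cong refl if_cong arg_cong[where f = card] Collect_cong conj_cong target_dvd) (use assms in auto)
 ultimately show ?thesis by (simp add: hcost_def sum.distrib)
qed

lemma ncoll_fcoll:
 assumes "m \<ge> 1"
 shows "ncoll Vf Wf S Lst Cnt n m = fcoll (ci1 Vf n <+> ci2 Vf Wf Cnt n) (case_sum (cf1 Vf n) (cf2 Vf Wf S Lst n)) m"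
proof -
 have "(\<Sum>x<n. coll1 Vf n z m x) = (\<Sum>x<n. if Vf (x * n + z) \<noteq> 0 then card {x'. x' < n \<and> Vf (x' * n + z) \<noteq> 0 \<and> cf1 Vf n (z, x, x') \<noteq> 0 \<and> int m dvd cf1 Vf n (z, x, x')} else 0)" for z
  unfolding coll1_def cf1_def prod.case dvd_diff_mod
  by (intro sum.cong refl) (auto intro!: arg_cong[where f = card])
 then have "(\<Sum>z<n. \<Sum>x<n. coll1 Vf n z m x) = fcoll (ci1 Vf n) (cf1 Vf n) m"
  unfolding fcoll_def card_ci1 by simp
 moreover have "(\<Sum>z<n. cost2 Vf Wf S Lst Cnt n m z) = fcoll (ci2 Vf Wf Cnt n) (cf2 Vf Wf S Lst n) m"
  unfolding fcoll_def card_ci2 cost2_def coll2_def cf2_def prod.case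
 proof (intro sum.cong refl if_cong arg_cong[where f = card] Collect_cong, goal_cases)
  case (1 z y g x)
  have e: "int X - int S \<noteq> 0 \<longleftrightarrow> X \<noteq> S" for X by simp
  have "Vf (x * n + z) mod m = tgt S m (Wf (y * n + z)) (Lst (y * n + g)) \<longleftrightarrow> int m dvd int (Vf (x * n + z) + Lst (y * n + g) + Wf (y * n + z)) - int S"
   using 1 assms by (intro target_dvd) auto
  then show ?case unfolding e by blast
 qed
 ultimately show ?thesis by (simp add: ncoll_def sum.distrib fcoll_Plus finite_ci)
qed

lemma cf_bound:
 assumes "p \<in> ci1 Vf n <+> ci2 Vf Wf Cnt n" "S + 3 * B \<le> X"
 shows "\<bar>case_sum (cf1 Vf n) (cf2 Vf Wf S Lst n) p\<bar> \<le> int X"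
proof (cases p)
 case (Inl q)
 then obtain z x x' where q: "q = (z, x, x')" "z < n" "x < n" "x' < n" using assms(1) by (auto simp: ci1_def)
 then have "Vf (x * n + z) \<le> B" "Vf (x' * n + z) \<le> B" using VW mult_add_less by blast+
 then show ?thesis using assms(2) by (simp add: Inl q cf1_def)
next
 case (Inr q)
 then obtain z y g x where q: "q = (z, y, g, x)" "z < n" "y < n" "g < Cnt y" "x < n" using assms(1) by (auto simp: ci2_def)
 then have "Vf (x * n + z) \<le> B" "Wf (y * n + z) \<le> B" "Lst (y * n + g) \<le> B" using VW LC mult_add_less by blast+
 then show ?thesis using assms(2) by (simp add: Inr q cf2_def)
qed

lemma card_ci: "card (ci1 Vf n <+> ci2 Vf Wf Cnt n) \<le> n ^ 3 * (1 + cap)"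
proof -
 have b: "card {x. x < n \<and> P x} \<le> n" for P using card_mono[of "{..<n}" "{x. x < n \<and> P x}"] by auto
 have "card {p \<in> ci1 Vf n. True} \<le> (\<Sum>z<n. \<Sum>x<n. n)"
  unfolding card_ci1 by (intro sum_mono) (auto simp: b)
 moreover have "card {p \<in> ci2 Vf Wf Cnt n. True} \<le> (\<Sum>z<n. \<Sum>y<n. cap * n)"
  unfolding card_ci2
 proof (intro sum_mono, goal_cases)
  case (1 z y)
  have "(\<Sum>g<Cnt y. card {x. x < n \<and> Vf (x * n + z) \<noteq> 0 \<and> True}) \<le> Cnt y * n"
   using sum_bounded_above[of "{..<Cnt y}" "\<lambda>g. card {x. x < n \<and> Vf (x * n + z) \<noteq> 0 \<and> True}" n] b by simp
  also have "\<dots> \<le> cap * n" using LC(1) 1 by (intro mult_le_mono1) auto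
  finally show ?case by auto
 qed
 ultimately show ?thesis by (simp add: card_Plus finite_ci power3_eq_cube algebra_simps)
qed

text \<open>By \<open>greedy_step\<close> each round multiplies the collisions by at most h over the
  number of big primes; the start is bounded by the size of the whole index set. The values are
  differences bounded by S + 3 * B.\<close>

lemma greedy_ncoll:
 assumes "greedy (hcost Vf Wf S Lst Cnt n) Q i m" "Q \<ge> 2" "(S + 3 * B) * (S + 3 * B) \<le> Q ^ h"
 shows "card (big_primes Q) ^ i * ncoll Vf Wf S Lst Cnt n m \<le> h ^ i * (n ^ 3 * (1 + cap))"
proof -
 let ?I = "ci1 Vf n <+> ci2 Vf Wf Cnt n" and ?f = "case_sum (cf1 Vf n) (cf2 Vf Wf S Lst n)" and ?H = "hcost Vf Wf S Lst Cnt n"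
 let ?c = "card {x \<in> ci1 Vf n. cf1 Vf n x = 0} + card {x \<in> ci2 Vf Wf Cnt n. cf2 Vf Wf S Lst n x = 0}"
 have fin: "finite ?I" using finite_ci by (intro finite_Plus) auto
 \<comment> \<open>Cost and collisions differ by the number of genuine equalities, which does not
   depend on m; so a factor that minimises the cost minimises the collisions.\<close>
 have H: "?H m = fcoll ?I ?f m + ?c" if "m \<ge> 1" for m
  unfolding hcost_dvd[OF that] fcoll_Plus[OF finite_ci] card_dvd_fcoll[OF finite_ci(1)] card_dvd_fcoll[OF finite_ci(2)] by simp
 have "card (big_primes Q) ^ i * fcoll ?I ?f m \<le> h ^ i * card ?I"
  using assms(1)
 proof (induction i arbitrary: m)
  case 0
  show ?case by (simp, unfold fcoll_def, rule card_mono[OF fin]) auto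
 next
  case (Suc i)
  from Suc.prems obtain m0 q where m0: "greedy ?H Q i m0" "q \<in> {1..Q}" "m = m0 * q" "\<And>q. q \<in> {1..Q} \<Longrightarrow> ?H m \<le> ?H (m0 * q)" by auto
  have g1: "m0 \<ge> 1" using greedy_bounds[OF m0(1)] by simp
  have best: "fcoll ?I ?f m \<le> fcoll ?I ?f (m0 * p)" if "p \<in> big_primes Q" for p
  proof -
   have p: "p \<in> {1..Q}" using that by (auto simp: big_primes_def dest: prime_gt_0_nat)
   have "m \<ge> 1" "m0 * p \<ge> 1" using m0(2,3) g1 p by (auto simp: Suc_le_eq)
   with m0(4)[OF p] show ?thesis using H by simp
  qed
  have "card (big_primes Q) * fcoll ?I ?f m \<le> h * fcoll ?I ?f m0"
   by (rule greedy_step[OF fin cf_bound[OF _ order.refl] assms(3,2) g1 best])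
  then have "card (big_primes Q) ^ i * (card (big_primes Q) * fcoll ?I ?f m) \<le> card (big_primes Q) ^ i * (h * fcoll ?I ?f m0)"
   by (rule mult_le_mono2)
  also have "\<dots> = h * (card (big_primes Q) ^ i * fcoll ?I ?f m0)" by simp
  also have "\<dots> \<le> h * (h ^ i * card ?I)" using Suc.IH[OF m0(1)] by (rule mult_le_mono2)
  finally show ?case by (simp add: ac_simps)
 qed
 also have "\<dots> \<le> h ^ i * (n ^ 3 * (1 + cap))" using card_ci by (rule mult_le_mono2)
 finally show ?thesis using ncoll_fcoll[of m] greedy_bounds[OF assms(1)] by simp
qed

text \<open>The trivial bound, for the finitely many n for which the supply of primes is not yet
  sufficient.\<close>

lemma ncoll_le:
 assumes "m \<ge> 1"
 shows "ncoll Vf Wf S Lst Cnt n m \<le> n ^ 3 * (1 + cap)"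
proof -
 have "fcoll (ci1 Vf n <+> ci2 Vf Wf Cnt n) (case_sum (cf1 Vf n) (cf2 Vf Wf S Lst n)) m \<le> card (ci1 Vf n <+> ci2 Vf Wf Cnt n)"
  unfolding fcoll_def by (rule card_mono) (auto simp: finite_ci)
 then show ?thesis using card_ci ncoll_fcoll[OF assms] by simp
qed

end

subsection \<open>From structured programs to the word RAM\<close>

text \<open>The number P = 2 ^ floorlog 2 n exceeds n and is at least 2, so a constant x is at most
  P ^ x. In the word factor, 5 pays for 6 * n * n, (g + 1) * z for the power, a for the factor a,
  and 2 for the two additions.\<close>

lemma word_bound:
 fixes g z a :: nat
 assumes "n \<ge> 1"
 defines "w \<equiv> word_size (5 + (g + 1) * z + a + 2) n"
 shows "6 * n * n + ((g * n) ^ z + 1) * a < 2 ^ w" "(6 :: nat) < 2 ^ w" "w > 0"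
proof -
 let ?P = "2 ^ floorlog 2 n :: nat"
 have fl: "n < ?P" using floorlog_bounds[of n 2] assms(1) by simp
 have P2: "2 \<le> ?P" using fl assms(1) by linarith
 have w: "2 ^ w = ?P ^ (5 + (g + 1) * z + a + 2)"
  by (simp add: w_def word_size_def power_mult[symmetric] mult.commute)
 have pg: "x \<le> ?P ^ x" for x
 proof -
  have "x \<le> 2 ^ x" by (simp add: less_imp_le less_exp)
  also have "\<dots> \<le> ?P ^ x" using P2 by (rule power_mono) simp
  finally show ?thesis .
 qed
 have "g * n \<le> ?P ^ g * ?P" using pg[of g] fl by (intro mult_le_mono) auto
 then have "(g * n) ^ z \<le> (?P ^ (g + 1)) ^ z" by (intro power_mono) (simp_all add: mult.commute)
 then have gz: "(g * n) ^ z \<le> ?P ^ ((g + 1) * z)" by (simp only: power_mult)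
 have one: "1 \<le> ?P ^ x" for x using P2 by simp
 have "(g * n) ^ z + 1 \<le> ?P ^ ((g + 1) * z) * 2" using gz one[of "(g + 1) * z"] by linarith
 also have "\<dots> \<le> ?P ^ ((g + 1) * z) * ?P" using P2 by (rule mult_le_mono2)
 finally have "((g * n) ^ z + 1) * a \<le> (?P ^ ((g + 1) * z) * ?P) * ?P ^ a" using pg[of a] by (intro mult_le_mono) auto
 also have "\<dots> = ?P ^ ((g + 1) * z + a + 1)" by (simp add: power_add)
 also have "\<dots> \<le> ?P ^ (5 + (g + 1) * z + a + 1)" using P2 by (intro power_increasing) auto
 finally have b1: "((g * n) ^ z + 1) * a \<le> ?P ^ (5 + (g + 1) * z + a + 1)" .
 have P8: "8 \<le> ?P ^ 3" using power_mono[OF P2, of 3] by simp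
 have "6 * n * n < ?P ^ 3 * ?P * ?P"
 proof -
  have nn: "n * n < ?P * ?P" using fl by (intro mult_strict_mono) auto
  have "6 * (n * n) \<le> ?P ^ 3 * (n * n)" using P8 by (intro mult_le_mono1) linarith
  also have "\<dots> < ?P ^ 3 * (?P * ?P)" using nn P2 by (intro mult_strict_left_mono) auto
  finally show ?thesis by (simp only: mult.assoc)
 qed
 also have "\<dots> = ?P ^ 5" by (simp add: eval_nat_numeral)
 also have "\<dots> \<le> ?P ^ (5 + (g + 1) * z + a + 1)" using P2 by (intro power_increasing) auto
 finally have "6 * n * n + ((g * n) ^ z + 1) * a < 2 * ?P ^ (5 + (g + 1) * z + a + 1)" using b1 by linarith
 also have "\<dots> \<le> ?P * ?P ^ (5 + (g + 1) * z + a + 1)" using P2 by (rule mult_le_mono1)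
 also have "\<dots> = 2 ^ w"
 proof -
  have "5 + (g + 1) * z + a + 2 = Suc (5 + (g + 1) * z + a + 1)" by simp
  then show ?thesis unfolding w by (simp only: power_Suc)
 qed
 finally show "6 * n * n + ((g * n) ^ z + 1) * a < 2 ^ w" .
 have "?P ^ 3 \<le> ?P ^ (5 + (g + 1) * z + a + 2)" using P2 by (intro power_increasing) auto
 then show six: "(6 :: nat) < 2 ^ w" unfolding w using P8 by linarith
 show "w > 0" using six by (cases w) auto
qed

text \<open>If the values are bounded by a polynomial in n, with the constants folded into g, then
  words of O(log n) bits suffice; the word factor depends on the program but not on n.\<close>

lemma implement:
 assumes "amax p \<le> g" "g \<ge> 2" "z \<ge> 1"
  and wp: "\<And>n A B C. n \<ge> 1 \<Longrightarrow> A \<in> carrier_mat n n \<Longrightarrow> B \<in> carrier_mat n n \<Longrightarrow> C \<in> carrier_mat n n \<Longrightarrow>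
   (\<forall>M\<in>{A, B, C}. entries_bounded (int (n ^ c)) M) \<Longrightarrow> d_weights (d n) A B C \<Longrightarrow>
   wp (6 * n * n) ((g * n) ^ z) p (input_st n A B C) (\<lambda>s' tt.
    (\<forall>i<n. \<forall>j<n. io s' (i * n + j) = of_bool (\<exists>k<n. exact_triangle A B C i k j)) \<and> tt \<le> T n)"
 shows "\<exists>\<kappa>. solves_d_weights_exact_triangle d c \<kappa> (compile p) (\<lambda>n. 3 + csize (Suc (amax p)) p * T n)"
proof -
 let ?\<kappa> = "5 + (g + 1) * (z * Suc (dmax p)) + Suc (amax p) + 2"
 have "solves_d_weights_exact_triangle d c ?\<kappa> (compile p) (\<lambda>n. 3 + csize (Suc (amax p)) p * T n)"
  unfolding solves_d_weights_exact_triangle_def Let_def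
 proof (intro allI ballI impI, goal_cases)
  case (1 n A B C)
  let ?w = "word_size ?\<kappa> n" and ?Z = "(g * n) ^ z" and ?s = "input_st n A B C"
  have wb: "6 * n * n + (?Z ^ Suc (dmax p) + 1) * Suc (amax p) < 2 ^ ?w" "(6 :: nat) < 2 ^ ?w" "?w > 0"
   using word_bound[OF 1(1), of g "z * Suc (dmax p)" "Suc (amax p)"] by (simp_all only: power_mult)
  have gn: "g * 1 \<le> g * n" "1 * n \<le> g * n" using 1(1) assms(2) by (intro mult_le_mono; simp)+
  have "(g * n) ^ 1 \<le> ?Z" using gn assms(2,3) by (intro power_increasing) auto
  then have gZ: "g * n \<le> ?Z" by simp
  have W: "wp (6 * n * n) ?Z p ?s (\<lambda>s' tt. (\<forall>i<n. \<forall>j<n. io s' (i * n + j) = of_bool (\<exists>k<n. exact_triangle A B C i k j)) \<and> tt \<le> T n)"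
   using 1 by (intro wp) auto
  have Z: "n \<le> ?Z" "amax p \<le> ?Z" "?Z \<ge> 2" using gn gZ assms(1,2) by linarith+
  have okp: "ok (6 * n * n) ?Z p ?s" using W by (simp add: wp_def)
  obtain tt where tt: "tt \<le> 3 + csize (Suc (amax p)) p * tm p ?s"
   "halted (compile p) (run ?w (compile p) tt (init_config ?w n (encode_mat ?w A @ encode_mat ?w B @ encode_mat ?w C)))"
   "\<And>x. x < 6 * n * n \<Longrightarrow> mem (run ?w (compile p) tt (init_config ?w n (encode_mat ?w A @ encode_mat ?w B @ encode_mat ?w C))) x = nat (take_bit ?w (io (ev p ?s) x))"
   using compile_correct[OF 1(2-4) Z wb(1,2) okp] by blast
  have res: "\<forall>i<n. \<forall>j<n. io (ev p ?s) (i * n + j) = of_bool (\<exists>k<n. exact_triangle A B C i k j)" "tm p ?s \<le> T n"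
   using W by (auto simp: wp_def)
  have "csize (Suc (amax p)) p * tm p ?s \<le> csize (Suc (amax p)) p * T n" using res(2) by (rule mult_le_mono2)
  then have "tt \<le> 3 + csize (Suc (amax p)) p * T n" using tt(1) by linarith
  moreover have "mem (run ?w (compile p) tt (init_config ?w n (encode_mat ?w A @ encode_mat ?w B @ encode_mat ?w C))) (i * n + j) =
    of_bool (\<exists>k<n. exact_triangle A B C i k j)" if ij: "i < n" "j < n" for i j
  proof -
   have "i * n + j < 6 * n * n" using mult_add_less[OF ij] by simp
   then show ?thesis using tt(3) res(1) ij wb(3) by (simp add: take_bit_of_1_eq_0_iff of_bool_def)
  qed
  ultimately show ?case using tt(2) by blast
 qed
 then show ?thesis by blast
qed

subsection \<open>The exponent\<close>

lemma small_powr: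
 fixes a b :: real
 assumes "a < b"
 shows "(\<lambda>n :: nat. real n powr a) \<in> o(\<lambda>n. real n powr b)"
 using assms by real_asymp

text \<open>The set of exponents is nonempty and bounded below, so its infimum in the reals is
  meaningful.\<close>

lemma omega_set:
 defines "X \<equiv> {\<tau>. (\<lambda>n. real (matmul_ops TYPE(rat) n)) \<in> O(\<lambda>n. real n powr \<tau>)}"
 shows "3 \<in> X" "\<tau> \<in> X \<Longrightarrow> 2 \<le> \<tau>"
proof -
 have "(\<lambda>n. real (matmul_ops TYPE(rat) n)) \<in> O(\<lambda>n. real n powr 3)"
 proof (rule bigoI[where c = 2], rule eventually_mono[OF eventually_gt_at_top[of 0]])
  fix n :: nat assume "n > 0"
  moreover have "real (matmul_ops TYPE(rat) n) \<le> real (2 * n ^ 3)" using matmul_ops_upper by (rule of_nat_mono)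
  ultimately show "norm (real (matmul_ops TYPE(rat) n)) \<le> 2 * norm (real n powr 3)" by (simp add: powr_numeral)
 qed
 then show "3 \<in> X" by (simp add: X_def)
 assume "\<tau> \<in> X"
 then have O: "(\<lambda>n. real (matmul_ops TYPE(rat) n)) \<in> O(\<lambda>n. real n powr \<tau>)" by (simp add: X_def)
 have "(\<lambda>n. real n powr 2) \<in> O(\<lambda>n. real (matmul_ops TYPE(rat) n))"
 proof (rule bigoI[where c = 1], rule eventually_mono[OF eventually_gt_at_top[of 0]])
  fix n :: nat assume "n > 0"
  moreover have "real (n ^ 2) \<le> real (matmul_ops TYPE(rat) n)" using matmul_ops_lower by (rule of_nat_mono)
  ultimately show "norm (real n powr 2) \<le> 1 * norm (real (matmul_ops TYPE(rat) n))" by (simp add: powr_numeral)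
 qed
 then have big: "(\<lambda>n. real n powr 2) \<in> O(\<lambda>n. real n powr \<tau>)" using O by (rule landau_o.big_trans)
 show "2 \<le> \<tau>"
 proof (rule ccontr)
  assume "\<not> 2 \<le> \<tau>"
  then have "\<tau> < 2" by simp
  from landau_o.big_small_trans[OF big small_powr[OF this]]
  have "eventually (\<lambda>n. real n powr 2 = 0) sequentially" by (simp add: landau_o.small_refl_iff)
  then have "eventually (\<lambda>n :: nat. False) sequentially" using eventually_gt_at_top[of 0] by eventually_elim simp
  then show False by simp
 qed
qed

lemma omega_ge_2: "2 \<le> \<omega>"
 unfolding matmul_exponent_def using omega_set(1) by (intro cInf_greatest omega_set(2)) blast+

text \<open>The infimum need not be attained, but there is an admissible exponent strictly below
  \<omega> + e, and the gap also swallows the constant of the asymptotic bound.\<close>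

lemma matmul_ops_eventually:
 assumes "e > 0"
 shows "eventually (\<lambda>n. real (matmul_ops TYPE(rat) n) \<le> real n powr (\<omega> + e)) sequentially"
proof -
 let ?X = "{\<tau>. (\<lambda>n. real (matmul_ops TYPE(rat) n)) \<in> O(\<lambda>n. real n powr \<tau>)}"
 have ne: "?X \<noteq> {}" using omega_set(1) by blast
 have "Inf ?X < \<omega> + e" using assms by (simp add: matmul_exponent_def)
 from cInf_lessD[OF ne this] obtain \<tau> where \<tau>: "\<tau> \<in> ?X" "\<tau> < \<omega> + e" ..
 have "(\<lambda>n. real n powr \<tau>) \<in> o(\<lambda>n. real n powr (\<omega> + e))" using \<tau>(2) by (rule small_powr)
 then have "(\<lambda>n. real (matmul_ops TYPE(rat) n)) \<in> o(\<lambda>n. real n powr (\<omega> + e))" by (rule landau_o.big_small_trans[OF \<tau>(1)[unfolded mem_Collect_eq]])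
 from landau_o.smallD[OF this, of 1] show ?thesis by simp
qed

subsection \<open>Running time for suitable parameters\<close>

text \<open>Four terms dominate: the cost of Q candidate moduli over all cells and listed weights,
  the clearing of up to Q ^ t buckets per column and candidate, the reading of the coefficients, and
  the transforms. The numerical constants are generous.\<close>

lemma maintime_le:
 assumes "n \<ge> 1" "Q \<ge> 1" "cap \<ge> 1" "K \<ge> 1" "R \<ge> 1"
 shows "maintime n l Q t cap R K \<le> (500 + 40 * t + 3 * R) *
  (n * n * Q * cap + n * Q * Q ^ t + n * n * (l + 1) * (2 * K - 1) ^ l + (l + 1) * R ^ l)"
proof -
 let ?q = "Q ^ t" and ?p = "(2 * K - 1) ^ l" and ?r = "R ^ l"
 define W where "W = n * n * Q * cap + n * Q * ?q + n * n * (l + 1) * ?p + (l + 1) * ?r"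
 have pos: "?p \<ge> 1" "?r \<ge> 1" "?q \<ge> 1" using assms by auto
 have grow: "x \<le> x * y" if "y \<ge> 1" for x y :: nat using mult_le_mono2[OF that, of x] by simp
 note g = grow[OF assms(1)] grow[OF assms(2)] grow[OF assms(3)] grow[OF pos(1)] grow[OF pos(2)] grow[OF pos(3)]
 have W1: "n * n * Q * cap \<le> W" and W2: "n * Q * ?q \<le> W" and W3: "n * n * (l + 1) * ?p \<le> W" and W4: "(l + 1) * ?r \<le> W"
  by (simp_all add: W_def)
 have a1: "n * n * Q \<le> W" using g(3)[of "n * n * Q"] W1 by linarith
 have a2: "n * n \<le> W" using g(2)[of "n * n"] a1 by linarith
 have a3: "n \<le> W" using g(1)[of n] a2 by linarith
 have a4: "1 \<le> W" using a3 assms(1) by linarith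
 have "n * n * cap \<le> n * n * cap * Q" by (rule g(2))
 then have a5: "n * n * cap \<le> W" using W1 by (simp only: mult.assoc mult.commute mult.left_commute; linarith)
 have "n * Q \<le> n * Q * n" by (rule g(1))
 then have a6: "n * Q \<le> W" using a1 by (simp only: mult.assoc mult.commute mult.left_commute; linarith)
 have "Q \<le> Q * n" by (rule g(1))
 then have a7: "Q \<le> W" using a6 by (simp only: mult.assoc mult.commute mult.left_commute; linarith)
 have "n * ?q \<le> n * ?q * Q" by (rule g(2))
 then have a8: "n * ?q \<le> W" using W2 by (simp only: mult.assoc mult.commute mult.left_commute; linarith)
 have b0: "n * n * l * ?p + n * n * ?p \<le> W" using W3 by (simp add: algebra_simps)
 have b1: "n * n * l \<le> W" using g(4)[of "n * n * l"] b0 by linarith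
 have "l \<le> l * (n * n)" using assms(1) by (intro grow) simp
 then have b2: "l \<le> W" using b1 by (simp only: mult.assoc mult.commute mult.left_commute; linarith)
 have "n * ?p \<le> n * ?p * n" by (rule g(1))
 then have b3: "n * ?p \<le> W" using b0 by (simp only: mult.assoc mult.commute mult.left_commute; linarith)
 have "?p \<le> ?p * n" by (rule g(1))
 then have b4: "?p \<le> W" using b3 by (simp only: mult.assoc mult.commute mult.left_commute; linarith)
 have "l * ?p \<le> l * ?p * (n * n)" using assms(1) by (intro grow) simp
 then have b5: "l * ?p \<le> W" using b0 by (simp only: mult.assoc mult.commute mult.left_commute; linarith)
 have b6: "n * n * l * ?p \<le> W" "n * n * ?p \<le> W" using b0 by linarith+
 have c: "l * ?r \<le> W" "?r \<le> W" using W4 by (simp_all add: algebra_simps)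
 have cR: "R * (l * ?r) \<le> R * W" using c(1) by (rule mult_le_mono2)
 have T: "Q * (n * (2 * ?q + 8 * n + n * (2 * cap + 5) + 5) + 8) + 5 \<le> 35 * W"
  using W1 W2 a1 a4 a6 a7 by (simp add: algebra_simps)
 have tT: "t * (Q * (n * (2 * ?q + 8 * n + n * (2 * cap + 5) + 5) + 8) + 5) \<le> t * (35 * W)"
  using T by (rule mult_le_mono2)
 have T1: "trytime n cap \<le> 30 * W" unfolding trytime_def using a2 a3 a4 a5 by (simp add: algebra_simps)
 have T2: "n * (n * 20 + 2) \<le> 22 * W" using a2 a3 by (simp add: algebra_simps)
 have T3: "2 * (n * (n * (6 * l + 10) + 2)) \<le> 36 * W" using b1 a2 a3 by (simp add: algebra_simps)
 have "3 * (l * (?r * (R + 2) + 5)) = 3 * (R * (l * ?r)) + (6 * (l * ?r) + 15 * l)" by (simp add: algebra_simps)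
 also have "\<dots> \<le> 3 * (R * W) + (6 * W + 15 * W)" by (intro add_le_mono mult_le_mono2 cR c(1) b2)
 finally have T4: "3 * (l * (?r * (R + 2) + 5)) \<le> 3 * (R * W) + 21 * W" by simp
 have T5: "?p * (n * (n * (6 * l + 11) + 2) + 4 * l + 6) \<le> 29 * W" using b3 b4 b5 b6 by (simp add: algebra_simps)
 have T6: "n * (2 * ?q + 18 * n + n * (7 * cap + 5) + 4) \<le> 36 * W" using a8 a2 a3 a5 by (simp add: algebra_simps)
 have aux: "4 * n + 10 * l + 18 + (A1 + 1) + 6 * (A2 + 2) + (A3 + 2) + (A4 + A5 + 2 * A6 + A7 + 10) + (A8 + 2) + (3 * A9 + 1) \<le> 500 * W + B1 + B2"
  if "A1 \<le> 22 * W" "A2 \<le> 30 * W" "A3 \<le> B1" "A4 \<le> 36 * W" "A5 \<le> B2 + 21 * W" "A6 \<le> W" "A7 \<le> 29 * W" "A8 \<le> 36 * W" "A9 \<le> W" for A1 A2 A3 A4 A5 A6 A7 A8 A9 B1 B2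
 proof -
  have "4 * n + 10 * l + 18 + (A1 + 1) + 6 * (A2 + 2) + (A3 + 2) + (A4 + A5 + 2 * A6 + A7 + 10) + (A8 + 2) + (3 * A9 + 1)
   \<le> 4 * W + 10 * W + 18 * W + (22 * W + 1 * W) + 6 * (30 * W + 2 * W) + (B1 + 2 * W) +
    (36 * W + (B2 + 21 * W) + 2 * W + 29 * W + 10 * W) + (36 * W + 2 * W) + (3 * W + 1 * W)"
   using that a3 b2 a4 by (intro add_le_mono mult_le_mono2) auto
  also have "\<dots> \<le> 500 * W + B1 + B2" by simp
  finally show ?thesis .
 qed
 have "maintime n l Q t cap R K \<le> 500 * W + t * (35 * W) + 3 * (R * W)"
  unfolding maintime_def by (rule aux[OF T2 T1 tT T3 T4 c(2) T5 T6 a2])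
 then show ?thesis unfolding W_def[symmetric] by (simp add: algebra_simps)
qed

lemma pow_upper:
 assumes "real x \<le> real a powr e" "a > 0"
 shows "real (x ^ l) \<le> real (a ^ l) powr e"
proof -
 have "real x ^ l \<le> (real a powr e) ^ l" using assms by (intro power_mono) auto
 also have "\<dots> = (real a ^ l) powr e" using assms(2) by (simp add: powr_realpow[symmetric] powr_powr mult.commute)
 finally show ?thesis by simp
qed

lemma pow_lower:
 assumes "real a powr e \<le> real x" "a > 0"
 shows "real (a ^ l) powr e \<le> real (x ^ l)"
proof -
 have "(real a ^ l) powr e = (real a powr e) ^ l" using assms(2) by (simp add: powr_realpow[symmetric] powr_powr mult.commute)
 also have "\<dots> \<le> real x ^ l" using assms by (intro power_mono) auto
 finally show ?thesis by simp
qed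

lemma pow_powr: "a > 0 \<Longrightarrow> real (a ^ k) powr x = real a powr (real k * x)"
 by (simp add: powr_realpow[symmetric] powr_powr)

text \<open>Here \<open>\<beta> = 3 - \<omega>\<close>, \<open>e = \<delta> / 32\<close> and \<open>N' = n0 ^ l\<close>, so that \<open>n \<le> N' \<le> n0 ^ t * n\<close>. Since \<open>8 \<le> n0 powr e\<close>, the
 constant factors lost in each of the \<open>l\<close> levels of the tensor power cost only a factor \<open>N' powr e\<close>.\<close>

context
 fixes e \<beta> :: real and t b n0 K R :: nat and n l1 l Q cap N' :: nat
 assumes e: "0 < e" "32 * e < \<beta>" "\<beta> \<le> 1"
  and t: "1 \<le> 4 * e * real t"
  and b: "real t * (\<beta> - 32 * e) \<le> real b * (\<beta> - 8 * e)" "real b * (\<beta> - 8 * e) \<le> real t * (\<beta> - 32 * e) + (\<beta> - 8 * e)"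
  and n0: "n0 \<ge> 2" "8 \<le> real n0 powr e"
  and K: "real n0 powr (\<beta> - 8 * e) \<le> real K" "real K \<le> 2 * real n0 powr (\<beta> - 8 * e)"
  and R: "real R \<le> 8 * real n0 powr (3 - 7 * e)" "R \<ge> 1"
  and n: "n \<ge> 1" "l1 = lev (n0 ^ t) n" "l = t * l1" "Q = K ^ l1" "cap = Q ^ b" "N' = n0 ^ l"
begin

lemma t_pos: "t \<ge> 1"
 using t by (cases t) auto

lemma K_pos: "K \<ge> 1"
proof -
 have "0 < real n0 powr (\<beta> - 8 * e)" using n0 by simp
 then have "0 < real K" using K(1) by linarith
 then show ?thesis by simp
qed

lemma Q_pos: "Q \<ge> 1" "cap \<ge> 1"
 using K_pos n by simp_all

lemma N_bounds: "n \<le> N'" "N' \<le> n0 ^ t * n" "1 \<le> N'"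
proof -
 have "2 \<le> n0 ^ t" using n0 t_pos self_le_power[of n0 t] by simp
 then show "n \<le> N'" "N' \<le> n0 ^ t * n"
  using lev_le[of "n0 ^ t" n] lev_upper[of "n0 ^ t" n] n by (simp_all add: power_mult)
 then show "1 \<le> N'" using n by simp
qed

lemma N_mono: "x \<le> y \<Longrightarrow> real N' powr x \<le> real N' powr y"
 using N_bounds(3) by (intro powr_mono) auto

lemma absorb: "real x \<le> 8 * real n0 powr y \<Longrightarrow> real x \<le> real n0 powr (y + e)"
proof -
 have "8 * real n0 powr y \<le> real n0 powr e * real n0 powr y" using n0 by (intro mult_right_mono) auto
 then show "real x \<le> 8 * real n0 powr y \<Longrightarrow> real x \<le> real n0 powr (y + e)" by (simp add: powr_add mult.commute)
qed

lemma RL_le: "real (R ^ l) \<le> real N' powr (3 - 6 * e)"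
 using pow_upper[OF absorb[OF R(1)], of l] n0 n by simp

lemma K_upper: "real K \<le> real n0 powr (\<beta> - 7 * e)" "real (2 * K - 1) \<le> real n0 powr (\<beta> - 7 * e)"
proof -
 have p: "0 < real n0 powr (\<beta> - 8 * e)" using n0 by simp
 have "real K \<le> 8 * real n0 powr (\<beta> - 8 * e)" using K p by linarith
 from absorb[OF this] show "real K \<le> real n0 powr (\<beta> - 7 * e)" by simp
 have "real (2 * K - 1) \<le> 8 * real n0 powr (\<beta> - 8 * e)" using K p K_pos by simp
 from absorb[OF this] show "real (2 * K - 1) \<le> real n0 powr (\<beta> - 7 * e)" by simp
qed

lemma PC_le: "real ((2 * K - 1) ^ l) \<le> real N' powr (1 - 7 * e)"
proof -
 have "real ((2 * K - 1) ^ l) \<le> real N' powr (\<beta> - 7 * e)" using pow_upper[OF K_upper(2), of l] n0 n by simp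
 also have "\<dots> \<le> real N' powr (1 - 7 * e)" using e by (intro N_mono) simp
 finally show ?thesis .
qed

lemma Qt_le: "real (Q ^ t) \<le> real N' powr (1 - 7 * e)"
proof -
 have "Q ^ t = K ^ l" by (simp add: n power_mult[symmetric] mult.commute)
 then have "real (Q ^ t) \<le> real N' powr (\<beta> - 7 * e)" using pow_upper[OF K_upper(1), of l] n0 n by simp
 also have "\<dots> \<le> real N' powr (1 - 7 * e)" using e by (intro N_mono) simp
 finally show ?thesis .
qed

text \<open>As l + 1 \<le> 2 ^ l and 2 is below n0 powr e, the number of levels costs no more than
  another constant factor per level.\<close>

lemma l_le: "real (l + 1) \<le> real N' powr e"
proof -
 have "l + 1 \<le> 2 ^ l" using less_exp[of l] by (simp add: Suc_le_eq)
 then have "real (l + 1) \<le> real (2 ^ l)" by (rule of_nat_mono)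
 also have "\<dots> \<le> real (n0 ^ l) powr e" using n0 by (intro pow_upper) auto
 finally show ?thesis using n by simp
qed

text \<open>For the exponent of Q * cap = Q ^ (b + 1), where Q is at most n0 ^ l1 to the power
  \<beta> - 7 * e. Rounding b up and the extra factor Q cost terms of order 1, which are paid in
  multiples of e * t because 1 \<le> 4 * e * t.\<close>

lemma b_upper: "real (b + 1) * (\<beta> - 7 * e) \<le> real t * (1 - 20 * e)"
proof -
 let ?\<mu> = "\<beta> - 8 * e"
 have mu: "0 < ?\<mu>" "?\<mu> \<le> 1" using e by simp_all
 have aux: "x - 31 * p + 2 * m + 2 * e \<le> x - 31 * p + 2 * (4 * p) + 2 * p" if "m \<le> 1" "e \<le> p" "1 \<le> 4 * p" for x p m :: real
  using that by linarith
 have te: "e \<le> e * real t" "1 \<le> 4 * (e * real t)" using t_pos e t by simp_all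
 have "real b * ?\<mu> \<le> real t * ?\<mu> + ?\<mu>"
 proof -
  have "real t * (\<beta> - 32 * e) \<le> real t * ?\<mu>" using e by (intro mult_left_mono) auto
  then show ?thesis using b(2) by linarith
 qed
 then have "real b * ?\<mu> \<le> (real t + 1) * ?\<mu>" by (simp add: algebra_simps)
 then have bt: "real b \<le> real t + 1" using mu(1) by (rule mult_right_le_imp_le)
 have be: "real b * e \<le> (real t + 1) * e" using bt e by (intro mult_right_mono) auto
 have "real (b + 1) * (\<beta> - 7 * e) = real b * ?\<mu> + real b * e + ?\<mu> + e" by (simp add: algebra_simps)
 also have "\<dots> \<le> (real t * (\<beta> - 32 * e) + ?\<mu>) + (real t + 1) * e + ?\<mu> + e" using b(2) be by linarith
 also have "\<dots> = real t * \<beta> - 31 * (e * real t) + 2 * ?\<mu> + 2 * e" by (simp add: algebra_simps)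
 also have "\<dots> \<le> real t * \<beta> - 31 * (e * real t) + 2 * (4 * (e * real t)) + 2 * (e * real t)" by (rule aux[OF mu(2) te])
 also have "\<dots> = real t * \<beta> - 21 * (e * real t)" by simp
 also have "\<dots> \<le> real t * 1 - 20 * (e * real t)"
 proof -
  have "real t * \<beta> \<le> real t * 1" using e by (intro mult_left_mono) auto
  moreover have "0 \<le> e * real t" using e by simp
  ultimately show ?thesis by linarith
 qed
 finally show ?thesis by (simp add: algebra_simps)
qed

lemma Qcap_le: "real (Q * cap) \<le> real N' powr (1 - 20 * e)"
proof -
 have "Q * cap = K ^ (l1 * (b + 1))" by (simp add: n power_mult[symmetric] power_add[symmetric] algebra_simps)
 then have "real (Q * cap) \<le> real (n0 ^ (l1 * (b + 1))) powr (\<beta> - 7 * e)" using pow_upper[OF K_upper(1), of "l1 * (b + 1)"] n0 by simp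
 also have "\<dots> = real n0 powr (real l1 * (real (b + 1) * (\<beta> - 7 * e)))" using n0 by (subst pow_powr) (auto simp: algebra_simps)
 also have "\<dots> \<le> real n0 powr (real l1 * (real t * (1 - 20 * e)))" using b_upper n0 by (intro powr_mono mult_left_mono) auto
 also have "\<dots> = real N' powr (1 - 20 * e)" unfolding n(6,3) using n0 by (subst pow_powr) (auto simp: algebra_simps)
 finally show ?thesis .
qed

text \<open>The capacity covers the permitted number of weights, \<beta> - 32 * e being the exponent
  3 - \<omega> - \<delta> of the problem.\<close>

lemma cap_ge: "real n powr (\<beta> - 32 * e) \<le> real cap"
proof -
 have "real n powr (\<beta> - 32 * e) \<le> real N' powr (\<beta> - 32 * e)" using N_bounds e by (intro powr_mono2) auto
 also have "\<dots> = real n0 powr (real l1 * (real t * (\<beta> - 32 * e)))" unfolding n(6,3) using n0 by (subst pow_powr) (auto simp: algebra_simps)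
 also have "\<dots> \<le> real n0 powr (real l1 * (real b * (\<beta> - 8 * e)))" using b(1) n0 by (intro powr_mono mult_left_mono) auto
 also have "\<dots> = real (n0 ^ (l1 * b)) powr (\<beta> - 8 * e)" using n0 by (subst pow_powr) (auto simp: algebra_simps)
 also have "\<dots> \<le> real (K ^ (l1 * b))" using K(1) n0 by (intro pow_lower) auto
 also have "K ^ (l1 * b) = cap" by (simp add: n power_mult)
 finally show ?thesis .
qed

lemma Q_ge: "real n powr ((\<beta> - 8 * e) / real t) \<le> real Q"
proof -
 have "real n powr ((\<beta> - 8 * e) / real t) \<le> real N' powr ((\<beta> - 8 * e) / real t)" using N_bounds e by (intro powr_mono2) auto
 also have "\<dots> = real (n0 ^ l1) powr (\<beta> - 8 * e)"
 proof -
  have "real (t * l1) * ((\<beta> - 8 * e) / real t) = real l1 * (\<beta> - 8 * e)" using t_pos by simp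
  then show ?thesis unfolding n(6,3) using n0 by (simp only: pow_powr)
 qed
 also have "\<dots> \<le> real (K ^ l1)" using K(1) n0 by (intro pow_lower) auto
 finally show ?thesis using n by simp
qed

text \<open>Each of the t rounds divides n ^ 3 * (1 + cap) by B / h, which is at least Q powr (1 - 4
  * e); the powers of h cancel because the supply of primes is required with the factor h.\<close>

lemma coll_le:
 assumes B: "real h * real Q powr (1 - 4 * e) \<le> real B" "h \<ge> 1" "B ^ t * C \<le> h ^ t * (n ^ 3 * (1 + cap))"
 shows "real C \<le> 2 * real n powr (3 - 16 * e)"
proof -
 have Q0: "real Q > 0" using Q_pos by simp
 have "(real h * real Q powr (1 - 4 * e)) ^ t * real C \<le> real B ^ t * real C" using B(1) by (intro mult_right_mono power_mono) auto
 also have "\<dots> \<le> real (h ^ t * (n ^ 3 * (1 + cap)))" using B(3) by (metis of_nat_le_iff of_nat_mult of_nat_power)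
 also have "\<dots> \<le> real h ^ t * (real n ^ 3 * (2 * real cap))"
  unfolding of_nat_mult of_nat_power using Q_pos by (intro mult_left_mono) auto
 finally have "real h ^ t * ((real Q powr (1 - 4 * e)) ^ t * real C) \<le> real h ^ t * (real n ^ 3 * (2 * real cap))" by (simp add: power_mult_distrib mult.assoc)
 then have "(real Q powr (1 - 4 * e)) ^ t * real C \<le> real n ^ 3 * (2 * real cap)" using B(2) by (simp add: mult_le_cancel_left_pos)
 moreover have "(real Q powr (1 - 4 * e)) ^ t = real Q powr ((1 - 4 * e) * real t)" using Q0 by (simp add: powr_realpow[symmetric] powr_powr)
 moreover have "real cap = real Q powr real b" using Q0 n by (simp add: powr_realpow)
 ultimately have "real Q powr ((1 - 4 * e) * real t) * real C \<le> 2 * real n ^ 3 * real Q powr real b" by simp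
 then have "real C \<le> 2 * real n ^ 3 * real Q powr real b / real Q powr ((1 - 4 * e) * real t)" using Q0 by (simp add: pos_le_divide_eq mult.commute)
 also have "\<dots> = 2 * real n ^ 3 * real Q powr (- ((1 - 4 * e) * real t - real b))" by (simp add: powr_diff)
 also have "real Q powr (- ((1 - 4 * e) * real t - real b)) \<le> real n powr (- (16 * e))"
 proof -
  let ?\<mu> = "\<beta> - 8 * e" and ?E = "(1 - 4 * e) * real t - real b"
  have mu: "0 < ?\<mu>" "?\<mu> \<le> 1" using e by simp_all
  have "4 * e * real t * ?\<mu> \<le> 4 * e * real t * 1" using e mu by (intro mult_left_mono) auto
  then have "16 * e * real t \<le> real t * ?\<mu> - 4 * e * real t * ?\<mu> - (real t * (\<beta> - 32 * e) + ?\<mu>)"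
   using mu t by (simp add: algebra_simps)
  also have "\<dots> \<le> ?E * ?\<mu>" using b(2) by (simp add: algebra_simps)
  finally have E: "16 * e * real t \<le> ?E * ?\<mu>" .
  then have "0 < ?E * ?\<mu>" using e t_pos by (intro order.strict_trans2[OF _ E]) auto
  then have E0: "0 < ?E" using mu by (simp add: zero_less_mult_iff)
  have n0': "0 < real n powr (?\<mu> / real t)" using n by simp
  have "real Q powr (- ?E) \<le> (real n powr (?\<mu> / real t)) powr (- ?E)" using Q_ge n0' E0 by (intro powr_mono2') auto
  also have "\<dots> = real n powr (- (?E * ?\<mu> / real t))"
  proof -
   have "?\<mu> / real t * (- ?E) = - (?E * ?\<mu> / real t)" by (simp add: mult.commute del: minus_diff_eq)
   then show ?thesis by (simp only: powr_powr)
  qed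
  also have "\<dots> \<le> real n powr (- (16 * e))"
   using n(1) E t_pos by (intro powr_mono) (auto simp: pos_le_divide_eq)
  finally show ?thesis .
 qed
 also have "2 * real n ^ 3 * real n powr (- (16 * e)) = 2 * real n powr (3 - 16 * e)"
  using n(1) by (simp add: powr_diff powr_minus powr_numeral divide_simps)
 finally show ?thesis by (simp add: mult_left_mono)
qed

text \<open>The transforms decide the exponent: R ^ l is at most N' powr (3 - 6 * e), and the number
  of levels takes another e.\<close>

lemma time_le: "real (maintime n l Q t cap R K) \<le> real (500 + 40 * t + 3 * R) * (4 * real N' powr (3 - 5 * e))"
proof -
 let ?Y = "real N' powr (3 - 5 * e)" and ?y = "real N'"
 have y: "?y > 0" "real n \<le> ?y" using N_bounds by simp_all
 have p: "?y powr 1 = ?y" using y by simp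
 have nn: "real n * real n \<le> ?y powr 2" using y by (simp add: powr_numeral power2_eq_square mult_mono)
 have W1: "real (n * n * Q * cap) \<le> ?Y"
 proof -
  have "real n * real n * real (Q * cap) \<le> ?y powr 2 * ?y powr (1 - 20 * e)" using nn Qcap_le by (intro mult_mono) auto
  also have "\<dots> = ?y powr (3 - 20 * e)" by (simp only: powr_add[symmetric]) simp
  also have "\<dots> \<le> ?Y" using e by (intro N_mono) simp
  finally show ?thesis by (simp only: of_nat_mult mult.assoc)
 qed
 have "real Q \<le> real (Q ^ t)" using Q_pos t_pos self_le_power[of "real Q" t] by simp
 then have Q1: "real Q \<le> ?y powr (1 - 7 * e)" using Qt_le by linarith
 have W2: "real (n * Q * Q ^ t) \<le> ?Y"
 proof -
  have "real n * real Q * real (Q ^ t) \<le> ?y powr 1 * ?y powr (1 - 7 * e) * ?y powr (1 - 7 * e)" unfolding p using y Q1 Qt_le by (intro mult_mono) auto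
  also have "\<dots> = ?y powr (3 - 14 * e)" by (simp only: powr_add[symmetric]) simp
  also have "\<dots> \<le> ?Y" using e by (intro N_mono) simp
  finally show ?thesis by simp
 qed
 have W3: "real (n * n * (l + 1) * (2 * K - 1) ^ l) \<le> ?Y"
 proof -
  have "(real n * real n) * real (l + 1) * real ((2 * K - 1) ^ l) \<le> ?y powr 2 * ?y powr e * ?y powr (1 - 7 * e)"
   using nn l_le PC_le by (intro mult_mono) auto
  also have "\<dots> = ?y powr (3 - 6 * e)" by (simp only: powr_add[symmetric]) simp
  also have "\<dots> \<le> ?Y" using e by (intro N_mono) simp
  finally show ?thesis by (simp only: of_nat_mult)
 qed
 have W4: "real ((l + 1) * R ^ l) \<le> ?Y"
 proof -
  have "real (l + 1) * real (R ^ l) \<le> ?y powr e * ?y powr (3 - 6 * e)" using l_le RL_le by (intro mult_mono) auto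
  also have "\<dots> = ?Y" by (simp only: powr_add[symmetric]) simp
  finally show ?thesis by (simp only: of_nat_mult)
 qed
 have "real (maintime n l Q t cap R K) \<le> real ((500 + 40 * t + 3 * R) *
  (n * n * Q * cap + n * Q * Q ^ t + n * n * (l + 1) * (2 * K - 1) ^ l + (l + 1) * R ^ l))"
  using maintime_le[OF n(1) Q_pos K_pos R(2)] by (rule of_nat_mono)
 also have "\<dots> = real (500 + 40 * t + 3 * R) * (real (n * n * Q * cap) + real (n * Q * Q ^ t) + real (n * n * (l + 1) * (2 * K - 1) ^ l) + real ((l + 1) * R ^ l))"
  by (simp only: of_nat_mult[of "500 + 40 * t + 3 * R"] of_nat_add[of "n * n * Q * cap + n * Q * Q ^ t + n * n * (l + 1) * (2 * K - 1) ^ l"]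
   of_nat_add[of "n * n * Q * cap + n * Q * Q ^ t"] of_nat_add[of "n * n * Q * cap"])
 also have "\<dots> \<le> real (500 + 40 * t + 3 * R) * (4 * ?Y)" using W1 W2 W3 W4 by (intro mult_left_mono) auto
 finally show ?thesis .
qed

end

text \<open>Every summand of z serves one of the quantities; the 8 covers fixed powers such as the
  fifth power needed for the cost of a modulus.\<close>

lemma word_bounds:
 assumes "n \<ge> 1" "n0 \<ge> 2" "t \<ge> 1" "K \<ge> 1" "l1 = lev (n0 ^ t) n" "l = t * l1" "n0 ^ t + t + 4 \<le> g" "z = c + R + D + K * b + 8"
 defines "Z \<equiv> (g * n) ^ z"
 shows "3 * n ^ c + 3 \<le> Z" "n0 ^ t * n \<le> Z" "l \<le> Z" "2 * R ^ l \<le> Z" "(K ^ l1) ^ b \<le> Z" "D ^ l * n + 1 \<le> Z"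
  "n * (n * n + n * (n * n)) \<le> Z" "t \<le> Z"
proof -
 define G where "G = g * n"
 have "g * 1 \<le> G" "n0 ^ t * n \<le> G" "1 * n \<le> G" unfolding G_def using assms(1,7) by (intro mult_le_mono; simp)+
 then have G: "g \<le> G" "n0 ^ t * n \<le> G" "n \<le> G" by simp_all
 then have G4: "4 \<le> G" using assms(7) by linarith
 have up: "x \<le> Z" if "x \<le> G ^ k" "k \<le> z" for x k
  using that power_increasing[OF that(2), of G] G4 unfolding Z_def G_def[symmetric] by linarith
 have pos: "1 \<le> G ^ k" for k using G4 by simp
 have "2 \<le> n0 ^ t" using assms self_le_power[of n0 t] by simp
 then have N: "n0 ^ l \<le> G" using lev_upper[of "n0 ^ t" n] assms(1,5,6) G(2) by (simp add: power_mult)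
 \<comment> \<open>As 2 ^ l \<le> n0 ^ l \<le> G, the l-th power of a constant x is at most G ^ x
   and thus polynomial in n.\<close>
 have pw: "x ^ l \<le> G ^ x" for x :: nat
 proof -
  have "x ^ l \<le> (2 ^ x) ^ l" by (intro power_mono) (simp_all add: less_imp_le less_exp)
  also have "\<dots> = (2 ^ l) ^ x" by (simp only: power_mult[symmetric] mult.commute)
  also have "\<dots> \<le> (n0 ^ l) ^ x" using assms(2) by (intro power_mono) auto
  also have "\<dots> \<le> G ^ x" using N by (intro power_mono) auto
  finally show ?thesis .
 qed
 show "t \<le> Z" using G(1) assms(7,8) by (intro up[of _ 1]) auto
 show "n0 ^ t * n \<le> Z" using G(2) assms(8) by (intro up[of _ 1]) auto
 have "l \<le> 2 ^ l" by (simp add: less_imp_le less_exp)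
 also have "\<dots> \<le> n0 ^ l" using assms(2) by (intro power_mono) auto
 finally show "l \<le> Z" using N assms(8) by (intro up[of _ 1]) auto
 have "2 * R ^ l \<le> G * G ^ R" using pw[of R] G4 by (intro mult_le_mono) auto
 then show "2 * R ^ l \<le> Z" using assms(8) by (intro up[of _ "Suc R"]) auto
 have "K ^ l1 \<le> K ^ l" using assms(3,4,6) by (intro power_increasing) auto
 then have "(K ^ l1) ^ b \<le> (G ^ K) ^ b" using pw[of K] by (intro power_mono) auto
 then show "(K ^ l1) ^ b \<le> Z" using assms(8) by (intro up[of _ "K * b"]) (auto simp: power_mult)
 have nc: "n ^ c \<le> G ^ c" using G(3) by (intro power_mono) auto
 have "3 * n ^ c + 3 \<le> 6 * G ^ c" using nc pos[of c] by linarith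
 also have "\<dots> \<le> (G * G) * G ^ c" using mult_le_mono[OF G4 G4] by (intro mult_le_mono1) linarith
 finally show "3 * n ^ c + 3 \<le> Z" using assms(8) by (intro up[of _ "c + 2"]) (auto simp: power_add power2_eq_square mult.commute)
 have "D ^ l * n \<le> G ^ D * G" using pw[of D] G(3) by (intro mult_le_mono) auto
 moreover have "1 \<le> G ^ D * G" using mult_le_mono[OF pos[of D], of 1 G] G4 by linarith
 ultimately have "D ^ l * n + 1 \<le> 2 * (G ^ D * G)" by linarith
 also have "\<dots> \<le> G * (G ^ D * G)" using G4 by (intro mult_le_mono1) simp
 finally show "D ^ l * n + 1 \<le> Z" using assms(8) by (intro up[of _ "D + 2"]) (auto simp: power_add power2_eq_square ac_simps)
 have "n * (n * n + n * (n * n)) \<le> G * (G * G + G * (G * G))" using G(3) by (intro mult_le_mono add_le_mono)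
 also have "\<dots> \<le> G * (G * (G * G) + G * (G * G))" using G4 by (intro mult_le_mono2 add_le_mono mult_le_mono) simp_all
 also have "\<dots> = 2 * (G * (G * (G * G)))" by (simp add: algebra_simps)
 also have "\<dots> \<le> G * (G * (G * (G * G)))" using G4 by (intro mult_le_mono1) simp
 also have "\<dots> = G ^ 5" by (simp add: eval_nat_numeral)
 finally show "n * (n * n + n * (n * n)) \<le> Z" using assms(8) by (intro up[of _ 5]) auto
qed

text \<open>A smaller bound on the number of weights admits fewer instances.\<close>

lemma solves_mono:
 assumes "solves_d_weights_exact_triangle d' c \<kappa> P T" "\<And>n. n \<ge> 1 \<Longrightarrow> d n \<le> d' n"
 shows "solves_d_weights_exact_triangle d c \<kappa> P T"
proof -
 have "d_weights (d' n) A B C" if "d_weights (d n) A B C" "n \<ge> 1" for n A B C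
  using that assms(2)[OF that(2)] unfolding d_weights_def few_row_weights_def by (meson order.trans)
 then show ?thesis using assms(1) unfolding solves_d_weights_exact_triangle_def by blast
qed

subsection \<open>The case \<open>\<omega> \<ge> 3\<close>\<close>

text \<open>Here the bound on the weights is a negative power of n. For n \<ge> 2 it is below 1, so
  one of the matrices has no entries and all answers are 0. For n = 1 it equals 1 and the only
  triple must be tested; then u = 1, and the required sum 3 * u + 3 is 6.\<close>

definition trivf :: com where
 "trivf = (If (V vN \<^bold>= N 1) (vO :=: N 1 ;; normf ;;
   Put aOut (N 0) ((N 0 \<^bold>< Arr aA (N 0)) \<^bold>* (N 0 \<^bold>< Arr aB (N 0)) \<^bold>* (N 0 \<^bold>< Arr aC (N 0)) \<^bold>* (Arr aA (N 0) \<^bold>+ Arr aB (N 0) \<^bold>+ Arr aC (N 0) \<^bold>= N 6))) Skip ;;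
   vMOD :=: N 2 ;; outf)"

lemma wp_trivf:
 assumes n: "n \<ge> 1" and car: "A \<in> carrier_mat n n" "B \<in> carrier_mat n n" "C \<in> carrier_mat n n"
  and bd: "\<forall>M\<in>{A, B, C}. entries_bounded (int (n ^ c)) M" and d: "d_weights (real n powr x) A B C" "x < 0" and g: "g \<ge> 3"
 shows "wp (6 * n * n) ((g * n) ^ 2) trivf (input_st n A B C) (\<lambda>s' tt.
  (\<forall>i<n. \<forall>j<n. io s' (i * n + j) = of_bool (\<exists>k<n. exact_triangle A B C i k j)) \<and> tt \<le> 3 * (n * n) + 40)"
proof (cases "n = 1")
 case True
 let ?Z = "(g * n) ^ 2" and ?s = "set_var vO 1 (input_st n A B C)"
 have "3 ^ 2 \<le> ?Z" using g True by (intro power_mono) auto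
 then have Z: "9 \<le> ?Z" by simp
 have b: "entries_bounded (int 1) A" "entries_bounded (int 1) B" "entries_bounded (int 1) C" using bd True by auto
 have tri: "entA 1 A 0 0 \<noteq> 0 \<and> entA 1 B 0 0 \<noteq> 0 \<and> entC 1 C 0 0 \<noteq> 0 \<and> entA 1 A 0 0 + entA 1 B 0 0 + entC 1 C 0 0 = 6 \<longleftrightarrow> exact_triangle A B C 0 0 0"
  using ent_triangle[OF car b, of 0 0 0] True by simp
 have e1: "eval (N 1) (input_st n A B C) = 1" "eval (V vN \<^bold>= N 1) (input_st n A B C) \<noteq> 0" using True by simp_all
 show ?thesis
  unfolding trivf_def wp_Seq wp_If
 proof (subst if_P[OF e1(2)], unfold wp_Seq wp_simps(2) e1(1), intro conjI, goal_cases)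
  case 1
  then show ?case using Z by simp
 next
  case 2
  show ?case
  proof (rule wp_conseq[OF wp_normf[of A n B C 1]], goal_cases)
   case (14 s1 t1)
   have f: "vr s1 vN = 1" "ar s1 aA 0 = entA 1 A 0 0" "ar s1 aB 0 = entA 1 B 0 0" "ar s1 aC 0 = entC 1 C 0 0" "t1 \<le> 23"
    using 14 True by (simp_all add: frame_def)
   define v where "v = (of_bool (exact_triangle A B C 0 0 0) :: nat)"
   have ev: "eval ((N 0 \<^bold>< Arr aA (N 0)) \<^bold>* (N 0 \<^bold>< Arr aB (N 0)) \<^bold>* (N 0 \<^bold>< Arr aC (N 0)) \<^bold>* (Arr aA (N 0) \<^bold>+ Arr aB (N 0) \<^bold>+ Arr aC (N 0) \<^bold>= N 6)) s1 = v"
    using f tri by (auto simp: v_def)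
   have e0: "eval (N k) s = k" for k s by simp
   have v1: "v \<le> 1" by (simp add: v_def)
   let ?s2 = "set_var vMOD 2 (set_arr aOut 0 v s1)"
   have o: "wp (6 * n * n) ?Z outf ?s2 (\<lambda>s' t. (\<forall>x<n * n. io s' x = of_bool (ar ?s2 aOut x mod 2 \<noteq> 0)) \<and> t \<le> 3 * (n * n) + 1)"
    using f Z True by (intro wp_outf) auto
   show ?case
    unfolding wp_simps ev e0
   proof (intro conjI, goal_cases)
    case 1
    then show ?case using Z v1 by linarith
   next
    case 2
    then show ?case using Z by linarith
   next
    case 3
    show ?case
     by (rule wp_conseq[OF o]) (use True f v1 in \<open>auto simp: v_def\<close>)
   qed
  qed (use car b True Z in auto)
 qed
next
 case False
 then have n2: "n \<ge> 2" using n by simp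
 have lt: "real n powr x < 1" using n2 d(2) powr_less_mono[of x 0 "real n"] by simp
 have "4 * (n * n) \<le> (g * n) ^ 2"
 proof -
  have "3 * n \<le> g * n" using g by simp
  from mult_le_mono[OF this this] have "9 * (n * n) \<le> (g * n) ^ 2" by (simp only: power2_eq_square; simp)
  then show ?thesis by linarith
 qed
 then have Z: "n * n \<le> (g * n) ^ 2" "2 \<le> (g * n) ^ 2" using n2 mult_le_mono[OF n2 n2] by linarith+
 have none: "M $$ (i, j) = None" if M: "few_row_weights (real n powr x) M" "M \<in> carrier_mat n n" "i < n" "j < n" for M i j
 proof (rule ccontr)
  assume "M $$ (i, j) \<noteq> None"
  then obtain w where w: "M $$ (i, j) = Some w" by auto
  have fin: "finite (row_weights M i)"
   by (rule finite_subset[of _ "(\<lambda>x. the (M $$ (i, x))) ` {..<dim_col M}"]) (force simp: row_weights_def)+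
  have "w \<in> row_weights M i" using w M by (auto simp: row_weights_def)
  then have "card (row_weights M i) \<noteq> 0" using fin by auto
  moreover have "real (card (row_weights M i)) \<le> real n powr x" using M by (auto simp: few_row_weights_def)
  ultimately show False using lt by linarith
 qed
 have noneT: "M $$ (i, j) = None" if M: "few_row_weights (real n powr x) (transpose_mat M)" "M \<in> carrier_mat n n" "i < n" "j < n" for M i j
  using none[of "transpose_mat M" j i] that by auto
 have no: "\<not> exact_triangle A B C i k j" if "i < n" "k < n" "j < n" for i k j
  using d(1) car that none noneT unfolding d_weights_def exact_triangle_def by fastforce
 let ?s = "set_var vMOD 2 (input_st n A B C)"
 have o: "wp (6 * n * n) ((g * n) ^ 2) outf ?s (\<lambda>s' t. (\<forall>x<n * n. io s' x = of_bool (ar ?s aOut x mod 2 \<noteq> 0)) \<and> t \<le> 3 * (n * n) + 1)"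
  using Z by (intro wp_outf) auto
 have e: "\<not> eval (V vN \<^bold>= N 1) (input_st n A B C) \<noteq> 0" using False by simp
 show ?thesis
  unfolding trivf_def wp_Seq wp_If
  apply (subst if_not_P[OF e])
  unfolding wp_simps eval.simps
  using Z(2) by (intro conjI wp_conseq[OF o]) (use no mult_add_less in auto)
qed

lemma omega_ge_3_case:
 assumes "x < 0"
 shows "\<exists>\<kappa> P T. solves_d_weights_exact_triangle (\<lambda>n. real n powr x) c \<kappa> P T \<and> (\<lambda>n. real (T n)) \<in> O(\<lambda>n. real n powr (3 - 1))"
proof -
 let ?g = "3 + amax trivf" and ?cs = "csize (Suc (amax trivf)) trivf"
 let ?T = "\<lambda>n. 3 + ?cs * (3 * (n * n) + 40)"
 have "\<exists>\<kappa>. solves_d_weights_exact_triangle (\<lambda>n. real n powr x) c \<kappa> (compile trivf) ?T"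
 proof (rule implement[where g = ?g and z = 2], goal_cases)
  case (4 n A B C)
  then show ?case using assms by (intro wp_trivf) auto
 qed simp_all
 moreover have "(\<lambda>n. real (?T n)) \<in> O(\<lambda>n. real n powr (3 - 1))"
 proof (rule bigoI[where c = "real (3 + 43 * ?cs)"], rule eventually_mono[OF eventually_gt_at_top[of 0]])
  fix n :: nat assume n: "n > 0"
  have nn: "1 \<le> n * n" using n by simp
  have "?cs * (3 * (n * n) + 40) \<le> ?cs * (43 * (n * n))" using nn by (intro mult_le_mono2) linarith
  then have "?T n \<le> (3 + 43 * ?cs) * (n * n)"
  proof -
   have "(3 + 43 * ?cs) * (n * n) = 3 * (n * n) + ?cs * (43 * (n * n))" by (simp add: algebra_simps)
   then show ?thesis using \<open>?cs * (3 * (n * n) + 40) \<le> ?cs * (43 * (n * n))\<close> nn by linarith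
  qed
  then have "real (?T n) \<le> real ((3 + 43 * ?cs) * (n * n))" by (rule of_nat_mono)
  also have "\<dots> = real (3 + 43 * ?cs) * real n powr (3 - 1)" using n by (simp only: of_nat_mult) (simp add: powr_numeral power2_eq_square)
  finally show "norm (real (?T n)) \<le> real (3 + 43 * ?cs) * norm (real n powr (3 - 1))" by simp
 qed
 ultimately show ?thesis by blast
qed

text \<open>The constants e, t, b, n0, K, R are chosen from \<delta> and \<omega> alone; c
  influences h, the thresholds, the word size and the program, but not the saving in the
  exponent.\<close>

lemma omega_less_3_case:
 assumes \<delta>: "0 < \<delta>" "\<delta> < 3 - \<omega>"
 shows "\<exists>\<kappa> P T. solves_d_weights_exact_triangle (\<lambda>n. real n powr ((3 - \<omega>) - \<delta>)) c \<kappa> P T \<and>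
  (\<lambda>n. real (T n)) \<in> O(\<lambda>n. real n powr (3 - 5 * (\<delta> / 32)))"
proof -
 define e \<beta> where "e = \<delta> / 32" and "\<beta> = 3 - \<omega>"
 have e: "0 < e" "32 * e < \<beta>" "\<beta> \<le> 1" using \<delta> omega_ge_2 by (simp_all add: e_def \<beta>_def)
 let ?\<mu> = "\<beta> - 8 * e"
 have mu: "0 < ?\<mu>" "?\<mu> \<le> 1" using e by simp_all
 \<comment> \<open>One factor Q is roughly m ^ (1 / t), and 1 / t \<le> 4 * e keeps small both the
   cost of trying Q candidates and the effect of rounding b.\<close>
 define t where "t = nat \<lceil>1 / (4 * e)\<rceil>"
 have "1 / (4 * e) \<le> real t" unfolding t_def by (rule real_nat_ceiling_ge)
 then have t: "1 \<le> 4 * e * real t" using e by (simp add: field_simps)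
 have t1: "t \<ge> 1" using t by (cases t) auto
 \<comment> \<open>The least b for which the lower bound n powr (?\<mu> / t) on Q guarantees that Q
   ^ b reaches the permitted number of weights.\<close>
 define b where "b = nat \<lceil>real t * (\<beta> - 32 * e) / ?\<mu>\<rceil>"
 have "real t * (\<beta> - 32 * e) / ?\<mu> \<le> real b" unfolding b_def by (rule real_nat_ceiling_ge)
 then have b1: "real t * (\<beta> - 32 * e) \<le> real b * ?\<mu>" using mu by (simp add: pos_divide_le_eq)
 have "0 \<le> real t * (\<beta> - 32 * e) / ?\<mu>" using e mu by simp
 then have "real b \<le> real t * (\<beta> - 32 * e) / ?\<mu> + 1" unfolding b_def by linarith
 then have "real b * ?\<mu> \<le> (real t * (\<beta> - 32 * e) / ?\<mu> + 1) * ?\<mu>" using mu by (intro mult_right_mono) auto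
 also have "\<dots> = real t * (\<beta> - 32 * e) + ?\<mu>"
 proof -
  have "(y / m + 1) * m = y + m" if "0 < m" for y m :: real using that by (simp add: distrib_right)
  then show ?thesis using mu(1) .
 qed
 finally have b2: "real b * ?\<mu> \<le> real t * (\<beta> - 32 * e) + ?\<mu>" .
 have "eventually (\<lambda>n :: nat. 8 \<le> real n powr e) sequentially"
 proof -
  have "filterlim (\<lambda>n. real n powr e) at_top sequentially" using e(1) by real_asymp
  then show ?thesis by (simp add: filterlim_at_top)
 qed
 then have "eventually (\<lambda>n. n \<ge> 2 \<and> 8 \<le> real n powr e \<and> real (matmul_ops TYPE(rat) n) \<le> real n powr (\<omega> + e)) sequentially"
  using matmul_ops_eventually[OF e(1)] eventually_ge_at_top[of 2] by eventually_elim simp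
 \<comment> \<open>A single size suffices: the constant 8 is below n0 powr e, and multiplication of
   this size comes within e of the exponent.\<close>
 then obtain n0 where n0: "n0 \<ge> 2" "8 \<le> real n0 powr e" "real (matmul_ops TYPE(rat) n0) \<le> real n0 powr (\<omega> + e)"
  unfolding eventually_sequentially by blast
 \<comment> \<open>The modulus is at most K ^ l, so this choice aims at about n powr (\<beta> - 8 *
   e).\<close>
 define K where "K = nat \<lceil>real n0 powr ?\<mu>\<rceil>"
 have K1: "real n0 powr ?\<mu> \<le> real K" unfolding K_def by (rule real_nat_ceiling_ge)
 have one: "1 \<le> real n0 powr ?\<mu>" using n0 mu by (intro ge_one_powr_ge_zero) auto
 have K2: "real K \<le> 2 * real n0 powr ?\<mu>" unfolding K_def using one by linarith
 have K0: "K \<ge> 1" using K1 one by (cases K) auto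
 define mm where "mm = matmul_ops TYPE(rat) n0"
 \<comment> \<open>At most 2 * mm products for the matrices times 2 * K - 1 for the polynomials. The
   8 in the bound on R consists of this 2, the 2 in 2 * K - 1, and the 2 from rounding K.\<close>
 define R where "R = 2 * mm * (2 * K - 1)"
 have n0mm: "n0 * n0 \<le> mm" using matmul_ops_lower[where 'a = rat, of n0] by (simp add: mm_def power2_eq_square)
 have R1: "n0 * n0 * (2 * K - 1) \<le> R" unfolding R_def using n0mm by (intro mult_le_mono1) simp
 have "1 \<le> n0 * n0 * (2 * K - 1)" using n0 K0 by simp
 then have R3: "R \<ge> 1" using R1 by linarith
 have "real R = 2 * real mm * real (2 * K - 1)" unfolding R_def by simp
 also have "\<dots> \<le> 2 * real n0 powr (\<omega> + e) * (4 * real n0 powr ?\<mu>)"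
  using n0(3) K2 K0 by (intro mult_mono) (auto simp: mm_def)
 also have "\<dots> = 8 * (real n0 powr (\<omega> + e) * real n0 powr ?\<mu>)" by simp
 also have "\<dots> = 8 * real n0 powr (3 - 7 * e)" by (simp only: powr_add[symmetric]) (simp add: \<beta>_def)
 finally have R2: "real R \<le> 8 * real n0 powr (3 - 7 * e)" .
 obtain gs :: "rat gate list" and out where gs: "length gs = mm" "slp_multiplies n0 gs out"
  using matmul_ops_witness[where 'a = rat, of n0] unfolding mm_def by blast
 obtain Di al be ga where D: "Di > 0" "tensor_alg (n0 * n0 * K) (n0 * n0 * (2 * K - 1)) R Di al be ga (tbase n0 K)"
  using base_tensor[OF gs(2), of "2 * mm" K] gs(1) unfolding R_def by auto
 define D where "D = nat Di"
 have DD: "D > 0" "tensor_alg (n0 * n0 * K) (n0 * n0 * (2 * K - 1)) R (int D) al be ga (tbase n0 K)"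
  using D by (simp_all add: D_def)
 define L1 where "L1 n = lev (n0 ^ t) n" for n
 define Q where "Q n = K ^ L1 n" for n
 define cap where "cap n = Q n ^ b" for n
 have Qge: "real n powr (?\<mu> / real t) \<le> real (Q n)" if "n \<ge> 1" for n
  by (rule Q_ge[OF e t b1 b2 n0(1,2) K1 K2 R2 R3 that L1_def refl Q_def cap_def refl])
 \<comment> \<open>Makes n powr (2 * c + 8) at most Q ^ h. The differences of sums are at most 15 *
   n ^ c, whose square is at most n ^ (2 * c + 8) for n \<ge> 2 since 225 \<le> 2 ^ 8. The added 1
   keeps h positive.\<close>
 define h where "h = nat \<lceil>real (2 * c + 8) * real t / ?\<mu>\<rceil> + 1"
 have "real (2 * c + 8) * real t / ?\<mu> \<le> real h" unfolding h_def by linarith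
 then have h: "real (2 * c + 8) \<le> ?\<mu> / real t * real h" using mu t1 by (simp add: field_simps)
 have h1: "h \<ge> 1" by (simp add: h_def)
 obtain Q0 where Q0: "\<And>q. q \<ge> Q0 \<Longrightarrow> real h * real q powr (1 - 4 * e) \<le> card (big_primes q)"
  using prime_supply[of "4 * e" "real h"] e by auto
 have "eventually (\<lambda>n :: nat. real (Q0 + 2) \<le> real n powr (?\<mu> / real t)) sequentially"
 proof -
  have "?\<mu> / real t > 0" using mu t1 by simp
  then have "filterlim (\<lambda>n. real n powr (?\<mu> / real t)) at_top sequentially" by real_asymp
  then show ?thesis by (simp add: filterlim_at_top)
 qed
 then obtain n1 where n1: "\<And>n. n \<ge> n1 \<Longrightarrow> real (Q0 + 2) \<le> real n powr (?\<mu> / real t)" unfolding eventually_sequentially by blast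
 \<comment> \<open>The time bound must hold for every n, so small n fall back on the trivial bound
   for the collisions; they do not influence the asymptotics.\<close>
 define F where "F n = (if n \<ge> n1 + 2 then nat \<lfloor>2 * real n powr (3 - 16 * e)\<rfloor> else n ^ 3 * (1 + cap n))" for n
 define T0 where "T0 n = maintime n (t * L1 n) (Q n) t (cap n) R K + 9 * F n" for n
 define p where "p = mainf n0 K R D al be ga t b c"
 define g where "g = n0 ^ t + t + 4 + amax p"
 define z where "z = c + R + D + K * b + 8"
 have coll: "ncoll Vf Wf S Lst Cnt n m \<le> F n"
  if n: "n \<ge> 1" and S: "S = 3 * n ^ c + 3" and gr: "greedy (hcost Vf Wf S Lst Cnt n) (Q n) t m"
   and VW: "\<And>x. x < n * n \<Longrightarrow> Vf x \<le> 2 * n ^ c + 1 \<and> Wf x \<le> 2 * n ^ c + 1"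
   and LC: "\<And>y. y < n \<Longrightarrow> Cnt y \<le> cap n" "\<And>y g. y < n \<Longrightarrow> g < Cnt y \<Longrightarrow> Lst (y * n + g) \<le> 2 * n ^ c + 1"
  for n S Vf Wf Lst Cnt m
 proof (cases "n \<ge> n1 + 2")
  case False
  have BS: "2 * n ^ c + 1 \<le> S" using S by simp
  have "m \<ge> 1" using greedy_bounds[OF gr] by simp
  from ncoll_le[where B = "2 * n ^ c + 1" and n = n and cap = "cap n" and Vf = Vf and Wf = Wf and Lst = Lst and Cnt = Cnt and S = S, OF VW LC BS this] show ?thesis using False by (simp add: F_def)
 next
  case True
  have BS: "2 * n ^ c + 1 \<le> S" using S by simp
  have Qn: "real (Q0 + 2) \<le> real (Q n)" using n1[of n] Qge[OF n] True by linarith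
  have Q2: "Q n \<ge> 2" "Q n \<ge> Q0" using Qn by simp_all
  have nc: "1 \<le> n ^ c" using n by simp
  have "S + 3 * (2 * x + 1) \<le> 15 * x" if "S = 3 * x + 3" "1 \<le> x" for x using that by simp
  from this[OF S nc] have "(S + 3 * (2 * n ^ c + 1)) * (S + 3 * (2 * n ^ c + 1)) \<le> (15 * n ^ c) * (15 * n ^ c)" by (intro mult_le_mono)
  also have "\<dots> = 225 * n ^ (2 * c)" by (simp add: power_add[symmetric] mult_2)
  also have "\<dots> \<le> n ^ 8 * n ^ (2 * c)"
  proof -
   have "2 ^ 8 \<le> n ^ 8" using True by (intro power_mono) auto
   then show ?thesis by (intro mult_le_mono1) simp
  qed
  also have "\<dots> \<le> Q n ^ h"
  proof -
   have "real (n ^ 8 * n ^ (2 * c)) = real n powr real (2 * c + 8)" using n by (simp add: powr_realpow power_add mult.commute del: of_nat_add)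
   also have "\<dots> \<le> real n powr (?\<mu> / real t * real h)" using h n by (intro powr_mono) auto
   also have "\<dots> = (real n powr (?\<mu> / real t)) ^ h" using n by (simp add: powr_realpow[symmetric] powr_powr)
   also have "\<dots> \<le> real (Q n) ^ h" using Qge[OF n] by (intro power_mono) auto
   also have "\<dots> = real (Q n ^ h)" by simp
   finally show ?thesis by (simp only: of_nat_le_iff)
  qed
  finally have X: "(S + 3 * (2 * n ^ c + 1)) * (S + 3 * (2 * n ^ c + 1)) \<le> Q n ^ h" .
  have C: "card (big_primes (Q n)) ^ t * ncoll Vf Wf S Lst Cnt n m \<le> h ^ t * (n ^ 3 * (1 + cap n))"
   by (rule greedy_ncoll[where B = "2 * n ^ c + 1" and n = n and cap = "cap n" and Vf = Vf and Wf = Wf and Lst = Lst and Cnt = Cnt and S = S, OF VW LC BS gr Q2(1) X])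
  have "real (ncoll Vf Wf S Lst Cnt n m) \<le> 2 * real n powr (3 - 16 * e)"
   by (rule coll_le[OF e t b1 b2 n0(1,2) K1 K2 R2 R3 n L1_def refl Q_def cap_def refl Q0[OF Q2(2)] h1 C])
  then have "ncoll Vf Wf S Lst Cnt n m \<le> nat \<lfloor>2 * real n powr (3 - 16 * e)\<rfloor>" by (simp add: le_nat_floor)
  then show ?thesis using True by (simp add: F_def)
 qed
 have "\<exists>\<kappa>. solves_d_weights_exact_triangle (\<lambda>n. real n powr (\<beta> - 32 * e)) c \<kappa> (compile p) (\<lambda>n. 3 + csize (Suc (amax p)) p * T0 n)"
 proof (rule implement[where g = g and z = z], goal_cases)
  case (4 n A B C)
  have bd: "entries_bounded (int (n ^ c)) A" "entries_bounded (int (n ^ c)) B" "entries_bounded (int (n ^ c)) C" using 4(5) by simp_all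
  have cap: "real n powr (\<beta> - 32 * e) \<le> real (cap n)"
   by (rule cap_ge[OF e t b1 b2 n0(1,2) K1 K2 R2 R3 4(1) L1_def refl Q_def cap_def refl])
  have gg: "n0 ^ t + t + 4 \<le> g" by (simp add: g_def)
  note wb = word_bounds[OF 4(1) n0(1) t1 K0 L1_def refl gg z_def, folded Q_def, folded cap_def]
  have t0: "t > 0" "K > 0" using t1 K0 by simp_all
  have W: "wp (6 * n * n) ((g * n) ^ z) p (input_st n A B C) (\<lambda>s' tt.
    (\<forall>i<n. \<forall>j<n. io s' (i * n + j) = of_bool (\<exists>k<n. exact_triangle A B C i k j)) \<and>
    (\<exists>Vf Wf Lst Cnt m. greedy (hcost Vf Wf (3 * n ^ c + 3) Lst Cnt n) (Q n) t m \<and> (\<forall>x<n * n. Vf x \<le> 2 * n ^ c + 1 \<and> Wf x \<le> 2 * n ^ c + 1) \<and>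
     (\<forall>y<n. Cnt y \<le> cap n \<and> (\<forall>g<Cnt y. Lst (y * n + g) \<le> 2 * n ^ c + 1)) \<and>
     tt \<le> maintime n (t * L1 n) (Q n) t (cap n) R K + 9 * ncoll Vf Wf (3 * n ^ c + 3) Lst Cnt n m))"
   unfolding p_def
   by (rule wp_mainf[OF DD(2) n0(1) t0 DD(1) R1 4(1) L1_def refl Q_def cap_def refl refl 4(2-4) bd 4(6) cap wb])
  show ?case
  proof (rule wp_conseq[OF W], goal_cases)
   case (1 s' tt)
   from 1(1) obtain Vf Wf Lst Cnt m where x: "greedy (hcost Vf Wf (3 * n ^ c + 3) Lst Cnt n) (Q n) t m"
    "\<And>x. x < n * n \<Longrightarrow> Vf x \<le> 2 * n ^ c + 1 \<and> Wf x \<le> 2 * n ^ c + 1"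
    "\<And>y. y < n \<Longrightarrow> Cnt y \<le> cap n" "\<And>y g. y < n \<Longrightarrow> g < Cnt y \<Longrightarrow> Lst (y * n + g) \<le> 2 * n ^ c + 1"
    "tt \<le> maintime n (t * L1 n) (Q n) t (cap n) R K + 9 * ncoll Vf Wf (3 * n ^ c + 3) Lst Cnt n m"
    by blast
   have "ncoll Vf Wf (3 * n ^ c + 3) Lst Cnt n m \<le> F n" by (rule coll[OF 4(1) refl x(1-4)])
   then have "tt \<le> T0 n" unfolding T0_def using x(5) by linarith
   then show ?case using 1(1) by blast
  qed
 qed (simp_all add: g_def z_def)
 then obtain \<kappa> where sol: "solves_d_weights_exact_triangle (\<lambda>n. real n powr (\<beta> - 32 * e)) c \<kappa> (compile p) (\<lambda>n. 3 + csize (Suc (amax p)) p * T0 n)" ..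
 let ?cs = "csize (Suc (amax p)) p" and ?C0 = "real (500 + 40 * t + 3 * R)" and ?E = "3 - 5 * e"
 \<comment> \<open>The 18 is 9 * 2: nine units per collision, and at most 2 * n powr (3 - 16 * e)
   collisions for large n.\<close>
 define M where "M = ?C0 * (4 * real (n0 ^ t) powr ?E) + 18"
 have M0: "0 \<le> M" by (simp add: M_def)
 have E0: "0 < ?E" using e by simp
 have big: "(\<lambda>n. real (3 + ?cs * T0 n)) \<in> O(\<lambda>n. real n powr ?E)"
 proof (rule bigoI[where c = "3 + real ?cs * M"], rule eventually_mono[OF eventually_ge_at_top[of "n1 + 2"]])
  fix n assume n: "n1 + 2 \<le> n"
  then have n_1: "n \<ge> 1" by simp
  let ?N = "n0 ^ (t * L1 n)"
  have "?N \<le> n0 ^ t * n" by (rule N_bounds(2)[OF e t b1 b2 n0(1,2) K1 K2 R2 R3 n_1 L1_def refl Q_def cap_def refl])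
  then have "real ?N \<le> real (n0 ^ t * n)" by (rule of_nat_mono)
  then have "real ?N powr ?E \<le> real (n0 ^ t * n) powr ?E" using E0 by (intro powr_mono2) auto
  also have "\<dots> = real (n0 ^ t) powr ?E * real n powr ?E" by (simp only: of_nat_mult) (simp add: powr_mult)
  finally have N: "real ?N powr ?E \<le> real (n0 ^ t) powr ?E * real n powr ?E" .
  have "real (maintime n (t * L1 n) (Q n) t (cap n) R K) \<le> ?C0 * (4 * real ?N powr ?E)"
   by (rule time_le[OF e t b1 b2 n0(1,2) K1 K2 R2 R3 n_1 L1_def refl Q_def cap_def refl])
  also have "\<dots> \<le> ?C0 * (4 * (real (n0 ^ t) powr ?E * real n powr ?E))" using N by (intro mult_left_mono) auto
  finally have m: "real (maintime n (t * L1 n) (Q n) t (cap n) R K) \<le> ?C0 * (4 * real (n0 ^ t) powr ?E) * real n powr ?E" by (simp only: mult.assoc)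
  have "F n = nat \<lfloor>2 * real n powr (3 - 16 * e)\<rfloor>" using n by (simp add: F_def)
  then have "real (F n) \<le> 2 * real n powr (3 - 16 * e)" by simp
  also have "\<dots> \<le> 2 * real n powr ?E" using n_1 e by (intro mult_left_mono powr_mono) auto
  finally have f: "real (F n) \<le> 2 * real n powr ?E" .
  have "real (T0 n) = real (maintime n (t * L1 n) (Q n) t (cap n) R K) + 9 * real (F n)" by (simp add: T0_def)
  also have "\<dots> \<le> M * real n powr ?E" using m f unfolding M_def distrib_right by linarith
  finally have T: "real (T0 n) \<le> M * real n powr ?E" .
  have one: "1 \<le> real n powr ?E" using n_1 E0 by (intro ge_one_powr_ge_zero) auto
  have "real (3 + ?cs * T0 n) = 3 + real ?cs * real (T0 n)" by simp
  also have "\<dots> \<le> 3 * real n powr ?E + real ?cs * (M * real n powr ?E)" using one T by (intro add_mono mult_left_mono) auto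
  finally have "real (3 + ?cs * T0 n) \<le> (3 + real ?cs * M) * real n powr ?E" by (simp only: distrib_right mult.assoc)
  then show "norm (real (3 + ?cs * T0 n)) \<le> (3 + real ?cs * M) * norm (real n powr ?E)" by simp
 qed
 have "\<beta> - 32 * e = (3 - \<omega>) - \<delta>" by (simp add: e_def \<beta>_def)
 note sol[unfolded this]
 then show ?thesis unfolding e_def[symmetric] using big by (intro exI conjI)
qed

theorem theorem1p5:
 fixes \<delta> :: real
 assumes "\<delta> > 0"
 shows "\<exists>\<epsilon>>0. \<forall>c :: nat. \<exists>(\<kappa> :: nat) (P :: instr list) (T :: nat => nat).
      solves_d_weights_exact_triangle (\<lambda>n. real n powr ((3 - \<omega>) - \<delta>)) c \<kappa> P T \<and>
      (\<lambda>n. real (T n)) \<in> O(\<lambda>n. real n powr (3 - \<epsilon>))"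
proof (cases "\<omega> < 3")
 case False
 \<comment> \<open>For \<omega> \<ge> 3 the exponent of n in the bound on the weights is negative
   and quadratic time suffices, hence the saving 1.\<close>
 then show ?thesis using omega_ge_3_case[of "(3 - \<omega>) - \<delta>"] assms by (intro exI[of _ 1]) auto
next
 case True
 \<comment> \<open>For large \<delta> the exponent 3 - \<omega> - \<delta> would not be positive. A
   smaller value only admits more instances, and half of 3 - \<omega> keeps the exponent
   positive.\<close>
 define \<delta>' where "\<delta>' = min \<delta> ((3 - \<omega>) / 2)"
 have d: "0 < \<delta>'" "\<delta>' < 3 - \<omega>" "\<delta>' \<le> \<delta>" using True assms by (auto simp: \<delta>'_def min_less_iff_disj)
 have mono: "real n powr ((3 - \<omega>) - \<delta>) \<le> real n powr ((3 - \<omega>) - \<delta>')" if "n \<ge> 1" for n :: nat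
  using that d by (intro powr_mono) auto
 show ?thesis
 proof (intro exI[of _ "5 * (\<delta>' / 32)"] conjI allI)
  show "0 < 5 * (\<delta>' / 32)" using d by simp
  fix c
  obtain \<kappa> P T where x: "solves_d_weights_exact_triangle (\<lambda>n. real n powr ((3 - \<omega>) - \<delta>')) c \<kappa> P T"
   "(\<lambda>n. real (T n)) \<in> O(\<lambda>n. real n powr (3 - 5 * (\<delta>' / 32)))"
   using omega_less_3_case[OF d(1,2)] by blast
  from solves_mono[OF x(1) mono] x(2)
  show "\<exists>\<kappa> P T. solves_d_weights_exact_triangle (\<lambda>n. real n powr ((3 - \<omega>) - \<delta>)) c \<kappa> P T \<and>
   (\<lambda>n. real (T n)) \<in> O(\<lambda>n. real n powr (3 - 5 * (\<delta>' / 32)))" by blast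
 qed
qed

end
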